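(* Consider the arithmetic functions: $\sigma_s(k)=\sum_{d\mid k}d^s$ ($s$ real, $s\ne0$); $\theta(k)$, the number of squarefree divisors of $k$; $J_s(k)=\sum_{d\mid k}d^s\mu(k/d)$, the generalized Euler totient function ($s$ real, $s>0$); $|\mu(k)|$, where $\mu$ is the Möbius function. Each of them is, for every real $p>1$, a good weighting function for the dominated ergodic theorem in $L^p$ and a good weighting function for the pointwise ergodic theorem in $L^p$. Moreover, $\sigma_s$ ($s\neq0$), $|\mu|$ and $J_s$ ($s>0$) are good weighting functions for the dominated ergodic theorem in $L^{1,\infty}$ and for the pointwise ergodic theorem in $L^{1,\infty}$.
   Context: A dynamical system $(X,\mathcal A,\nu,\tau)$ is a probability space $(X,\mathcal A,\nu)$ with a measurable transformation $\tau:X\to X$ preserving $\nu$. Put $\|f\|_{1,\infty}=\sup_{\lambda>0}\lambda\,\nu(\{x\in X:|f(x)|>\lambda\})$. For a sequence of real numbers $(w_k)_{k\ge 1}$ put $W_n=\sum_{k=1}^n|w_k|$, where it is assumed that $W_n\ne 0$ and $W_n\to\infty$. The sequence $(w_k)_{k\ge1}$ is a good weight for the dominated ergodic theorem in $L^p$, $p>1$, if there exists $C_p>0$ such that for every dynamical system $(X,\mathcal A,\nu,\tau)$ and every $f\in L^p(\nu)$, $$\Big\|\sup_{n\ge 1}\frac{|\sum_{1\le k\le n} w_k f\circ\tau^k|}{W_n}\Big\|_p\le C_p\|f\|_p ,$$ and a good weight for the dominated ergodic theorem in $L^{1,\infty}$ if there exists $C>0$ such that for every dynamical system and every $f\in L^1(\nu)$,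 $$\Big\|\sup_{n\ge 1}\frac{|\sum_{1\le k\le n} w_k f\circ\tau^k|}{W_n}\Big\|_{1,\infty}\le C\|f\|_1 .$$ It is a good weight for the pointwise ergodic theorem in $L^p$ (respectively in $L^{1,\infty}$) if for every dynamical system $(X,\mathcal A,\nu,\tau)$ and every $f\in L^p(\nu)$ (respectively every $f\in L^1(\nu)$) the sequence $\big(\frac1{W_n}\sum_{1\le k\le n} w_k f\circ\tau^k\big)_n$ converges $\nu$-a.s. An arithmetic function $w$ is a good weighting function when $(w(k))_{k\ge1}$ is a good weight. *)

theory Defs
  imports
    "HOL-Probability.Probability"
    "HOL-Computational_Algebra.Squarefree"
    "HOL-Computational_Algebra.Primes"
begin

section \<open>Arithmetic functions\<close>

definition moebius_mu :: "nat \<Rightarrow> int" where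
  "moebius_mu n = (if squarefree n then (- 1) ^ card (prime_factors n) else 0)"

definition divisor_sigma :: "real \<Rightarrow> nat \<Rightarrow> real" where
  "divisor_sigma s k = (\<Sum>d | d dvd k. real d powr s)"

definition sqfree_divisor_count :: "nat \<Rightarrow> real" where
  "sqfree_divisor_count k = real (card {d. d dvd k \<and> squarefree d})"

definition euler_jordan :: "real \<Rightarrow> nat \<Rightarrow> real" where
  "euler_jordan s k = (\<Sum>d | d dvd k. real d powr s * real_of_int (moebius_mu (k div d)))"

definition abs_moebius :: "nat \<Rightarrow> real" where
  "abs_moebius k = real_of_int \<bar>moebius_mu k\<bar>"

section \<open>Dynamical systems and weighted averages\<close>

definition dynamical_system :: "'a measure \<Rightarrow> ('a \<Rightarrow> 'a) \<Rightarrow> bool" where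
  "dynamical_system M \<tau> \<longleftrightarrow>
     prob_space M \<and> \<tau> \<in> measurable M M \<and> distr M M \<tau> = M"

text \<open>A weight is a sequence \<open>w\<close> indexed by \<open>k \<ge> 1\<close>; the value \<open>w 0\<close> is never used.\<close>

definition weight_sum :: "(nat \<Rightarrow> real) \<Rightarrow> nat \<Rightarrow> real" where
  "weight_sum w n = (\<Sum>k=1..n. \<bar>w k\<bar>)"

definition admissible_weight :: "(nat \<Rightarrow> real) \<Rightarrow> bool" where
  "admissible_weight w \<longleftrightarrow>
     (\<forall>n\<ge>1. weight_sum w n \<noteq> 0) \<and> filterlim (weight_sum w) at_top sequentially"

definition weighted_average ::
    "(nat \<Rightarrow> real) \<Rightarrow> ('a \<Rightarrow> 'a) \<Rightarrow> ('a \<Rightarrow> complex) \<Rightarrow> nat \<Rightarrow> 'a \<Rightarrow> complex" where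
  "weighted_average w \<tau> f n x =
     (\<Sum>k=1..n. complex_of_real (w k) * f ((\<tau> ^^ k) x)) / complex_of_real (weight_sum w n)"

text \<open>Values and norms are taken in \<^typ>\<open>ennreal\<close>, since the supremum may a priori be infinite.\<close>

definition maximal_function ::
    "(nat \<Rightarrow> real) \<Rightarrow> ('a \<Rightarrow> 'a) \<Rightarrow> ('a \<Rightarrow> complex) \<Rightarrow> 'a \<Rightarrow> ennreal" where
  "maximal_function w \<tau> f x = (SUP n\<in>{1..}. ennreal (norm (weighted_average w \<tau> f n x)))"

section \<open>Norms\<close>

text \<open>Only used for exponents \<open>p > 0\<close>, where \<open>\<infinity>\<^sup>p = \<infinity>\<close>.\<close>

definition ennreal_powr :: "ennreal \<Rightarrow> real \<Rightarrow> ennreal" where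
  "ennreal_powr x p = (if x = top then top else ennreal (enn2real x powr p))"

definition Lp_norm :: "real \<Rightarrow> 'a measure \<Rightarrow> ('a \<Rightarrow> ennreal) \<Rightarrow> ennreal" where
  "Lp_norm p M g = ennreal_powr (\<integral>\<^sup>+ x. ennreal_powr (g x) p \<partial>M) (1 / p)"

definition weak_L1_norm :: "'a measure \<Rightarrow> ('a \<Rightarrow> ennreal) \<Rightarrow> ennreal" where
  "weak_L1_norm M g = (SUP l\<in>{0::real<..}. ennreal l * emeasure M {x \<in> space M. g x > ennreal l})"

definition in_Lp :: "real \<Rightarrow> 'a measure \<Rightarrow> ('a \<Rightarrow> complex) \<Rightarrow> bool" where
  "in_Lp p M f \<longleftrightarrow> f \<in> borel_measurable M \<and> Lp_norm p M (\<lambda>x. ennreal (norm (f x))) < top"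

section \<open>Good weights\<close>

text \<open>
  The maximal inequality with constant \<open>C\<close>, for all dynamical systems whose
  underlying set lives in the type \<open>'a\<close>.
\<close>

definition strong_maximal_ineq :: "'a itself \<Rightarrow> real \<Rightarrow> (nat \<Rightarrow> real) \<Rightarrow> real \<Rightarrow> bool" where
  "strong_maximal_ineq _ p w C \<longleftrightarrow>
     (\<forall>(M :: 'a measure) \<tau> f. dynamical_system M \<tau> \<longrightarrow> in_Lp p M f \<longrightarrow>
        Lp_norm p M (maximal_function w \<tau> f) \<le> ennreal C * Lp_norm p M (\<lambda>x. ennreal (norm (f x))))"

definition weak_maximal_ineq :: "'a itself \<Rightarrow> (nat \<Rightarrow> real) \<Rightarrow> real \<Rightarrow> bool" where
  "weak_maximal_ineq _ w C \<longleftrightarrow>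
     (\<forall>(M :: 'a measure) \<tau> f. dynamical_system M \<tau> \<longrightarrow> in_Lp 1 M f \<longrightarrow>
        weak_L1_norm M (maximal_function w \<tau> f) \<le> ennreal C * Lp_norm 1 M (\<lambda>x. ennreal (norm (f x))))"

text \<open>
  A good weight needs one constant for all dynamical systems, so the constant must not depend on
  the type \<open>'a\<close>. As types cannot be quantified inside a formula, "there is \<open>C\<close> such that for all
  systems" is rendered by a constant that mentions no type variable: it is chosen among those that
  work for all systems on the sequence space \<^typ>\<open>nat \<Rightarrow> complex\<close>. A theorem asserting
  goodness for a free type variable \<open>'a\<close> then provides this one constant, depending on \<open>w\<close> (and
  \<open>p\<close>) only, for all systems on all types. Nothing is lost by this choice: every
  constant valid on the sequence space is valid on every type, by passing to the law of
  \<open>(f \<circ> \<tau>\<^sup>k)\<^sub>k\<close> under the shift; this is proved below.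
\<close>

definition strong_const :: "real \<Rightarrow> (nat \<Rightarrow> real) \<Rightarrow> real" where
  "strong_const p w = (SOME C. 0 < C \<and> strong_maximal_ineq TYPE(nat \<Rightarrow> complex) p w C)"

definition weak_const :: "(nat \<Rightarrow> real) \<Rightarrow> real" where
  "weak_const w = (SOME C. 0 < C \<and> weak_maximal_ineq TYPE(nat \<Rightarrow> complex) w C)"

definition good_dominated_Lp :: "'a itself \<Rightarrow> real \<Rightarrow> (nat \<Rightarrow> real) \<Rightarrow> bool" where
  "good_dominated_Lp T p w \<longleftrightarrow> admissible_weight w \<and>
     0 < strong_const p w \<and> strong_maximal_ineq T p w (strong_const p w)"

definition good_dominated_weak_L1 :: "'a itself \<Rightarrow> (nat \<Rightarrow> real) \<Rightarrow> bool" where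
  "good_dominated_weak_L1 T w \<longleftrightarrow> admissible_weight w \<and>
     0 < weak_const w \<and> weak_maximal_ineq T w (weak_const w)"

definition good_pointwise_Lp :: "'a itself \<Rightarrow> real \<Rightarrow> (nat \<Rightarrow> real) \<Rightarrow> bool" where
  "good_pointwise_Lp _ p w \<longleftrightarrow> admissible_weight w \<and>
     (\<forall>(M :: 'a measure) \<tau> f. dynamical_system M \<tau> \<longrightarrow> in_Lp p M f \<longrightarrow>
        (AE x in M. convergent (\<lambda>n. weighted_average w \<tau> f n x)))"

text \<open>For the pointwise theorem, "in \<open>L\<^sup>1\<^sup>,\<^sup>\<infinity>\<close>" refers to all \<open>f \<in> L\<^sup>1\<close>.\<close>

definition good_pointwise_weak_L1 :: "'a itself \<Rightarrow> (nat \<Rightarrow> real) \<Rightarrow> bool" where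
  "good_pointwise_weak_L1 T w \<longleftrightarrow> good_pointwise_Lp T 1 w"

section \<open>Transfer of maximal inequalities from the sequence space\<close>

lemma ennreal_powr_measurable [measurable]:
  "(\<lambda>x. ennreal_powr x p) \<in> borel_measurable borel"
  unfolding ennreal_powr_def by measurable

lemma sequence_model:
  fixes M :: "'a measure" and f :: "'a \<Rightarrow> complex"
  assumes ds: "dynamical_system M \<tau>" and f[measurable]: "f \<in> borel_measurable M"
  obtains N :: "(nat \<Rightarrow> complex) measure" and S F
  where "dynamical_system N S" "F \<in> borel_measurable N"
    and "\<And>p. Lp_norm p N (\<lambda>x. ennreal (norm (F x))) = Lp_norm p M (\<lambda>x. ennreal (norm (f x)))"
    and "\<And>p w. Lp_norm p N (maximal_function w S F) = Lp_norm p M (maximal_function w \<tau> f)"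
    and "\<And>w. weak_L1_norm N (maximal_function w S F) = weak_L1_norm M (maximal_function w \<tau> f)"
proof -
  interpret prob_space M using ds by (simp add: dynamical_system_def)
  have tau[measurable]: "\<tau> \<in> measurable M M" and inv: "distr M M \<tau> = M"
    using ds by (auto simp: dynamical_system_def)
  have pow[measurable]: "\<tau> ^^ k \<in> measurable M M" for k
    by (induction k) (auto intro: measurable_comp[OF _ tau] simp: id_def)
  define P where "P = PiM UNIV (\<lambda>_::nat. borel :: complex measure)"
  define \<phi> where "\<phi> x = (\<lambda>k::nat. f ((\<tau> ^^ k) x))" for x
  define S where "S = (\<lambda>(\<omega>::nat \<Rightarrow> complex) i. \<omega> (Suc i))"
  define F where "F = (\<lambda>\<omega>::nat \<Rightarrow> complex. \<omega> 0)"
  define N where "N = distr M P \<phi>"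
  have phi[measurable]: "\<phi> \<in> measurable M P"
    unfolding \<phi>_def P_def by (rule measurable_PiM_single') auto
  have S[measurable]: "S \<in> measurable P P"
    unfolding S_def P_def by (rule measurable_PiM_single') auto
  have F[measurable]: "F \<in> borel_measurable P"
    unfolding F_def P_def by measurable
  have Sphi: "S (\<phi> x) = \<phi> (\<tau> x)" for x
    by (simp add: S_def \<phi>_def funpow_Suc_right del: funpow.simps)
  have Spow: "(S ^^ k) \<omega> i = \<omega> (i + k)" for k \<omega> i
    by (induction k arbitrary: i) (auto simp: S_def)
  have ds': "dynamical_system N S"
    unfolding dynamical_system_def
  proof (intro conjI)
    show "prob_space N" unfolding N_def by (rule prob_space_distr) simp
    show "S \<in> measurable N N" unfolding N_def by simp
    have "distr N N S = distr N P S" by (rule distr_cong) (auto simp: N_def)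
    also have "\<dots> = distr M P (S \<circ> \<phi>)" unfolding N_def by (rule distr_distr) auto
    also have "S \<circ> \<phi> = \<phi> \<circ> \<tau>" using Sphi by auto
    also have "distr M P (\<phi> \<circ> \<tau>) = distr (distr M M \<tau>) P \<phi>"
      by (rule distr_distr[symmetric]) auto
    finally show "distr N N S = N" by (simp add: inv N_def)
  qed
  have FN: "F \<in> borel_measurable N" unfolding N_def by simp
  have Fphi: "F ((S ^^ k) (\<phi> x)) = f ((\<tau> ^^ k) x)" for k x
    by (simp add: F_def Spow \<phi>_def)
  have mf: "maximal_function w S F (\<phi> x) = maximal_function w \<tau> f x" for w x
    by (simp add: maximal_function_def weighted_average_def Fphi)
  have Spm[measurable]: "S ^^ k \<in> measurable P P" for k
    by (induction k) (auto intro: measurable_comp[OF _ S] simp: id_def)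
  have mm[measurable]: "maximal_function w S F \<in> borel_measurable P" for w
    unfolding maximal_function_def weighted_average_def by measurable
  have Lp: "Lp_norm p N g = Lp_norm p M (\<lambda>x. g (\<phi> x))" if "g \<in> borel_measurable P" for p g
  proof -
    note [measurable] = that
    have "(\<integral>\<^sup>+ x. ennreal_powr (g x) p \<partial>N) = (\<integral>\<^sup>+ x. ennreal_powr (g (\<phi> x)) p \<partial>M)"
      unfolding N_def by (rule nn_integral_distr) auto
    then show ?thesis by (simp add: Lp_norm_def)
  qed
  have wk: "weak_L1_norm N g = weak_L1_norm M (\<lambda>x. g (\<phi> x))" if "g \<in> borel_measurable P" for g
  proof -
    note [measurable] = that
    have "emeasure N {x \<in> space N. g x > ennreal l} = emeasure M {x \<in> space M. g (\<phi> x) > ennreal l}"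
      for l
    proof -
      have "emeasure N {x \<in> space P. g x > ennreal l}
          = emeasure M (\<phi> -` {x \<in> space P. g x > ennreal l} \<inter> space M)"
        unfolding N_def by (rule emeasure_distr) auto
      also have "\<phi> -` {x \<in> space P. g x > ennreal l} \<inter> space M = {x \<in> space M. g (\<phi> x) > ennreal l}"
        using measurable_space[OF phi] by auto
      finally show ?thesis by (simp add: N_def)
    qed
    then show ?thesis by (simp add: weak_L1_norm_def)
  qed
  show ?thesis
  proof (rule that[OF ds' FN])
    show "Lp_norm p N (\<lambda>x. ennreal (norm (F x))) = Lp_norm p M (\<lambda>x. ennreal (norm (f x)))" for p
      using Fphi[of 0] by (subst Lp) auto
    show "Lp_norm p N (maximal_function w S F) = Lp_norm p M (maximal_function w \<tau> f)" for p w
      by (subst Lp) (auto simp: mf)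
    show "weak_L1_norm N (maximal_function w S F) = weak_L1_norm M (maximal_function w \<tau> f)" for w
      by (subst wk) (auto simp: mf)
  qed
qed

lemma strong_maximal_ineq_transfer:
  assumes "strong_maximal_ineq TYPE(nat \<Rightarrow> complex) p w C"
  shows "strong_maximal_ineq TYPE('a) p w C"
  unfolding strong_maximal_ineq_def
proof (intro allI impI)
  fix M :: "'a measure" and \<tau> f
  assume ds: "dynamical_system M \<tau>" and f: "in_Lp p M f"
  then have "f \<in> borel_measurable M" by (simp add: in_Lp_def)
  from sequence_model[OF ds this] show "Lp_norm p M (maximal_function w \<tau> f)
      \<le> ennreal C * Lp_norm p M (\<lambda>x. ennreal (norm (f x)))"
    by (metis assms f in_Lp_def strong_maximal_ineq_def)
qed

lemma weak_maximal_ineq_transfer: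
  assumes "weak_maximal_ineq TYPE(nat \<Rightarrow> complex) w C"
  shows "weak_maximal_ineq TYPE('a) w C"
  unfolding weak_maximal_ineq_def
proof (intro allI impI)
  fix M :: "'a measure" and \<tau> f
  assume ds: "dynamical_system M \<tau>" and f: "in_Lp 1 M f"
  then have "f \<in> borel_measurable M" by (simp add: in_Lp_def)
  from sequence_model[OF ds this] show "weak_L1_norm M (maximal_function w \<tau> f)
      \<le> ennreal C * Lp_norm 1 M (\<lambda>x. ennreal (norm (f x)))"
    by (metis assms f in_Lp_def weak_maximal_ineq_def)
qed

lemma good_dominated_LpI:
  assumes "admissible_weight w" "0 < C" "strong_maximal_ineq TYPE(nat \<Rightarrow> complex) p w C"
  shows "good_dominated_Lp TYPE('a) p w"
proof -
  have "0 < strong_const p w \<and> strong_maximal_ineq TYPE(nat \<Rightarrow> complex) p w (strong_const p w)"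
    unfolding strong_const_def by (rule someI[of _ C]) (use assms in simp)
  then show ?thesis
    using assms(1) by (auto simp: good_dominated_Lp_def intro: strong_maximal_ineq_transfer)
qed

lemma good_dominated_weak_L1I:
  assumes "admissible_weight w" "0 < C" "weak_maximal_ineq TYPE(nat \<Rightarrow> complex) w C"
  shows "good_dominated_weak_L1 TYPE('a) w"
proof -
  have "0 < weak_const w \<and> weak_maximal_ineq TYPE(nat \<Rightarrow> complex) w (weak_const w)"
    unfolding weak_const_def by (rule someI[of _ C]) (use assms in simp)
  then show ?thesis
    using assms(1) by (auto simp: good_dominated_weak_L1_def intro: weak_maximal_ineq_transfer)
qed

end

theory Submission
  imports Defs
begin

text \<open>
  Every weight \<open>w\<close> treated here is a sum over divisors: \<open>w k\<close> is the sum of \<open>a m * v (k div b m)\<close>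
  over the \<open>m\<close> for which \<open>b m\<close> divides \<open>k\<close>, where \<open>b m\<close> is \<open>m\<close> or \<open>m ^ 2\<close>. A weighted sum along
  \<open>\<tau>\<close> therefore splits into sums with weight \<open>v\<close> along the maps \<open>\<tau> ^^ b m\<close>, and the maximal
  function of \<open>w\<close> is at most a combination of the maximal functions of \<open>v\<close> for these maps
  (\<open>divisor_sum_weight.weighted_max_le\<close>), with summable coefficients \<open>c m\<close>.

  For \<open>\<sigma>\<^sub>s\<close>, \<open>J\<^sub>s\<close> and \<open>\<bar>\<mu>\<bar>\<close> the inner weight \<open>v\<close> is a power of \<open>k\<close>, whose averages are dominated
  by Cesaro averages; these have weak type (1,1) by the maximal ergodic theorem (\<open>weak_type_one\<close>).
  The coefficients decay like \<open>m powr - (1 + e)\<close>, which is what is needed to add up functions in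
  weak \<open>L\<^sup>1\<close> (\<open>stein_weiss\<close>). For bounded functions the averages converge term by term, by
  Birkhoff's theorem and dominated convergence; the total weights of \<open>w\<close> and \<open>v\<close> are comparable
  because the shares of the terms do not add up to 0, which for coefficients \<open>\<mu>(m)\<close> is
  \<open>suminf_moebius_powr_nonzero\<close>. Weak type at one exponent gives the strong inequality at all
  larger ones (\<open>weak_type_imp_strong_type\<close>), and it carries convergence over from bounded
  functions (\<open>pointwise_of_weak_type\<close>).

  For \<open>\<theta>\<close> the inner weight is the number of divisors, so everything reduces to that weight. Its
  own decomposition, with constant inner weight, has the coefficients \<open>1 / m\<close>, which are no longer
  summable. Dirichlet's hyperbola method restricts the divisors of times up to \<open>n\<close> to those up to
  \<open>sqrt n\<close>, and the indicator of divisibility is expanded in Ramanujan sums \<open>c\<^sub>q\<close>. The maximal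
  function is then at most a constant times the sum over \<open>i\<close> of \<open>block_max\<close>, the contribution of
  the \<open>q\<close> between \<open>2 ^ i\<close> and \<open>2 ^ Suc i\<close> (\<open>divisor_count_max_le_blocks\<close>). In \<open>L\<^sup>2\<close> this
  contribution decays exponentially in \<open>i\<close>, since the Fourier transforms of the averages
  concentrate near the fractions \<open>a / q\<close>, which are well spaced (\<open>sum_kernels_over_fractions\<close>,
  \<open>block_max_L2\<close>); in \<open>L\<^sup>r\<close>, for \<open>r > 1\<close>, it grows at most polynomially (\<open>block_max_Lr\<close>). Cutting
  the function in block \<open>i\<close> at the level \<open>2 powr (i / 4)\<close> combines both bounds into weak type \<open>p\<close>
  for \<open>1 < p < 2\<close> (\<open>sum_block_max_weak\<close>). The \<open>L\<^sup>2\<close> bound also dominates the series over \<open>q\<close>,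
  which gives convergence for bounded functions along times with a bounded number of binary
  digits; every other time is close to one of these (\<open>bounded_convergence_divisor_count\<close>).
\<close>

section \<open>Divisor sums and the Moebius function\<close>

lemma prod_prime_factors_squarefree:
  assumes "squarefree (d::nat)"
  shows "\<Prod>(prime_factors d) = d"
proof -
  have "d \<noteq> 0" using assms by (metis not_squarefree_0)
  have "(\<Prod>p\<in>prime_factors d. p) = (\<Prod>p\<in>prime_factors d. p ^ multiplicity p d)"
    using assms squarefree_factorial_semiring'[OF \<open>d \<noteq> 0\<close>] by (intro prod.cong) auto
  also have "\<dots> = d" using prod_prime_factors[OF \<open>d \<noteq> 0\<close>] by simp
  finally show ?thesis by simp
qed

lemma prime_factors_prod_primes:
  assumes "finite S" "\<And>p::nat. p \<in> S \<Longrightarrow> prime p"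
  shows "prime_factors (\<Prod>S) = S" "squarefree (\<Prod>S)"
proof -
  have "prime_factorization (prod_mset (mset_set S)) = mset_set S"
    by (rule prime_factorization_prod_mset_primes) (use assms in auto)
  moreover have "prod_mset (mset_set S) = \<Prod>S"
    using prod_unfold_prod_mset[of id S] by simp
  ultimately show "prime_factors (\<Prod>S) = S" using assms by simp
  show "squarefree (\<Prod>S)"
    by (rule squarefree_prod_coprime) (use assms in \<open>auto intro: squarefree_prime primes_coprime\<close>)
qed

lemma bij_betw_prime_subsets:
  assumes "n > (0::nat)"
  shows "bij_betw Prod (Pow (prime_factors n)) {d. d dvd n \<and> squarefree d}"
proof (rule bij_betw_byWitness[where f' = prime_factors])
  have fin: "finite S" if "S \<in> Pow (prime_factors n)" for S
    using that finite_subset[of S "prime_factors n"] by simp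
  have pr: "prime p" if "S \<in> Pow (prime_factors n)" "p \<in> S" for S p
    using that in_prime_factors_imp_prime by blast
  show "\<forall>S\<in>Pow (prime_factors n). prime_factors (\<Prod>S) = S"
    by (intro ballI prime_factors_prod_primes(1)[OF fin]) (auto intro: pr)
  show "\<forall>d\<in>{d. d dvd n \<and> squarefree d}. \<Prod>(prime_factors d) = d"
    using prod_prime_factors_squarefree by auto
  show "Prod ` Pow (prime_factors n) \<subseteq> {d. d dvd n \<and> squarefree d}"
  proof safe
    fix S assume S: "S \<subseteq> prime_factors n"
    show "squarefree (\<Prod>S)"
      by (rule prime_factors_prod_primes(2)[OF fin]) (use S pr in auto)
    have "\<Prod>S dvd \<Prod>(prime_factors n)" using S by (intro prod_dvd_prod_subset) auto
    also have "\<dots> dvd (\<Prod>p\<in>prime_factors n. p ^ multiplicity p n)"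
      by (intro prod_dvd_prod) (auto simp: prime_factors_multiplicity intro!: dvd_power)
    also have "\<dots> = n" using prod_prime_factors[of n] assms by simp
    finally show "\<Prod>S dvd n" .
  qed
  show "prime_factors ` {d. d dvd n \<and> squarefree d} \<subseteq> Pow (prime_factors n)"
    using assms dvd_prime_factors by (metis (mono_tags, lifting) Pow_iff image_subsetI mem_Collect_eq neq0_conv)
qed

text \<open>
  Expanding the product gives one term for each set of prime factors of \<open>n\<close>. These sets correspond
  to the squarefree divisors of \<open>n\<close>, and the signs are the values of \<open>\<mu>\<close>.
\<close>
lemma sum_moebius_mult:
  fixes g :: "nat \<Rightarrow> real"
  assumes "n > 0" and g1: "g 1 = 1" and gm: "\<And>a b. g (a * b) = g a * g b"
  shows "(\<Sum>d | d dvd n. of_int (moebius_mu d) * g d) = (\<Prod>p\<in>prime_factors n. 1 - g p)"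
proof -
  have g_prod: "g (\<Prod>S) = (\<Prod>p\<in>S. g p)" if "finite S" for S
    using that g1 by induction (auto simp: gm)
  have "(\<Sum>d | d dvd n. of_int (moebius_mu d) * g d)
      = (\<Sum>d | d dvd n \<and> squarefree d. of_int (moebius_mu d) * g d)"
    by (rule sum.mono_neutral_right) (use assms(1) in \<open>auto simp: moebius_mu_def\<close>)
  also have "\<dots> = (\<Sum>S\<in>Pow (prime_factors n). of_int (moebius_mu (\<Prod>S)) * g (\<Prod>S))"
    by (rule sum.reindex_bij_betw[OF bij_betw_prime_subsets[OF assms(1)], symmetric])
  also have "\<dots> = (\<Sum>S\<in>Pow (prime_factors n). (\<Prod>p\<in>S. - g p) * (\<Prod>p\<in>prime_factors n - S. 1))"
  proof (rule sum.cong[OF refl])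
    fix S assume S: "S \<in> Pow (prime_factors n)"
    then have fS: "finite S" by (auto intro: finite_subset)
    have "prime_factors (\<Prod>S) = S" "squarefree (\<Prod>S)"
      using S by (auto intro!: prime_factors_prod_primes[OF fS])
    then show "of_int (moebius_mu (\<Prod>S)) * g (\<Prod>S)
        = (\<Prod>p\<in>S. - g p) * (\<Prod>p\<in>prime_factors n - S. 1)"
      by (simp add: moebius_mu_def g_prod[OF fS] prod_uminus)
  qed
  also have "\<dots> = (\<Prod>p\<in>prime_factors n. - g p + 1)"
    by (subst prod_add) auto
  finally show ?thesis by simp
qed

lemma sum_moebius:
  assumes "n > 0"
  shows "(\<Sum>d | d dvd n. real_of_int (moebius_mu d)) = (if n = 1 then 1 else 0)"
proof -
  have "(\<Sum>d | d dvd n. real_of_int (moebius_mu d)) = (\<Prod>p\<in>prime_factors n. (1 - 1 :: real))"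
    using sum_moebius_mult[of n "\<lambda>_. 1"] assms by simp
  also have "\<dots> = (if n = 1 then 1 else 0)"
    using assms by (auto simp: prime_factorization_empty_iff card_gt_0_iff)
  finally show ?thesis .
qed

lemma abs_moebius_mu_le: "\<bar>real_of_int (moebius_mu d)\<bar> \<le> 1"
  by (simp add: moebius_mu_def)

lemma abs_moebius_eq: "abs_moebius k = (if squarefree k then 1 else 0)"
  by (simp add: abs_moebius_def moebius_mu_def)

text \<open>
  The squares dividing \<open>k\<close> are the squares of the divisors of its square part, and that part is 1
  exactly for squarefree \<open>k\<close>; so this is \<open>sum_moebius\<close> for the square part.
\<close>
lemma abs_moebius_square_divisors:
  assumes "k > 0"
  shows "abs_moebius k = (\<Sum>d | d ^ 2 dvd k. real_of_int (moebius_mu d))"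
proof -
  have "squarefree k \<longleftrightarrow> square_part k = 1"
    using assms unfolding squarefree_def
    by (metis dvd_refl dvd_square_part_iff nat_dvd_1_iff_1)
  moreover have "{d. d ^ 2 dvd k} = {d. d dvd square_part k}"
    by (simp add: dvd_square_part_iff)
  moreover have "square_part k > 0"
    using assms square_part_0_iff[of k] by (meson neq0_conv)
  ultimately show ?thesis
    using sum_moebius[of "square_part k"] by (simp add: abs_moebius_eq)
qed

lemma card_dvd_between:
  assumes "k > 0" "c dvd (k::nat)"
  shows "card {e. c dvd e \<and> e dvd k} = card {e. e dvd k div c}"
proof -
  have c: "c > 0" using assms by (auto intro: Nat.gr0I)
  have "bij_betw (\<lambda>e. c * e) {e. e dvd k div c} {e. c dvd e \<and> e dvd k}"
  proof (rule bij_betw_byWitness[where f' = "\<lambda>e. e div c"])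
    show "(\<lambda>e. c * e) ` {e. e dvd k div c} \<subseteq> {e. c dvd e \<and> e dvd k}"
      using assms c by (auto simp: dvd_div_iff_mult mult.commute)
    show "(\<lambda>e. e div c) ` {e. c dvd e \<and> e dvd k} \<subseteq> {e. e dvd k div c}"
      using div_dvd_div assms(2) by blast
  qed (use c in auto)
  then show ?thesis by (simp add: bij_betw_same_card)
qed

text \<open>
  The squarefree divisors are counted by summing \<open>\<bar>\<mu>\<bar>\<close> over all divisors; after inserting the
  previous expansion of \<open>\<bar>\<mu>\<bar>\<close>, the divisors that are multiples of \<open>d ^ 2\<close> correspond to the
  divisors of \<open>k div d ^ 2\<close>.
\<close>
lemma sqfree_divisor_count_square_divisors:
  assumes "k > 0"
  shows "sqfree_divisor_count k
    = (\<Sum>d | d ^ 2 dvd k. real_of_int (moebius_mu d) * real (card {e. e dvd k div d ^ 2}))"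
proof -
  have fin: "finite {e. e dvd k}" using assms by simp
  have finsq: "finite {d. d ^ 2 dvd k}" 
    by (rule finite_subset[OF _ fin]) (auto intro: dvd_trans[OF dvd_power[of 2]])
  have "sqfree_divisor_count k = (\<Sum>e | e dvd k. abs_moebius e)"
    using fin by (simp add: sqfree_divisor_count_def abs_moebius_eq sum.If_cases
        flip: Collect_conj_eq)
  also have "\<dots> = (\<Sum>e | e dvd k. \<Sum>d | d ^ 2 dvd k \<and> d ^ 2 dvd e. real_of_int (moebius_mu d))"
  proof (intro sum.cong refl)
    fix e assume e: "e \<in> {e. e dvd k}"
    then have "e > 0" using assms by (auto intro: Nat.gr0I)
    moreover have "{d. d ^ 2 dvd k \<and> d ^ 2 dvd e} = {d. d ^ 2 dvd e}"
      using e by (auto intro: dvd_trans)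
    ultimately show "abs_moebius e = (\<Sum>d | d ^ 2 dvd k \<and> d ^ 2 dvd e. real_of_int (moebius_mu d))"
      using abs_moebius_square_divisors by simp
  qed
  also have "\<dots> = (\<Sum>d | d ^ 2 dvd k. \<Sum>e | e dvd k \<and> d ^ 2 dvd e. real_of_int (moebius_mu d))"
    using sum.swap_restrict[OF fin finsq, of "\<lambda>e d. real_of_int (moebius_mu d)" "\<lambda>e d. d ^ 2 dvd e"]
    by simp
  also have "\<dots> = (\<Sum>d | d ^ 2 dvd k. real_of_int (moebius_mu d) * real (card {e. e dvd k div d ^ 2}))"
  proof (intro sum.cong refl)
    fix d assume d: "d \<in> {d. d ^ 2 dvd k}"
    have "{e. e dvd k \<and> d ^ 2 dvd e} = {e. d ^ 2 dvd e \<and> e dvd k}" by auto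
    then show "(\<Sum>e | e dvd k \<and> d ^ 2 dvd e. real_of_int (moebius_mu d))
        = real_of_int (moebius_mu d) * real (card {e. e dvd k div d ^ 2})"
      using card_dvd_between[OF assms, of "d ^ 2"] d by simp
  qed
  finally show ?thesis .
qed

lemma sum_divisors_flip:
  assumes "k > 0"
  shows "(\<Sum>d | d dvd (k::nat). h d (k div d)) = (\<Sum>d | d dvd k. h (k div d) d)"
  by (rule sum.reindex_bij_witness[where i = "\<lambda>d. k div d" and j = "\<lambda>d. k div d"])
     (use assms in auto)

lemma divisor_sigma_flip:
  "k > 0 \<Longrightarrow> divisor_sigma s k = (\<Sum>d | d dvd k. real (k div d) powr s)"
  unfolding divisor_sigma_def using sum_divisors_flip[of k "\<lambda>d e. real d powr s"] by simp

lemma euler_jordan_flip: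
  "k > 0 \<Longrightarrow> euler_jordan s k = (\<Sum>d | d dvd k. real_of_int (moebius_mu d) * real (k div d) powr s)"
  unfolding euler_jordan_def
  using sum_divisors_flip[of k "\<lambda>d e. real d powr s * real_of_int (moebius_mu e)"]
  by (simp add: mult.commute)

text \<open>
  As for Euler's function, \<open>J\<^sub>s k\<close> is \<open>k powr s\<close> times the product of the factors \<open>1 - p powr - s\<close>
  over the primes dividing \<open>k\<close>, and these lie between 0 and 1.
\<close>
lemma euler_jordan_nonneg:
  assumes "s > 0" "k > 0"
  shows "euler_jordan s k \<ge> 0"
proof -
  have "euler_jordan s k
      = (\<Sum>d | d dvd k. real k powr s * (real_of_int (moebius_mu d) * real d powr - s))"
    unfolding euler_jordan_flip[OF assms(2)]
  proof (intro sum.cong refl)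
    fix d assume "d \<in> {d. d dvd k}"
    then have "real (k div d) = real k / real d" by (simp add: real_of_nat_div)
    then show "real_of_int (moebius_mu d) * real (k div d) powr s
        = real k powr s * (real_of_int (moebius_mu d) * real d powr - s)"
      by (simp add: powr_divide powr_minus field_simps)
  qed
  also have "\<dots> = real k powr s * (\<Prod>p\<in>prime_factors k. 1 - real p powr - s)"
    using sum_moebius_mult[of k "\<lambda>d. real d powr - s"] assms
    by (simp add: powr_mult flip: sum_distrib_left)
  also have "\<dots> \<ge> 0"
  proof (intro mult_nonneg_nonneg prod_nonneg ballI)
    fix p assume "p \<in> prime_factors k"
    then have "real p \<ge> 1" using in_prime_factors_imp_prime prime_ge_1_nat by force
    then have "real p powr - s \<le> real p powr 0" using assms by (intro powr_mono) auto
    then show "0 \<le> 1 - real p powr - s" using \<open>real p \<ge> 1\<close> by simp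
  qed auto
  finally show ?thesis .
qed

text \<open>
  The identity behind all comparisons between the weight and its inner weight: the sum over the
  times up to \<open>n\<close> becomes, for each \<open>m\<close>, a sum over the multiples of \<open>b m\<close>, that is over the orbit
  of \<open>\<tau> ^^ b m\<close> when \<open>F k\<close> is the value of a function at time \<open>k\<close>. As \<open>b m \<ge> m\<close>, only \<open>m \<le> n\<close>
  contribute.
\<close>
lemma sum_divisor_convolution:
  fixes a v F :: "nat \<Rightarrow> real" and b :: "nat \<Rightarrow> nat"
  assumes b: "\<And>m. b m \<ge> m"
  shows "(\<Sum>k=1..n. (\<Sum>m | m \<in> {1..k} \<and> b m dvd k. a m * v (k div b m)) * F k)
       = (\<Sum>m=1..n. a m * (\<Sum>j=1..n div b m. v j * F (b m * j)))"
proof -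
  have "(\<Sum>k=1..n. (\<Sum>m | m \<in> {1..k} \<and> b m dvd k. a m * v (k div b m)) * F k)
      = (\<Sum>k=1..n. (\<Sum>m | m \<in> {1..n} \<and> b m dvd k. a m * v (k div b m) * F k))"
  proof (rule sum.cong[OF refl])
    fix k assume k: "k \<in> {1..n}"
    have "m \<le> k" if "b m dvd k" for m
      using b[of m] dvd_imp_le[OF that] k by auto
    then have "{m. m \<in> {1..k} \<and> b m dvd k} = {m. m \<in> {1..n} \<and> b m dvd k}"
      using k by (meson Collect_cong atLeastAtMost_iff order_trans)
    then show "(\<Sum>m | m \<in> {1..k} \<and> b m dvd k. a m * v (k div b m)) * F k
        = (\<Sum>m | m \<in> {1..n} \<and> b m dvd k. a m * v (k div b m) * F k)"
      by (simp add: sum_distrib_right)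
  qed
  also have "\<dots> = (\<Sum>m=1..n. (\<Sum>k | k \<in> {1..n} \<and> b m dvd k. a m * v (k div b m) * F k))"
    by (rule sum.swap_restrict) auto
  also have "\<dots> = (\<Sum>m=1..n. a m * (\<Sum>j=1..n div b m. v j * F (b m * j)))"
  proof (rule sum.cong[OF refl])
    fix m assume "m \<in> {1..n}"
    then have bm: "b m > 0" using b[of m] by auto
    have "(\<Sum>k | k \<in> {1..n} \<and> b m dvd k. a m * v (k div b m) * F k)
        = (\<Sum>j=1..n div b m. a m * v j * F (b m * j))"
    proof (rule sum.reindex_bij_witness[where i = "\<lambda>j. b m * j" and j = "\<lambda>k. k div b m"])
      fix k assume k: "k \<in> {k. k \<in> {1..n} \<and> b m dvd k}"
      then have "b m \<le> k" using dvd_imp_le[of "b m" k] by auto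
      then show "k div b m \<in> {1..n div b m}"
        using k bm by (simp add: div_le_mono div_greater_zero_iff Suc_le_eq)
    next
      fix j assume "j \<in> {1..n div b m}"
      then show "b m * j \<in> {k. k \<in> {1..n} \<and> b m dvd k}"
        using bm by (simp add: less_eq_div_iff_mult_less_eq mult.commute Suc_le_eq)
    qed (use bm in auto)
    then show "(\<Sum>k | k \<in> {1..n} \<and> b m dvd k. a m * v (k div b m) * F k)
        = a m * (\<Sum>j=1..n div b m. v j * F (b m * j))"
      by (simp add: sum_distrib_left mult.assoc)
  qed
  finally show ?thesis .
qed

lemma filterlim_div_at_top:
  assumes "b > 0"
  shows "filterlim (\<lambda>n::nat. n div b) at_top sequentially"
  unfolding filterlim_at_top
proof
  fix Z :: nat
  show "eventually (\<lambda>n. Z \<le> n div b) sequentially"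
    by (rule eventually_sequentiallyI[of "Z * b"]) (use assms in \<open>simp add: less_eq_div_iff_mult_less_eq\<close>)
qed

lemma tannery_nat:
  fixes a :: "nat \<Rightarrow> nat \<Rightarrow> real"
  assumes "\<And>k. (\<lambda>n. a k n) \<longlonglongrightarrow> c k" "\<And>k n. \<bar>a k n\<bar> \<le> B k" "summable B"
  shows "(\<lambda>n. \<Sum>k. a k n) \<longlonglongrightarrow> (\<Sum>k. c k)"
proof -
  have "eventually (\<lambda>(k, n). norm (a k n) \<le> B k) (at_top \<times>\<^sub>F sequentially)"
    by (rule always_eventually) (use assms(2) in auto)
  from tannerys_theorem[OF assms(1) this assms(3)] show ?thesis by simp
qed

text \<open>
  The product of this series with the sum of \<open>m powr - t\<close> is 1. Multiplying the two Dirichlet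
  series directly would require rearranging a double series; instead the finite sums over pairs
  with product at most \<open>n\<close> are exactly 1 by Moebius inversion, and the limit is taken by dominated
  convergence.
\<close>
lemma suminf_moebius_powr_nonzero:
  assumes "t > 1"
  shows "(\<Sum>m. real_of_int (moebius_mu m) * real m powr - t) \<noteq> 0"
proof -
  define f where "f m = real m powr - t" for m :: nat
  define Z where "Z n = (\<Sum>j=1..n. f j)" for n :: nat
  have f_nonneg: "f m \<ge> 0" for m by (simp add: f_def)
  have f0: "f 0 = 0" by (simp add: f_def)
  have sf: "summable f" using assms unfolding f_def by (simp add: summable_real_powr_iff)
  have Z_alt: "Z n = (\<Sum>j<Suc n. f j)" for n
    unfolding Z_def by (rule sum.mono_neutral_left) (auto simp: f0 not_less_eq_eq Suc_le_eq)
  have Z_lim: "Z \<longlonglongrightarrow> suminf f"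
    unfolding Z_alt using LIMSEQ_Suc[OF summable_LIMSEQ[OF sf]] .
  have Z_le: "\<bar>Z n\<bar> \<le> suminf f" for n
    using sum_le_suminf[OF sf, of "{..<Suc n}"] f_nonneg sum_nonneg[of "{..<Suc n}" f] by (simp add: Z_alt)
  define a where "a m n = of_int (moebius_mu m) * f m * Z (n div m)" for m n :: nat
  have lim: "(\<lambda>n. \<Sum>m. a m n) \<longlonglongrightarrow> (\<Sum>m. of_int (moebius_mu m) * f m * suminf f)"
  proof (rule tannery_nat)
    show "(\<lambda>n. a m n) \<longlonglongrightarrow> of_int (moebius_mu m) * f m * suminf f" for m
    proof (cases "m = 0")
      case False
      then show ?thesis unfolding a_def
        by (intro tendsto_intros filterlim_compose[OF Z_lim filterlim_div_at_top]) auto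
    qed (simp add: a_def f0)
    show "\<bar>a m n\<bar> \<le> f m * suminf f" for m n
    proof -
      have "\<bar>a m n\<bar> = \<bar>of_int (moebius_mu m)\<bar> * (f m * \<bar>Z (n div m)\<bar>)"
        by (simp add: a_def abs_mult f_nonneg)
      also have "\<dots> \<le> 1 * (f m * suminf f)"
        using abs_moebius_mu_le[of m] Z_le[of "n div m"] f_nonneg[of m]
        by (intro mult_mono mult_left_mono) auto
      finally show ?thesis by simp
    qed
    show "summable (\<lambda>m. f m * suminf f)" by (rule summable_mult2[OF sf])
  qed
  have one: "(\<Sum>m. a m n) = 1" if "n \<ge> 1" for n
  proof -
    have "(\<Sum>m. a m n) = (\<Sum>m=1..n. a m n)"
      by (rule suminf_finite) (auto simp: a_def f0 Z_def not_less_eq_eq Suc_le_eq)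
    also have "\<dots> = (\<Sum>m=1..n. of_int (moebius_mu m) * (\<Sum>j=1..n div m. 1 * f (m * j)))"
      unfolding a_def Z_def by (simp add: f_def powr_mult sum_distrib_left mult_ac)
    also have "\<dots> = (\<Sum>k=1..n. (\<Sum>m | m \<in> {1..k} \<and> m dvd k. of_int (moebius_mu m) * 1) * f k)"
      by (rule sum_divisor_convolution[symmetric, where b = "\<lambda>m. m"]) simp
    also have "\<dots> = (\<Sum>k=1..n. if k = 1 then 1 else 0)"
    proof (rule sum.cong[OF refl])
      fix k assume k: "k \<in> {1..n}"
      have "{m. m \<in> {1..k} \<and> m dvd k} = {m. m dvd k}"
        using k by (auto simp: dvd_imp_le Suc_le_eq intro: Nat.gr0I)
      then show "(\<Sum>m | m \<in> {1..k} \<and> m dvd k. of_int (moebius_mu m) * 1) * f k = (if k = 1 then 1 else 0)"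
        using sum_moebius[of k] k by (simp add: f_def)
    qed
    also have "\<dots> = 1" using that by simp
    finally show ?thesis .
  qed
  have "(\<lambda>n::nat. 1) \<longlonglongrightarrow> (\<Sum>m. of_int (moebius_mu m) * f m * suminf f)"
    by (rule Lim_transform_eventually[OF lim], rule eventually_sequentiallyI[of 1], rule one)
  then have "1 = (\<Sum>m. of_int (moebius_mu m) * f m * suminf f)"
    using LIMSEQ_unique tendsto_const by blast
  moreover have "summable (\<lambda>m. of_int (moebius_mu m) * f m)"
  proof (rule summable_comparison_test'[OF sf])
    fix m show "norm (of_int (moebius_mu m) * f m) \<le> f m"
      using mult_right_mono[OF abs_moebius_mu_le f_nonneg[of m], of m] f_nonneg[of m] by (simp add: abs_mult)
  qed
  ultimately have "1 = (\<Sum>m. of_int (moebius_mu m) * f m) * suminf f"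
    by (simp add: suminf_mult2)
  then show ?thesis by (auto simp: f_def)
qed

section \<open>Iterates of a measure-preserving map\<close>

lemma dynamical_system_funpow_measurable [measurable (raw)]:
  assumes "dynamical_system M \<tau>"
  shows "\<tau> ^^ k \<in> measurable M M"
proof (induction k)
  case (Suc k)
  have "\<tau> \<in> measurable M M" using assms by (simp add: dynamical_system_def)
  then show ?case using measurable_comp[OF Suc] by simp
qed (simp add: id_def)

lemma dynamical_system_funpow_distr:
  assumes "dynamical_system M \<tau>"
  shows "distr M M (\<tau> ^^ k) = M"
proof (induction k)
  case (Suc k)
  have \<tau>: "\<tau> \<in> measurable M M" "distr M M \<tau> = M"
    using assms by (auto simp: dynamical_system_def)
  have "distr M M (\<tau> ^^ Suc k) = distr M M (\<tau> \<circ> (\<tau> ^^ k))" by simp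
  also have "\<dots> = distr (distr M M (\<tau> ^^ k)) M \<tau>"
    by (rule distr_distr[symmetric, OF \<tau>(1) dynamical_system_funpow_measurable[OF assms]])
  also have "\<dots> = M" by (simp only: Suc \<tau>)
  finally show ?case .
qed (simp add: id_def)

lemma dynamical_system_funpow:
  assumes "dynamical_system M \<tau>"
  shows "dynamical_system M (\<tau> ^^ k)"
  unfolding dynamical_system_def
  using assms dynamical_system_funpow_measurable[OF assms] dynamical_system_funpow_distr[OF assms]
  by (metis dynamical_system_def)

lemma funpow_mult_apply:
  fixes \<tau> :: "'a \<Rightarrow> 'a"
  shows "((\<tau> ^^ d) ^^ k) x = (\<tau> ^^ (d * k)) x"
  by (simp add: funpow_mult mult.commute)

lemma nn_integral_funpow:
  assumes "dynamical_system M \<tau>" "g \<in> borel_measurable M"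
  shows "(\<integral>\<^sup>+x. g ((\<tau> ^^ k) x) \<partial>M) = (\<integral>\<^sup>+x. g x \<partial>M)"
  using nn_integral_distr[OF dynamical_system_funpow_measurable[OF assms(1), of k], of g] assms
  by (simp add: dynamical_system_funpow_distr)

lemma integral_funpow:
  fixes g :: "'a \<Rightarrow> real"
  assumes "dynamical_system M \<tau>" "integrable M g"
  shows "integral\<^sup>L M (\<lambda>x. g ((\<tau> ^^ k) x)) = integral\<^sup>L M g"
    "integrable M (\<lambda>x. g ((\<tau> ^^ k) x))"
proof -
  note m = dynamical_system_funpow_measurable[OF assms(1), of k]
  have g: "g \<in> borel_measurable M" using assms by auto
  show "integral\<^sup>L M (\<lambda>x. g ((\<tau> ^^ k) x)) = integral\<^sup>L M g"
    using integral_distr[OF m g] dynamical_system_funpow_distr[OF assms(1), of k] by simp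
  show "integrable M (\<lambda>x. g ((\<tau> ^^ k) x))"
    using integrable_distr_eq[OF m g] dynamical_system_funpow_distr[OF assms(1), of k] assms by simp
qed

section \<open>The maximal ergodic theorem\<close>

text \<open>
  This is the maximum of the first \<open>N\<close> Birkhoff sums and 0, in the recursive form on which
  Garsia's proof of the maximal ergodic theorem rests.
\<close>
fun birkhoff_max :: "('a \<Rightarrow> 'a) \<Rightarrow> ('a \<Rightarrow> real) \<Rightarrow> nat \<Rightarrow> 'a \<Rightarrow> real" where
  "birkhoff_max \<tau> f 0 x = 0"
| "birkhoff_max \<tau> f (Suc N) x = max 0 (f x + birkhoff_max \<tau> f N (\<tau> x))"

lemma birkhoff_max_nonneg: "birkhoff_max \<tau> f N x \<ge> 0"
  by (cases N) auto

lemma birkhoff_max_mono: "birkhoff_max \<tau> f N x \<le> birkhoff_max \<tau> f (Suc N) x"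
proof (induction N arbitrary: x)
  case (Suc N)
  then have "max 0 (f x + birkhoff_max \<tau> f N (\<tau> x)) \<le> max 0 (f x + birkhoff_max \<tau> f (Suc N) (\<tau> x))"
    by (intro max.mono add_left_mono order_refl)
  then show ?case by (simp only: birkhoff_max.simps(2)[of \<tau> f _ x])
qed simp

lemma sum_Suc_shift_funpow:
  "(\<Sum>k<Suc n. f ((\<tau> ^^ k) x)) = f x + (\<Sum>k<n. f ((\<tau> ^^ k) (\<tau> x)))" for f :: "'a \<Rightarrow> real"
  by (subst sum.lessThan_Suc_shift) (simp add: funpow_Suc_right del: funpow.simps)

lemma birkhoff_sum_le_max:
  "n \<le> N \<Longrightarrow> (\<Sum>k<n. f ((\<tau> ^^ k) x)) \<le> birkhoff_max \<tau> f N x"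
proof (induction N arbitrary: n x)
  case (Suc N)
  show ?case
  proof (cases n)
    case (Suc m)
    then have "(\<Sum>k<m. f ((\<tau> ^^ k) (\<tau> x))) \<le> birkhoff_max \<tau> f N (\<tau> x)"
      using Suc.IH Suc.prems by simp
    then show ?thesis unfolding Suc sum_Suc_shift_funpow by simp
  qed (simp add: birkhoff_max_nonneg del: birkhoff_max.simps)
qed simp

lemma birkhoff_max_attained:
  "\<exists>n\<le>N. birkhoff_max \<tau> f N x = (\<Sum>k<n. f ((\<tau> ^^ k) x))"
proof (induction N arbitrary: x)
  case (Suc N)
  obtain n where n: "n \<le> N" "birkhoff_max \<tau> f N (\<tau> x) = (\<Sum>k<n. f ((\<tau> ^^ k) (\<tau> x)))"
    using Suc by blast
  show ?case
  proof (cases "f x + birkhoff_max \<tau> f N (\<tau> x) \<ge> 0")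
    case True
    then have "birkhoff_max \<tau> f (Suc N) x = (\<Sum>k<Suc n. f ((\<tau> ^^ k) x))"
      unfolding sum_Suc_shift_funpow using n by simp
    then show ?thesis using n by (intro exI[of _ "Suc n"]) simp
  next
    case False
    then show ?thesis by (intro exI[of _ 0]) simp
  qed
qed simp

lemma birkhoff_max_pos_iff:
  "birkhoff_max \<tau> f N x > 0 \<longleftrightarrow> (\<exists>n\<in>{1..N}. (\<Sum>k<n. f ((\<tau> ^^ k) x)) > 0)"
proof
  assume *: "birkhoff_max \<tau> f N x > 0"
  obtain n where "n \<le> N" "birkhoff_max \<tau> f N x = (\<Sum>k<n. f ((\<tau> ^^ k) x))"
    using birkhoff_max_attained[of N \<tau> f x] by auto
  moreover have "n \<noteq> 0" using calculation * by (cases n) auto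
  ultimately show "\<exists>n\<in>{1..N}. (\<Sum>k<n. f ((\<tau> ^^ k) x)) > 0" using * by (intro bexI[of _ n]) auto
next
  assume "\<exists>n\<in>{1..N}. (\<Sum>k<n. f ((\<tau> ^^ k) x)) > 0"
  then obtain n where "n \<le> N" "(\<Sum>k<n. f ((\<tau> ^^ k) x)) > 0" by auto
  then show "birkhoff_max \<tau> f N x > 0" using birkhoff_sum_le_max[of n N f \<tau> x] by linarith
qed

lemma integrable_birkhoff_max:
  assumes ds: "dynamical_system M \<tau>" and f: "integrable M f"
  shows "integrable M (birkhoff_max \<tau> f N)"
proof (induction N)
  case (Suc N)
  have "integrable M (\<lambda>x. birkhoff_max \<tau> f N (\<tau> x))"
    using integral_funpow(2)[OF ds Suc, of 1] by simp
  then have "integrable M (\<lambda>x. max 0 (f x + birkhoff_max \<tau> f N (\<tau> x)))"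
    using f by (intro integrable_max) auto
  moreover have "birkhoff_max \<tau> f (Suc N) = (\<lambda>x. max 0 (f x + birkhoff_max \<tau> f N (\<tau> x)))" by auto
  ultimately show ?case by simp
qed (simp add: fun_eq_iff[symmetric] cong: integrable_cong)

text \<open>
  Garsia's argument: where the running maximum \<open>S\<close> is positive, the recursion and monotonicity in
  \<open>N\<close> give \<open>S x - S (\<tau> x) \<le> f x\<close>; elsewhere \<open>S x = 0 \<le> S (\<tau> x)\<close>. The integral of \<open>S - S \<circ> \<tau>\<close>
  vanishes by invariance.
\<close>
lemma maximal_ergodic_finite:
  fixes f :: "'a \<Rightarrow> real"
  assumes ds: "dynamical_system M \<tau>" and f: "integrable M f"
  shows "(\<integral>x. indicator {x. birkhoff_max \<tau> f N x > 0} x * f x \<partial>M) \<ge> 0"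
proof -
  let ?S = "birkhoff_max \<tau> f N"
  have S: "integrable M ?S" and S': "integrable M (\<lambda>x. ?S (\<tau> x))"
    using integrable_birkhoff_max[OF assms] integral_funpow(2)[OF ds, of _ 1] by auto
  have [measurable]: "?S \<in> borel_measurable M" "f \<in> borel_measurable M" using S f by auto
  have "{x\<in>space M. ?S x > 0} \<in> sets M" by measurable
  then have int: "integrable M (\<lambda>x. indicator {x\<in>space M. ?S x > 0} x * f x)"
    using integrable_real_mult_indicator[OF _ f] by (simp add: mult.commute)
  have "0 = (\<integral>x. ?S x - ?S (\<tau> x) \<partial>M)"
    using integral_funpow(1)[OF ds S, of 1] S S' by simp
  also have "\<dots> \<le> (\<integral>x. indicator {x\<in>space M. ?S x > 0} x * f x \<partial>M)"
  proof (rule integral_mono[OF _ int])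
    show "integrable M (\<lambda>x. ?S x - ?S (\<tau> x))" using S S' by simp
    fix x assume x: "x \<in> space M"
    show "?S x - ?S (\<tau> x) \<le> indicator {x\<in>space M. ?S x > 0} x * f x"
    proof (cases "?S x > 0")
      case True
      then obtain N' where N: "N = Suc N'" by (cases N) auto
      have "?S x = f x + birkhoff_max \<tau> f N' (\<tau> x)" using True unfolding N by auto
      also have "\<dots> \<le> f x + ?S (\<tau> x)" unfolding N using birkhoff_max_mono[of \<tau> f N' "\<tau> x"] by simp
      finally show ?thesis using True x by simp
    next
      case False
      then show ?thesis using birkhoff_max_nonneg[of \<tau> f N x] birkhoff_max_nonneg[of \<tau> f N "\<tau> x"] by simp
    qed
  qed
  also have "\<dots> = (\<integral>x. indicator {x. ?S x > 0} x * f x \<partial>M)"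
    by (intro Bochner_Integration.integral_cong) (auto simp: indicator_def)
  finally show ?thesis .
qed

lemma maximal_ergodic:
  fixes f :: "'a \<Rightarrow> real"
  assumes ds: "dynamical_system M \<tau>" and f: "integrable M f"
  shows "(\<integral>x. indicator {x. \<exists>n\<ge>1. (\<Sum>k<n. f ((\<tau> ^^ k) x)) > 0} x * f x \<partial>M) \<ge> 0"
proof -
  let ?E = "\<lambda>N. {x. birkhoff_max \<tau> f N x > 0}" and ?E' = "{x. \<exists>n\<ge>1. (\<Sum>k<n. f ((\<tau> ^^ k) x)) > 0}"
  have [measurable]: "birkhoff_max \<tau> f N \<in> borel_measurable M" for N
    using integrable_birkhoff_max[OF assms] by auto
  have [measurable]: "f \<in> borel_measurable M" "\<tau> ^^ k \<in> measurable M M" for k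
    using f ds by (auto intro: dynamical_system_funpow_measurable)
  have "(\<lambda>N. \<integral>x. indicator (?E N) x * f x \<partial>M) \<longlonglongrightarrow> (\<integral>x. indicator ?E' x * f x \<partial>M)"
  proof (rule integral_dominated_convergence[where w = "\<lambda>x. \<bar>f x\<bar>"])
    show "AE x in M. (\<lambda>N. indicator (?E N) x * f x) \<longlonglongrightarrow> indicator ?E' x * f x"
    proof (intro AE_I2 tendsto_intros)
      fix x
      show "(\<lambda>N. indicator (?E N) x :: real) \<longlonglongrightarrow> indicator ?E' x"
      proof (cases "x \<in> ?E'")
        case True
        then obtain n where n: "n \<ge> 1" "(\<Sum>k<n. f ((\<tau> ^^ k) x)) > 0" by auto
        have "x \<in> ?E N" if "N \<ge> n" for N
          using n that by (auto simp: birkhoff_max_pos_iff)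
        then have "eventually (\<lambda>N. indicator (?E N) x = (1::real)) sequentially"
          by (intro eventually_sequentiallyI[of n]) auto
        then show ?thesis using True tendsto_eventually by auto
      next
        case False
        then have "x \<notin> ?E N" for N by (auto simp: birkhoff_max_pos_iff)
        then show ?thesis using False by simp
      qed
    qed
    show "integrable M (\<lambda>x. \<bar>f x\<bar>)" using f by simp
    show "(\<lambda>x. indicator ?E' x * f x) \<in> borel_measurable M"
      by (subst measurable_cong[of _ _ "\<lambda>x. indicator {x\<in>space M. \<exists>n\<ge>1. (\<Sum>k<n. f ((\<tau> ^^ k) x)) > 0} x * f x"])
         (auto simp: indicator_def)
    show "(\<lambda>x. indicator (?E N) x * f x) \<in> borel_measurable M" for N
      by (subst measurable_cong[of _ _ "\<lambda>x. indicator {x\<in>space M. birkhoff_max \<tau> f N x > 0} x * f x"])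
         (auto simp: indicator_def)
  qed (auto simp: indicator_def)
  then show ?thesis
    by (rule LIMSEQ_le_const) (use maximal_ergodic_finite[OF assms] in auto)
qed

text \<open>
  The maximal ergodic theorem for \<open>f \<circ> \<tau> - t\<close>, whose Birkhoff sums are positive exactly where an
  average of \<open>f\<close> over the times from 1 to \<open>n\<close> exceeds \<open>t\<close>.
\<close>
lemma weak_type_averages:
  fixes f :: "'a \<Rightarrow> real"
  assumes ds: "dynamical_system M \<tau>" and f: "integrable M f" and pos: "\<And>x. f x \<ge> 0" and t: "t > 0"
  shows "t * measure M {x\<in>space M. \<exists>n\<ge>1. (\<Sum>k=1..n. f ((\<tau> ^^ k) x)) > t * real n} \<le> integral\<^sup>L M f"
proof -
  interpret prob_space M using ds by (simp add: dynamical_system_def)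
  define g where "g x = f (\<tau> x) - t" for x
  have fm[measurable]: "f \<in> borel_measurable M" "\<tau> ^^ k \<in> measurable M M" for k
    using f ds by (auto intro: dynamical_system_funpow_measurable)
  have f': "integrable M (\<lambda>x. f (\<tau> x))" and If': "(\<integral>x. f (\<tau> x) \<partial>M) = integral\<^sup>L M f"
    using integral_funpow[OF ds f, of 1] by auto
  have g: "integrable M g" unfolding g_def using f' by simp
  have sums: "(\<Sum>k<n. g ((\<tau> ^^ k) x)) = (\<Sum>k=1..n. f ((\<tau> ^^ k) x)) - t * real n" for n x
  proof -
    have "(\<Sum>k<n. f (\<tau> ((\<tau> ^^ k) x))) = (\<Sum>k=1..n. f ((\<tau> ^^ k) x))"
      by (rule sum.reindex_bij_witness[where i = "\<lambda>k. k - 1" and j = Suc]) auto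
    then show ?thesis by (simp add: g_def sum_subtractf)
  qed
  define E where "E = {x\<in>space M. \<exists>n\<ge>1. (\<Sum>k=1..n. f ((\<tau> ^^ k) x)) > t * real n}"
  have [measurable]: "E \<in> sets M" unfolding E_def by measurable
  have iE: "integrable M (\<lambda>x. indicator E x * f (\<tau> x))" "integrable M (\<lambda>x. indicator E x * t)"
    using integrable_real_mult_indicator[of E M "\<lambda>x. f (\<tau> x)"]
      integrable_real_mult_indicator[of E M "\<lambda>x. t"] f'
    by (simp_all add: mult.commute[of "indicator E _"])
  have "0 \<le> (\<integral>x. indicator {x. \<exists>n\<ge>1. (\<Sum>k<n. g ((\<tau> ^^ k) x)) > 0} x * g x \<partial>M)"
    by (rule maximal_ergodic[OF ds g])
  also have "\<dots> = (\<integral>x. indicator E x * f (\<tau> x) - indicator E x * t \<partial>M)"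
    unfolding sums by (intro Bochner_Integration.integral_cong) (simp_all add: E_def g_def indicator_def)
  also have "\<dots> = (\<integral>x. indicator E x * f (\<tau> x) \<partial>M) - t * measure M E"
    using iE by (simp add: mult.commute)
  also have "(\<integral>x. indicator E x * f (\<tau> x) \<partial>M) \<le> (\<integral>x. f (\<tau> x) \<partial>M)"
    by (rule integral_mono[OF iE(1) f']) (use pos in \<open>auto simp: indicator_def\<close>)
  finally show ?thesis using If' by (simp add: E_def)
qed

section \<open>Birkhoff's theorem for bounded functions\<close>

text \<open>
  The upper and lower limits \<open>U\<close> and \<open>L\<close> of the averages are invariant under \<open>\<tau>\<close>. If
  \<open>L < a < b < U\<close> held on a set \<open>E\<close> of positive measure, the maximal ergodic theorem on the
  invariant set \<open>E\<close>, applied to \<open>f - b\<close> and to \<open>a - f\<close>, would bound the integral of \<open>f\<close> over \<open>E\<close>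
  below by \<open>b\<close> and above by \<open>a\<close> times the measure of \<open>E\<close>. Countably many rational pairs \<open>a < b\<close>
  suffice.
\<close>
lemma birkhoff_bounded_lessThan:
  fixes f :: "'a \<Rightarrow> real"
  assumes ds: "dynamical_system M \<tau>" and fm[measurable]: "f \<in> borel_measurable M"
    and bd: "\<And>x. \<bar>f x\<bar> \<le> B"
  shows "AE x in M. convergent (\<lambda>n. (\<Sum>k<n. f ((\<tau> ^^ k) x)) / real n)"
proof -
  interpret prob_space M using ds by (simp add: dynamical_system_def)
  have tau[measurable]: "\<tau> \<in> measurable M M" using ds by (simp add: dynamical_system_def)
  have pow[measurable]: "\<tau> ^^ k \<in> measurable M M" for k using ds by (rule dynamical_system_funpow_measurable)
  have f: "integrable M f" by (rule integrable_const_bound[of _ B]) (use bd in auto)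
  define A where "A n x = (\<Sum>k<n. f ((\<tau> ^^ k) x)) / real n" for n x
  define U where "U x = limsup (\<lambda>n. ereal (A n x))" for x
  define L where "L x = liminf (\<lambda>n. ereal (A n x))" for x
  have [measurable]: "A n \<in> borel_measurable M" for n unfolding A_def by measurable
  have [measurable]: "U \<in> borel_measurable M" "L \<in> borel_measurable M"
    unfolding U_def L_def by measurable
  have Abd: "\<bar>A n x\<bar> \<le> B" for n x
  proof -
    have "\<bar>\<Sum>k<n. f ((\<tau> ^^ k) x)\<bar> \<le> (\<Sum>k<n. B)"
      by (rule order_trans[OF sum_abs sum_mono]) (use bd in auto)
    moreover have "B \<ge> 0" using bd[of undefined] by linarith
    ultimately show ?thesis by (cases "n = 0") (auto simp: A_def divide_simps mult.commute)
  qed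
  \<comment> \<open>Averages started at \<open>x\<close> and at \<open>\<tau> x\<close> differ by O(1/n); this makes both limits invariant.\<close>
  have diff: "(\<lambda>n. ereal (A (n + 1) x - A n (\<tau> x))) \<longlonglongrightarrow> ereal 0" for x
  proof -
    have "(\<lambda>n. A (n + 1) x - A n (\<tau> x)) \<longlonglongrightarrow> 0"
    proof (rule Lim_null_comparison)
      show "(\<lambda>n. 2 * B / real (n + 1)) \<longlonglongrightarrow> 0"
        using LIMSEQ_ignore_initial_segment[OF lim_const_over_n[of "2 * B"], of 1] by simp
      show "eventually (\<lambda>n. norm (A (n + 1) x - A n (\<tau> x)) \<le> 2 * B / real (n + 1)) sequentially"
      proof (rule eventually_sequentiallyI[of 1])
        fix n :: nat assume n: "1 \<le> n"
        have "A (n + 1) x = (f x + real n * A n (\<tau> x)) / real (n + 1)"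
          using n sum_Suc_shift_funpow[of f \<tau> x n] by (simp add: A_def)
        then have "A (n + 1) x - A n (\<tau> x) = (f x - A n (\<tau> x)) / real (n + 1)"
          by (simp add: field_simps)
        moreover have "\<bar>f x - A n (\<tau> x)\<bar> \<le> 2 * B" using bd[of x] Abd[of n "\<tau> x"] by linarith
        ultimately show "norm (A (n + 1) x - A n (\<tau> x)) \<le> 2 * B / real (n + 1)"
          by (simp add: divide_right_mono)
      qed
    qed
    then show ?thesis by simp
  qed
  have U_inv: "U (\<tau> x) = U x" for x
  proof -
    have "U x = limsup (\<lambda>n. ereal (A (n + 1) x))" unfolding U_def by (rule limsup_shift[symmetric])
    also have "\<dots> = limsup (\<lambda>n. ereal (A (n + 1) x - A n (\<tau> x)) + ereal (A n (\<tau> x)))" by simp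
    also have "\<dots> = ereal 0 + limsup (\<lambda>n. ereal (A n (\<tau> x)))"
      by (rule ereal_limsup_lim_add[OF diff]) simp
    finally show ?thesis by (simp add: U_def)
  qed
  have L_inv: "L (\<tau> x) = L x" for x
  proof -
    have "L x = liminf (\<lambda>n. ereal (A (n + 1) x))" unfolding L_def by (rule liminf_shift[symmetric])
    also have "\<dots> = liminf (\<lambda>n. ereal (A (n + 1) x - A n (\<tau> x)) + ereal (A n (\<tau> x)))" by simp
    also have "\<dots> = ereal 0 + liminf (\<lambda>n. ereal (A n (\<tau> x)))"
      by (rule ereal_liminf_lim_add[OF diff]) simp
    finally show ?thesis by (simp add: L_def)
  qed
  have inv: "U ((\<tau> ^^ k) x) = U x" "L ((\<tau> ^^ k) x) = L x" for k x
    by (induction k) (simp_all add: U_inv L_inv)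
  have null: "AE x in M. \<not> (L x < ereal a \<and> ereal b < U x)" if ab: "a < b" for a b :: real
  proof -
    define E where "E = {x\<in>space M. L x < ereal a \<and> ereal b < U x}"
    have E[measurable]: "E \<in> sets M" unfolding E_def by measurable
    have orbit: "(\<tau> ^^ k) x \<in> E \<longleftrightarrow> x \<in> E" if "x \<in> space M" for x k
      using that measurable_space[OF pow[of k] that] by (auto simp: E_def inv)
    have Ef: "integrable M (\<lambda>x. indicator E x * f x)"
      using integrable_real_mult_indicator[OF E f] by (simp add: mult.commute)
    have Ec: "integrable M (\<lambda>x. indicator E x * c)" for c :: real
      using integrable_real_mult_indicator[of E M "\<lambda>x. c"] E by (simp add: mult.commute[of "indicator E _"])
    \<comment> \<open>With \<open>s = 1\<close> and \<open>s = - 1\<close> this gives the lower and the upper bound of the integral over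
      \<open>E\<close>.\<close>
    have key: "0 \<le> (\<integral>x. indicator E x * (s * f x - c) \<partial>M)"
      if c: "\<And>x. x \<in> E \<Longrightarrow> \<exists>n\<ge>1. s * A n x > c" for s c :: real
    proof -
      define g where "g x = indicator E x * (s * f x - c)" for x
      have g: "integrable M g" unfolding g_def
        using Ef Ec[of c] by (simp add: right_diff_distrib mult.left_commute[of _ s])
      have sums: "(\<Sum>k<n. g ((\<tau> ^^ k) x)) = indicator E x * (real n * (s * A n x - c))"
        if "x \<in> space M" for n x
        using orbit[OF that]
        by (cases "n = 0"; cases "x \<in> E")
           (simp_all add: g_def A_def sum_subtractf right_diff_distrib flip: sum_distrib_left)
      have "0 \<le> (\<integral>x. indicator {x. \<exists>n\<ge>1. (\<Sum>k<n. g ((\<tau> ^^ k) x)) > 0} x * g x \<partial>M)"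
        by (rule maximal_ergodic[OF ds g])
      also have "\<dots> = integral\<^sup>L M g"
      proof (rule Bochner_Integration.integral_cong[OF refl])
        fix x assume x: "x \<in> space M"
        show "indicator {x. \<exists>n\<ge>1. (\<Sum>k<n. g ((\<tau> ^^ k) x)) > 0} x * g x = g x"
        proof (cases "x \<in> E")
          case True
          then obtain n where "n \<ge> 1" "s * A n x > c" using c by blast
          then have "\<exists>n\<ge>1. (\<Sum>k<n. g ((\<tau> ^^ k) x)) > 0"
            using True by (intro exI[of _ n]) (simp add: sums[OF x])
          then show ?thesis by simp
        qed (simp add: g_def)
      qed
      finally show ?thesis by (simp add: g_def[abs_def])
    qed
    have up: "0 \<le> (\<integral>x. indicator E x * (1 * f x - b) \<partial>M)"
    proof (rule key)
      fix x assume "x \<in> E"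
      then have "ereal b < limsup (\<lambda>n. ereal (A n x))" by (simp add: E_def U_def)
      then have "\<exists>\<^sub>F n in sequentially. ereal (A n x) > ereal b"
        using Limsup_bounded[of "\<lambda>n. ereal (A n x)" "ereal b" sequentially]
        by (auto simp: frequently_def not_less)
      then show "\<exists>n\<ge>1. 1 * A n x > b" by (auto simp: frequently_sequentially)
    qed
    have lo: "0 \<le> (\<integral>x. indicator E x * (- 1 * f x - (- a)) \<partial>M)"
    proof (rule key)
      fix x assume "x \<in> E"
      then have "liminf (\<lambda>n. ereal (A n x)) < ereal a" by (simp add: E_def L_def)
      then have "\<exists>\<^sub>F n in sequentially. ereal (A n x) < ereal a"
        using Liminf_bounded[of "ereal a" "\<lambda>n. ereal (A n x)" sequentially]
        by (auto simp: frequently_def not_less)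
      then show "\<exists>n\<ge>1. - 1 * A n x > - a" by (auto simp: frequently_sequentially)
    qed
    have int: "(\<integral>x. indicator E x * (s * f x - c) \<partial>M) = s * (\<integral>x. indicator E x * f x \<partial>M) - c * measure M E"
      for s c :: real
      using Ef Ec[of c] by (simp add: right_diff_distrib mult.left_commute[of _ s] mult.commute[of _ c])
    have "0 \<le> (a - b) * measure M E"
      using up lo unfolding int by (simp add: left_diff_distrib)
    then have "measure M E = 0" using ab by (simp add: zero_le_mult_iff measure_le_0_iff)
    then have "emeasure M E = 0" by (simp add: emeasure_eq_measure)
    then show ?thesis by (intro AE_I[of _ _ E]) (auto simp: E_def)
  qed
  have "AE x in M. \<forall>a b :: rat. a < b \<longrightarrow> \<not> (L x < ereal (of_rat a) \<and> ereal (of_rat b) < U x)"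
  proof -
    have "AE x in M. a < b \<longrightarrow> \<not> (L x < ereal (of_rat a) \<and> ereal (of_rat b) < U x)" for a b :: rat
      using null[of "of_rat a" "of_rat b"] by (cases "a < b") (auto simp: of_rat_less)
    then show ?thesis by (simp add: AE_all_countable)
  qed
  then show ?thesis
  proof eventually_elim
    fix x assume x: "\<forall>a b :: rat. a < b \<longrightarrow> \<not> (L x < ereal (of_rat a) \<and> ereal (of_rat b) < U x)"
    have LU: "L x \<le> U x" unfolding L_def U_def by (rule Liminf_le_Limsup) simp
    have "L x = U x"
    proof (rule ccontr)
      assume "L x \<noteq> U x"
      then have "L x < U x" using LU by simp
      then obtain a :: rat where a: "L x < real_of_rat a" "real_of_rat a < U x" using ereal_dense3 by blast
      then obtain b :: rat where b: "real_of_rat a < ereal (real_of_rat b)" "real_of_rat b < U x"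
        using ereal_dense3 by blast
      then have "a < b" by (simp add: of_rat_less)
      then show False using x a b by blast
    qed
    moreover have "U x \<le> ereal B" unfolding U_def
      by (rule Limsup_bounded, rule always_eventually) (use Abd abs_le_D1 in auto)
    moreover have "ereal (- B) \<le> L x" unfolding L_def
      by (rule Liminf_bounded, rule always_eventually) (metis Abd abs_le_D2 ereal_less_eq(3) minus_le_iff)
    ultimately obtain r where "L x = ereal r" "U x = ereal r" by (cases "U x") auto
    then have "(\<lambda>n. A n x) \<longlonglongrightarrow> r"
      by (intro limsup_le_liminf_real) (auto simp: U_def L_def)
    then show "convergent (\<lambda>n. (\<Sum>k<n. f ((\<tau> ^^ k) x)) / real n)"
      by (auto simp: A_def convergent_def)
  qed
qed

lemma birkhoff_bounded:
  fixes f :: "'a \<Rightarrow> real"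
  assumes ds: "dynamical_system M \<tau>" and fm: "f \<in> borel_measurable M"
    and bd: "\<And>x. \<bar>f x\<bar> \<le> B"
  shows "AE x in M. convergent (\<lambda>n. (\<Sum>k=1..n. f ((\<tau> ^^ k) x)) / real n)"
proof -
  have "(\<lambda>x. f (\<tau> x)) \<in> borel_measurable M"
    using ds by (intro measurable_compose[OF _ fm]) (auto simp: dynamical_system_def)
  moreover have "(\<Sum>k<n. f (\<tau> ((\<tau> ^^ k) x))) = (\<Sum>k=1..n. f ((\<tau> ^^ k) x))" for n x
    by (rule sum.reindex_bij_witness[where i = "\<lambda>k. k - 1" and j = Suc]) auto
  ultimately show ?thesis using birkhoff_bounded_lessThan[OF ds, of "\<lambda>x. f (\<tau> x)" B] bd by simp
qed

section \<open>Weak-type inequalities\<close>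

text \<open>
  For nonnegative weights the maximal function is dominated by the one of the absolute value. All
  estimates are made for nonnegative real functions, where no norms are needed; with values in the
  extended nonnegative reals the supremum needs no finiteness condition.
\<close>
definition weighted_max ::
    "(nat \<Rightarrow> real) \<Rightarrow> ('a \<Rightarrow> 'a) \<Rightarrow> ('a \<Rightarrow> real) \<Rightarrow> 'a \<Rightarrow> ennreal" where
  "weighted_max w \<tau> f x = (SUP n\<in>{1..}. ennreal ((\<Sum>k=1..n. w k * f ((\<tau> ^^ k) x)) / weight_sum w n))"

text \<open>
  The constant stands outside the \<open>p\<close>-th power, so that interpolation multiplies it by a factor
  that depends on the exponents alone.
\<close>
definition weak_type :: "'a itself \<Rightarrow> real \<Rightarrow> (nat \<Rightarrow> real) \<Rightarrow> real \<Rightarrow> bool" where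
  "weak_type _ p w C \<longleftrightarrow> (\<forall>(M :: 'a measure) \<tau> f t. dynamical_system M \<tau> \<longrightarrow> f \<in> borel_measurable M \<longrightarrow>
     (\<forall>x. f x \<ge> 0) \<longrightarrow> t > 0 \<longrightarrow>
     emeasure M {x \<in> space M. weighted_max w \<tau> f x > ennreal t}
       \<le> ennreal (C / t powr p) * (\<integral>\<^sup>+x. ennreal (f x powr p) \<partial>M))"

lemma weak_typeD:
  fixes M :: "'a measure"
  assumes "weak_type TYPE('a) p w C" "dynamical_system M \<tau>" "f \<in> borel_measurable M"
    "\<And>x. f x \<ge> 0" "t > 0"
  shows "emeasure M {x \<in> space M. weighted_max w \<tau> f x > ennreal t}
       \<le> ennreal (C / t powr p) * (\<integral>\<^sup>+x. ennreal (f x powr p) \<partial>M)"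
  using assms unfolding weak_type_def by blast

lemma measurable_weighted_max:
  assumes "dynamical_system M \<tau>" and [measurable]: "f \<in> borel_measurable M"
  shows "weighted_max w \<tau> f \<in> borel_measurable M"
proof -
  have [measurable]: "\<tau> ^^ k \<in> measurable M M" for k
    by (rule dynamical_system_funpow_measurable[OF assms(1)])
  show ?thesis unfolding weighted_max_def by measurable
qed

lemma weight_sum_nonneg: "weight_sum w n \<ge> 0"
  by (simp add: weight_sum_def sum_nonneg)

lemma weight_sum_pos: "admissible_weight w \<Longrightarrow> n \<ge> 1 \<Longrightarrow> weight_sum w n > 0"
  using weight_sum_nonneg[of w n] by (fastforce simp: admissible_weight_def less_le)

lemma weight_sum_eq: "(\<And>k. k \<ge> 1 \<Longrightarrow> w k \<ge> 0) \<Longrightarrow> weight_sum w n = (\<Sum>k=1..n. w k)"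
  by (simp add: weight_sum_def)

lemma norm_weighted_average_le:
  assumes "\<And>k. k \<ge> 1 \<Longrightarrow> w k \<ge> 0"
  shows "norm (weighted_average w \<tau> f n x)
    \<le> (\<Sum>k=1..n. w k * norm (f ((\<tau> ^^ k) x))) / weight_sum w n"
proof -
  have "norm (weighted_average w \<tau> f n x)
      = norm (\<Sum>k=1..n. complex_of_real (w k) * f ((\<tau> ^^ k) x)) / weight_sum w n"
    by (simp add: weighted_average_def norm_divide weight_sum_nonneg)
  also have "\<dots> \<le> (\<Sum>k=1..n. w k * norm (f ((\<tau> ^^ k) x))) / weight_sum w n"
    by (intro divide_right_mono weight_sum_nonneg order_trans[OF norm_sum] sum_mono)
       (use assms in \<open>auto simp: norm_mult\<close>)
  finally show ?thesis .
qed

lemma maximal_function_le_weighted_max: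
  assumes "\<And>k. k \<ge> 1 \<Longrightarrow> w k \<ge> 0"
  shows "maximal_function w \<tau> f x \<le> weighted_max w \<tau> (\<lambda>x. norm (f x)) x"
  unfolding maximal_function_def weighted_max_def
  by (intro SUP_mono') (use norm_weighted_average_le[OF assms] in \<open>auto intro!: ennreal_leI\<close>)

lemma weight_sum_one: "weight_sum (\<lambda>_. 1) n = real n"
  by (simp add: weight_sum_def)

lemma weak_type_one: "weak_type TYPE('a) 1 (\<lambda>_. 1) 1"
  unfolding weak_type_def
proof (intro allI impI)
  fix M :: "'a measure" and \<tau> and f :: "'a \<Rightarrow> real" and t :: real
  assume ds: "dynamical_system M \<tau>" and fm[measurable]: "f \<in> borel_measurable M"
    and f: "\<forall>x. f x \<ge> 0" and t: "t > 0"
  interpret prob_space M using ds by (simp add: dynamical_system_def)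
  show "emeasure M {x \<in> space M. weighted_max (\<lambda>_. 1) \<tau> f x > ennreal t}
       \<le> ennreal (1 / t powr 1) * (\<integral>\<^sup>+x. ennreal (f x powr 1) \<partial>M)"
  proof (cases "(\<integral>\<^sup>+x. ennreal (f x) \<partial>M) = \<infinity>")
    case True
    then show ?thesis using f t by (simp add: ennreal_mult_top)
  next
    case False
    then have int: "integrable M f"
      by (intro integrableI_nonneg) (use f in \<open>auto simp: less_top\<close>)
    have eq: "{x \<in> space M. weighted_max (\<lambda>_. 1) \<tau> f x > ennreal t}
        = {x\<in>space M. \<exists>n\<ge>1. (\<Sum>k=1..n. f ((\<tau> ^^ k) x)) > t * real n}" (is "?E = ?E'")
    proof -
      have "ennreal t < ennreal ((\<Sum>k=1..n. f ((\<tau> ^^ k) x)) / real n)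
          \<longleftrightarrow> (\<Sum>k=1..n. f ((\<tau> ^^ k) x)) > t * real n" if "n \<ge> 1" for n x
        using t that by (subst ennreal_less_iff) (auto simp: field_simps)
      then show ?thesis
        by (auto simp: weighted_max_def less_SUP_iff weight_sum_one)
    qed
    have "t * measure M ?E' \<le> integral\<^sup>L M f"
      using weak_type_averages[OF ds int _ t] f by auto
    then have "measure M ?E' \<le> 1 / t * integral\<^sup>L M f" using t by (simp add: field_simps)
    then have "emeasure M ?E' \<le> ennreal (1 / t * integral\<^sup>L M f)"
      by (simp add: emeasure_eq_measure ennreal_leI)
    also have "\<dots> = ennreal (1 / t) * ennreal (integral\<^sup>L M f)"
      by (rule ennreal_mult) (use t f in auto)
    also have "\<dots> = ennreal (1 / t powr 1) * (\<integral>\<^sup>+x. ennreal (f x powr 1) \<partial>M)"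
      using f t by (subst nn_integral_eq_integral) (use int in auto)
    finally show ?thesis unfolding eq .
  qed
qed

subsection \<open>Integrating the distribution function\<close>

lemma ennreal_powr_ennreal [simp]: "r \<ge> 0 \<Longrightarrow> ennreal_powr (ennreal r) p = ennreal (r powr p)"
  by (simp add: ennreal_powr_def)

lemma nn_integral_powr_Ioo:
  assumes "a > 0" "r \<ge> 0"
  shows "(\<integral>\<^sup>+t. indicator {0<..<r} t * ennreal (t powr (a - 1)) \<partial>lborel) = ennreal (r powr a / a)"
proof -
  have "(\<integral>\<^sup>+t. indicator {0<..<r} t * ennreal (t powr (a - 1)) \<partial>lborel)
      = (\<integral>\<^sup>+t. ennreal (indicator {0..r} t * (t powr (a - 1))) \<partial>lborel)"
  proof (rule nn_integral_cong_AE)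
    show "AE t in lborel. indicator {0<..<r} t * ennreal (t powr (a - 1))
        = ennreal (indicator {0..r} t * (t powr (a - 1)))"
      using AE_lborel_singleton[of r] by eventually_elim (auto simp: indicator_def)
  qed
  also have "\<dots> = ennreal (r powr a / a)"
  proof (rule nn_integral_has_integral_lebesgue)
    show "((\<lambda>t. t powr (a - 1)) has_integral r powr a / a) {0..r}"
      using has_integral_powr_from_0[of "a - 1" r] assms by simp
  qed auto
  finally show ?thesis .
qed

lemma ennreal_powr_layers:
  assumes p: "p > 0"
  shows "ennreal_powr y p
    = (\<integral>\<^sup>+t. indicator {0<..} t * ennreal (p * t powr (p - 1)) * indicator {t. ennreal t < y} t \<partial>lborel)"
    (is "_ = ?I y")
proof -
  have fin: "?I (ennreal r) = ennreal (r powr p)" if "r \<ge> 0" for r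
  proof -
    have "?I (ennreal r) = (\<integral>\<^sup>+t. ennreal p * (indicator {0<..<r} t * ennreal (t powr (p - 1))) \<partial>lborel)"
      by (intro nn_integral_cong) (use p that in \<open>auto simp: indicator_def ennreal_mult ennreal_less_iff\<close>)
    also have "\<dots> = ennreal p * ennreal (r powr p / p)"
      by (subst nn_integral_cmult) (use nn_integral_powr_Ioo[OF p that] in auto)
    also have "\<dots> = ennreal (r powr p)" using p by (simp flip: ennreal_mult)
    finally show ?thesis .
  qed
  show ?thesis
  proof (cases y)
    case (real r)
    then show ?thesis using fin by simp
  next
    case top
    have "ennreal K \<le> ?I top" for K
    proof (cases "K \<ge> 0")
      case True
      have "ennreal K = ?I (ennreal (K powr (1 / p)))"
        using True p by (subst fin) (auto simp: powr_powr)
      also have "\<dots> \<le> ?I top"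
        by (intro nn_integral_mono mult_left_mono) (auto simp: indicator_def)
      finally show ?thesis .
    qed (simp add: ennreal_neg)
    note bound = this
    have "?I top = top"
    proof (rule ccontr)
      assume "?I top \<noteq> top"
      then obtain r where "r \<ge> 0" "?I top = ennreal r" by (cases "?I top") auto
      then show False using bound[of "r + 1"] by simp
    qed
    then show ?thesis using top by (simp add: ennreal_powr_def)
  qed
qed

lemma layer_cake:
  assumes "sigma_finite_measure M" and [measurable]: "Y \<in> borel_measurable M" and p: "p > 0"
  shows "(\<integral>\<^sup>+x. ennreal_powr (Y x) p \<partial>M)
    = (\<integral>\<^sup>+t. indicator {0<..} t * ennreal (p * t powr (p - 1))
         * emeasure M {x \<in> space M. ennreal t < Y x} \<partial>lborel)"
proof -
  interpret sigma_finite_measure M by fact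
  interpret pair_sigma_finite M lborel ..
  have "(\<integral>\<^sup>+x. ennreal_powr (Y x) p \<partial>M)
      = (\<integral>\<^sup>+x. (\<integral>\<^sup>+t. indicator {0<..} t * ennreal (p * t powr (p - 1))
           * indicator {x \<in> space M. ennreal t < Y x} x \<partial>lborel) \<partial>M)"
    unfolding ennreal_powr_layers[OF p] by (intro nn_integral_cong) (auto simp: indicator_def)
  also have "\<dots> = (\<integral>\<^sup>+t. (\<integral>\<^sup>+x. indicator {0<..} t * ennreal (p * t powr (p - 1))
           * indicator {x \<in> space M. ennreal t < Y x} x \<partial>M) \<partial>lborel)"
    by (rule Fubini'[symmetric]) measurable
  also have "\<dots> = (\<integral>\<^sup>+t. indicator {0<..} t * ennreal (p * t powr (p - 1))
         * emeasure M {x \<in> space M. ennreal t < Y x} \<partial>lborel)"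
    by (intro nn_integral_cong) (simp add: nn_integral_cmult)
  finally show ?thesis .
qed

text \<open>
  Truncation at \<open>T\<close> removes all levels above \<open>T\<close>, and below it the distribution function is at
  most \<open>A / t\<close>, so that the layer-cake integral converges for every \<open>p > 1\<close>.
\<close>
lemma truncated_moment:
  assumes "sigma_finite_measure M" and [measurable]: "Y \<in> borel_measurable M"
    and p: "p > 1" and T: "T \<ge> 0"
    and weak: "\<And>t. t > 0 \<Longrightarrow> emeasure M {x \<in> space M. ennreal t < Y x} \<le> ennreal (1 / t) * A"
  shows "(\<integral>\<^sup>+x. ennreal_powr (min (Y x) (ennreal T)) p \<partial>M)
    \<le> ennreal (p / (p - 1) * T powr (p - 1)) * A"
proof -
  have "(\<integral>\<^sup>+x. ennreal_powr (min (Y x) (ennreal T)) p \<partial>M)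
      = (\<integral>\<^sup>+t. indicator {0<..} t * ennreal (p * t powr (p - 1))
         * emeasure M {x \<in> space M. ennreal t < min (Y x) (ennreal T)} \<partial>lborel)"
    by (rule layer_cake) (use assms in auto)
  also have "\<dots> \<le> (\<integral>\<^sup>+t. (ennreal p * A) * (indicator {0<..<T} t * ennreal (t powr ((p - 1) - 1))) \<partial>lborel)"
  proof (intro nn_integral_mono)
    fix t :: real
    consider "t \<le> 0" | "t > 0" "t \<ge> T" | "t > 0" "t < T" by linarith
    then show "indicator {0<..} t * ennreal (p * t powr (p - 1))
         * emeasure M {x \<in> space M. ennreal t < min (Y x) (ennreal T)}
       \<le> (ennreal p * A) * (indicator {0<..<T} t * ennreal (t powr ((p - 1) - 1)))"
    proof cases
      case 2
      then have "ennreal T \<le> ennreal t" by (simp add: ennreal_leI)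
      then have "{x \<in> space M. ennreal t < min (Y x) (ennreal T)} = {}" by auto
      then show ?thesis by (simp only: emeasure_empty) simp
    next
      case 3
      have "{x \<in> space M. ennreal t < min (Y x) (ennreal T)} = {x \<in> space M. ennreal t < Y x}"
        using 3 by (auto simp: ennreal_less_iff)
      then have "ennreal (p * t powr (p - 1)) * emeasure M {x \<in> space M. ennreal t < min (Y x) (ennreal T)}
          \<le> ennreal (p * t powr (p - 1)) * (ennreal (1 / t) * A)"
        using weak[OF 3(1)] by (simp add: mult_left_mono)
      also have "\<dots> = ennreal (p * t powr (p - 1) * (1 / t)) * A"
        by (subst ennreal_mult) (use 3 p in \<open>auto simp: mult.assoc\<close>)
      also have "p * t powr (p - 1) * (1 / t) = p * t powr ((p - 1) - 1)"
        using 3 by (simp add: powr_diff power2_eq_square)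
      also have "ennreal \<dots> * A = (ennreal p * A) * ennreal (t powr ((p - 1) - 1))"
        using p by (simp add: ennreal_mult mult_ac)
      finally show ?thesis using 3 by simp
    qed auto
  qed
  also have "\<dots> = (ennreal p * A) * ennreal (T powr (p - 1) / (p - 1))"
    by (subst nn_integral_cmult) (use nn_integral_powr_Ioo[of "p - 1" T] p T in auto)
  also have "\<dots> = ennreal (p / (p - 1) * T powr (p - 1)) * A"
  proof -
    have "ennreal (p / (p - 1) * T powr (p - 1)) = ennreal p * ennreal (T powr (p - 1) / (p - 1))"
      using p by (subst ennreal_mult[symmetric]) auto
    then show ?thesis by (simp add: mult_ac)
  qed
  finally show ?thesis .
qed

subsection \<open>From weak type to strong type\<close>

lemma weighted_average_const:
  assumes "admissible_weight w" "\<And>k. k \<ge> 1 \<Longrightarrow> w k \<ge> 0" "n \<ge> 1"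
  shows "(\<Sum>k=1..n. w k * c) / weight_sum w n = c"
  using weight_sum_pos[OF assms(1,3)] by (simp add: weight_sum_eq[OF assms(2)] flip: sum_distrib_right)

text \<open>
  The part of \<open>f\<close> below \<open>t / 2\<close> contributes at most \<open>t / 2\<close> to every average, so where an average
  exceeds \<open>t\<close> the remaining part of \<open>f\<close> has an average above \<open>t / 2\<close>.
\<close>
lemma weighted_max_truncate:
  assumes adm: "admissible_weight w" and w: "\<And>k. k \<ge> 1 \<Longrightarrow> w k \<ge> 0"
    and f: "\<And>x. f x \<ge> 0" and t: "t > 0"
    and big: "weighted_max w \<tau> f x > ennreal t"
  shows "weighted_max w \<tau> (\<lambda>x. if f x > t / 2 then f x else 0) x > ennreal (t / 2)"
proof -
  obtain n where n: "n \<ge> 1" "ennreal t < ennreal ((\<Sum>k=1..n. w k * f ((\<tau> ^^ k) x)) / weight_sum w n)"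
    using big by (auto simp: weighted_max_def less_SUP_iff)
  let ?g = "\<lambda>x. if f x > t / 2 then f x else 0"
  have "t < (\<Sum>k=1..n. w k * f ((\<tau> ^^ k) x)) / weight_sum w n"
    using n t by (simp add: ennreal_less_iff)
  also have "\<dots> \<le> (\<Sum>k=1..n. w k * ?g ((\<tau> ^^ k) x) + w k * (t / 2)) / weight_sum w n"
  proof (intro divide_right_mono weight_sum_nonneg sum_mono)
    fix k assume "k \<in> {1..n}"
    then have "w k \<ge> 0" using w by simp
    moreover have "f ((\<tau> ^^ k) x) \<le> ?g ((\<tau> ^^ k) x) + t / 2" using f t by auto
    ultimately show "w k * f ((\<tau> ^^ k) x) \<le> w k * ?g ((\<tau> ^^ k) x) + w k * (t / 2)"
      using mult_left_mono[of "f ((\<tau> ^^ k) x)" "?g ((\<tau> ^^ k) x) + t / 2" "w k"] by (simp only: distrib_left)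
  qed
  also have "\<dots> = (\<Sum>k=1..n. w k * ?g ((\<tau> ^^ k) x)) / weight_sum w n + t / 2"
    using weighted_average_const[OF adm w n(1), of "t / 2"] by (simp only: sum.distrib add_divide_distrib)
  finally have "t / 2 < (\<Sum>k=1..n. w k * ?g ((\<tau> ^^ k) x)) / weight_sum w n" by linarith
  then have "ennreal (t / 2) < ennreal ((\<Sum>k=1..n. w k * ?g ((\<tau> ^^ k) x)) / weight_sum w n)"
    using t by (intro ennreal_lessI) linarith+
  then show ?thesis using n(1) by (auto simp: weighted_max_def less_SUP_iff)
qed

text \<open>
  Marcinkiewicz interpolation between weak type \<open>q\<close> and the trivial bound for bounded functions.
  At level \<open>t\<close> the weak inequality is applied to the part of \<open>f\<close> above \<open>t / 2\<close>; integrating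
  against \<open>p * t powr (p - 1)\<close> and exchanging the integrals leaves the integral of
  \<open>t powr (p - q - 1)\<close> up to \<open>2 * f x\<close>, which converges because \<open>q < p\<close>.
\<close>
lemma weak_type_imp_strong_type:
  fixes M :: "'a measure"
  assumes wt: "weak_type TYPE('a) q w C" and adm: "admissible_weight w"
    and w: "\<And>k. k \<ge> 1 \<Longrightarrow> w k \<ge> 0" and q: "0 < q" "q < p" and C: "C \<ge> 0"
    and ds: "dynamical_system M \<tau>" and fm[measurable]: "f \<in> borel_measurable M" and f: "\<And>x. f x \<ge> 0"
  shows "(\<integral>\<^sup>+x. ennreal_powr (weighted_max w \<tau> f x) p \<partial>M)
    \<le> ennreal (C * 2 powr p * p / (p - q)) * (\<integral>\<^sup>+x. ennreal (f x powr p) \<partial>M)"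
proof -
  interpret prob_space M using ds by (simp add: dynamical_system_def)
  have sf: "sigma_finite_measure M" ..
  interpret pair_sigma_finite M lborel ..
  have [measurable]: "weighted_max w \<tau> f \<in> borel_measurable M" by (rule measurable_weighted_max[OF ds fm])
  have dist: "emeasure M {x \<in> space M. ennreal t < weighted_max w \<tau> f x}
      \<le> (\<integral>\<^sup>+x. ennreal (C * 2 powr q * t powr - q) * ennreal (f x powr q) * indicator {x\<in>space M. t < 2 * f x} x \<partial>M)"
    if t: "t > 0" for t
  proof -
    let ?g = "\<lambda>x. if f x > t / 2 then f x else 0"
    have [measurable]: "weighted_max w \<tau> ?g \<in> borel_measurable M"
      by (rule measurable_weighted_max[OF ds]) measurable
    have "emeasure M {x \<in> space M. ennreal t < weighted_max w \<tau> f x}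
        \<le> emeasure M {x \<in> space M. ennreal (t / 2) < weighted_max w \<tau> ?g x}"
    proof (rule emeasure_mono)
      show "{x \<in> space M. ennreal t < weighted_max w \<tau> f x}
          \<subseteq> {x \<in> space M. ennreal (t / 2) < weighted_max w \<tau> ?g x}"
        using weighted_max_truncate[where f = f and w = w and t = t and \<tau> = \<tau>, OF adm _ _ t] w f by blast
    qed measurable
    also have "\<dots> \<le> ennreal (C / (t / 2) powr q) * (\<integral>\<^sup>+x. ennreal (?g x powr q) \<partial>M)"
      by (rule weak_typeD[OF wt ds]) (use f t in auto)
    also have "\<dots> = (\<integral>\<^sup>+x. ennreal (C / (t / 2) powr q) * ennreal (?g x powr q) \<partial>M)"
      by (rule nn_integral_cmult[symmetric]) measurable
    also have "\<dots> = (\<integral>\<^sup>+x. ennreal (C * 2 powr q * t powr - q) * ennreal (f x powr q)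
          * indicator {x\<in>space M. t < 2 * f x} x \<partial>M)"
    proof (intro nn_integral_cong)
      fix x assume "x \<in> space M"
      have "C / (t / 2) powr q = C * 2 powr q * t powr - q"
        using t by (simp add: powr_divide powr_minus field_simps)
      then show "ennreal (C / (t / 2) powr q) * ennreal (?g x powr q)
          = ennreal (C * 2 powr q * t powr - q) * ennreal (f x powr q) * indicator {x\<in>space M. t < 2 * f x} x"
        using \<open>x \<in> space M\<close> by (auto simp: indicator_def)
    qed
    finally show ?thesis .
  qed
  let ?h = "\<lambda>x t. ennreal (C * 2 powr q * p) * ennreal (f x powr q)
      * (indicator {0<..<2 * f x} t * ennreal (t powr ((p - q) - 1)))"
  have hm: "(\<lambda>(x, t). ?h x t) \<in> borel_measurable (M \<Otimes>\<^sub>M lborel)"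
  proof -
    have "(\<lambda>(x, t). ?h x t) = (\<lambda>z. ennreal (C * 2 powr q * p) * ennreal (f (fst z) powr q)
      * ((if 0 < snd z \<and> snd z < 2 * f (fst z) then 1 else 0) * ennreal (snd z powr ((p - q) - 1))))"
      by (auto simp: fun_eq_iff indicator_def)
    then show ?thesis by simp
  qed
  have "(\<integral>\<^sup>+x. ennreal_powr (weighted_max w \<tau> f x) p \<partial>M)
    = (\<integral>\<^sup>+t. indicator {0<..} t * ennreal (p * t powr (p - 1))
         * emeasure M {x \<in> space M. ennreal t < weighted_max w \<tau> f x} \<partial>lborel)"
    by (rule layer_cake[OF sf]) (use q in auto)
  also have "\<dots> \<le> (\<integral>\<^sup>+t. (\<integral>\<^sup>+x. ?h x t \<partial>M) \<partial>lborel)"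
  proof (intro nn_integral_mono)
    fix t :: real
    show "indicator {0<..} t * ennreal (p * t powr (p - 1))
         * emeasure M {x \<in> space M. ennreal t < weighted_max w \<tau> f x} \<le> (\<integral>\<^sup>+x. ?h x t \<partial>M)"
    proof (cases "t > 0")
      case True
      have "ennreal (p * t powr (p - 1)) * emeasure M {x \<in> space M. ennreal t < weighted_max w \<tau> f x}
          \<le> ennreal (p * t powr (p - 1)) * (\<integral>\<^sup>+x. ennreal (C * 2 powr q * t powr - q)
              * ennreal (f x powr q) * indicator {x\<in>space M. t < 2 * f x} x \<partial>M)"
        by (intro mult_left_mono dist True) auto
      also have "\<dots> = (\<integral>\<^sup>+x. ennreal (p * t powr (p - 1)) * (ennreal (C * 2 powr q * t powr - q)
              * ennreal (f x powr q) * indicator {x\<in>space M. t < 2 * f x} x) \<partial>M)"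
        by (rule nn_integral_cmult[symmetric]) measurable
      also have "\<dots> = (\<integral>\<^sup>+x. ?h x t \<partial>M)"
      proof (intro nn_integral_cong)
        fix x assume x: "x \<in> space M"
        have "ennreal (p * t powr (p - 1)) * ennreal (C * 2 powr q * t powr - q)
            = ennreal (p * t powr (p - 1) * (C * 2 powr q * t powr - q))"
          by (rule ennreal_mult[symmetric]) (use q C in auto)
        also have "p * t powr (p - 1) * (C * 2 powr q * t powr - q) = C * 2 powr q * p * t powr ((p - q) - 1)"
        proof -
          have "t powr (p - 1) * t powr - q = t powr ((p - q) - 1)"
            unfolding powr_add[symmetric] by (simp add: algebra_simps)
          moreover have "p * t powr (p - 1) * (C * 2 powr q * t powr - q)
              = C * 2 powr q * p * (t powr (p - 1) * t powr - q)" by (simp only: mult_ac)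
          ultimately show ?thesis by (simp only:)
        qed
        also have "ennreal \<dots> = ennreal (C * 2 powr q * p) * ennreal (t powr ((p - q) - 1))"
          by (rule ennreal_mult) (use q C in auto)
        finally have *: "ennreal (p * t powr (p - 1)) * ennreal (C * 2 powr q * t powr - q) = \<dots>" .
        show "ennreal (p * t powr (p - 1)) * (ennreal (C * 2 powr q * t powr - q)
              * ennreal (f x powr q) * indicator {x\<in>space M. t < 2 * f x} x) = ?h x t"
        proof (cases "t < 2 * f x")
          case True2: True
          have "ennreal (p * t powr (p - 1)) * (ennreal (C * 2 powr q * t powr - q) * ennreal (f x powr q))
              = (ennreal (p * t powr (p - 1)) * ennreal (C * 2 powr q * t powr - q)) * ennreal (f x powr q)"
            by (simp add: mult.assoc)
          also have "\<dots> = ennreal (C * 2 powr q * p) * ennreal (f x powr q) * ennreal (t powr ((p - q) - 1))"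
            unfolding * by (simp add: mult_ac)
          finally show ?thesis using True True2 x by (simp add: indicator_def)
        qed (simp add: indicator_def)
      qed
      finally show ?thesis using True by simp
    qed simp
  qed
  also have "\<dots> = (\<integral>\<^sup>+x. (\<integral>\<^sup>+t. ?h x t \<partial>lborel) \<partial>M)"
    by (rule Fubini'[OF hm])
  also have "\<dots> = (\<integral>\<^sup>+x. ennreal (C * 2 powr p * p / (p - q)) * ennreal (f x powr p) \<partial>M)"
  proof (intro nn_integral_cong)
    fix x
    have "(\<integral>\<^sup>+t. ?h x t \<partial>lborel)
        = ennreal (C * 2 powr q * p) * ennreal (f x powr q) * ennreal ((2 * f x) powr (p - q) / (p - q))"
      by (subst nn_integral_cmult) (use nn_integral_powr_Ioo[of "p - q" "2 * f x"] q f in auto)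
    also have "\<dots> = ennreal (C * 2 powr q * p * f x powr q * ((2 * f x) powr (p - q) / (p - q)))"
      using q C by (simp flip: ennreal_mult)
    also have "C * 2 powr q * p * f x powr q * ((2 * f x) powr (p - q) / (p - q))
        = C * (2 powr q * 2 powr (p - q)) * p / (p - q) * (f x powr q * f x powr (p - q))"
      using f by (simp add: powr_mult)
    also have "\<dots> = (C * 2 powr p * p / (p - q)) * f x powr p"
      by (simp flip: powr_add)
    also have "ennreal \<dots> = ennreal (C * 2 powr p * p / (p - q)) * ennreal (f x powr p)"
      by (rule ennreal_mult) (use q C in auto)
    finally show "(\<integral>\<^sup>+t. ?h x t \<partial>lborel) = ennreal (C * 2 powr p * p / (p - q)) * ennreal (f x powr p)" .
  qed
  also have "\<dots> = ennreal (C * 2 powr p * p / (p - q)) * (\<integral>\<^sup>+x. ennreal (f x powr p) \<partial>M)"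
    by (rule nn_integral_cmult) measurable
  finally show ?thesis .
qed

lemma ennreal_mult_mult: "a \<ge> 0 \<Longrightarrow> b \<ge> 0 \<Longrightarrow> ennreal a * (ennreal b * x) = ennreal (a * b) * x"
  by (simp add: ennreal_mult mult.assoc)

lemma ennreal_powr_mono: "x \<le> y \<Longrightarrow> p \<ge> 0 \<Longrightarrow> ennreal_powr x p \<le> ennreal_powr y p"
  by (cases x; cases y) (auto simp: ennreal_powr_def top_unique intro!: ennreal_leI powr_mono2)

lemma ennreal_powr_cmult:
  assumes "c > 0"
  shows "ennreal_powr (ennreal c * x) p = ennreal (c powr p) * ennreal_powr x p"
proof (cases x)
  case (real r)
  then show ?thesis using assms by (simp flip: ennreal_mult add: powr_mult)
next
  case top
  then show ?thesis using assms by (simp add: ennreal_powr_def ennreal_mult_top)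
qed

lemma ennreal_powr_one [simp]: "ennreal_powr x 1 = x"
  by (cases x) (auto simp: ennreal_powr_def)

lemma strong_maximal_ineq_of_weak_type:
  assumes wt: "weak_type TYPE('a) q w C" and adm: "admissible_weight w"
    and w: "\<And>k. k \<ge> 1 \<Longrightarrow> w k \<ge> 0" and q: "0 < q" "q < p" and C: "C \<ge> 0"
  shows "\<exists>K>0. strong_maximal_ineq TYPE('a) p w K"
proof -
  define K0 where "K0 = C * 2 powr p * p / (p - q) + 1"
  have K0: "K0 > 0" using q C unfolding K0_def by (intro add_nonneg_pos divide_nonneg_pos) auto
  have "strong_maximal_ineq TYPE('a) p w (K0 powr (1 / p))"
    unfolding strong_maximal_ineq_def
  proof (intro allI impI)
    fix M :: "'a measure" and \<tau> f
    assume ds: "dynamical_system M \<tau>" and "in_Lp p M f"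
    then have fm[measurable]: "f \<in> borel_measurable M" by (simp add: in_Lp_def)
    let ?g = "\<lambda>x. norm (f x)"
    have "(\<integral>\<^sup>+x. ennreal_powr (maximal_function w \<tau> f x) p \<partial>M)
        \<le> (\<integral>\<^sup>+x. ennreal_powr (weighted_max w \<tau> ?g x) p \<partial>M)"
      using q by (intro nn_integral_mono ennreal_powr_mono maximal_function_le_weighted_max w) auto
    also have "\<dots> \<le> ennreal (C * 2 powr p * p / (p - q)) * (\<integral>\<^sup>+x. ennreal (?g x powr p) \<partial>M)"
      by (rule weak_type_imp_strong_type[OF wt adm w q C ds]) auto
    also have "\<dots> \<le> ennreal K0 * (\<integral>\<^sup>+x. ennreal (?g x powr p) \<partial>M)"
      by (intro mult_right_mono ennreal_leI) (auto simp: K0_def)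
    finally have "Lp_norm p M (maximal_function w \<tau> f)
        \<le> ennreal_powr (ennreal K0 * (\<integral>\<^sup>+x. ennreal (?g x powr p) \<partial>M)) (1 / p)"
      unfolding Lp_norm_def using q by (intro ennreal_powr_mono) auto
    also have "\<dots> = ennreal (K0 powr (1 / p)) * Lp_norm p M (\<lambda>x. ennreal (?g x))"
      unfolding ennreal_powr_cmult[OF K0] Lp_norm_def by simp
    finally show "Lp_norm p M (maximal_function w \<tau> f)
        \<le> ennreal (K0 powr (1 / p)) * Lp_norm p M (\<lambda>x. ennreal (?g x))" .
  qed
  then show ?thesis using K0 by (intro exI[of _ "K0 powr (1 / p)"]) simp
qed

lemma weak_maximal_ineq_of_weak_type:
  assumes wt: "weak_type TYPE('a) 1 w C" and w: "\<And>k. k \<ge> 1 \<Longrightarrow> w k \<ge> 0" and C: "C \<ge> 0"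
  shows "weak_maximal_ineq TYPE('a) w C"
  unfolding weak_maximal_ineq_def weak_L1_norm_def
proof (intro allI impI SUP_least)
  fix M :: "'a measure" and \<tau> f and l :: real
  assume ds: "dynamical_system M \<tau>" and "in_Lp 1 M f" and l: "l \<in> {0<..}"
  then have fm[measurable]: "f \<in> borel_measurable M" by (simp add: in_Lp_def)
  let ?g = "\<lambda>x. norm (f x)"
  have [measurable]: "weighted_max w \<tau> ?g \<in> borel_measurable M"
    by (rule measurable_weighted_max[OF ds]) measurable
  have "emeasure M {x \<in> space M. ennreal l < maximal_function w \<tau> f x}
      \<le> emeasure M {x \<in> space M. ennreal l < weighted_max w \<tau> ?g x}"
  proof (rule emeasure_mono)
    show "{x \<in> space M. ennreal l < maximal_function w \<tau> f x}
        \<subseteq> {x \<in> space M. ennreal l < weighted_max w \<tau> ?g x}"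
      using maximal_function_le_weighted_max[of w \<tau> f] w by (auto intro: less_le_trans)
  qed measurable
  also have "\<dots> \<le> ennreal (C / l powr 1) * (\<integral>\<^sup>+x. ennreal (?g x powr 1) \<partial>M)"
    by (rule weak_typeD[OF wt ds]) (use l in auto)
  finally have "ennreal l * emeasure M {x \<in> space M. ennreal l < maximal_function w \<tau> f x}
      \<le> ennreal l * (ennreal (C / l) * (\<integral>\<^sup>+x. ennreal (?g x) \<partial>M))"
    using l by (intro mult_left_mono) auto
  also have "\<dots> = ennreal (l * (C / l)) * (\<integral>\<^sup>+x. ennreal (?g x) \<partial>M)"
    using l C by (subst ennreal_mult) (auto simp: mult.assoc)
  finally show "ennreal l * emeasure M {x \<in> space M. ennreal l < maximal_function w \<tau> f x}
      \<le> ennreal C * Lp_norm 1 M (\<lambda>x. ennreal (?g x))"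
    using l by (simp add: Lp_norm_def)
qed

section \<open>Pointwise convergence from a maximal inequality\<close>

text \<open>
  Bounded functions are the dense class on which convergence is established directly; a maximal
  inequality extends it to the whole space.
\<close>
definition bounded_convergence :: "'a itself \<Rightarrow> (nat \<Rightarrow> real) \<Rightarrow> bool" where
  "bounded_convergence _ w \<longleftrightarrow> (\<forall>(M :: 'a measure) \<tau> f B. dynamical_system M \<tau> \<longrightarrow>
     f \<in> borel_measurable M \<longrightarrow> (\<forall>x. \<bar>f x\<bar> \<le> B) \<longrightarrow>
     (AE x in M. convergent (\<lambda>n. (\<Sum>k=1..n. w k * f ((\<tau> ^^ k) x)) / weight_sum w n)))"

lemma bounded_convergenceD:
  fixes M :: "'a measure"
  assumes "bounded_convergence TYPE('a) w" "dynamical_system M \<tau>" "f \<in> borel_measurable M"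
    "\<And>x. \<bar>f x\<bar> \<le> B"
  shows "AE x in M. convergent (\<lambda>n. (\<Sum>k=1..n. w k * f ((\<tau> ^^ k) x)) / weight_sum w n)"
  using assms unfolding bounded_convergence_def by blast

lemma bounded_convergence_complex:
  fixes M :: "'a measure"
  assumes bc: "bounded_convergence TYPE('a) w" and ds: "dynamical_system M \<tau>"
    and [measurable]: "f \<in> borel_measurable M" and B: "\<And>x. norm (f x) \<le> B"
  shows "AE x in M. convergent (\<lambda>n. weighted_average w \<tau> f n x)"
proof -
  have "AE x in M. convergent (\<lambda>n. (\<Sum>k=1..n. w k * Re (f ((\<tau> ^^ k) x))) / weight_sum w n)"
    by (rule bounded_convergenceD[OF bc ds, of _ B]) (use B abs_Re_le_cmod order_trans in \<open>auto, blast\<close>)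
  moreover have "AE x in M. convergent (\<lambda>n. (\<Sum>k=1..n. w k * Im (f ((\<tau> ^^ k) x))) / weight_sum w n)"
    by (rule bounded_convergenceD[OF bc ds, of _ B]) (use B abs_Im_le_cmod order_trans in \<open>auto, blast\<close>)
  ultimately show ?thesis
  proof eventually_elim
    case (elim x)
    have "weighted_average w \<tau> f n x
        = Complex ((\<Sum>k=1..n. w k * Re (f ((\<tau> ^^ k) x))) / weight_sum w n)
            ((\<Sum>k=1..n. w k * Im (f ((\<tau> ^^ k) x))) / weight_sum w n)" for n
      by (simp add: complex_eq_iff weighted_average_def)
    moreover obtain a b where
      "(\<lambda>n. (\<Sum>k=1..n. w k * Re (f ((\<tau> ^^ k) x))) / weight_sum w n) \<longlonglongrightarrow> a"
      "(\<lambda>n. (\<Sum>k=1..n. w k * Im (f ((\<tau> ^^ k) x))) / weight_sum w n) \<longlonglongrightarrow> b"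
      using elim by (auto simp: convergent_def)
    ultimately have "(\<lambda>n. weighted_average w \<tau> f n x) \<longlonglongrightarrow> Complex a b"
      by (simp add: tendsto_Complex)
    then show ?case by (auto simp: convergent_def)
  qed
qed

lemma weighted_average_diff:
  "weighted_average w \<tau> f n x - weighted_average w \<tau> g n x = weighted_average w \<tau> (\<lambda>x. f x - g x) n x"
  by (simp add: weighted_average_def diff_divide_distrib sum_subtractf right_diff_distrib)

text \<open>
  The Banach principle. Truncating \<open>f\<close> at height \<open>K\<close> leaves a remainder \<open>g K\<close> whose \<open>p\<close>-th moment
  tends to 0, so by the weak inequality almost every point has remainders with arbitrarily small
  maximal functions. Hence the averages of \<open>f\<close> are uniformly approximated by those of a bounded
  function, which converge.
\<close>
lemma pointwise_of_weak_type:
  assumes wt: "weak_type TYPE('a) p w C" and p: "p > 0"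
    and adm: "admissible_weight w" and w: "\<And>k. k \<ge> 1 \<Longrightarrow> w k \<ge> 0"
    and bc: "bounded_convergence TYPE('a) w"
  shows "good_pointwise_Lp TYPE('a) p w"
  unfolding good_pointwise_Lp_def
proof (intro conjI adm allI impI)
  fix M :: "'a measure" and \<tau> f
  assume ds: "dynamical_system M \<tau>" and Lp: "in_Lp p M f"
  interpret prob_space M using ds by (simp add: dynamical_system_def)
  have fm[measurable]: "f \<in> borel_measurable M" using Lp by (simp add: in_Lp_def)
  have fin: "(\<integral>\<^sup>+x. ennreal (norm (f x) powr p) \<partial>M) < \<infinity>"
  proof (rule ccontr)
    assume "\<not> ?thesis"
    then have "(\<integral>\<^sup>+x. ennreal (norm (f x) powr p) \<partial>M) = top"
      by (metis infinity_ennreal_def top.not_eq_extremum)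
    then show False using Lp by (simp add: in_Lp_def Lp_norm_def) (simp add: ennreal_powr_def)
  qed
  define h where "h K x = (if norm (f x) \<le> real K then f x else 0)" for K :: nat and x
  define g where "g K x = norm (f x - h K x)" for K :: nat and x
  have [measurable]: "h K \<in> borel_measurable M" "g K \<in> borel_measurable M" for K
    unfolding h_def g_def by measurable
  have Mg[measurable]: "weighted_max w \<tau> (g K) \<in> borel_measurable M" for K
    by (rule measurable_weighted_max[OF ds]) simp
  have g_lim: "(\<lambda>K. \<integral>\<^sup>+x. ennreal (g K x powr p) \<partial>M) \<longlonglongrightarrow> (\<integral>\<^sup>+x. 0 \<partial>M)"
  proof (rule nn_integral_dominated_convergence[where w = "\<lambda>x. ennreal (norm (f x) powr p)"])
    show "AE x in M. (\<lambda>K. ennreal (g K x powr p)) \<longlonglongrightarrow> 0"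
    proof (intro AE_I2 tendsto_eventually)
      fix x
      obtain K where K: "norm (f x) \<le> real K" using real_arch_simple by blast
      show "\<forall>\<^sub>F K in sequentially. ennreal (g K x powr p) = 0"
        by (rule eventually_sequentiallyI[of K]) (use K p in \<open>auto simp: g_def h_def\<close>)
    qed
    show "AE x in M. ennreal (g K x powr p) \<le> ennreal (norm (f x) powr p)" for K
      by (intro AE_I2 ennreal_leI powr_mono2) (use p in \<open>auto simp: g_def h_def\<close>)
  qed (use fin in auto)
  have null: "AE x in M. \<exists>K. weighted_max w \<tau> (g K) x \<le> ennreal t" if t: "t > 0" for t
  proof -
    let ?N = "{x\<in>space M. \<forall>K. ennreal t < weighted_max w \<tau> (g K) x}"
    have "emeasure M ?N \<le> ennreal (C / t powr p) * (\<integral>\<^sup>+x. ennreal (g K x powr p) \<partial>M)" for K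
    proof -
      have "emeasure M ?N \<le> emeasure M {x\<in>space M. ennreal t < weighted_max w \<tau> (g K) x}"
        by (rule emeasure_mono) auto
      also have "\<dots> \<le> ennreal (C / t powr p) * (\<integral>\<^sup>+x. ennreal (g K x powr p) \<partial>M)"
        by (rule weak_typeD[OF wt ds _ _ t]) (auto simp: g_def)
      finally show ?thesis .
    qed
    moreover have "(\<lambda>K. ennreal (C / t powr p) * (\<integral>\<^sup>+x. ennreal (g K x powr p) \<partial>M)) \<longlonglongrightarrow> ennreal (C / t powr p) * 0"
      using g_lim by (intro ennreal_tendsto_cmult) auto
    ultimately have "emeasure M ?N \<le> ennreal (C / t powr p) * 0"
      by (intro LIMSEQ_le_const) auto
    then have "emeasure M ?N = 0" by simp
    then show ?thesis
      by (intro AE_I[of _ _ ?N]) (auto simp: not_le)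
  qed
  have "AE x in M. \<forall>j::nat. \<exists>K. weighted_max w \<tau> (g K) x \<le> ennreal (1 / Suc j)"
    unfolding AE_all_countable by (intro allI null) simp
  moreover have "AE x in M. \<forall>K. convergent (\<lambda>n. weighted_average w \<tau> (h K) n x)"
    unfolding AE_all_countable
    by (intro allI bounded_convergence_complex[OF bc ds]) (auto simp: h_def)
  ultimately show "AE x in M. convergent (\<lambda>n. weighted_average w \<tau> f n x)"
  proof eventually_elim
    case (elim x)
    have "Cauchy (\<lambda>n. weighted_average w \<tau> f n x)"
    proof (rule CauchyI)
      fix e :: real assume e: "e > 0"
      obtain j where j: "1 / Suc j < e / 3" using e nat_approx_posE[of "e / 3"] by auto
      obtain K where K: "weighted_max w \<tau> (g K) x \<le> ennreal (1 / Suc j)" using elim(1) by blast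
      have close: "norm (weighted_average w \<tau> f n x - weighted_average w \<tau> (h K) n x) < e / 3"
        if n: "n \<ge> 1" for n
      proof -
        have "ennreal (norm (weighted_average w \<tau> f n x - weighted_average w \<tau> (h K) n x))
            \<le> ennreal ((\<Sum>k=1..n. w k * g K ((\<tau> ^^ k) x)) / weight_sum w n)"
          unfolding weighted_average_diff
          using norm_weighted_average_le[of w \<tau> "\<lambda>x. f x - h K x"] w by (intro ennreal_leI) (simp add: g_def)
        also have "\<dots> \<le> weighted_max w \<tau> (g K) x"
          unfolding weighted_max_def using n by (intro SUP_upper) auto
        also note K
        finally have "norm (weighted_average w \<tau> f n x - weighted_average w \<tau> (h K) n x) \<le> 1 / Suc j"
          by (subst (asm) ennreal_le_iff) auto
        then show ?thesis using j by linarith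
      qed
      have "Cauchy (\<lambda>n. weighted_average w \<tau> (h K) n x)"
        using elim(2) by (simp add: Cauchy_convergent_iff)
      then obtain N where N: "norm (weighted_average w \<tau> (h K) m x - weighted_average w \<tau> (h K) n x) < e / 3"
        if "m \<ge> N" "n \<ge> N" for m n
        using e unfolding Cauchy_iff by (metis divide_pos_pos zero_less_numeral)
      have "norm (weighted_average w \<tau> f m x - weighted_average w \<tau> f n x) < e"
        if "m \<ge> max 1 N" "n \<ge> max 1 N" for m n
      proof -
        have mn: "m \<ge> 1" "n \<ge> 1" "m \<ge> N" "n \<ge> N" using that by auto
        have "norm ((a - b) + (b - c) - (d - c)) \<le> norm (a - b) + norm (b - c) + norm (d - c)" for a b c d :: complex
          by (rule order_trans[OF norm_triangle_ineq4 add_right_mono[OF norm_triangle_ineq]])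
        from this[of "weighted_average w \<tau> f m x" "weighted_average w \<tau> (h K) m x"
            "weighted_average w \<tau> (h K) n x" "weighted_average w \<tau> f n x"]
        show ?thesis using close[OF mn(1)] close[OF mn(2)] N[OF mn(3,4)] by simp
      qed
      then show "\<exists>M. \<forall>m\<ge>M. \<forall>n\<ge>M. norm (weighted_average w \<tau> f m x - weighted_average w \<tau> f n x) < e"
        by blast
    qed
    then show ?case by (simp add: Cauchy_convergent_iff)
  qed
qed

section \<open>Summing weak-type functions\<close>

lemma summable_powr_neg: "s > 1 \<Longrightarrow> summable (\<lambda>m. real m powr - s)"
  by (simp add: summable_real_powr_iff)

text \<open>
  The first summand comes from the exceptional set where some \<open>Y m\<close> is large, the second from the
  truncated functions. The value of \<open>\<eta>\<close> makes the coefficients raised to the power \<open>1 - \<eta>\<close> equal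
  to \<open>m powr - (1 + e / 2)\<close>, halfway to the critical exponent.
\<close>
definition stein_weiss_const :: "real \<Rightarrow> real" where
  "stein_weiss_const e = (let S = (\<Sum>m. real m powr - (1 + e)); \<eta> = e / (2 * (1 + e)) in
     2 * S\<^sup>2 + 2 * ((1 + \<eta>) / \<eta>) * (\<Sum>m. real m powr - (1 + e / 2)))"

text \<open>
  Weak \<open>L\<^sup>1\<close> is not a normed space, so a summable sequence of coefficients does not suffice;
  polynomial decay does. Let \<open>c m\<close> be the coefficients and \<open>S\<close> their sum. Each \<open>Y m\<close> is cut at
  \<open>l / c m\<close> with \<open>l = t / (2 * S)\<close>. The sets where \<open>Y m\<close> exceeds its cut have total measure at
  most \<open>S * A / l\<close>. The truncated functions satisfy \<open>y \<le> l + l powr - \<eta> * y powr (1 + \<eta>)\<close>: the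
  constants \<open>l\<close> add up to \<open>t / 2\<close>, and the moments of order \<open>1 + \<eta>\<close>, finite by truncation, are
  summable after multiplication by \<open>c m\<close>, so Markov's inequality applies to the rest.
\<close>
lemma stein_weiss:
  assumes "sigma_finite_measure M" and [measurable]: "\<And>m. Y m \<in> borel_measurable M"
    and e: "e > 0" and t: "t > 0"
    and weak: "\<And>m t. m \<ge> 1 \<Longrightarrow> t > 0 \<Longrightarrow> emeasure M {x \<in> space M. ennreal t < Y m x} \<le> ennreal (1 / t) * A"
  shows "emeasure M {x \<in> space M. ennreal t < (\<Sum>m. ennreal (real m powr - (1 + e)) * Y m x)}
    \<le> ennreal (stein_weiss_const e / t) * A"
proof -
  define c where "c m = real m powr - (1 + e)" for m :: nat
  define \<eta> where "\<eta> = e / (2 * (1 + e))"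
  define S where "S = suminf c"
  define R where "R = (\<Sum>m. real m powr - (1 + e / 2))"
  have \<eta>: "\<eta> > 0" using e by (simp add: \<eta>_def)
  have c_nonneg: "c m \<ge> 0" and c0: "c 0 = 0" and c_pos: "m \<ge> 1 \<Longrightarrow> c m > 0" for m by (auto simp: c_def)
  have sc: "summable c" unfolding c_def using e by (intro summable_powr_neg) simp
  have sR: "summable (\<lambda>m. real m powr - (1 + e / 2))" using e by (intro summable_powr_neg) simp
  have R: "R \<ge> 0" unfolding R_def using sR by (intro suminf_nonneg) auto
  have S: "S > 0" unfolding S_def using suminf_pos2[OF sc, of 1] c_nonneg by (simp add: c_def)
  define l where "l = t / (2 * S)"
  have l: "l > 0" using t S by (simp add: l_def)
  define N where "N m x = min (Y m x) (ennreal (l / c m))" for m x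
  have [measurable]: "N m \<in> borel_measurable M" for m unfolding N_def by measurable
  define Z where "Z x = (\<Sum>m. ennreal (c m) * ennreal_powr (N m x) (1 + \<eta>))" for x
  have [measurable]: "Z \<in> borel_measurable M" unfolding Z_def
    using measurable_compose[OF _ ennreal_powr_measurable] by measurable
  let ?big = "{x \<in> space M. ennreal t < (\<Sum>m. ennreal (c m) * Y m x)}"
  \<comment> \<open>\<open>?B1\<close> is where a truncation takes effect, \<open>?B2\<close> where the truncated moments are large.\<close>
  let ?B1 = "\<Union>m\<in>{1..}. {x \<in> space M. ennreal (l / c m) < Y m x}"
  let ?B2 = "{x \<in> space M. 1 \<le> ennreal (2 / t * l powr - \<eta>) * Z x}"
  have sub: "?big \<subseteq> ?B1 \<union> ?B2"
  proof
    fix x assume x: "x \<in> ?big"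
    show "x \<in> ?B1 \<union> ?B2"
    proof (cases "x \<in> ?B1")
      case False
      have YN: "ennreal (c m) * Y m x = ennreal (c m) * N m x" for m
        using False x by (cases "m = 0") (auto simp: c0 N_def not_less min_def)
      have pt: "ennreal (c m) * N m x \<le> ennreal (c m * l) + ennreal (l powr - \<eta>) * (ennreal (c m) * ennreal_powr (N m x) (1 + \<eta>))" for m
      proof -
        have "N m x \<noteq> top" by (auto simp: N_def min_def top_unique)
        then obtain r where r: "r \<ge> 0" "N m x = ennreal r" by (cases "N m x") auto
        have "r \<le> l + l powr - \<eta> * r powr (1 + \<eta>)"
        proof (cases "r \<le> l")
          case True then show ?thesis using l r by (simp add: add_increasing2)
        next
          case False
          then have "l powr \<eta> \<le> r powr \<eta>" using l \<eta> by (intro powr_mono2) auto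
          then have "r * 1 \<le> r * (l powr - \<eta> * r powr \<eta>)"
            using r l by (intro mult_left_mono) (auto simp: powr_minus field_simps)
          also have "\<dots> = l powr - \<eta> * r powr (1 + \<eta>)"
            using r False l by (simp add: powr_add)
          finally show ?thesis using l by simp
        qed
        then have "c m * r \<le> c m * l + l powr - \<eta> * (c m * r powr (1 + \<eta>))"
          using mult_left_mono[OF _ c_nonneg[of m]] by (fastforce simp: algebra_simps)
        then have "ennreal (c m * r) \<le> ennreal (c m * l + l powr - \<eta> * (c m * r powr (1 + \<eta>)))"
          by (rule ennreal_leI)
        also have "\<dots> = ennreal (c m * l) + ennreal (l powr - \<eta> * (c m * r powr (1 + \<eta>)))"
          using c_nonneg[of m] l by (intro ennreal_plus) auto
        finally show ?thesis unfolding r(2) using c_nonneg[of m] r(1) by (simp add: ennreal_mult)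
      qed
      have "ennreal t < (\<Sum>m. ennreal (c m) * N m x)" using x by (simp add: YN)
      also have "\<dots> \<le> (\<Sum>m. ennreal (c m * l) + ennreal (l powr - \<eta>) * (ennreal (c m) * ennreal_powr (N m x) (1 + \<eta>)))"
        by (intro suminf_le pt) auto
      also have "\<dots> = (\<Sum>m. ennreal (c m * l)) + ennreal (l powr - \<eta>) * Z x"
        unfolding Z_def by (subst suminf_add[symmetric]) (auto simp: ennreal_suminf_cmult)
      also have "(\<Sum>m. ennreal (c m * l)) = ennreal (S * l)"
        using sc c_nonneg l unfolding S_def
        by (subst suminf_ennreal2) (auto simp: summable_mult2 suminf_mult2)
      also have "S * l = t / 2" using S by (simp add: l_def)
      finally have *: "ennreal t < ennreal (t / 2) + ennreal (l powr - \<eta>) * Z x" .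
      have "1 \<le> ennreal (2 / t * l powr - \<eta>) * Z x"
      proof (cases "Z x")
        case (real z)
        have "ennreal t < ennreal (t / 2 + l powr - \<eta> * z)"
          using * real t by (subst ennreal_plus) (auto simp: ennreal_mult)
        then have "t / 2 < l powr - \<eta> * z" using t by (simp add: ennreal_less_iff)
        then have "1 \<le> 2 / t * l powr - \<eta> * z" using t by (simp add: field_simps)
        then show ?thesis using real t by (simp flip: ennreal_mult)
      next
        case top
        then show ?thesis using t l by (simp add: ennreal_mult_top)
      qed
      then show ?thesis using x by auto
    qed simp
  qed
  have B1: "emeasure M ?B1 \<le> ennreal (2 * S\<^sup>2 / t) * A"
  proof -
    have "emeasure M ?B1 = emeasure M (\<Union>m. {x \<in> space M. m \<ge> 1 \<and> ennreal (l / c m) < Y m x})"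
      by (rule arg_cong[where f = "emeasure M"]) auto
    also have "\<dots> \<le> (\<Sum>m. emeasure M {x \<in> space M. m \<ge> 1 \<and> ennreal (l / c m) < Y m x})"
      by (rule emeasure_subadditive_countably) auto
    also have "\<dots> \<le> (\<Sum>m. ennreal (c m / l) * A)"
    proof (intro suminf_le)
      fix m :: nat
      show "emeasure M {x \<in> space M. m \<ge> 1 \<and> ennreal (l / c m) < Y m x} \<le> ennreal (c m / l) * A"
      proof (cases "m \<ge> 1")
        case True
        then show ?thesis using weak[OF True, of "l / c m"] l c_pos by simp
      qed simp
    qed auto
    also have "\<dots> = (\<Sum>m. ennreal (c m / l)) * A" by (rule ennreal_suminf_multc)
    also have "(\<Sum>m. ennreal (c m / l)) = ennreal (S / l)"
      using sc c_nonneg l unfolding S_def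
      by (subst suminf_ennreal2) (auto simp: summable_divide suminf_divide)
    also have "S / l = 2 * S\<^sup>2 / t" using S t by (simp add: l_def power2_eq_square)
    finally show ?thesis .
  qed
  have IZ: "(\<integral>\<^sup>+x. Z x \<partial>M) \<le> ennreal ((1 + \<eta>) / \<eta> * l powr \<eta> * R) * A"
  proof -
    have "(\<integral>\<^sup>+x. Z x \<partial>M) = (\<Sum>m. \<integral>\<^sup>+x. ennreal (c m) * ennreal_powr (N m x) (1 + \<eta>) \<partial>M)"
      unfolding Z_def by (rule nn_integral_suminf)
        (use measurable_compose[OF _ ennreal_powr_measurable] in measurable)
    also have "\<dots> \<le> (\<Sum>m. ennreal ((1 + \<eta>) / \<eta> * l powr \<eta> * (real m powr - (1 + e / 2))) * A)"
    proof (intro suminf_le)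
      fix m :: nat
      show "(\<integral>\<^sup>+x. ennreal (c m) * ennreal_powr (N m x) (1 + \<eta>) \<partial>M)
          \<le> ennreal ((1 + \<eta>) / \<eta> * l powr \<eta> * (real m powr - (1 + e / 2))) * A"
      proof (cases "m \<ge> 1")
        case True
        have "(\<integral>\<^sup>+x. ennreal (c m) * ennreal_powr (N m x) (1 + \<eta>) \<partial>M)
            = ennreal (c m) * (\<integral>\<^sup>+x. ennreal_powr (N m x) (1 + \<eta>) \<partial>M)"
          by (rule nn_integral_cmult)
             (use measurable_compose[OF _ ennreal_powr_measurable] in measurable)
        also have "\<dots> \<le> ennreal (c m) * (ennreal ((1 + \<eta>) / \<eta> * (l / c m) powr \<eta>) * A)"
          unfolding N_def
          using truncated_moment[OF assms(1), of "Y m" "1 + \<eta>" "l / c m" A] weak[OF True] \<eta> l c_nonneg[of m]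
          by (intro mult_left_mono) auto
        also have "\<dots> = ennreal (c m * ((1 + \<eta>) / \<eta> * (l / c m) powr \<eta>)) * A"
          by (rule ennreal_mult_mult) (use \<eta> l c_nonneg[of m] in auto)
        also have "c m * ((1 + \<eta>) / \<eta> * (l / c m) powr \<eta>) = (1 + \<eta>) / \<eta> * l powr \<eta> * (c m powr (1 - \<eta>))"
          using c_pos[OF True] l by (simp add: powr_divide powr_diff)
        also have "c m powr (1 - \<eta>) = real m powr - (1 + e / 2)"
        proof -
          have "- (1 + e) * (1 - \<eta>) = - (1 + e / 2)" using e by (simp add: \<eta>_def field_simps)
          then show ?thesis unfolding c_def powr_powr by simp
        qed
        finally show ?thesis .
      next
        case False
        then have "m = 0" by simp
        then show ?thesis by (simp add: c0)
      qed
    qed auto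
    also have "\<dots> = (\<Sum>m. ennreal ((1 + \<eta>) / \<eta> * l powr \<eta> * (real m powr - (1 + e / 2)))) * A"
      by (rule ennreal_suminf_multc)
    also have "(\<Sum>m. ennreal ((1 + \<eta>) / \<eta> * l powr \<eta> * (real m powr - (1 + e / 2))))
        = ennreal ((1 + \<eta>) / \<eta> * l powr \<eta> * R)"
    proof (rule suminf_ennreal_eq)
      show "(\<lambda>m. (1 + \<eta>) / \<eta> * l powr \<eta> * (real m powr - (1 + e / 2))) sums ((1 + \<eta>) / \<eta> * l powr \<eta> * R)"
        unfolding R_def by (rule sums_mult[OF summable_sums[OF sR]])
    qed (use \<eta> in auto)
    finally show ?thesis .
  qed
  have B2: "emeasure M ?B2 \<le> ennreal (2 * ((1 + \<eta>) / \<eta>) * R / t) * A"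
  proof -
    have "emeasure M ?B2 \<le> ennreal (2 / t * l powr - \<eta>) * (\<integral>\<^sup>+x. Z x * indicator (space M) x \<partial>M)"
      using nn_integral_Markov_inequality[of Z "space M" M "ennreal (2 / t * l powr - \<eta>)"] by simp
    also have "(\<integral>\<^sup>+x. Z x * indicator (space M) x \<partial>M) = (\<integral>\<^sup>+x. Z x \<partial>M)"
      by (intro nn_integral_cong) simp
    also have "ennreal (2 / t * l powr - \<eta>) * (\<integral>\<^sup>+x. Z x \<partial>M)
        \<le> ennreal (2 / t * l powr - \<eta>) * (ennreal ((1 + \<eta>) / \<eta> * l powr \<eta> * R) * A)"
      by (intro mult_left_mono IZ) auto
    also have "\<dots> = ennreal (2 / t * l powr - \<eta> * ((1 + \<eta>) / \<eta> * l powr \<eta> * R)) * A"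
      using t \<eta> R by (subst ennreal_mult) (auto simp: mult.assoc)
    also have "2 / t * l powr - \<eta> * ((1 + \<eta>) / \<eta> * l powr \<eta> * R) = 2 * ((1 + \<eta>) / \<eta>) * R / t"
    proof -
      have "l powr - \<eta> * l powr \<eta> = 1" using l by (simp add: powr_minus)
      moreover have "2 / t * l powr - \<eta> * ((1 + \<eta>) / \<eta> * l powr \<eta> * R)
          = 2 * ((1 + \<eta>) / \<eta>) * R / t * (l powr - \<eta> * l powr \<eta>)" by (simp add: mult_ac)
      ultimately show ?thesis by simp
    qed
    finally show ?thesis .
  qed
  have "emeasure M ?big \<le> emeasure M (?B1 \<union> ?B2)"
    by (rule emeasure_mono[OF sub]) measurable
  also have "\<dots> \<le> emeasure M ?B1 + emeasure M ?B2"
    by (rule emeasure_subadditive) measurable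
  also have "\<dots> \<le> ennreal (2 * S\<^sup>2 / t) * A + ennreal (2 * ((1 + \<eta>) / \<eta>) * R / t) * A"
    by (intro add_mono B1 B2)
  also have "\<dots> = ennreal (2 * S\<^sup>2 / t + 2 * ((1 + \<eta>) / \<eta>) * R / t) * A"
    using t \<eta> R by (subst ennreal_plus) (auto simp: distrib_right)
  also have "2 * S\<^sup>2 / t + 2 * ((1 + \<eta>) / \<eta>) * R / t = stein_weiss_const e / t"
  proof -
    have "stein_weiss_const e = 2 * S\<^sup>2 + 2 * ((1 + \<eta>) / \<eta>) * R"
      unfolding stein_weiss_const_def Let_def S_def R_def \<eta>_def c_def by (rule refl)
    then show ?thesis by (simp only: add_divide_distrib)
  qed
  finally show ?thesis by (simp add: c_def)
qed

section \<open>Power weights\<close>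

text \<open>
  Mean value theorem for \<open>x powr (s + 1)\<close>; both bounds are telescoped below.
\<close>
lemma powr_Suc_diff_bounds:
  fixes s :: real
  assumes "s \<ge> 0" "k \<ge> 1"
  shows "(s + 1) * real k powr s \<le> real (Suc k) powr (s + 1) - real k powr (s + 1)"
    "real (Suc k) powr (s + 1) - real k powr (s + 1) \<le> (s + 1) * real (Suc k) powr s"
proof -
  have "\<exists>z>real k. z < real (Suc k) \<and> real (Suc k) powr (s + 1) - real k powr (s + 1)
      = (real (Suc k) - real k) * ((s + 1) * z powr s)"
  proof (rule MVT2)
    fix x assume "real k \<le> x" "x \<le> real (Suc k)"
    then have "x > 0" using assms by linarith
    from has_real_derivative_powr[OF this, of "s + 1"]
    show "((\<lambda>x. x powr (s + 1)) has_real_derivative (s + 1) * x powr s) (at x)" by simp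
  qed simp
  then obtain z where z: "real k < z" "z < real (Suc k)"
    "real (Suc k) powr (s + 1) - real k powr (s + 1) = (s + 1) * z powr s" by auto
  have "real k powr s \<le> z powr s" "z powr s \<le> real (Suc k) powr s"
    using z assms by (auto intro!: powr_mono2)
  then show "(s + 1) * real k powr s \<le> real (Suc k) powr (s + 1) - real k powr (s + 1)"
    "real (Suc k) powr (s + 1) - real k powr (s + 1) \<le> (s + 1) * real (Suc k) powr s"
    unfolding z(3) using assms by (auto intro!: mult_left_mono)
qed

lemma weight_sum_powr_eq: "weight_sum (\<lambda>k. real k powr s) n = (\<Sum>k=1..n. real k powr s)"
  by (simp add: weight_sum_def)

lemma weight_sum_powr_lower:
  assumes "s \<ge> 0"
  shows "real n powr (s + 1) \<le> (s + 1) * weight_sum (\<lambda>k. real k powr s) n"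
proof (induction n)
  case (Suc n)
  show ?case
  proof (cases "n = 0")
    case True
    then show ?thesis using assms by (simp add: weight_sum_powr_eq)
  next
    case False
    have "real (Suc n) powr (s + 1) \<le> real n powr (s + 1) + (s + 1) * real (Suc n) powr s"
      using powr_Suc_diff_bounds(2)[OF assms, of n] False by linarith
    then show ?thesis using Suc by (simp add: weight_sum_powr_eq distrib_left)
  qed
qed (simp add: weight_sum_powr_eq)

lemma weight_sum_powr_upper:
  assumes "s \<ge> 0"
  shows "(s + 1) * weight_sum (\<lambda>k. real k powr s) n \<le> real (Suc n) powr (s + 1)"
proof (induction n)
  case (Suc n)
  have "(s + 1) * real (Suc n) powr s \<le> real (Suc (Suc n)) powr (s + 1) - real (Suc n) powr (s + 1)"
    by (rule powr_Suc_diff_bounds(1)[OF assms]) simp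
  moreover have "weight_sum (\<lambda>k. real k powr s) (Suc n)
      = weight_sum (\<lambda>k. real k powr s) n + real (Suc n) powr s" by (simp add: weight_sum_powr_eq)
  ultimately show ?case using Suc by (simp only: distrib_left)
qed (simp add: weight_sum_powr_eq)

lemma weight_sum_powr_le:
  assumes "s \<ge> 0"
  shows "weight_sum (\<lambda>k. real k powr s) n \<le> real n powr (s + 1)"
proof -
  have "(\<Sum>k=1..n. real k powr s) \<le> (\<Sum>k=1..n. real n powr s)"
    using assms by (intro sum_mono powr_mono2) auto
  also have "\<dots> = real n powr (s + 1)" by (simp add: powr_add)
  finally show ?thesis by (simp add: weight_sum_powr_eq)
qed

lemma weight_sum_powr_asymp:
  assumes "s \<ge> 0"
  shows "(\<lambda>n. weight_sum (\<lambda>k. real k powr s) n / real n powr (s + 1)) \<longlonglongrightarrow> 1 / (s + 1)"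
proof (rule tendsto_sandwich)
  show "\<forall>\<^sub>F n in sequentially. 1 / (s + 1) \<le> weight_sum (\<lambda>k. real k powr s) n / real n powr (s + 1)"
  proof (rule eventually_sequentiallyI[of 1])
    fix n :: nat assume "1 \<le> n"
    then show "1 / (s + 1) \<le> weight_sum (\<lambda>k. real k powr s) n / real n powr (s + 1)"
      using weight_sum_powr_lower[OF assms, of n] assms by (simp add: field_simps)
  qed
  show "\<forall>\<^sub>F n in sequentially. weight_sum (\<lambda>k. real k powr s) n / real n powr (s + 1)
      \<le> (1 + 1 / real n) powr (s + 1) / (s + 1)"
  proof (rule eventually_sequentiallyI[of 1])
    fix n :: nat assume n: "1 \<le> n"
    have "(1 + 1 / real n) powr (s + 1) = real (Suc n) powr (s + 1) / real n powr (s + 1)"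
      using n by (simp add: field_simps flip: powr_divide)
    then show "weight_sum (\<lambda>k. real k powr s) n / real n powr (s + 1) \<le> (1 + 1 / real n) powr (s + 1) / (s + 1)"
      using weight_sum_powr_upper[OF assms, of n] assms n by (simp add: field_simps)
  qed
  have "(\<lambda>n. (1 + 1 / real n) powr (s + 1) / (s + 1)) \<longlonglongrightarrow> (1 + 0) powr (s + 1) / (s + 1)"
    using assms by (intro tendsto_intros lim_1_over_n) auto
  then show "(\<lambda>n. (1 + 1 / real n) powr (s + 1) / (s + 1)) \<longlonglongrightarrow> 1 / (s + 1)" by simp
qed simp

lemma real_div_le: "real (n div b) \<le> real n / real b"
proof -
  have "real (n div b) = of_int \<lfloor>real n / real b\<rfloor>" by (simp add: floor_divide_of_nat_eq)
  then show ?thesis by simp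
qed

lemma real_div_gt: "real n / real b - 1 < real (n div b)"
proof -
  have "real (n div b) = of_int \<lfloor>real n / real b\<rfloor>" by (simp add: floor_divide_of_nat_eq)
  then show ?thesis by linarith
qed

lemma tendsto_div_ratio:
  assumes "b > 0"
  shows "(\<lambda>n. real (n div b) / real n) \<longlonglongrightarrow> 1 / real b"
proof (rule tendsto_sandwich)
  show "\<forall>\<^sub>F n in sequentially. 1 / real b - 1 / real n \<le> real (n div b) / real n"
  proof (rule eventually_sequentiallyI[of 1])
    fix n :: nat assume n: "1 \<le> n"
    have "real n / real b - 1 \<le> real (n div b)"
      using real_div_gt[of n b] by linarith
    then have "(real n / real b - 1) / real n \<le> real (n div b) / real n"
      by (rule divide_right_mono) simp
    moreover have "(real n / real b - 1) / real n = 1 / real b - 1 / real n"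
      using n assms by (simp add: field_simps)
    ultimately show "1 / real b - 1 / real n \<le> real (n div b) / real n" by simp
  qed
  show "\<forall>\<^sub>F n in sequentially. real (n div b) / real n \<le> 1 / real b"
  proof (rule eventually_sequentiallyI[of 1])
    fix n :: nat assume n: "1 \<le> n"
    then show "real (n div b) / real n \<le> 1 / real b"
      using real_div_le[of n b] assms by (simp add: field_simps)
  qed
  have "(\<lambda>n. 1 / real b - 1 / real n) \<longlonglongrightarrow> 1 / real b - 0" by (intro tendsto_intros lim_1_over_n)
  then show "(\<lambda>n. 1 / real b - 1 / real n) \<longlonglongrightarrow> 1 / real b" by simp
qed simp

lemma weight_sum_powr_ratio:
  assumes s: "s \<ge> 0" and b: "b > 0"
  shows "(\<lambda>n. weight_sum (\<lambda>k. real k powr s) (n div b) / weight_sum (\<lambda>k. real k powr s) n)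
    \<longlonglongrightarrow> real b powr - (s + 1)"
proof -
  let ?V = "weight_sum (\<lambda>k. real k powr s)"
  define q where "q n = ?V n / real n powr (s + 1)" for n
  have q: "q \<longlonglongrightarrow> 1 / (s + 1)" unfolding q_def by (rule weight_sum_powr_asymp[OF s])
  have "(\<lambda>n. q (n div b) / q n * (real (n div b) / real n) powr (s + 1))
      \<longlonglongrightarrow> (1 / (s + 1)) / (1 / (s + 1)) * (1 / real b) powr (s + 1)"
    using b s by (intro tendsto_intros q filterlim_compose[OF q filterlim_div_at_top] tendsto_div_ratio) auto
  also have "(1 / (s + 1)) / (1 / (s + 1)) * (1 / real b) powr (s + 1) = real b powr - (s + 1)"
    using s by (simp add: powr_divide powr_minus inverse_eq_divide del: minus_add_distrib)
  finally have lim: "(\<lambda>n. q (n div b) / q n * (real (n div b) / real n) powr (s + 1)) \<longlonglongrightarrow> real b powr - (s + 1)" .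
  show ?thesis
  proof (rule Lim_transform_eventually[OF lim])
    show "\<forall>\<^sub>F n in sequentially. q (n div b) / q n * (real (n div b) / real n) powr (s + 1) = ?V (n div b) / ?V n"
    proof (rule eventually_sequentiallyI[of b])
      fix n assume "b \<le> n"
      then have "n > 0" "n div b > 0" using b by (auto simp: div_greater_zero_iff)
      then show "q (n div b) / q n * (real (n div b) / real n) powr (s + 1) = ?V (n div b) / ?V n"
        by (simp add: q_def powr_divide)
    qed
  qed
qed

lemma weight_sum_powr_div_le:
  assumes s: "s \<ge> 0" and b: "b > 0"
  shows "weight_sum (\<lambda>k. real k powr s) (n div b)
    \<le> (s + 1) * real b powr - (s + 1) * weight_sum (\<lambda>k. real k powr s) n"
proof -
  have "weight_sum (\<lambda>k. real k powr s) (n div b) \<le> real (n div b) powr (s + 1)"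
    by (rule weight_sum_powr_le[OF s])
  also have "\<dots> \<le> (real n / real b) powr (s + 1)"
    using s by (intro powr_mono2 real_div_le) auto
  also have "\<dots> = real b powr - (s + 1) * real n powr (s + 1)"
    by (simp add: powr_divide powr_minus field_simps del: minus_add_distrib)
  also have "\<dots> \<le> real b powr - (s + 1) * ((s + 1) * weight_sum (\<lambda>k. real k powr s) n)"
    by (intro mult_left_mono weight_sum_powr_lower[OF s]) auto
  finally show ?thesis by (simp add: mult_ac)
qed

lemma admissible_powr:
  assumes s: "s \<ge> 0"
  shows "admissible_weight (\<lambda>k. real k powr s)"
proof -
  have pos: "real n \<le> (s + 1) * weight_sum (\<lambda>k. real k powr s) n" if "n \<ge> 1" for n
  proof -
    have "real n powr 1 \<le> real n powr (s + 1)" using that s by (intro powr_mono) auto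
    then show ?thesis using weight_sum_powr_lower[OF s, of n] that by simp
  qed
  have "filterlim (\<lambda>n. 1 / (s + 1) * real n) at_top sequentially"
    using s by (intro filterlim_tendsto_pos_mult_at_top[OF tendsto_const] filterlim_real_sequentially) auto
  then have "filterlim (weight_sum (\<lambda>k. real k powr s)) at_top sequentially"
    by (rule filterlim_at_top_mono, intro eventually_sequentiallyI[of 1])
       (use pos s in \<open>simp add: field_simps\<close>)
  moreover have "weight_sum (\<lambda>k. real k powr s) n \<noteq> 0" if "n \<ge> 1" for n
    using pos[OF that] that by auto
  ultimately show ?thesis by (simp add: admissible_weight_def)
qed

text \<open>
  The largest weight up to \<open>n\<close> is \<open>n powr s\<close>, and the total weight is at least \<open>1 / (s + 1)\<close> times
  what it would be if all weights had that size.
\<close>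
lemma weighted_max_powr_le:
  assumes s: "s \<ge> 0" and f: "\<And>x. f x \<ge> 0"
  shows "weighted_max (\<lambda>k. real k powr s) \<tau> f x \<le> ennreal (s + 1) * weighted_max (\<lambda>_. 1) \<tau> f x"
  unfolding weighted_max_def
proof (rule SUP_least)
  fix n :: nat assume n: "n \<in> {1..}"
  let ?V = "weight_sum (\<lambda>k. real k powr s) n"
  have V: "?V > 0" using weight_sum_pos[OF admissible_powr[OF s]] n by simp
  have nonneg: "(\<Sum>k=1..n. f ((\<tau> ^^ k) x)) \<ge> 0" using f by (intro sum_nonneg) auto
  have "(\<Sum>k=1..n. real k powr s * f ((\<tau> ^^ k) x)) \<le> (\<Sum>k=1..n. real n powr s * f ((\<tau> ^^ k) x))"
    using s f by (intro sum_mono mult_right_mono powr_mono2) auto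
  also have "\<dots> = real n powr (s + 1) * ((\<Sum>k=1..n. f ((\<tau> ^^ k) x)) / real n)"
    using n by (simp add: powr_add flip: sum_distrib_left)
  also have "\<dots> \<le> ((s + 1) * ?V) * ((\<Sum>k=1..n. f ((\<tau> ^^ k) x)) / real n)"
    using nonneg by (intro mult_right_mono weight_sum_powr_lower[OF s]) auto
  finally have "(\<Sum>k=1..n. real k powr s * f ((\<tau> ^^ k) x)) / ?V
      \<le> (s + 1) * ((\<Sum>k=1..n. 1 * f ((\<tau> ^^ k) x)) / weight_sum (\<lambda>_. 1) n)"
    using V by (simp add: weight_sum_one field_simps)
  then have "ennreal ((\<Sum>k=1..n. real k powr s * f ((\<tau> ^^ k) x)) / ?V)
      \<le> ennreal ((s + 1) * ((\<Sum>k=1..n. 1 * f ((\<tau> ^^ k) x)) / weight_sum (\<lambda>_. 1) n))"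
    by (rule ennreal_leI)
  also have "\<dots> = ennreal (s + 1) * ennreal ((\<Sum>k=1..n. 1 * f ((\<tau> ^^ k) x)) / weight_sum (\<lambda>_. 1) n)"
    using s nonneg by (intro ennreal_mult) (auto simp: weight_sum_one)
  also have "\<dots> \<le> ennreal (s + 1) * (SUP n\<in>{1..}. ennreal ((\<Sum>k=1..n. 1 * f ((\<tau> ^^ k) x)) / weight_sum (\<lambda>_. 1) n))"
    using n by (intro mult_left_mono SUP_upper) auto
  finally show "ennreal ((\<Sum>k=1..n. real k powr s * f ((\<tau> ^^ k) x)) / ?V) \<le> \<dots>" .
qed

text \<open>
  Summation by parts: the increments of \<open>v\<close> add up to at most \<open>v n\<close>.
\<close>
lemma abel_bound:
  fixes v a :: "nat \<Rightarrow> real"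
  assumes mono: "\<And>k. v k \<le> v (Suc k)" and v0: "v 0 \<ge> 0"
    and S: "\<And>m. m \<le> n \<Longrightarrow> \<bar>\<Sum>k=1..m. a k\<bar> \<le> B"
  shows "\<bar>\<Sum>k=1..n. v k * a k\<bar> \<le> 2 * B * v n"
proof -
  have v: "v m \<ge> 0" for m by (induction m) (use mono v0 order_trans in blast)+
  have "\<bar>(\<Sum>k=1..m. v k * a k) - v m * (\<Sum>k=1..m. a k)\<bar> \<le> B * v m" if "m \<le> n" for m
    using that
  proof (induction m)
    case 0
    then show ?case using S[of 0] v0 by simp
  next
    case (Suc m)
    have "(\<Sum>k=1..Suc m. v k * a k) - v (Suc m) * (\<Sum>k=1..Suc m. a k)
        = ((\<Sum>k=1..m. v k * a k) - v m * (\<Sum>k=1..m. a k)) - (v (Suc m) - v m) * (\<Sum>k=1..m. a k)"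
      by (simp add: algebra_simps)
    also have "\<bar>\<dots>\<bar> \<le> B * v m + (v (Suc m) - v m) * B"
    proof -
      have "\<bar>(v (Suc m) - v m) * (\<Sum>k=1..m. a k)\<bar> \<le> (v (Suc m) - v m) * B"
        using S[of m] Suc.prems mono[of m] by (simp add: abs_mult mult_left_mono)
      then show ?thesis using Suc by linarith
    qed
    finally show ?case by (simp add: algebra_simps)
  qed
  from this[of n] have "\<bar>(\<Sum>k=1..n. v k * a k) - v n * (\<Sum>k=1..n. a k)\<bar> \<le> B * v n" by simp
  moreover have "\<bar>v n * (\<Sum>k=1..n. a k)\<bar> \<le> B * v n"
    using S[of n] v[of n] by (simp add: abs_mult mult.commute[of B] mult_left_mono)
  ultimately have "\<bar>\<Sum>k=1..n. v k * a k\<bar> \<le> B * v n + B * v n" by linarith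
  then show ?thesis by simp
qed

text \<open>
  Cesaro convergence to 0 says that the partial sums are \<open>o(n)\<close>; summation by parts turns this
  into \<open>o(n powr (s + 1))\<close> for the weighted sums, which is smaller than the total weight.
\<close>
lemma cesaro_imp_powr_mean_null:
  fixes a :: "nat \<Rightarrow> real"
  assumes s: "s \<ge> 0" and lim: "(\<lambda>n. (\<Sum>k=1..n. a k) / real n) \<longlonglongrightarrow> 0"
  shows "(\<lambda>n. (\<Sum>k=1..n. real k powr s * a k) / weight_sum (\<lambda>k. real k powr s) n) \<longlonglongrightarrow> 0"
proof (rule LIMSEQ_I)
  fix e :: real assume e: "e > 0"
  \<comment> \<open>Up to \<open>n\<close> the partial sums are at most \<open>2 * d * n\<close>; summation by parts doubles this and the
    comparison with the total weight costs \<open>s + 1\<close>, which leaves \<open>e / 2\<close>.\<close>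
  define d where "d = e / (8 * (s + 1))"
  have d: "d > 0" using e s by (simp add: d_def)
  obtain N where N: "\<bar>\<Sum>k=1..n. a k\<bar> \<le> d * real n" if "n \<ge> N" for n
  proof -
    obtain N where N: "\<And>n. n \<ge> N \<Longrightarrow> norm ((\<Sum>k=1..n. a k) / real n - 0) < d"
      using LIMSEQ_D[OF lim d] by blast
    show ?thesis
    proof (rule that[of "max 1 N"])
      fix n assume "n \<ge> max 1 N"
      then show "\<bar>\<Sum>k=1..n. a k\<bar> \<le> d * real n" using N[of n] by (simp add: field_simps)
    qed
  qed
  define C where "C = (\<Sum>m\<le>N. \<bar>\<Sum>k=1..m. a k\<bar>)"
  have C: "C \<ge> 0" by (simp add: C_def sum_nonneg)
  have S: "\<bar>\<Sum>k=1..m. a k\<bar> \<le> d * real n + C" if "m \<le> n" for m n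
  proof (cases "m \<le> N")
    case True
    then have "\<bar>\<Sum>k=1..m. a k\<bar> \<le> C" unfolding C_def by (intro member_le_sum) auto
    then show ?thesis using d by (simp add: add_increasing)
  next
    case False
    then have "\<bar>\<Sum>k=1..m. a k\<bar> \<le> d * real m" using N[of m] by simp
    also have "\<dots> \<le> d * real n" using that d by simp
    finally show ?thesis using C by simp
  qed
  obtain N1 :: nat where N1: "C / d < real N1" using reals_Archimedean2 by blast
  show "\<exists>no. \<forall>n\<ge>no. norm ((\<Sum>k=1..n. real k powr s * a k) / weight_sum (\<lambda>k. real k powr s) n - 0) < e"
  proof (intro exI[of _ "max 1 N1"] allI impI)
    fix n assume n: "n \<ge> max 1 N1"
    let ?V = "weight_sum (\<lambda>k. real k powr s) n"
    have V: "?V > 0" using weight_sum_pos[OF admissible_powr[OF s]] n by simp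
    have "C \<le> d * real n" using N1 n d by (simp add: field_simps) (smt (verit) mult_left_mono of_nat_le_iff)
    have "\<bar>\<Sum>k=1..n. real k powr s * a k\<bar> \<le> 2 * (d * real n + C) * real n powr s"
      by (rule abel_bound) (use S s in \<open>auto intro!: powr_mono2\<close>)
    also have "\<dots> \<le> 2 * (2 * d * real n) * real n powr s"
      using \<open>C \<le> d * real n\<close> by (intro mult_right_mono) auto
    also have "\<dots> = 4 * d * real n powr (s + 1)" using n by (simp add: powr_add)
    also have "\<dots> \<le> 4 * d * ((s + 1) * ?V)"
      using d by (intro mult_left_mono weight_sum_powr_lower[OF s]) auto
    also have "\<dots> = (4 * d * (s + 1)) * ?V" by simp
    also have "4 * d * (s + 1) = e / 2" using s by (simp add: d_def field_simps)
    also have "e / 2 * ?V < e * ?V" using e by (intro mult_strict_right_mono[OF _ V]) simp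
    finally show "norm ((\<Sum>k=1..n. real k powr s * a k) / ?V - 0) < e"
      using V by (simp add: field_simps abs_mult)
  qed
qed

lemma bounded_convergence_powr:
  assumes s: "s \<ge> 0"
  shows "bounded_convergence TYPE('a) (\<lambda>k. real k powr s)"
  unfolding bounded_convergence_def
proof (intro allI impI)
  fix M :: "'a measure" and \<tau> and f :: "'a \<Rightarrow> real" and B
  assume ds: "dynamical_system M \<tau>" and fm: "f \<in> borel_measurable M" and B: "\<forall>x. \<bar>f x\<bar> \<le> B"
  let ?V = "weight_sum (\<lambda>k. real k powr s)"
  have "AE x in M. convergent (\<lambda>n. (\<Sum>k=1..n. f ((\<tau> ^^ k) x)) / real n)"
    by (rule birkhoff_bounded[OF ds fm, of B]) (use B in simp)
  then show "AE x in M. convergent (\<lambda>n. (\<Sum>k=1..n. real k powr s * f ((\<tau> ^^ k) x)) / ?V n)"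
  proof eventually_elim
    case (elim x)
    then obtain l where l: "(\<lambda>n. (\<Sum>k=1..n. f ((\<tau> ^^ k) x)) / real n) \<longlonglongrightarrow> l" by (auto simp: convergent_def)
    have "(\<lambda>n. (\<Sum>k=1..n. f ((\<tau> ^^ k) x) - l) / real n) \<longlonglongrightarrow> 0"
    proof (rule Lim_transform_eventually)
      show "(\<lambda>n. (\<Sum>k=1..n. f ((\<tau> ^^ k) x)) / real n - l) \<longlonglongrightarrow> 0" using l by (simp add: LIM_zero)
      show "\<forall>\<^sub>F n in sequentially. (\<Sum>k=1..n. f ((\<tau> ^^ k) x)) / real n - l = (\<Sum>k=1..n. f ((\<tau> ^^ k) x) - l) / real n"
        by (rule eventually_sequentiallyI[of 1]) (simp add: sum_subtractf field_simps)
    qed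
    from cesaro_imp_powr_mean_null[OF s this]
    have "(\<lambda>n. (\<Sum>k=1..n. real k powr s * (f ((\<tau> ^^ k) x) - l)) / ?V n + l) \<longlonglongrightarrow> 0 + l"
      by (intro tendsto_intros)
    then have "(\<lambda>n. (\<Sum>k=1..n. real k powr s * f ((\<tau> ^^ k) x)) / ?V n) \<longlonglongrightarrow> 0 + l"
    proof (rule Lim_transform_eventually, intro eventually_sequentiallyI[of 1])
      fix n :: nat assume "1 \<le> n"
      then have "?V n > 0" using weight_sum_pos[OF admissible_powr[OF s]] by simp
      moreover have "(\<Sum>k=1..n. real k powr s * (f ((\<tau> ^^ k) x) - l))
          = (\<Sum>k=1..n. real k powr s * f ((\<tau> ^^ k) x)) - l * ?V n"
        by (simp add: right_diff_distrib sum_subtractf weight_sum_powr_eq mult.commute[of _ l] sum_distrib_left)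
      ultimately show "(\<Sum>k=1..n. real k powr s * (f ((\<tau> ^^ k) x) - l)) / ?V n + l
          = (\<Sum>k=1..n. real k powr s * f ((\<tau> ^^ k) x)) / ?V n" by (simp add: field_simps)
    qed
    then show ?case by (auto simp: convergent_def)
  qed
qed

section \<open>Weights given by a sum over divisors\<close>

text \<open>
  The weight \<open>w\<close> has the inner weight \<open>v\<close> and the coefficients \<open>a\<close>; \<open>b m\<close> is \<open>m\<close> or \<open>m ^ 2\<close> in the
  applications. In units of the total weight of \<open>v\<close>, the \<open>m\<close>-th term of \<open>w\<close> has size at most \<open>c m\<close>
  at every time, and up to the factor \<open>a m\<close> its share tends to \<open>r m\<close>; so limits over \<open>m\<close> and over
  the time may be exchanged. A nonzero total share is what makes the total weights of \<open>w\<close> and \<open>v\<close>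
  comparable.
\<close>
locale divisor_sum_weight =
  fixes w v a c r :: "nat \<Rightarrow> real" and b :: "nat \<Rightarrow> nat"
  assumes b: "\<And>m. b m \<ge> m"
    and w_eq: "\<And>k. k \<ge> 1 \<Longrightarrow> w k = (\<Sum>m | m \<in> {1..k} \<and> b m dvd k. a m * v (k div b m))"
    and w_nonneg: "\<And>k. k \<ge> 1 \<Longrightarrow> w k \<ge> 0" and w1: "w 1 > 0"
    and v_nonneg: "\<And>k. k \<ge> 1 \<Longrightarrow> v k \<ge> 0" and v_adm: "admissible_weight v"
    and a0: "a 0 = 0"
    and ratio_le: "\<And>m n. m \<ge> 1 \<Longrightarrow> \<bar>a m\<bar> * weight_sum v (n div b m) \<le> c m * weight_sum v n"
    and c_nonneg: "\<And>m. c m \<ge> 0" and c_summable: "summable c"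
    and ratio_lim: "\<And>m. m \<ge> 1 \<Longrightarrow> (\<lambda>n. weight_sum v (n div b m) / weight_sum v n) \<longlonglongrightarrow> r m"
    and nonzero: "(\<Sum>m. a m * r m) \<noteq> 0"
begin

abbreviation "V \<equiv> weight_sum v"
abbreviation "W \<equiv> weight_sum w"

lemma V_pos: "n \<ge> 1 \<Longrightarrow> V n > 0"
  by (rule weight_sum_pos[OF v_adm])

lemma W_pos: "n \<ge> 1 \<Longrightarrow> W n > 0"
proof -
  assume n: "n \<ge> 1"
  have "0 < w 1" by (rule w1)
  also have "w 1 \<le> (\<Sum>k=1..n. w k)" using n w_nonneg by (intro member_le_sum) auto
  finally show ?thesis using weight_sum_eq[of w n] w_nonneg by simp
qed

lemma weighted_sum_eq:
  "(\<Sum>k=1..n. w k * F k) = (\<Sum>m=1..n. a m * (\<Sum>j=1..n div b m. v j * F (b m * j)))"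
  using sum_divisor_convolution[of b a v F n] b w_eq by simp

text \<open>
  After division by \<open>V\<close> the weighted sum is a sum over \<open>m\<close> dominated by \<open>c\<close>, so it converges as
  soon as each term does. For \<open>F = 1\<close> this gives the total weight, for bounded observables along
  an orbit the averages.
\<close>
lemma tendsto_weighted_sum:
  assumes lim: "\<And>m. m \<ge> 1 \<Longrightarrow> (\<lambda>n. (\<Sum>j=1..n. v j * F (b m * j)) / V n) \<longlonglongrightarrow> l m"
    and F: "\<And>k. \<bar>F k\<bar> \<le> B"
  shows "(\<lambda>n. (\<Sum>k=1..n. w k * F k) / V n) \<longlonglongrightarrow> (\<Sum>m. a m * (r m * l m))"
proof -
  define t where "t m n = a m * ((V (n div b m) / V n) * ((\<Sum>j=1..n div b m. v j * F (b m * j)) / V (n div b m)))" for m n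
  have V0: "V 0 = 0" by (simp add: weight_sum_def)
  have vsum: "\<bar>\<Sum>j=1..n. v j * F (g j)\<bar> \<le> B * V n" for n and g :: "nat \<Rightarrow> nat"
  proof -
    have "\<bar>\<Sum>j=1..n. v j * F (g j)\<bar> \<le> (\<Sum>j=1..n. v j * B)"
      by (intro order_trans[OF sum_abs] sum_mono) (use F v_nonneg in \<open>auto simp: abs_mult intro!: mult_left_mono\<close>)
    also have "\<dots> = B * V n"
      using weight_sum_eq[of v n] v_nonneg by (simp add: sum_distrib_left mult.commute)
    finally show ?thesis .
  qed
  have B: "B \<ge> 0" using F[of 0] by linarith
  have "(\<lambda>n. \<Sum>m. t m n) \<longlonglongrightarrow> (\<Sum>m. a m * (r m * l m))"
  proof (rule tannery_nat)
    show "(\<lambda>n. t m n) \<longlonglongrightarrow> a m * (r m * l m)" for m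
    proof (cases "m \<ge> 1")
      case True
      then have "b m > 0" using b[of m] by simp
      then show ?thesis unfolding t_def
        by (intro tendsto_intros ratio_lim True filterlim_compose[OF lim[OF True] filterlim_div_at_top])
    next
      case False
      then have "m = 0" by simp
      then show ?thesis by (simp add: t_def a0)
    qed
    show "\<bar>t m n\<bar> \<le> c m * B" for m n
    proof (cases "m \<ge> 1 \<and> n div b m \<ge> 1")
      case True
      then have n: "n \<ge> 1" by (cases n) auto
      have V: "V n > 0" "V (n div b m) > 0" using V_pos True n by auto
      have "\<bar>t m n\<bar> = (\<bar>a m\<bar> * V (n div b m)) / V n * (\<bar>\<Sum>j=1..n div b m. v j * F (b m * j)\<bar> / V (n div b m))"
        using V by (simp add: t_def abs_mult)
      also have "\<dots> \<le> c m * B"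
      proof (intro mult_mono)
        show "\<bar>a m\<bar> * V (n div b m) / V n \<le> c m"
          using ratio_le[of m n] True V by (simp add: field_simps)
        show "\<bar>\<Sum>j=1..n div b m. v j * F (b m * j)\<bar> / V (n div b m) \<le> B"
          using vsum[where n = "n div b m" and g = "\<lambda>j. b m * j"] V by (simp add: field_simps)
      qed (use V c_nonneg in auto)
      finally show ?thesis .
    next
      case False
      then have "t m n = 0" by (cases "m \<ge> 1") (auto simp: t_def a0 V0 not_less_eq_eq Suc_le_eq)
      then show ?thesis using B c_nonneg[of m] by simp
    qed
    show "summable (\<lambda>m. c m * B)" by (rule summable_mult2[OF c_summable])
  qed
  moreover have "(\<Sum>m. t m n) = (\<Sum>k=1..n. w k * F k) / V n" for n
  proof -
    have "(\<Sum>m. t m n) = (\<Sum>m=1..n. t m n)"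
    proof (rule suminf_finite)
      fix m assume m: "m \<notin> {1..n}"
      show "t m n = 0"
      proof (cases "m = 0")
        case False
        then have "n < b m" using b[of m] m by auto
        then show ?thesis by (simp add: t_def)
      qed (simp add: t_def a0)
    qed simp
    also have "\<dots> = (\<Sum>m=1..n. a m * (\<Sum>j=1..n div b m. v j * F (b m * j)) / V n)"
    proof (rule sum.cong[OF refl])
      fix m
      show "t m n = a m * (\<Sum>j=1..n div b m. v j * F (b m * j)) / V n"
      proof (cases "n div b m \<ge> 1")
        case True
        then show ?thesis using V_pos[OF True] by (simp add: t_def)
      next
        case False
        then have "n div b m = 0" by simp
        then show ?thesis by (simp only: t_def) simp
      qed
    qed
    also have "\<dots> = (\<Sum>k=1..n. w k * F k) / V n"
      unfolding weighted_sum_eq sum_divide_distrib ..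
    finally show ?thesis .
  qed
  ultimately show ?thesis by simp
qed

lemma tendsto_weight_ratio: "(\<lambda>n. W n / V n) \<longlonglongrightarrow> (\<Sum>m. a m * r m)"
proof -
  have "(\<lambda>n. (\<Sum>k=1..n. w k * 1) / V n) \<longlonglongrightarrow> (\<Sum>m. a m * (r m * 1))"
  proof (rule tendsto_weighted_sum[where B = 1])
    show "(\<lambda>n. (\<Sum>j=1..n. v j * 1) / V n) \<longlonglongrightarrow> 1" for m
    proof (rule tendsto_eventually, rule eventually_sequentiallyI[of 1])
      fix n :: nat assume "1 \<le> n"
      then show "(\<Sum>j=1..n. v j * 1) / V n = 1"
        using V_pos[of n] weight_sum_eq[of v n] v_nonneg by simp
    qed
  qed simp
  then show ?thesis using weight_sum_eq[of w] w_nonneg by simp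
qed

lemma ratio_limit_pos: "(\<Sum>m. a m * r m) > 0"
proof -
  have "0 \<le> (\<Sum>m. a m * r m)"
    by (rule LIMSEQ_le_const[OF tendsto_weight_ratio]) (auto intro!: divide_nonneg_nonneg weight_sum_nonneg)
  then show ?thesis using nonzero by simp
qed

lemma admissible: "admissible_weight w"
proof -
  have "filterlim (\<lambda>n. (W n / V n) * V n) at_top sequentially"
    using v_adm by (intro filterlim_tendsto_pos_mult_at_top[OF tendsto_weight_ratio ratio_limit_pos])
      (simp add: admissible_weight_def)
  then have "filterlim W at_top sequentially"
  proof (rule filterlim_mono_eventually[OF _ order_refl order_refl], intro eventually_sequentiallyI[of 1])
    fix n :: nat assume "1 \<le> n"
    then show "(W n / V n) * V n = W n" using V_pos[of n] by simp
  qed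
  then show ?thesis using W_pos by (force simp: admissible_weight_def)
qed

lemma weight_comparison: "\<exists>K>0. \<forall>n. V n \<le> K * W n"
proof -
  have "(\<lambda>n. inverse (W n / V n)) \<longlonglongrightarrow> inverse (\<Sum>m. a m * r m)"
    by (rule tendsto_inverse[OF tendsto_weight_ratio nonzero])
  then have "Bseq (\<lambda>n. V n / W n)" by (intro convergent_imp_Bseq) (auto simp: convergent_def)
  then obtain K where K: "K > 0" "\<And>n. norm (V n / W n) \<le> K" by (auto elim: BseqE)
  have "V n \<le> K * W n" for n
  proof (cases "n \<ge> 1")
    case True
    then show ?thesis using K(2)[of n] W_pos[OF True] V_pos[OF True] by (simp add: field_simps)
  qed (simp add: not_less_eq_eq weight_sum_def)
  then show ?thesis using K by blast
qed

lemma bounded_convergence: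
  assumes "bounded_convergence TYPE('a) v"
  shows "bounded_convergence TYPE('a) w"
  unfolding bounded_convergence_def
proof (intro allI impI)
  fix M :: "'a measure" and \<tau> and f :: "'a \<Rightarrow> real" and B
  assume ds: "dynamical_system M \<tau>" and fm: "f \<in> borel_measurable M" and B: "\<forall>x. \<bar>f x\<bar> \<le> B"
  have "AE x in M. \<forall>m. convergent (\<lambda>n. (\<Sum>j=1..n. v j * f (((\<tau> ^^ b m) ^^ j) x)) / V n)"
    unfolding AE_all_countable
    by (intro allI bounded_convergenceD[OF assms dynamical_system_funpow[OF ds] fm, of B]) (use B in simp)
  then show "AE x in M. convergent (\<lambda>n. (\<Sum>k=1..n. w k * f ((\<tau> ^^ k) x)) / W n)"
  proof eventually_elim
    case (elim x)
    then obtain l where l: "\<And>m. (\<lambda>n. (\<Sum>j=1..n. v j * f (((\<tau> ^^ b m) ^^ j) x)) / V n) \<longlonglongrightarrow> l m"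
      unfolding convergent_def by metis
    have "(\<lambda>n. (\<Sum>k=1..n. w k * f ((\<tau> ^^ k) x)) / V n) \<longlonglongrightarrow> (\<Sum>m. a m * (r m * l m))"
      by (rule tendsto_weighted_sum) (use l B in \<open>auto simp: funpow_mult_apply\<close>)
    then have "(\<lambda>n. ((\<Sum>k=1..n. w k * f ((\<tau> ^^ k) x)) / V n) / (W n / V n))
        \<longlonglongrightarrow> (\<Sum>m. a m * (r m * l m)) / (\<Sum>m. a m * r m)"
      by (rule tendsto_divide[OF _ tendsto_weight_ratio nonzero])
    then have "(\<lambda>n. (\<Sum>k=1..n. w k * f ((\<tau> ^^ k) x)) / W n) \<longlonglongrightarrow> (\<Sum>m. a m * (r m * l m)) / (\<Sum>m. a m * r m)"
    proof (rule Lim_transform_eventually, intro eventually_sequentiallyI[of 1])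
      fix n :: nat assume "1 \<le> n"
      then show "((\<Sum>k=1..n. w k * f ((\<tau> ^^ k) x)) / V n) / (W n / V n) = (\<Sum>k=1..n. w k * f ((\<tau> ^^ k) x)) / W n"
        using V_pos[of n] by simp
    qed
    then show ?case by (auto simp: convergent_def)
  qed
qed

lemma weighted_max_le:
  assumes K: "K > 0" "\<And>n. V n \<le> K * W n" and f: "\<And>x. f x \<ge> 0"
  shows "weighted_max w \<tau> f x \<le> ennreal K * (\<Sum>m. ennreal (c m) * weighted_max v (\<tau> ^^ b m) f x)"
  unfolding weighted_max_def[of w]
proof (rule SUP_least)
  fix n :: nat assume n: "n \<in> {1..}"
  define T where "T m = (\<Sum>j=1..n div b m. v j * f ((\<tau> ^^ (b m * j)) x))" for m
  have T: "T m \<ge> 0" for m unfolding T_def by (intro sum_nonneg mult_nonneg_nonneg v_nonneg f) simp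
  have V: "V n > 0" and W: "W n > 0" using V_pos W_pos n by auto
  have "(\<Sum>k=1..n. w k * f ((\<tau> ^^ k) x)) \<le> (\<Sum>m=1..n. \<bar>a m\<bar> * T m)"
    unfolding weighted_sum_eq T_def[symmetric] by (intro sum_mono mult_right_mono T) simp
  also have "\<dots> \<le> (\<Sum>m=1..n. c m * V n * (T m / V (n div b m)))"
  proof (intro sum_mono)
    fix m assume m: "m \<in> {1..n}"
    show "\<bar>a m\<bar> * T m \<le> c m * V n * (T m / V (n div b m))"
    proof (cases "n div b m \<ge> 1")
      case True
      have "\<bar>a m\<bar> * T m = \<bar>a m\<bar> * V (n div b m) * (T m / V (n div b m))"
        using V_pos[OF True] by simp
      also have "\<dots> \<le> c m * V n * (T m / V (n div b m))"
        using m T[of m] by (intro mult_right_mono ratio_le divide_nonneg_nonneg weight_sum_nonneg) auto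
      finally show ?thesis .
    next
      case False
      then have "n div b m = 0" by simp
      then have "T m = 0" by (simp only: T_def) simp
      then show ?thesis by simp
    qed
  qed
  also have "\<dots> = V n * (\<Sum>m=1..n. c m * (T m / V (n div b m)))"
    by (simp add: sum_distrib_left mult_ac)
  also have "\<dots> \<le> (K * W n) * (\<Sum>m=1..n. c m * (T m / V (n div b m)))"
    by (intro mult_right_mono K sum_nonneg mult_nonneg_nonneg c_nonneg divide_nonneg_nonneg T weight_sum_nonneg)
  finally have "(\<Sum>k=1..n. w k * f ((\<tau> ^^ k) x)) / W n \<le> K * (\<Sum>m=1..n. c m * (T m / V (n div b m)))"
    using W by (simp add: field_simps)
  then have "ennreal ((\<Sum>k=1..n. w k * f ((\<tau> ^^ k) x)) / W n)
      \<le> ennreal (K * (\<Sum>m=1..n. c m * (T m / V (n div b m))))" by (rule ennreal_leI)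
  also have "\<dots> = ennreal K * (\<Sum>m=1..n. ennreal (c m) * ennreal (T m / V (n div b m)))"
  proof -
    have nn: "T m / V (n div b m) \<ge> 0" for m by (intro divide_nonneg_nonneg T weight_sum_nonneg)
    have "ennreal (K * (\<Sum>m=1..n. c m * (T m / V (n div b m))))
        = ennreal K * ennreal (\<Sum>m=1..n. c m * (T m / V (n div b m)))"
      by (intro ennreal_mult sum_nonneg mult_nonneg_nonneg c_nonneg nn) (use K in simp)
    also have "ennreal (\<Sum>m=1..n. c m * (T m / V (n div b m))) = (\<Sum>m=1..n. ennreal (c m * (T m / V (n div b m))))"
      by (rule sum_ennreal[symmetric]) (intro mult_nonneg_nonneg c_nonneg nn)
    also have "\<dots> = (\<Sum>m=1..n. ennreal (c m) * ennreal (T m / V (n div b m)))"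
      by (intro sum.cong refl ennreal_mult c_nonneg nn)
    finally show ?thesis .
  qed
  also have "\<dots> \<le> ennreal K * (\<Sum>m=1..n. ennreal (c m) * weighted_max v (\<tau> ^^ b m) f x)"
  proof (intro mult_left_mono sum_mono)
    fix m
    show "ennreal (T m / V (n div b m)) \<le> weighted_max v (\<tau> ^^ b m) f x"
    proof (cases "n div b m \<ge> 1")
      case True
      then show ?thesis unfolding weighted_max_def T_def
        by (intro SUP_upper2[of "n div b m"]) (auto simp: funpow_mult_apply)
    next
      case False
      then have "n div b m = 0" by simp
      then show ?thesis by (simp only: T_def) simp
    qed
  qed auto
  also have "\<dots> \<le> ennreal K * (\<Sum>m. ennreal (c m) * weighted_max v (\<tau> ^^ b m) f x)"
    by (intro mult_left_mono sum_le_suminf) auto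
  finally show "ennreal ((\<Sum>k=1..n. w k * f ((\<tau> ^^ k) x)) / W n) \<le> \<dots>" .
qed

end

section \<open>Ramanujan sums\<close>

text \<open>
  The Ramanujan sum \<open>c\<^sub>q(k)\<close>, given by its arithmetic formula. That it is the sum of the
  exponentials at the reduced fractions with denominator \<open>q\<close> is proved below.
\<close>
definition ramanujan :: "nat \<Rightarrow> nat \<Rightarrow> real" where
  "ramanujan q k = (\<Sum>e | e dvd q \<and> e dvd k. real e * real_of_int (moebius_mu (q div e)))"

lemma sum_moebius_between:
  assumes "d > 0" "e dvd (d::nat)"
  shows "(\<Sum>q | q dvd d \<and> e dvd q. real_of_int (moebius_mu (q div e))) = (if e = d then 1 else 0)"
proof -
  have e: "e > 0" using assms by (auto intro: Nat.gr0I)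
  have "(\<Sum>q | q dvd d \<and> e dvd q. real_of_int (moebius_mu (q div e)))
      = (\<Sum>j | j dvd d div e. real_of_int (moebius_mu j))"
  proof (rule sum.reindex_bij_witness[where i = "\<lambda>j. e * j" and j = "\<lambda>q. q div e"])
    fix j assume "j \<in> {j. j dvd d div e}"
    then show "e * j \<in> {q. q dvd d \<and> e dvd q}"
      using assms(2) e by (simp add: dvd_div_iff_mult mult.commute)
  next
    fix q assume "q \<in> {q. q dvd d \<and> e dvd q}"
    then show "q div e \<in> {j. j dvd d div e}" using div_dvd_div assms(2) by blast
  qed (use e in auto)
  also have "\<dots> = (if d div e = 1 then 1 else 0)"
  proof (rule sum_moebius)
    show "d div e > 0" using assms e dvd_imp_le[OF assms(2,1)] by (simp add: div_greater_zero_iff)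
  qed
  also have "d div e = 1 \<longleftrightarrow> e = d"
    using assms e by (metis dvd_mult_div_cancel mult.right_neutral div_self neq0_conv)
  finally show ?thesis .
qed

text \<open>
  Moebius inversion of the definition. It expresses the indicator of divisibility by \<open>d\<close>, times
  \<open>d\<close>, through functions of period dividing \<open>d\<close> whose averages can be controlled separately.
\<close>
lemma sum_ramanujan:
  assumes "d > 0"
  shows "(\<Sum>q | q dvd d. ramanujan q k) = (if d dvd k then real d else 0)"
proof -
  have fin: "finite {q. q dvd d}" using assms by simp
  have "(\<Sum>q | q dvd d. ramanujan q k)
      = (\<Sum>q | q dvd d. \<Sum>e | e \<in> {e. e dvd d \<and> e dvd k} \<and> e dvd q. real e * real_of_int (moebius_mu (q div e)))"
    unfolding ramanujan_def
    by (intro sum.cong refl) (auto intro: dvd_trans)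
  also have "\<dots> = (\<Sum>e\<in>{e. e dvd d \<and> e dvd k}. \<Sum>q | q \<in> {q. q dvd d} \<and> e dvd q. real e * real_of_int (moebius_mu (q div e)))"
    using sum.swap_restrict[of "{q. q dvd d}" "{e. e dvd d \<and> e dvd k}"
        "\<lambda>q e. real e * real_of_int (moebius_mu (q div e))" "\<lambda>q e. e dvd q"] fin by simp
  also have "\<dots> = (\<Sum>e\<in>{e. e dvd d \<and> e dvd k}. if e = d then real d else 0)"
  proof (rule sum.cong[OF refl])
    fix e assume "e \<in> {e. e dvd d \<and> e dvd k}"
    then show "(\<Sum>q | q \<in> {q. q dvd d} \<and> e dvd q. real e * real_of_int (moebius_mu (q div e))) = (if e = d then real d else 0)"
      using sum_moebius_between[OF assms, of e] by (simp flip: sum_distrib_left)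
  qed
  also have "\<dots> = (if d dvd k then real d else 0)"
    using fin by (subst sum.delta) auto
  finally show ?thesis .
qed

lemma abs_ramanujan_le_sum:
  assumes "q > 0"
  shows "\<bar>ramanujan q k\<bar> \<le> (\<Sum>e | e dvd q. if e dvd k then real e else 0)"
proof -
  have "\<bar>ramanujan q k\<bar> \<le> (\<Sum>e | e dvd q \<and> e dvd k. real e)"
    unfolding ramanujan_def
  proof (intro order_trans[OF sum_abs] sum_mono)
    fix e
    show "\<bar>real e * real_of_int (moebius_mu (q div e))\<bar> \<le> real e"
      using mult_left_mono[OF abs_moebius_mu_le, of "real e" "q div e"] by (simp add: abs_mult)
  qed
  also have "\<dots> = (\<Sum>e\<in>{e. e dvd q} \<inter> {e. e dvd k}. real e)"
    by (rule sum.cong) auto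
  also have "\<dots> = (\<Sum>e | e dvd q. if e dvd k then real e else 0)"
    using assms by (simp add: sum.inter_restrict)
  finally show ?thesis .
qed

lemma ramanujan_periodic: "ramanujan q (k + q * j) = ramanujan q k"
proof -
  have "{e. e dvd q \<and> e dvd k + q * j} = {e. e dvd q \<and> e dvd k}"
  proof -
    have "e dvd k + q * j \<longleftrightarrow> e dvd k" if "e dvd q" for e
      by (rule dvd_add_left_iff) (use that in simp)
    then show ?thesis by blast
  qed
  then show ?thesis by (simp add: ramanujan_def)
qed

lemma cis_two_pi_int: "cis (2 * pi * of_int m) = 1"
  by (rule cis_multiple_2pi) simp

lemma sum_roots_of_unity:
  fixes m :: int
  assumes L: "L > (0::nat)"
  shows "(\<Sum>b<L. cis (2 * pi * (real b * of_int m / real L))) = (if int L dvd m then of_nat L else 0)"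
proof -
  define z where "z = cis (2 * pi * (of_int m / real L))"
  have pow: "cis (2 * pi * (real b * of_int m / real L)) = z ^ b" for b
    unfolding z_def Complex.DeMoivre by (simp add: mult_ac)
  show ?thesis
  proof (cases "int L dvd m")
    case True
    then obtain t where t: "m = int L * t" by auto
    have "z = 1" using L cis_two_pi_int[of t] by (simp add: z_def t)
    then show ?thesis using True unfolding pow by simp
  next
    case False
    have "z \<noteq> 1"
    proof
      assume "z = 1"
      then have "cos (2 * pi * (of_int m / real L)) = 1" by (simp add: z_def complex_eq_iff)
      then obtain t :: int where "2 * pi * (of_int m / real L) = of_int t * 2 * pi"
        by (auto simp: cos_one_2pi_int)
      then have "of_int m = (of_int t * real L :: real)" using L by (simp add: field_simps)
      then have "m = t * int L" by (metis of_int_eq_iff of_int_mult of_int_of_nat_eq)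
      then show False using False by simp
    qed
    moreover have "z ^ L = 1"
      using L cis_two_pi_int[of m] by (simp add: z_def Complex.DeMoivre)
    ultimately have "(\<Sum>b<L. z ^ b) = 0" by (simp add: geometric_sum)
    then show ?thesis using False unfolding pow by simp
  qed
qed

text \<open>
  Every fraction with denominator \<open>d\<close> is, in lowest terms, a fraction whose denominator divides
  \<open>d\<close>.
\<close>
lemma sum_reduced_fractions:
  assumes d: "d > (0::nat)"
  shows "(\<Sum>q | q dvd d. \<Sum>a | a < q \<and> coprime a q. h (real a / real q)) = (\<Sum>b<d. h (real b / real d) :: complex)"
proof -
  have "(\<Sum>q | q dvd d. \<Sum>a | a < q \<and> coprime a q. h (real a / real q))
      = (\<Sum>(q, a)\<in>(SIGMA q:{q. q dvd d}. {a. a < q \<and> coprime a q}). h (real a / real q))"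
    using d by (intro sum.Sigma) auto
  also have "\<dots> = (\<Sum>b<d. h (real b / real d))"
  proof (rule sum.reindex_bij_witness[where i = "\<lambda>b. (d div gcd b d, b div gcd b d)" and j = "\<lambda>(q, a). a * (d div q)"])
    fix x assume x: "x \<in> (SIGMA q:{q. q dvd d}. {a. a < q \<and> coprime a q})"
    then obtain q a where qa: "x = (q, a)" "q dvd d" "a < q" "coprime a q" by auto
    obtain t where t: "d = q * t" using qa(2) by auto
    have q: "q > 0" and t0: "t > 0" using d t by auto
    have "gcd (a * t) (q * t) = t" using qa(4) by (simp add: gcd_mult_distrib_nat[symmetric] mult.commute[of _ t])
    then show "(case x of (q, a) \<Rightarrow> a * (d div q)) \<in> {..<d}"
      "(d div gcd (case x of (q, a) \<Rightarrow> a * (d div q)) d, (case x of (q, a) \<Rightarrow> a * (d div q)) div gcd (case x of (q, a) \<Rightarrow> a * (d div q)) d) = x"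
      using qa q t0 by (auto simp: t)
    show "h (real (case x of (q, a) \<Rightarrow> a * (d div q)) / real d) = (case x of (q, a) \<Rightarrow> h (real a / real q))"
      using qa q t0 by (simp add: t)
  next
    fix b assume b: "b \<in> {..<d}"
    define g where "g = gcd b d"
    have g: "g > 0" using d by (simp add: g_def)
    have "\<exists>b' d'. b = b' * g \<and> d = d' * g \<and> coprime b' d'"
      unfolding g_def by (rule gcd_coprime_exists) (use g g_def in simp)
    then obtain b' d' where bd: "b = b' * g" "d = d' * g" "coprime b' d'"
      by (elim exE conjE) (rule that)
    have d': "d' > 0" using d bd(2) by (cases d') auto
    have gcd: "gcd b d = g" by (simp add: g_def)
    have div: "d div g = d'" "b div g = b'" "d div d' = g" using bd g d' by simp_all
    have lt: "b' < d'" using b g unfolding bd by simp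
    show "(case (d div gcd b d, b div gcd b d) of (q, a) \<Rightarrow> a * (d div q)) = b"
      unfolding gcd prod.case div using bd(1) by simp
    show "(d div gcd b d, b div gcd b d) \<in> (SIGMA q:{q. q dvd d}. {a. a < q \<and> coprime a q})"
      unfolding gcd div using bd(2,3) lt by simp
  qed
  finally show ?thesis .
qed

text \<open>
  Both sides have the same sums over the divisors of \<open>q\<close>, namely \<open>q\<close> or 0 according to whether \<open>q\<close>
  divides \<open>k\<close>: the left-hand side by \<open>sum_ramanujan\<close>, the right-hand side by orthogonality of the
  characters. Induction over the divisors gives equality term by term.
\<close>
lemma ramanujan_exponential_sum:
  assumes "q > 0"
  shows "complex_of_real (ramanujan q k) = (\<Sum>a | a < q \<and> coprime a q. cis (2 * pi * (real k * (real a / real q))))"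
  using assms
proof (induction q rule: less_induct)
  case (less q)
  let ?e = "\<lambda>q. \<Sum>a | a < q \<and> coprime a q. cis (2 * pi * (real k * (real a / real q)))"
  have fin: "finite {d. d dvd q}" using less.prems by simp
  have "(\<Sum>d | d dvd q. ?e d) = (\<Sum>b<q. cis (2 * pi * (real k * (real b / real q))))"
    using sum_reduced_fractions[OF less.prems, of "\<lambda>t. cis (2 * pi * (real k * t))"] by simp
  also have "\<dots> = (if q dvd k then of_nat q else 0)"
    using sum_roots_of_unity[OF less.prems, of "int k"] by (simp add: mult_ac)
  also have "\<dots> = complex_of_real (\<Sum>d | d dvd q. ramanujan d k)"
    using sum_ramanujan[OF less.prems, of k] by simp
  finally have eq: "(\<Sum>d | d dvd q. complex_of_real (ramanujan d k)) = (\<Sum>d | d dvd q. ?e d)" by simp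
  have split: "(\<Sum>d | d dvd q. g d) = g q + (\<Sum>d\<in>{d. d dvd q} - {q}. g d)" for g :: "nat \<Rightarrow> complex"
    using fin by (subst sum.remove[of _ q]) auto
  have "(\<Sum>d\<in>{d. d dvd q} - {q}. complex_of_real (ramanujan d k)) = (\<Sum>d\<in>{d. d dvd q} - {q}. ?e d)"
  proof (rule sum.cong[OF refl])
    fix d assume d: "d \<in> {d. d dvd q} - {q}"
    then have "d < q" "d > 0" using less.prems dvd_imp_le[of d q] by (auto intro: Nat.gr0I)
    then show "complex_of_real (ramanujan d k) = ?e d" by (rule less.IH)
  qed
  then show ?case using eq unfolding split by simp
qed

lemma abs_ramanujan_le:
  assumes "q > 0"
  shows "\<bar>ramanujan q k\<bar> \<le> real q"
proof -
  have "\<bar>ramanujan q k\<bar> = norm (complex_of_real (ramanujan q k))" by simp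
  also have "\<dots> \<le> (\<Sum>a | a < q \<and> coprime a q. 1)"
    unfolding ramanujan_exponential_sum[OF assms] by (rule order_trans[OF norm_sum]) simp
  also have "\<dots> = real (card {a. a < q \<and> coprime a q})" by simp
  also have "card {a. a < q \<and> coprime a q} \<le> card {..<q}" by (rule card_mono) auto
  finally show ?thesis by simp
qed

section \<open>Exponential sums and spacing of fractions\<close>

text \<open>
  Concavity of the sine: its graph lies above the chord from 0 to \<open>pi / 2\<close>.
\<close>
lemma sin_pi_ge: "0 \<le> t \<Longrightarrow> t \<le> 1 / 2 \<Longrightarrow> 2 * t \<le> sin (pi * t)"
proof -
  assume t: "0 \<le> t" "t \<le> 1 / 2"
  have cv: "convex_on {0..pi / 2} (\<lambda>x. - sin x)"
  proof (rule f''_ge0_imp_convex)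
    fix x :: real assume x: "x \<in> {0..pi / 2}"
    show "((\<lambda>x. - sin x) has_real_derivative - cos x) (at x)"
      "((\<lambda>x. - cos x) has_real_derivative sin x) (at x)"
      by (auto intro!: derivative_eq_intros)
    show "0 \<le> sin x" using x by (intro sin_ge_zero) auto
  qed simp
  have "- sin ((1 - 2 * t) *\<^sub>R 0 + (2 * t) *\<^sub>R (pi / 2)) \<le> (1 - 2 * t) * - sin 0 + (2 * t) * - sin (pi / 2)"
    by (rule convex_onD[OF cv]) (use t in auto)
  then show "2 * t \<le> sin (pi * t)" by (simp add: mult_ac)
qed

lemma abs_sin_pi_ge:
  assumes "0 \<le> t" "t \<le> 1"
  shows "2 * min t (1 - t) \<le> \<bar>sin (pi * t)\<bar>"
proof (cases "t \<le> 1 / 2")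
  case True
  then show ?thesis using sin_pi_ge[of t] assms by (simp add: min_def)
next
  case False
  have "sin (pi * (1 - t)) = sin (pi * t)" by (simp add: right_diff_distrib sin_diff)
  then show ?thesis using sin_pi_ge[of "1 - t"] False assms by (simp add: min_def)
qed

lemma norm_dirichlet_kernel_le:
  "norm (\<Sum>k=1..n. cis (2 * pi * (real k * \<beta>))) \<le> real n"
  by (rule order_trans[OF norm_sum]) simp

text \<open>
  Telescoping the geometric sum bounds the kernel by the reciprocal of twice the distance from \<open>\<beta>\<close>
  to the nearest integer.
\<close>
lemma norm_dirichlet_kernel_frac:
  "norm (\<Sum>k=1..n. cis (2 * pi * (real k * \<beta>))) * (2 * min (frac \<beta>) (1 - frac \<beta>)) \<le> 1"
proof -
  define z where "z = cis (2 * pi * \<beta>)"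
  have pow: "cis (2 * pi * (real k * \<beta>)) = z ^ k" for k
    unfolding z_def Complex.DeMoivre by (simp add: mult_ac)
  have tel: "(\<Sum>k=1..n. z ^ k) * (1 - z) = z - z ^ Suc n"
  proof (induction n)
    case (Suc n)
    have "(\<Sum>k=1..Suc n. z ^ k) * (1 - z) = (\<Sum>k=1..n. z ^ k) * (1 - z) + z ^ Suc n * (1 - z)"
      by (simp add: distrib_right)
    also have "\<dots> = z - z ^ Suc (Suc n)" unfolding Suc by (simp add: algebra_simps)
    finally show ?case .
  qed simp
  have "z = cis (2 * pi * frac \<beta>) * cis (2 * pi * of_int \<lfloor>\<beta>\<rfloor>)"
    unfolding z_def cis_mult by (simp add: frac_def algebra_simps)
  then have zf: "z = cis (2 * pi * frac \<beta>)" by (simp add: cis_two_pi_int)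
  have "norm (1 - z) = 2 * \<bar>sin (pi * frac \<beta>)\<bar>"
    using dist_exp_i_1[of "2 * pi * frac \<beta>"] by (simp add: zf cis_conv_exp norm_minus_commute)
  then have "4 * min (frac \<beta>) (1 - frac \<beta>) \<le> norm (1 - z)"
    using abs_sin_pi_ge[of "frac \<beta>"] frac_ge_0[of \<beta>] frac_lt_1[of \<beta>] by simp
  then have "norm (\<Sum>k=1..n. z ^ k) * (4 * min (frac \<beta>) (1 - frac \<beta>)) \<le> norm (\<Sum>k=1..n. z ^ k) * norm (1 - z)"
    by (intro mult_left_mono) auto
  also have "\<dots> = norm (z - z ^ Suc n)" by (simp only: tel flip: norm_mult)
  also have "\<dots> \<le> norm z + norm (z ^ Suc n)" by (rule norm_triangle_ineq4)
  also have "\<dots> = 2" by (simp add: z_def norm_power norm_mult)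
  finally show ?thesis unfolding pow by (simp add: mult_ac)
qed

text \<open>
  The denominators of size \<open>2 ^ i\<close>. Within a block the weights \<open>1 / q\<close> vary by a factor of at most
  2 and the spacing of the fractions is of order \<open>1 / 4 ^ i\<close>.
\<close>
definition block :: "nat \<Rightarrow> nat set" where
  "block i = {2 ^ i..<2 ^ Suc i}"

lemma finite_block [simp]: "finite (block i)"
  by (simp add: block_def)

lemma block_pos: "q \<in> block i \<Longrightarrow> q > 0"
  using less_le_trans[of 0 "2 ^ i" q] by (simp add: block_def)

lemma card_block: "card (block i) = 2 ^ i"
  by (simp add: block_def)

text \<open>
  Two different points of the form \<open>\<beta> + a / q\<close> modulo 1, with reduced fractions and denominators
  below \<open>2 ^ Suc i\<close>, are at distance at least \<open>1 / (q * q')\<close>, which exceeds \<open>1 / 4 ^ Suc i\<close>. Hence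
  they cannot share a cell of that length.
\<close>
lemma fraction_cell_inj:
  fixes \<beta> :: real
  assumes qa: "q \<in> block i" "a < q" "coprime a q" and qa': "q' \<in> block i" "a' < q'" "coprime a' q'"
    and cell: "\<lfloor>4 ^ Suc i * frac (\<beta> + real a / real q)\<rfloor> = \<lfloor>4 ^ Suc i * frac (\<beta> + real a' / real q')\<rfloor>"
  shows "q = q' \<and> a = a'"
proof -
  have q: "q > 0" "q' > 0" using qa(1) qa'(1) block_pos by auto
  define t t' where "t = frac (\<beta> + real a / real q)" and "t' = frac (\<beta> + real a' / real q')"
  have "\<bar>4 ^ Suc i * t - 4 ^ Suc i * t'\<bar> < 1" using cell unfolding t_def t'_def by linarith
  then have "4 ^ Suc i * \<bar>t - t'\<bar> < 1" by (simp add: abs_mult flip: right_diff_distrib)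
  then have close: "\<bar>t - t'\<bar> < 1 / 4 ^ Suc i" by (simp add: field_simps)
  obtain u :: int where u: "t - t' = real a / real q - real a' / real q' + of_int u"
  proof
    show "t - t' = real a / real q - real a' / real q' + of_int (\<lfloor>\<beta> + real a' / real q'\<rfloor> - \<lfloor>\<beta> + real a / real q\<rfloor>)"
      by (simp add: t_def t'_def frac_def)
  qed
  \<comment> \<open>The numerator of the difference of the two points over the common denominator; it is an
    integer.\<close>
  define num where "num = int a * int q' - int a' * int q + u * int q * int q'"
  have tt: "t - t' = of_int num / (real q * real q')"
    using q unfolding u num_def by (simp add: field_simps)
  have "real q * real q' < 4 ^ Suc i"
  proof -
    have "real q < 2 ^ Suc i" "real q' < 2 ^ Suc i"
      using qa(1) qa'(1) unfolding block_def by (simp_all flip: of_nat_less_iff[where ?'a = real])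
    then have "real q * real q' < 2 ^ Suc i * 2 ^ Suc i" using q by (intro mult_strict_mono) auto
    also have "\<dots> = 4 ^ Suc i" by (simp flip: power_mult_distrib)
    finally show ?thesis .
  qed
  have "\<bar>real_of_int num\<bar> = \<bar>t - t'\<bar> * (real q * real q')" using q by (simp add: tt abs_mult)
  also have "\<dots> \<le> \<bar>t - t'\<bar> * 4 ^ Suc i"
    using \<open>real q * real q' < 4 ^ Suc i\<close> by (intro mult_left_mono) auto
  also have "\<dots> < 1" using close by (simp add: field_simps)
  finally have "num = 0" by linarith
  then have eq: "int a * int q' - int a' * int q = - u * int q * int q'" by (simp add: num_def)
  have "int q dvd int a * int q'"
  proof -
    have "int a * int q' = int q * (int a' - u * int q')" using eq by (simp add: algebra_simps)
    then show ?thesis by simp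
  qed
  then have "q dvd a * q'" by (metis int_dvd_int_iff of_nat_mult)
  then have 1: "q dvd q'" using qa(3) by (simp add: coprime_dvd_mult_right_iff coprime_commute)
  have "int q' dvd int a' * int q"
  proof -
    have "int a' * int q = int q' * (int a + u * int q)" using eq by (simp add: algebra_simps)
    then show ?thesis by simp
  qed
  then have "q' dvd a' * q" by (metis int_dvd_int_iff of_nat_mult)
  then have 2: "q' dvd q" using qa'(3) by (simp add: coprime_dvd_mult_right_iff coprime_commute)
  have qq: "q = q'" using 1 2 by (rule dvd_antisym)
  have "int a - int a' = - u * int q"
  proof -
    have "int q * (int a - int a') = int q * (- u * int q)" using eq unfolding qq by (simp add: algebra_simps)
    moreover have "int q \<noteq> 0" using q by simp
    ultimately show ?thesis using mult_left_cancel by blast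
  qed
  moreover have "\<bar>int a - int a'\<bar> < int q" using qa(2) qa'(2) qq by linarith
  ultimately have "\<bar>u\<bar> * int q < 1 * int q" using q by (simp add: abs_mult)
  then have "u = 0" using q by (subst (asm) mult_less_cancel_right_pos) auto
  then show ?thesis using \<open>int a - int a' = - u * int q\<close> qq by simp
qed

text \<open>
  A bound of order \<open>i\<close> for the sum over all reduced fractions with denominator in block \<open>i\<close> of the
  normalised Dirichlet kernels centred at these fractions.
\<close>
definition dirichlet_mass :: "nat \<Rightarrow> real" where
  "dirichlet_mass i = 10 * harm (4 ^ Suc i)"

lemma dirichlet_mass_nonneg: "dirichlet_mass i \<ge> 0"
  by (simp add: dirichlet_mass_def harm_nonneg)

text \<open>
  Divide the circle into \<open>4 ^ Suc i\<close> cells; each contains at most one of the shifted fractions.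
  Since \<open>n q \<ge> 4 ^ i\<close>, the normalised kernel at a fraction lying at least \<open>\<mu>\<close> cells away from 0 is
  at most \<open>2 / \<mu>\<close>, and it is always at most 1. Summing over the cells gives a harmonic sum from
  either side.
\<close>
lemma sum_kernels_over_fractions:
  fixes \<beta> :: real and n :: "nat \<Rightarrow> nat"
  assumes n: "\<And>q. q \<in> block i \<Longrightarrow> n q \<ge> 4 ^ i"
  shows "(\<Sum>q\<in>block i. \<Sum>a | a < q \<and> coprime a q.
      norm (\<Sum>k=1..n q. cis (2 * pi * (real k * (\<beta> + real a / real q)))) / real (n q)) \<le> dirichlet_mass i"
proof -
  define J :: nat where "J = 4 ^ Suc i"
  have J: "J > 0" by (simp add: J_def)
  \<comment> \<open>The contribution of the \<open>j\<close>-th cell. The two terms belong to the two directions from which 0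
    is approached; together they cover the minimum \<open>\<mu>\<close> of the distances.\<close>
  define G where "G j = 5 / (1 + real j) + 5 / real (J - j)" for j
  define cell where "cell = (\<lambda>(q, a). nat \<lfloor>4 ^ Suc i * frac (\<beta> + real a / real q)\<rfloor>)"
  define X where "X = (SIGMA q:block i. {a. a < q \<and> coprime a q})"
  have finX: "finite X" unfolding X_def by auto
  have cell_floor: "\<lfloor>4 ^ Suc i * frac (\<beta> + real a / real q)\<rfloor> \<ge> 0" for q a
    using frac_ge_0[of "\<beta> + real a / real q"] by simp
  have cell_range: "cell x < J" for x
  proof -
    obtain q a where x: "x = (q, a)" by (cases x)
    have "4 ^ Suc i * frac (\<beta> + real a / real q) < 4 ^ Suc i * 1"
      by (intro mult_strict_left_mono frac_lt_1) simp
    then have "\<lfloor>4 ^ Suc i * frac (\<beta> + real a / real q)\<rfloor> < 4 ^ Suc i"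
      by (subst floor_less_iff) simp
    then show ?thesis using cell_floor[of a q] by (simp add: x cell_def J_def nat_less_iff)
  qed
  have inj: "inj_on cell X"
  proof (rule inj_onI)
    fix x y assume x: "x \<in> X" and y: "y \<in> X" and eq: "cell x = cell y"
    obtain q a where qa: "x = (q, a)" by (cases x)
    obtain q' a' where qa': "y = (q', a')" by (cases y)
    have "\<lfloor>4 ^ Suc i * frac (\<beta> + real a / real q)\<rfloor> = \<lfloor>4 ^ Suc i * frac (\<beta> + real a' / real q')\<rfloor>"
      using eq cell_floor[of a q] cell_floor[of a' q'] by (simp add: cell_def qa qa' eq_nat_nat_iff)
    then have "q = q' \<and> a = a'"
      by (rule fraction_cell_inj[rotated 6]) (use x y in \<open>auto simp: X_def qa qa'\<close>)
    then show "x = y" by (simp add: qa qa')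
  qed
  have term_le: "norm (\<Sum>k=1..n q. cis (2 * pi * (real k * (\<beta> + real a / real q)))) / real (n q) \<le> G (cell (q, a))"
    if q: "q \<in> block i" for q a
  proof -
    let ?D = "norm (\<Sum>k=1..n q. cis (2 * pi * (real k * (\<beta> + real a / real q))))"
    define t where "t = frac (\<beta> + real a / real q)"
    define j where "j = cell (q, a)"
    define \<mu> where "\<mu> = min j (J - 1 - j)"
    have t: "0 \<le> t" "t < 1" by (auto simp: t_def frac_lt_1)
    have nq: "real (n q) \<ge> 4 ^ i" using n[OF q] by (metis of_nat_le_iff of_nat_numeral of_nat_power)
    have "(0::real) < 4 ^ i" by simp
    then have nq0: "real (n q) > 0" using nq by linarith
    have jt: "real j \<le> real J * t" "real J * t < real j + 1"
      using cell_floor[of a q] unfolding j_def cell_def t_def J_def by (auto simp: of_nat_nat intro: of_int_floor_le)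
    have "real \<mu> \<le> real J * min t (1 - t)"
    proof -
      have "real \<mu> \<le> real J * t" using jt(1) by (simp add: \<mu>_def)
      moreover have "real (J - 1 - j) = real J - 1 - real j" using cell_range[of "(q, a)"] by (simp add: j_def)
      then have "real \<mu> \<le> real J * (1 - t)" using jt(2) by (simp add: \<mu>_def algebra_simps)
      ultimately show ?thesis by (simp add: min_def)
    qed
    then have "?D * (2 * real \<mu>) \<le> ?D * (2 * (real J * min t (1 - t)))" by (intro mult_left_mono) auto
    also have "\<dots> = (?D * (2 * min t (1 - t))) * real J" by simp
    also have "\<dots> \<le> 1 * real J"
      using norm_dirichlet_kernel_frac[where \<beta> = "\<beta> + real a / real q" and n = "n q"]
      unfolding t_def[symmetric] by (rule mult_right_mono) simp
    finally have "?D * real \<mu> \<le> 2 * 4 ^ i" by (simp add: J_def mult_ac)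
    also have "\<dots> \<le> 2 * real (n q)" using nq by simp
    finally have 1: "?D / real (n q) * real \<mu> \<le> 2" using nq0 by (simp add: field_simps)
    have 2: "?D / real (n q) \<le> 1" using norm_dirichlet_kernel_le[where \<beta> = "\<beta> + real a / real q" and n = "n q"] nq0 by simp
    have "?D / real (n q) * (1 + real \<mu>) \<le> 5" using 1 2 by (simp add: distrib_left)
    then have "?D / real (n q) \<le> 5 / (1 + real \<mu>)" by (simp add: pos_le_divide_eq)
    also have "\<dots> \<le> G j"
    proof (cases "j \<le> J - 1 - j")
      case True
      then show ?thesis by (simp add: \<mu>_def G_def)
    next
      case False
      then have "1 + real \<mu> = real (J - j)"
        using cell_range[of "(q, a)"] by (simp add: \<mu>_def j_def of_nat_diff)
      then show ?thesis by (simp add: G_def)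
    qed
    finally show ?thesis by (simp add: j_def)
  qed
  have "(\<Sum>q\<in>block i. \<Sum>a | a < q \<and> coprime a q.
      norm (\<Sum>k=1..n q. cis (2 * pi * (real k * (\<beta> + real a / real q)))) / real (n q))
      \<le> (\<Sum>q\<in>block i. \<Sum>a | a < q \<and> coprime a q. G (cell (q, a)))"
    by (intro sum_mono term_le)
  also have "\<dots> = (\<Sum>x\<in>X. G (cell x))"
    unfolding X_def by (subst sum.Sigma) auto
  also have "\<dots> = (\<Sum>j\<in>cell ` X. G j)" by (simp add: sum.reindex[OF inj])
  also have "\<dots> \<le> (\<Sum>j<J. G j)"
    by (rule sum_mono2) (use cell_range in \<open>auto simp: G_def\<close>)
  also have "\<dots> = dirichlet_mass i"
  proof -
    have 1: "(\<Sum>j<J. 5 / (1 + real j)) = 5 * harm J"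
      by (simp add: harm_altdef sum_distrib_left divide_inverse)
    have "(\<Sum>j<J. 5 / real (J - j)) = (\<Sum>j<J. 5 / (1 + real j))"
      by (rule sum.reindex_bij_witness[where i = "\<lambda>j. J - 1 - j" and j = "\<lambda>j. J - 1 - j"])
         (auto simp: of_nat_diff)
    then show ?thesis using 1 by (simp add: G_def sum.distrib dirichlet_mass_def J_def)
  qed
  finally show ?thesis .
qed

text \<open>
  By the exponential formula the Fourier multiplier of the average weighted by \<open>c\<^sub>q\<close> is a sum of
  kernels centred at the fractions \<open>a / q\<close>. As the sum over the whole block of their absolute
  values is bounded, so is the sum of their squares: summing over \<open>q\<close> costs nothing compared with
  a single \<open>q\<close>.
\<close>
lemma ramanujan_multiplier_bound:
  fixes \<beta> :: real and n :: "nat \<Rightarrow> nat"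
  assumes n: "\<And>q. q \<in> block i \<Longrightarrow> n q \<ge> 4 ^ i"
  shows "(\<Sum>q\<in>block i. (norm (\<Sum>k=1..n q. of_real (ramanujan q k / real (n q)) * cis (2 * pi * (real k * \<beta>))))\<^sup>2)
    \<le> (dirichlet_mass i)\<^sup>2"
proof -
  let ?P = "\<lambda>q. norm (\<Sum>k=1..n q. of_real (ramanujan q k / real (n q)) * cis (2 * pi * (real k * \<beta>)))"
  have P: "?P q \<le> (\<Sum>a | a < q \<and> coprime a q. norm (\<Sum>k=1..n q. cis (2 * pi * (real k * (\<beta> + real a / real q)))) / real (n q))"
    if q: "q \<in> block i" for q
  proof -
    have "(\<Sum>k=1..n q. of_real (ramanujan q k / real (n q)) * cis (2 * pi * (real k * \<beta>)))
        = (\<Sum>k=1..n q. \<Sum>a | a < q \<and> coprime a q. cis (2 * pi * (real k * (\<beta> + real a / real q))) / of_nat (n q))"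
    proof (rule sum.cong[OF refl])
      fix k
      show "of_real (ramanujan q k / real (n q)) * cis (2 * pi * (real k * \<beta>))
          = (\<Sum>a | a < q \<and> coprime a q. cis (2 * pi * (real k * (\<beta> + real a / real q))) / of_nat (n q))"
      proof -
        have c: "cis (2 * pi * (real k * (real a / real q))) * cis (2 * pi * (real k * \<beta>))
            = cis (2 * pi * (real k * (\<beta> + real a / real q)))" for a
          unfolding cis_mult by (simp add: algebra_simps)
        show ?thesis
          unfolding of_real_divide ramanujan_exponential_sum[OF block_pos[OF q]] of_real_of_nat_eq
            times_divide_eq_left sum_distrib_right sum_divide_distrib c ..
      qed
    qed
    also have "\<dots> = (\<Sum>a | a < q \<and> coprime a q. (\<Sum>k=1..n q. cis (2 * pi * (real k * (\<beta> + real a / real q)))) / of_nat (n q))"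
      by (subst sum.swap) (simp add: sum_divide_distrib)
    finally have "?P q = norm (\<Sum>a | a < q \<and> coprime a q. (\<Sum>k=1..n q. cis (2 * pi * (real k * (\<beta> + real a / real q)))) / of_nat (n q))" by simp
    also have "\<dots> \<le> (\<Sum>a | a < q \<and> coprime a q. norm ((\<Sum>k=1..n q. cis (2 * pi * (real k * (\<beta> + real a / real q)))) / of_nat (n q)))"
      by (rule norm_sum)
    finally show ?thesis by (simp add: norm_divide)
  qed
  have "(\<Sum>q\<in>block i. (?P q)\<^sup>2) \<le> (\<Sum>q\<in>block i. ?P q * (\<Sum>q\<in>block i. ?P q))"
    unfolding power2_eq_square by (intro sum_mono mult_left_mono member_le_sum) auto
  also have "\<dots> = (\<Sum>q\<in>block i. ?P q)\<^sup>2" by (simp add: sum_distrib_right power2_eq_square)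
  also have "\<dots> \<le> (dirichlet_mass i)\<^sup>2"
  proof (intro power_mono sum_nonneg)
    have "(\<Sum>q\<in>block i. ?P q) \<le> (\<Sum>q\<in>block i. \<Sum>a | a < q \<and> coprime a q.
        norm (\<Sum>k=1..n q. cis (2 * pi * (real k * (\<beta> + real a / real q)))) / real (n q))"
      by (intro sum_mono P)
    also have "\<dots> \<le> dirichlet_mass i" by (rule sum_kernels_over_fractions[OF n])
    finally show "(\<Sum>q\<in>block i. ?P q) \<le> dirichlet_mass i" .
  qed auto
  finally show ?thesis .
qed

section \<open>Parseval on a cyclic group and transference\<close>

definition dft :: "nat \<Rightarrow> (nat \<Rightarrow> real) \<Rightarrow> nat \<Rightarrow> complex" where
  "dft L F b = (\<Sum>l<L. of_real (F l) * cis (- 2 * pi * (real l * (real b / real L))))"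

lemma parseval_cyclic:
  assumes L: "L > 0"
  shows "(\<Sum>b<L. (norm (dft L F b))\<^sup>2) = real L * (\<Sum>l<L. (F l)\<^sup>2)"
proof -
  have "complex_of_real (\<Sum>b<L. (norm (dft L F b))\<^sup>2) = (\<Sum>b<L. dft L F b * cnj (dft L F b))"
    unfolding of_real_sum complex_norm_square ..
  also have "\<dots> = (\<Sum>b<L. \<Sum>l<L. \<Sum>m<L. of_real (F l * F m) * cis (2 * pi * (real b * of_int (int m - int l) / real L)))"
  proof (rule sum.cong[OF refl])
    fix b
    have "dft L F b * cnj (dft L F b) = (\<Sum>l<L. \<Sum>m<L.
        (of_real (F l) * cis (- 2 * pi * (real l * (real b / real L)))) *
        (of_real (F m) * cis (2 * pi * (real m * (real b / real L)))))"
      unfolding dft_def cnj_sum sum_product by (simp add: cis_cnj)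
    also have "\<dots> = (\<Sum>l<L. \<Sum>m<L. of_real (F l * F m) * cis (2 * pi * (real b * of_int (int m - int l) / real L)))"
    proof (intro sum.cong refl)
      fix l m
      have c: "cis (- 2 * pi * (real l * (real b / real L))) * cis (2 * pi * (real m * (real b / real L)))
          = cis (2 * pi * (real b * of_int (int m - int l) / real L))"
        unfolding cis_mult by (rule arg_cong[where f = cis]) (simp add: diff_divide_distrib algebra_simps)
      show "(of_real (F l) * cis (- 2 * pi * (real l * (real b / real L)))) *
          (of_real (F m) * cis (2 * pi * (real m * (real b / real L))))
        = of_real (F l * F m) * cis (2 * pi * (real b * of_int (int m - int l) / real L))"
        unfolding c[symmetric] of_real_mult by (simp only: mult_ac)
    qed
    finally show "dft L F b * cnj (dft L F b) = \<dots>" .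
  qed
  also have "\<dots> = (\<Sum>l<L. \<Sum>m<L. \<Sum>b<L. of_real (F l * F m) * cis (2 * pi * (real b * of_int (int m - int l) / real L)))"
    by (subst sum.swap, rule sum.cong[OF refl], rule sum.swap)
  also have "\<dots> = (\<Sum>l<L. \<Sum>m<L. if m = l then of_real (F l * F l) * of_nat L else 0)"
  proof (intro sum.cong refl)
    fix l m assume lm: "l \<in> {..<L}" "m \<in> {..<L}"
    have dvd: "int L dvd int m - int l \<longleftrightarrow> m = l"
    proof
      assume "int L dvd int m - int l"
      moreover have "\<bar>int m - int l\<bar> < int L" using lm by auto
      ultimately have "int m - int l = 0" using dvd_imp_le_int[of "int m - int l" "int L"] by fastforce
      then show "m = l" by simp
    qed simp
    show "(\<Sum>b<L. of_real (F l * F m) * cis (2 * pi * (real b * of_int (int m - int l) / real L)))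
        = (if m = l then of_real (F l * F l) * of_nat L else 0)"
      unfolding sum_distrib_left[symmetric] sum_roots_of_unity[OF L] dvd by simp
  qed
  also have "\<dots> = (\<Sum>l<L. of_real (F l * F l) * of_nat L)" by (simp add: sum.delta)
  also have "\<dots> = complex_of_real (real L * (\<Sum>l<L. (F l)\<^sup>2))"
    by (simp add: sum_distrib_left power2_eq_square mult_ac)
  finally show ?thesis by (simp only: of_real_eq_iff)
qed

lemma sum_shift_periodic:
  fixes h :: "nat \<Rightarrow> 'b::ab_group_add"
  assumes "\<And>l. h (l + L) = h l"
  shows "(\<Sum>l<L. h (l + k)) = (\<Sum>l<L. h l)"
proof (induction k)
  case (Suc k)
  have "(\<Sum>l<L. h (l + Suc k)) = (\<Sum>l<Suc L. h (l + k)) - h k"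
    by (subst sum.lessThan_Suc_shift) simp
  also have "\<dots> = (\<Sum>l<L. h (l + k))" using assms[of k] by (simp add: add.commute)
  finally show ?case using Suc by simp
qed simp

text \<open>
  On periodic functions a weighted sum over translates is a convolution, which the transform turns
  into multiplication by its symbol.
\<close>
lemma dft_multiplier:
  assumes L: "L > 0" and per: "\<And>l. F (l + L) = F l"
  shows "dft L (\<lambda>l. \<Sum>k=1..n. p k * F (l + k)) b
    = (\<Sum>k=1..n. of_real (p k) * cis (2 * pi * (real k * (real b / real L)))) * dft L F b"
proof -
  let ?e = "\<lambda>l::nat. cis (- 2 * pi * (real l * (real b / real L)))"
  have eper: "?e (l + L) = ?e l" for l
  proof -
    have "?e (l + L) = ?e l * cis (2 * pi * of_int (- int b))"
      unfolding cis_mult using L by (intro arg_cong[where f = cis]) (simp add: field_simps)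
    then show ?thesis by (simp only: cis_two_pi_int) simp
  qed
  have shift: "(\<Sum>l<L. of_real (F (l + k)) * ?e (l + k)) = dft L F b" for k
    unfolding dft_def by (rule sum_shift_periodic) (simp only: per eper)
  have e: "?e l = cis (2 * pi * (real k * (real b / real L))) * ?e (l + k)" for l k
    unfolding cis_mult by (rule arg_cong[where f = cis]) (simp add: algebra_simps add_divide_distrib)
  have "dft L (\<lambda>l. \<Sum>k=1..n. p k * F (l + k)) b = (\<Sum>l<L. \<Sum>k=1..n. of_real (p k * F (l + k)) * ?e l)"
    by (simp add: dft_def sum_distrib_right)
  also have "\<dots> = (\<Sum>k=1..n. \<Sum>l<L. of_real (p k * F (l + k)) * ?e l)" by (rule sum.swap)
  also have "\<dots> = (\<Sum>k=1..n. of_real (p k) * cis (2 * pi * (real k * (real b / real L))) * dft L F b)"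
  proof (rule sum.cong[OF refl])
    fix k
    have "(\<Sum>l<L. of_real (p k * F (l + k)) * ?e l)
        = (\<Sum>l<L. (of_real (p k) * cis (2 * pi * (real k * (real b / real L)))) * (of_real (F (l + k)) * ?e (l + k)))"
      by (intro sum.cong refl, subst e[of _ k]) (simp add: mult_ac)
    also have "\<dots> = of_real (p k) * cis (2 * pi * (real k * (real b / real L))) * dft L F b"
      unfolding sum_distrib_left[symmetric] shift ..
    finally show "(\<Sum>l<L. of_real (p k * F (l + k)) * ?e l) = \<dots>" .
  qed
  finally show ?thesis by (simp add: sum_distrib_right)
qed

lemma cyclic_multiplier_bound:
  fixes p :: "'i \<Rightarrow> nat \<Rightarrow> real" and n :: "'i \<Rightarrow> nat"
  assumes L: "L > 0" and per: "\<And>l. F (l + L) = F l"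
    and bound: "\<And>\<beta>::real. (\<Sum>i\<in>I. (norm (\<Sum>k=1..n i. of_real (p i k) * cis (2 * pi * (real k * \<beta>))))\<^sup>2) \<le> B"
  shows "(\<Sum>i\<in>I. \<Sum>l<L. (\<Sum>k=1..n i. p i k * F (l + k))\<^sup>2) \<le> B * (\<Sum>l<L. (F l)\<^sup>2)"
proof -
  let ?P = "\<lambda>i \<beta>. norm (\<Sum>k=1..n i. of_real (p i k) * cis (2 * pi * (real k * \<beta>)))"
  have "real L * (\<Sum>i\<in>I. \<Sum>l<L. (\<Sum>k=1..n i. p i k * F (l + k))\<^sup>2)
      = (\<Sum>i\<in>I. \<Sum>b<L. (norm (dft L (\<lambda>l. \<Sum>k=1..n i. p i k * F (l + k)) b))\<^sup>2)"
    by (simp only: sum_distrib_left[of "real L" _ I] parseval_cyclic[OF L])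
  also have "\<dots> = (\<Sum>i\<in>I. \<Sum>b<L. (?P i (real b / real L))\<^sup>2 * (norm (dft L F b))\<^sup>2)"
    by (simp only: dft_multiplier[where F = F, OF L per] norm_mult power_mult_distrib)
  also have "\<dots> = (\<Sum>b<L. (\<Sum>i\<in>I. (?P i (real b / real L))\<^sup>2) * (norm (dft L F b))\<^sup>2)"
    by (subst sum.swap) (simp only: sum_distrib_right)
  also have "\<dots> \<le> (\<Sum>b<L. B * (norm (dft L F b))\<^sup>2)"
    by (intro sum_mono mult_right_mono bound) simp
  also have "\<dots> = B * (real L * (\<Sum>l<L. (F l)\<^sup>2))"
    by (simp only: sum_distrib_left[symmetric] parseval_cyclic[OF L])
  finally have "real L * (\<Sum>i\<in>I. \<Sum>l<L. (\<Sum>k=1..n i. p i k * F (l + k))\<^sup>2) \<le> real L * (B * (\<Sum>l<L. (F l)\<^sup>2))"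
    by (simp only: mult_ac)
  then show ?thesis using L by simp
qed

text \<open>
  Calderon's transference. The values of \<open>f\<close> along an orbit segment of length \<open>(K + 1) * N\<close>, where
  \<open>N\<close> bounds all the \<open>n i\<close>, are read as a function on a cyclic group. For the starting points
  \<open>l < K * N\<close> no sum wraps around, so the cyclic inequality applies to them; integrating, with
  invariance of the measure, and letting \<open>K\<close> tend to infinity removes the factor \<open>(K + 1) / K\<close>.
\<close>
lemma multiplier_transference:
  fixes p :: "'i \<Rightarrow> nat \<Rightarrow> real" and n :: "'i \<Rightarrow> nat" and f :: "'a \<Rightarrow> real"
  assumes ds: "dynamical_system M \<tau>" and fm[measurable]: "f \<in> borel_measurable M" and I: "finite I"
    and bound: "\<And>\<beta>::real. (\<Sum>i\<in>I. (norm (\<Sum>k=1..n i. of_real (p i k) * cis (2 * pi * (real k * \<beta>))))\<^sup>2) \<le> B"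
    and B: "B > 0"
  shows "(\<Sum>i\<in>I. \<integral>\<^sup>+x. ennreal ((\<Sum>k=1..n i. p i k * f ((\<tau> ^^ k) x))\<^sup>2) \<partial>M) \<le> ennreal B * (\<integral>\<^sup>+x. ennreal ((f x)\<^sup>2) \<partial>M)"
proof -
  have [measurable]: "\<tau> ^^ k \<in> measurable M M" for k by (rule dynamical_system_funpow_measurable[OF ds])
  obtain N where N: "N \<ge> 1" "\<And>i. i \<in> I \<Longrightarrow> n i \<le> N"
  proof
    show "Suc (\<Sum>i\<in>I. n i) \<ge> 1" by simp
    show "n i \<le> Suc (\<Sum>i\<in>I. n i)" if "i \<in> I" for i
      using member_le_sum[of i I n] I that by simp
  qed
  define g where "g i x = (\<Sum>k=1..n i. p i k * f ((\<tau> ^^ k) x))\<^sup>2" for i x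
  have [measurable]: "g i \<in> borel_measurable M" for i unfolding g_def by measurable
  define X where "X = (\<Sum>i\<in>I. \<integral>\<^sup>+x. ennreal (g i x) \<partial>M)"
  define A where "A = (\<integral>\<^sup>+x. ennreal ((f x)\<^sup>2) \<partial>M)"
  have pt: "(\<Sum>i\<in>I. \<Sum>l<K * N. g i ((\<tau> ^^ l) x)) \<le> B * (\<Sum>l<(K + 1) * N. (f ((\<tau> ^^ l) x))\<^sup>2)" for K x
  proof -
    define L where "L = (K + 1) * N"
    have L: "L > 0" using N(1) by (simp add: L_def)
    \<comment> \<open>The orbit segment, continued periodically.\<close>
    define F where "F l = f ((\<tau> ^^ (l mod L)) x)" for l
    have "(\<Sum>i\<in>I. \<Sum>l<K * N. g i ((\<tau> ^^ l) x)) = (\<Sum>i\<in>I. \<Sum>l<K * N. (\<Sum>k=1..n i. p i k * F (l + k))\<^sup>2)"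
    proof (intro sum.cong refl)
      fix i l assume i: "i \<in> I" and l: "l \<in> {..<K * N}"
      have "(\<Sum>k=1..n i. p i k * f ((\<tau> ^^ k) ((\<tau> ^^ l) x))) = (\<Sum>k=1..n i. p i k * F (l + k))"
      proof (rule sum.cong[OF refl])
        fix k assume "k \<in> {1..n i}"
        then have "l + k < L" using l N(2)[OF i] by (simp add: L_def)
        then show "p i k * f ((\<tau> ^^ k) ((\<tau> ^^ l) x)) = p i k * F (l + k)"
          by (simp add: F_def funpow_add[symmetric] add.commute flip: o_apply[of "\<tau> ^^ k"])
      qed
      then show "g i ((\<tau> ^^ l) x) = (\<Sum>k=1..n i. p i k * F (l + k))\<^sup>2" by (simp add: g_def)
    qed
    also have "\<dots> \<le> (\<Sum>i\<in>I. \<Sum>l<L. (\<Sum>k=1..n i. p i k * F (l + k))\<^sup>2)"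
      by (intro sum_mono sum_mono2) (auto simp: L_def)
    also have "\<dots> \<le> B * (\<Sum>l<L. (F l)\<^sup>2)"
      by (rule cyclic_multiplier_bound[OF L _ bound]) (simp add: F_def)
    also have "(\<Sum>l<L. (F l)\<^sup>2) = (\<Sum>l<L. (f ((\<tau> ^^ l) x))\<^sup>2)"
      by (rule sum.cong) (auto simp: F_def)
    finally show ?thesis by (simp add: L_def)
  qed
  have inv: "(\<integral>\<^sup>+x. ennreal ((f ((\<tau> ^^ l) x))\<^sup>2) \<partial>M) = A" for l
    unfolding A_def by (rule nn_integral_funpow[OF ds, where g = "\<lambda>x. ennreal ((f x)\<^sup>2)"]) measurable
  have int: "of_nat (K * N) * X \<le> ennreal B * (of_nat ((K + 1) * N) * A)" for K
  proof -
    have "of_nat (K * N) * X = (\<Sum>i\<in>I. \<Sum>l<K * N. \<integral>\<^sup>+x. ennreal (g i ((\<tau> ^^ l) x)) \<partial>M)"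
      unfolding X_def sum_distrib_left
      by (intro sum.cong refl) (simp add: nn_integral_funpow[OF ds, where g = "\<lambda>x. ennreal (g _ x)"])
    also have "\<dots> = (\<integral>\<^sup>+x. (\<Sum>i\<in>I. \<Sum>l<K * N. ennreal (g i ((\<tau> ^^ l) x))) \<partial>M)"
      by (simp add: nn_integral_sum)
    also have "\<dots> = (\<integral>\<^sup>+x. ennreal (\<Sum>i\<in>I. \<Sum>l<K * N. g i ((\<tau> ^^ l) x)) \<partial>M)"
      by (intro nn_integral_cong) (simp add: sum_ennreal sum_nonneg g_def)
    also have "\<dots> \<le> (\<integral>\<^sup>+x. ennreal (B * (\<Sum>l<(K + 1) * N. (f ((\<tau> ^^ l) x))\<^sup>2)) \<partial>M)"
      by (intro nn_integral_mono ennreal_leI pt)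
    also have "\<dots> = (\<integral>\<^sup>+x. ennreal B * (\<Sum>l<(K + 1) * N. ennreal ((f ((\<tau> ^^ l) x))\<^sup>2)) \<partial>M)"
      using B by (intro nn_integral_cong) (simp add: ennreal_mult sum_nonneg sum_ennreal)
    also have "\<dots> = ennreal B * (\<Sum>l<(K + 1) * N. \<integral>\<^sup>+x. ennreal ((f ((\<tau> ^^ l) x))\<^sup>2) \<partial>M)"
      by (subst nn_integral_cmult, measurable, subst nn_integral_sum) simp_all
    also have "\<dots> = ennreal B * (of_nat ((K + 1) * N) * A)"
      by (simp only: inv sum_constant card_lessThan)
    finally show ?thesis .
  qed
  have "X \<le> ennreal B * A"
  proof (cases "A = top")
    case True
    then show ?thesis using B by (simp add: ennreal_mult_top)
  next
    case False
    then obtain c where c: "c \<ge> 0" "A = ennreal c" by (cases A) auto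
    have rhs: "ennreal B * (of_nat ((K + 1) * N) * A) = ennreal (B * (real ((K + 1) * N) * c))" for K
      unfolding c(2) using B c(1) by (simp only: ennreal_mult ennreal_of_nat_eq_real_of_nat mult_nonneg_nonneg of_nat_0_le_iff less_imp_le)
    have "X \<noteq> top"
    proof
      assume "X = top"
      then have "of_nat (1 * N) * X = top" using N(1) by (simp add: ennreal_mult_top)
      then show False using int[of 1] unfolding rhs by (simp add: top_unique)
    qed
    then obtain y where y: "y \<ge> 0" "X = ennreal y" by (cases X) auto
    have "y \<le> B * c * (1 + 1 / real K)" if "K \<ge> 1" for K
    proof -
      have "ennreal (real (K * N) * y) \<le> ennreal (B * (real ((K + 1) * N) * c))"
        using int[of K] unfolding rhs unfolding y(2) using y(1)
        by (simp only: ennreal_mult ennreal_of_nat_eq_real_of_nat of_nat_0_le_iff)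
      then have "real (K * N) * y \<le> B * (real ((K + 1) * N) * c)"
        using B c(1) by (subst (asm) ennreal_le_iff) auto
      then have "real N * (real K * y) \<le> real N * (B * c * (real K + 1))"
        by (simp add: algebra_simps)
      then have "real K * y \<le> B * c * (real K + 1)" using N(1) by (simp only: mult_le_cancel_left_pos of_nat_0_less_iff)
      then show ?thesis using that by (simp add: field_simps)
    qed
    then have "y \<le> B * c * (1 + 0)"
      by (intro LIMSEQ_le_const[OF tendsto_mult[OF tendsto_const tendsto_add[OF tendsto_const lim_1_over_n]]]) auto
    then show ?thesis using B c y by (simp flip: ennreal_mult)
  qed
  then show ?thesis by (simp add: X_def A_def g_def)
qed

section \<open>Averages weighted by Ramanujan sums\<close>

definition ramanujan_avg :: "('a \<Rightarrow> 'a) \<Rightarrow> ('a \<Rightarrow> real) \<Rightarrow> nat \<Rightarrow> nat \<Rightarrow> 'a \<Rightarrow> real" where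
  "ramanujan_avg \<tau> f q n x = (\<Sum>k=1..n. ramanujan q k * f ((\<tau> ^^ k) x)) / real n"

lemma measurable_ramanujan_avg:
  assumes "dynamical_system M \<tau>" and [measurable]: "f \<in> borel_measurable M"
  shows "ramanujan_avg \<tau> f q n \<in> borel_measurable M"
proof -
  have [measurable]: "\<tau> ^^ k \<in> measurable M M" for k by (rule dynamical_system_funpow_measurable[OF assms(1)])
  show ?thesis unfolding ramanujan_avg_def by measurable
qed

lemma dirichlet_mass_pos: "dirichlet_mass i > 0"
  by (simp add: dirichlet_mass_def)

lemma ramanujan_avg_L2:
  assumes ds: "dynamical_system M \<tau>" and fm: "f \<in> borel_measurable M"
    and n: "\<And>q. q \<in> block i \<Longrightarrow> n q \<ge> 4 ^ i"
  shows "(\<Sum>q\<in>block i. \<integral>\<^sup>+x. ennreal ((ramanujan_avg \<tau> f q (n q) x)\<^sup>2) \<partial>M)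
    \<le> ennreal ((dirichlet_mass i)\<^sup>2) * (\<integral>\<^sup>+x. ennreal ((f x)\<^sup>2) \<partial>M)"
proof -
  have "ramanujan_avg \<tau> f q (n q) x = (\<Sum>k=1..n q. ramanujan q k / real (n q) * f ((\<tau> ^^ k) x))" for q x
    by (simp add: ramanujan_avg_def sum_divide_distrib)
  then show ?thesis
    using multiplier_transference[OF ds fm finite_block ramanujan_multiplier_bound[OF n]] dirichlet_mass_pos[of i]
    by simp
qed

text \<open>
  Times with at most \<open>h + 1\<close> significant binary digits. There are at most \<open>2 ^ Suc h * (J + 1)\<close> of
  them up to \<open>2 ^ J\<close>, so a maximum over such times can be estimated by a sum; on the other hand
  every time is approximated by one of them with relative error \<open>1 / 2 ^ h\<close>. For \<open>h = 0\<close> these are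
  the powers of 2 and 0.
\<close>
definition scales :: "nat \<Rightarrow> nat set" where
  "scales h = {a * 2 ^ j | a j. a < 2 ^ Suc h}"

lemma scales_card: "finite (scales h \<inter> {1..2 ^ J})" "card (scales h \<inter> {1..2 ^ J}) \<le> 2 ^ Suc h * (J + 1)"
proof -
  have sub: "scales h \<inter> {1..2 ^ J} \<subseteq> (\<lambda>(a, j). a * 2 ^ j) ` ({..<2 ^ Suc h} \<times> {..J})"
  proof
    fix n assume n: "n \<in> scales h \<inter> {1..2 ^ J}"
    then obtain a j where aj: "n = a * 2 ^ j" "a < 2 ^ Suc h" by (auto simp: scales_def)
    have "a \<noteq> 0" using n aj(1) by auto
    then have "2 ^ j \<le> n" using aj(1) by (cases a) auto
    moreover have "n \<le> 2 ^ J" using n by simp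
    ultimately have "(2::nat) ^ j \<le> 2 ^ J" by (rule le_trans)
    then have "j \<le> J" by simp
    then show "n \<in> (\<lambda>(a, j). a * 2 ^ j) ` ({..<2 ^ Suc h} \<times> {..J})" using aj by (intro image_eqI[of _ _ "(a, j)"]) auto
  qed
  show "finite (scales h \<inter> {1..2 ^ J})" by simp
  have "card (scales h \<inter> {1..2 ^ J}) \<le> card ((\<lambda>(a, j). a * 2 ^ j) ` ({..<(2::nat) ^ Suc h} \<times> {..J}))"
    by (rule card_mono[OF _ sub]) simp
  also have "\<dots> \<le> card ({..<(2::nat) ^ Suc h} \<times> {..J})" by (rule card_image_le) simp
  also have "\<dots> = 2 ^ Suc h * (J + 1)" by (simp add: card_cartesian_product)
  finally show "card (scales h \<inter> {1..2 ^ J}) \<le> 2 ^ Suc h * (J + 1)" .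
qed

text \<open>
  The times start at \<open>4 ^ i\<close>, the square of the size of \<open>q\<close> in block \<open>i\<close>: after the hyperbola
  method only \<open>q \<le> sqrt n\<close> occur.
\<close>
definition ramanujan_max :: "('a \<Rightarrow> 'a) \<Rightarrow> ('a \<Rightarrow> real) \<Rightarrow> nat \<Rightarrow> nat \<Rightarrow> nat \<Rightarrow> 'a \<Rightarrow> ennreal" where
  "ramanujan_max \<tau> f h i q x = (SUP n\<in>{n\<in>scales h. 4 ^ i \<le> n}. ennreal \<bar>ramanujan_avg \<tau> f q n x\<bar>)"

definition block_max :: "('a \<Rightarrow> 'a) \<Rightarrow> ('a \<Rightarrow> real) \<Rightarrow> nat \<Rightarrow> nat \<Rightarrow> 'a \<Rightarrow> ennreal" where
  "block_max \<tau> f h i x = (\<Sum>q\<in>block i. ennreal (1 / real q) * ramanujan_max \<tau> f h i q x)"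

lemma measurable_ramanujan_max:
  assumes "dynamical_system M \<tau>" "f \<in> borel_measurable M"
  shows "ramanujan_max \<tau> f h i q \<in> borel_measurable M"
proof -
  have [measurable]: "ramanujan_avg \<tau> f q n \<in> borel_measurable M" for n by (rule measurable_ramanujan_avg[OF assms])
  show ?thesis unfolding ramanujan_max_def by (rule borel_measurable_SUP) auto
qed

lemma measurable_block_max:
  assumes "dynamical_system M \<tau>" "f \<in> borel_measurable M"
  shows "block_max \<tau> f h i \<in> borel_measurable M"
proof -
  have [measurable]: "ramanujan_max \<tau> f h i q \<in> borel_measurable M" for q by (rule measurable_ramanujan_max[OF assms])
  show ?thesis unfolding block_max_def by measurable
qed

lemma SUP_power2_le:
  fixes a :: "'b \<Rightarrow> ennreal"
  assumes "\<And>n. n \<in> A \<Longrightarrow> (a n)\<^sup>2 \<le> c"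
  shows "(SUP n\<in>A. a n)\<^sup>2 \<le> c"
proof (cases c)
  case (real r)
  have "a n \<le> ennreal (sqrt r)" if "n \<in> A" for n
  proof (cases "a n")
    case (real s)
    then have "s\<^sup>2 \<le> r" using assms[OF that] \<open>c = ennreal r\<close> \<open>0 \<le> r\<close> by (simp add: ennreal_power)
    then show ?thesis using real real_le_rsqrt by (simp add: ennreal_leI)
  next
    case top
    then show ?thesis using assms[OF that] \<open>c = ennreal r\<close> by (simp add: top_unique)
  qed
  then have "(SUP n\<in>A. a n)\<^sup>2 \<le> (ennreal (sqrt r))\<^sup>2" by (intro power_mono SUP_least) auto
  then show ?thesis using real by (simp add: ennreal_power)
qed simp

lemma ennreal_sum_power2_le:
  fixes y :: "'b \<Rightarrow> ennreal"
  assumes "finite A"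
  shows "(\<Sum>q\<in>A. y q)\<^sup>2 \<le> of_nat (card A) * (\<Sum>q\<in>A. (y q)\<^sup>2)"
proof (cases "\<exists>q\<in>A. y q = top")
  case True
  then obtain q where q: "q \<in> A" "y q = top" by blast
  then have "(\<Sum>q\<in>A. (y q)\<^sup>2) = top"
    using assms by (subst sum.remove[of _ q]) auto
  moreover have "card A \<noteq> 0" using q assms by auto
  ultimately show ?thesis by (simp add: ennreal_mult_top)
next
  case False
  define z where "z q = enn2real (y q)" for q
  have y: "y q = ennreal (z q)" if "q \<in> A" for q using False that by (simp add: z_def less_top)
  have z: "z q \<ge> 0" for q by (simp add: z_def)
  have "(\<Sum>q\<in>A. y q) = (\<Sum>q\<in>A. ennreal (z q))" by (rule sum.cong[OF refl y])
  also have "\<dots> = ennreal (\<Sum>q\<in>A. z q)" by (rule sum_ennreal) (rule z)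
  finally have "(\<Sum>q\<in>A. y q)\<^sup>2 = ennreal ((\<Sum>q\<in>A. z q)\<^sup>2)"
    by (simp only: ennreal_power[OF sum_nonneg[OF z]])
  also have "\<dots> \<le> ennreal (real (card A) * (\<Sum>q\<in>A. (z q)\<^sup>2))"
    using sum_squared_le_sum_of_squares[of z A] by (intro ennreal_leI) (simp only: mult.commute)
  also have "\<dots> = of_nat (card A) * ennreal (\<Sum>q\<in>A. (z q)\<^sup>2)"
    by (simp add: ennreal_mult sum_nonneg ennreal_of_nat_eq_real_of_nat)
  also have "ennreal (\<Sum>q\<in>A. (z q)\<^sup>2) = (\<Sum>q\<in>A. ennreal ((z q)\<^sup>2))"
    by (rule sum_ennreal[symmetric]) simp
  also have "\<dots> = (\<Sum>q\<in>A. (y q)\<^sup>2)"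
    by (rule sum.cong[OF refl]) (simp only: y ennreal_power[OF z])
  finally show ?thesis .
qed

lemma sum_blocks:
  fixes u :: "nat \<Rightarrow> real"
  shows "(\<Sum>k=1..m * N. u k) = (\<Sum>j<m. \<Sum>k=1..N. u (k + j * N))"
proof (induction m)
  case (Suc m)
  have "(\<Sum>k=1..Suc m * N. u k) = (\<Sum>k=1..m * N + N. u k)" by (simp add: add.commute)
  also have "\<dots> = (\<Sum>k=1..m * N. u k) + (\<Sum>k=m * N + 1..m * N + N. u k)"
    by (rule sum.ub_add_nat) simp
  also have "(\<Sum>k=m * N + 1..m * N + N. u k) = (\<Sum>k=1..N. u (k + m * N))"
    using sum.shift_bounds_cl_nat_ivl[of u 1 "m * N" N] by (simp add: add.commute)
  finally show ?case using Suc by simp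
qed simp

text \<open>
  Let \<open>N\<close> be a multiple of \<open>q\<close>. As \<open>c\<^sub>q\<close> has period \<open>q\<close>, the average up to \<open>n\<close> splits into the
  averages over \<open>m\<close> consecutive windows of length \<open>N\<close>, each of them the average of length \<open>N\<close> at a
  point of the orbit of \<open>\<tau> ^^ N\<close>. The incomplete last window is estimated trivially, with
  \<open>\<bar>c\<^sub>q\<bar> \<le> q\<close>.
\<close>
lemma ramanujan_avg_long:
  fixes f :: "'a \<Rightarrow> real"
  assumes q: "q > 0" and N: "N = q * c" "c > 0" and m: "m = n div N" "m \<ge> 1"
  shows "\<bar>ramanujan_avg \<tau> f q n x\<bar>
    \<le> (\<Sum>j<m. \<bar>ramanujan_avg \<tau> f q N (((\<tau> ^^ N) ^^ j) x)\<bar>) / real m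
      + real q / (real m * real N) * (\<Sum>k=m * N + 1..m * N + N. \<bar>f ((\<tau> ^^ k) x)\<bar>)"
proof -
  have N0: "N > 0" using q N by simp
  define u where "u k = ramanujan q k * f ((\<tau> ^^ k) x)" for k
  have n: "n = m * N + n mod N" using m(1) by simp
  have mN: "m * N > 0" "m * N \<le> n" using m(2) N0 n by (simp, linarith)
  have "(\<Sum>k=1..n. u k) = (\<Sum>k=1..m * N. u k) + (\<Sum>k=m * N + 1..m * N + n mod N. u k)"
    by (subst n, rule sum.ub_add_nat) simp
  also have "\<bar>\<dots>\<bar> \<le> \<bar>\<Sum>k=1..m * N. u k\<bar> + \<bar>\<Sum>k=m * N + 1..m * N + n mod N. u k\<bar>" by (rule abs_triangle_ineq)
  also have "\<bar>\<Sum>k=1..m * N. u k\<bar> \<le> real N * (\<Sum>j<m. \<bar>ramanujan_avg \<tau> f q N (((\<tau> ^^ N) ^^ j) x)\<bar>)"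
  proof -
    have "(\<Sum>k=1..N. u (k + j * N)) = real N * ramanujan_avg \<tau> f q N (((\<tau> ^^ N) ^^ j) x)" for j
    proof -
      have "u (k + j * N) = ramanujan q k * f ((\<tau> ^^ k) (((\<tau> ^^ N) ^^ j) x))" for k
      proof -
        have "ramanujan q (k + j * N) = ramanujan q k"
          using ramanujan_periodic[of q k "c * j"] by (simp add: N(1) mult_ac)
        moreover have "(\<tau> ^^ (k + j * N)) x = (\<tau> ^^ k) (((\<tau> ^^ N) ^^ j) x)"
          by (simp add: funpow_add funpow_mult_apply mult.commute)
        ultimately show ?thesis by (simp add: u_def)
      qed
      then show ?thesis using N0 by (simp add: ramanujan_avg_def)
    qed
    then have "\<bar>\<Sum>k=1..m * N. u k\<bar> = \<bar>\<Sum>j<m. real N * ramanujan_avg \<tau> f q N (((\<tau> ^^ N) ^^ j) x)\<bar>"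
      unfolding sum_blocks by simp
    also have "\<dots> \<le> (\<Sum>j<m. \<bar>real N * ramanujan_avg \<tau> f q N (((\<tau> ^^ N) ^^ j) x)\<bar>)" by (rule sum_abs)
    finally show ?thesis by (simp add: abs_mult sum_distrib_left)
  qed
  also have "\<bar>\<Sum>k=m * N + 1..m * N + n mod N. u k\<bar> \<le> real q * (\<Sum>k=m * N + 1..m * N + N. \<bar>f ((\<tau> ^^ k) x)\<bar>)"
  proof -
    have "\<bar>\<Sum>k=m * N + 1..m * N + n mod N. u k\<bar> \<le> (\<Sum>k=m * N + 1..m * N + n mod N. real q * \<bar>f ((\<tau> ^^ k) x)\<bar>)"
      unfolding u_def abs_mult
      by (intro order_trans[OF sum_abs] sum_mono) (use abs_ramanujan_le[OF q] in \<open>auto simp: abs_mult intro!: mult_right_mono\<close>)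
    also have "\<dots> \<le> (\<Sum>k=m * N + 1..m * N + N. real q * \<bar>f ((\<tau> ^^ k) x)\<bar>)"
      by (rule sum_mono2) (use mod_less_divisor[OF N0, of n] in auto)
    finally show ?thesis by (simp add: sum_distrib_left)
  qed
  finally have "\<bar>\<Sum>k=1..n. u k\<bar> \<le> real N * (\<Sum>j<m. \<bar>ramanujan_avg \<tau> f q N (((\<tau> ^^ N) ^^ j) x)\<bar>)
      + real q * (\<Sum>k=m * N + 1..m * N + N. \<bar>f ((\<tau> ^^ k) x)\<bar>)" (is "_ \<le> ?A") by simp
  moreover have A: "?A \<ge> 0" by (intro add_nonneg_nonneg mult_nonneg_nonneg sum_nonneg) auto
  ultimately have "\<bar>\<Sum>k=1..n. u k\<bar> / real n \<le> ?A / (real m * real N)"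
  proof (intro frac_le)
    show "0 < real m * real N" using mN(1) by (simp flip: of_nat_mult)
    show "real m * real N \<le> real n" using mN(2) by (simp flip: of_nat_mult)
  qed
  also have "\<dots> = (\<Sum>j<m. \<bar>ramanujan_avg \<tau> f q N (((\<tau> ^^ N) ^^ j) x)\<bar>) / real m
      + real q / (real m * real N) * (\<Sum>k=m * N + 1..m * N + N. \<bar>f ((\<tau> ^^ k) x)\<bar>)"
    using N0 m(2) by (simp add: add_divide_distrib)
  finally show ?thesis by (simp add: ramanujan_avg_def u_def)
qed

lemma initial_average_le:
  assumes G: "\<And>x. G x \<ge> 0" and m: "m \<ge> 1"
  shows "ennreal ((\<Sum>j<m. G ((\<sigma> ^^ j) x)) / real m) \<le> ennreal (G x) + weighted_max (\<lambda>_. 1) \<sigma> G x"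
proof -
  have "(\<Sum>j<m. G ((\<sigma> ^^ j) x)) \<le> (\<Sum>j<Suc m. G ((\<sigma> ^^ j) x))" using G by simp
  also have "\<dots> = G x + (\<Sum>j=1..m. G ((\<sigma> ^^ j) x))"
    by (simp add: lessThan_Suc_atMost atMost_atLeast0 sum.atLeast_Suc_atMost)
  also have "\<dots> \<le> real m * G x + (\<Sum>j=1..m. G ((\<sigma> ^^ j) x))"
    using G[of x] m by (simp add: mult_le_cancel_right1)
  finally have "(\<Sum>j<m. G ((\<sigma> ^^ j) x)) / real m \<le> G x + (\<Sum>k=1..m. 1 * G ((\<sigma> ^^ k) x)) / weight_sum (\<lambda>_. 1) m"
    using m by (simp add: weight_sum_one field_simps)
  then have "ennreal ((\<Sum>j<m. G ((\<sigma> ^^ j) x)) / real m)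
      \<le> ennreal (G x + (\<Sum>k=1..m. 1 * G ((\<sigma> ^^ k) x)) / weight_sum (\<lambda>_. 1) m)" by (rule ennreal_leI)
  also have "\<dots> = ennreal (G x) + ennreal ((\<Sum>k=1..m. 1 * G ((\<sigma> ^^ k) x)) / weight_sum (\<lambda>_. 1) m)"
    using G by (intro ennreal_plus) (auto simp: weight_sum_one sum_nonneg)
  also have "\<dots> \<le> ennreal (G x) + weighted_max (\<lambda>_. 1) \<sigma> G x"
    unfolding weighted_max_def using m by (intro add_left_mono SUP_upper) auto
  finally show ?thesis .
qed

lemma ennreal_power2_add3:
  fixes a b c :: ennreal
  shows "(a + b + c)\<^sup>2 \<le> 3 * (a\<^sup>2 + b\<^sup>2 + c\<^sup>2)"
proof -
  define y where "y i = (if i = 0 then a else if i = 1 then b else c)" for i :: nat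
  have "(\<Sum>i\<in>{0,1,2}. y i)\<^sup>2 \<le> of_nat (card {0,1,2::nat}) * (\<Sum>i\<in>{0,1,2}. (y i)\<^sup>2)"
    by (rule ennreal_sum_power2_le) simp
  then show ?thesis by (simp add: y_def add.assoc)
qed

lemma ennreal_powr_two: "ennreal_powr y 2 = y\<^sup>2"
  by (cases y) (auto simp: ennreal_powr_def ennreal_power)

lemma admissible_one: "admissible_weight (\<lambda>_. 1)"
proof -
  have "weight_sum (\<lambda>_. 1) = real" by (rule ext) (rule weight_sum_one)
  then show ?thesis unfolding admissible_weight_def using filterlim_real_sequentially by simp
qed

lemma maximal_average_L2:
  assumes ds: "dynamical_system M \<sigma>" and G: "G \<in> borel_measurable M" "\<And>x. G x \<ge> 0"
  shows "(\<integral>\<^sup>+x. (weighted_max (\<lambda>_. 1) \<sigma> G x)\<^sup>2 \<partial>M) \<le> 8 * (\<integral>\<^sup>+x. ennreal ((G x)\<^sup>2) \<partial>M)"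
proof -
  have "(\<integral>\<^sup>+x. ennreal_powr (weighted_max (\<lambda>_. 1) \<sigma> G x) 2 \<partial>M)
      \<le> ennreal (1 * 2 powr 2 * 2 / (2 - 1)) * (\<integral>\<^sup>+x. ennreal (G x powr 2) \<partial>M)"
    by (rule weak_type_imp_strong_type[OF weak_type_one admissible_one]) (use ds G in auto)
  then show ?thesis using G(2) by (simp add: ennreal_powr_two)
qed

text \<open>
  Cauchy-Schwarz over the \<open>N\<close> terms of the window; the factors \<open>N\<close> cancel. The square of \<open>m\<close> in
  the denominator makes the bound summable over \<open>m\<close>.
\<close>
lemma edge_term_L2:
  assumes ds: "dynamical_system M \<tau>" and [measurable]: "f \<in> borel_measurable M" and m: "m \<ge> 1" and N: "N \<ge> 1"
  shows "(\<integral>\<^sup>+x. ennreal ((real q / (real m * real N) * (\<Sum>k=m * N + 1..m * N + N. \<bar>f ((\<tau> ^^ k) x)\<bar>))\<^sup>2) \<partial>M)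
    \<le> ennreal ((real q)\<^sup>2 * (1 / (real m)\<^sup>2)) * (\<integral>\<^sup>+x. ennreal ((f x)\<^sup>2) \<partial>M)"
proof -
  have [measurable]: "\<tau> ^^ k \<in> measurable M M" for k by (rule dynamical_system_funpow_measurable[OF ds])
  define K where "K = (real q)\<^sup>2 / ((real m)\<^sup>2 * real N)"
  have K: "K \<ge> 0" by (simp add: K_def)
  have pt: "(real q / (real m * real N) * (\<Sum>k=m * N + 1..m * N + N. \<bar>f ((\<tau> ^^ k) x)\<bar>))\<^sup>2
      \<le> K * (\<Sum>k=m * N + 1..m * N + N. (f ((\<tau> ^^ k) x))\<^sup>2)" for x
  proof -
    have "(\<Sum>k=m * N + 1..m * N + N. \<bar>f ((\<tau> ^^ k) x)\<bar>)\<^sup>2 \<le> (\<Sum>k=m * N + 1..m * N + N. (f ((\<tau> ^^ k) x))\<^sup>2) * real N"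
      using sum_squared_le_sum_of_squares[of "\<lambda>k. \<bar>f ((\<tau> ^^ k) x)\<bar>" "{m * N + 1..m * N + N}"] by simp
    then have "(real q / (real m * real N))\<^sup>2 * (\<Sum>k=m * N + 1..m * N + N. \<bar>f ((\<tau> ^^ k) x)\<bar>)\<^sup>2
        \<le> (real q / (real m * real N))\<^sup>2 * ((\<Sum>k=m * N + 1..m * N + N. (f ((\<tau> ^^ k) x))\<^sup>2) * real N)"
      by (intro mult_left_mono) auto
    also have "\<dots> = ((real q / (real m * real N))\<^sup>2 * real N) * (\<Sum>k=m * N + 1..m * N + N. (f ((\<tau> ^^ k) x))\<^sup>2)"
      by (simp only: mult_ac)
    also have "(real q / (real m * real N))\<^sup>2 * real N = K"
      using m N by (simp add: K_def power2_eq_square)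
    finally show ?thesis unfolding power_mult_distrib .
  qed
  have inv: "(\<integral>\<^sup>+x. ennreal ((f ((\<tau> ^^ k) x))\<^sup>2) \<partial>M) = (\<integral>\<^sup>+x. ennreal ((f x)\<^sup>2) \<partial>M)" for k
    by (rule nn_integral_funpow[OF ds, where g = "\<lambda>x. ennreal ((f x)\<^sup>2)"]) measurable
  have "(\<integral>\<^sup>+x. ennreal ((real q / (real m * real N) * (\<Sum>k=m * N + 1..m * N + N. \<bar>f ((\<tau> ^^ k) x)\<bar>))\<^sup>2) \<partial>M)
      \<le> (\<integral>\<^sup>+x. ennreal (K * (\<Sum>k=m * N + 1..m * N + N. (f ((\<tau> ^^ k) x))\<^sup>2)) \<partial>M)"
    by (intro nn_integral_mono ennreal_leI pt)
  also have "\<dots> = (\<integral>\<^sup>+x. ennreal K * (\<Sum>k=m * N + 1..m * N + N. ennreal ((f ((\<tau> ^^ k) x))\<^sup>2)) \<partial>M)"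
    using K by (intro nn_integral_cong) (simp add: ennreal_mult sum_nonneg sum_ennreal)
  also have "\<dots> = ennreal K * (\<Sum>k=m * N + 1..m * N + N. (\<integral>\<^sup>+x. ennreal ((f x)\<^sup>2) \<partial>M))"
    by (subst nn_integral_cmult, measurable, subst nn_integral_sum) (simp_all only: inv, measurable)
  also have "\<dots> = ennreal K * (ennreal (real N) * (\<integral>\<^sup>+x. ennreal ((f x)\<^sup>2) \<partial>M))"
    by (simp add: ennreal_of_nat_eq_real_of_nat)
  also have "\<dots> = ennreal (K * real N) * (\<integral>\<^sup>+x. ennreal ((f x)\<^sup>2) \<partial>M)"
    by (rule ennreal_mult_mult) (use K in auto)
  also have "K * real N = (real q)\<^sup>2 * (1 / (real m)\<^sup>2)" using N by (simp add: K_def)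
  finally show ?thesis .
qed

lemma suminf_inverse_squares:
  assumes "m0 \<ge> 1"
  shows "(\<Sum>j. ennreal (1 / (real (m0 + j))\<^sup>2)) \<le> ennreal (2 / real m0)"
proof -
  have partial: "(\<Sum>j<n. 1 / (real (m0 + j))\<^sup>2) \<le> 2 / real m0 - 2 / real (m0 + n)" for n
  proof (induction n)
    case (Suc n)
    define m where "m = real (m0 + n)"
    have m: "m \<ge> 1" using assms by (simp add: m_def)
    have "m * 1 \<le> m * m" using m by (intro mult_left_mono) auto
    then have "m * (m + 1) \<le> 2 * m\<^sup>2" by (simp add: power2_eq_square distrib_left)
    then have "2 / (2 * m\<^sup>2) \<le> 2 / (m * (m + 1))" using m by (intro divide_left_mono mult_pos_pos) auto
    then have "1 / m\<^sup>2 \<le> 2 / (m * (m + 1))" by simp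
    also have "\<dots> = 2 / m - 2 / (m + 1)" using m by (simp add: field_simps)
    finally show ?case using Suc by (simp add: m_def add.commute)
  qed simp
  have "(\<Sum>j<n. ennreal (1 / (real (m0 + j))\<^sup>2)) \<le> ennreal (2 / real m0)" for n
  proof -
    have "(\<Sum>j<n. ennreal (1 / (real (m0 + j))\<^sup>2)) = ennreal (\<Sum>j<n. 1 / (real (m0 + j))\<^sup>2)"
      by (rule sum_ennreal) simp
    also have "\<dots> \<le> ennreal (2 / real m0)"
      by (rule ennreal_leI) (use partial[of n] in \<open>simp add: order_trans\<close>)
    finally show ?thesis .
  qed
  then show ?thesis unfolding suminf_eq_SUP by (rule SUP_least)
qed

text \<open>
  The times below \<open>2 * 32 ^ i\<close> are few enough to be treated one by one. The bound is chosen so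
  that later times contain at least \<open>8 ^ i\<close> windows of length \<open>q * 2 ^ i\<close>, which is at most
  \<open>2 * 4 ^ i\<close>.
\<close>
definition short_scales :: "nat \<Rightarrow> nat \<Rightarrow> nat set" where
  "short_scales h i = {n\<in>scales h. 4 ^ i \<le> n \<and> n < 2 * 32 ^ i}"

lemma short_scales_card: "finite (short_scales h i)" "real (card (short_scales h i)) \<le> 2 ^ Suc h * (5 * real i + 2)"
proof -
  have "(2::nat) * 32 ^ i = 2 ^ (5 * i + 1)" by (simp add: power_mult)
  then have sub: "short_scales h i \<subseteq> scales h \<inter> {1..2 ^ (5 * i + 1)}"
  proof (intro subsetI IntI)
    fix n assume n: "n \<in> short_scales h i"
    have "(0::nat) < 4 ^ i" by simp
    then show "n \<in> {1..2 ^ (5 * i + 1)}"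
      using n \<open>2 * 32 ^ i = 2 ^ (5 * i + 1)\<close> unfolding short_scales_def atLeastAtMost_iff mem_Collect_eq by linarith
  qed (simp add: short_scales_def)
  show "finite (short_scales h i)" using sub scales_card(1) by (rule finite_subset)
  have "card (short_scales h i) \<le> card (scales h \<inter> {1..2 ^ (5 * i + 1)})"
    by (rule card_mono[OF scales_card(1) sub])
  also have "\<dots> \<le> 2 ^ Suc h * (5 * i + 1 + 1)" by (rule scales_card(2))
  finally have "real (card (short_scales h i)) \<le> real (2 ^ Suc h * (5 * i + 1 + 1))" by (simp only: of_nat_le_iff)
  then show "real (card (short_scales h i)) \<le> 2 ^ Suc h * (5 * real i + 2)" by (simp add: algebra_simps)
qed

text \<open>
  The maximum over the short times is estimated by the sum of squares. At a long time, the average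
  is at most an average over windows of length \<open>N = q * 2 ^ i\<close>, whose maximal function is bounded
  in \<open>L\<^sup>2\<close>, plus the edge term. The squared edge terms are summed over all \<open>m \<ge> 8 ^ i\<close>; the factor
  \<open>(real q)\<^sup>2\<close>, of order \<open>4 ^ i\<close>, leaves \<open>1 / 2 ^ i\<close>.
\<close>
lemma ramanujan_max_L2:
  fixes f :: "'a \<Rightarrow> real"
  assumes ds: "dynamical_system M \<tau>" and fm[measurable]: "f \<in> borel_measurable M" and q: "q \<in> block i"
  defines "I \<equiv> (\<integral>\<^sup>+x. ennreal ((f x)\<^sup>2) \<partial>M)"
  shows "(\<integral>\<^sup>+x. (ramanujan_max \<tau> f h i q x)\<^sup>2 \<partial>M)
    \<le> (\<Sum>n\<in>short_scales h i. \<integral>\<^sup>+x. ennreal ((ramanujan_avg \<tau> f q n x)\<^sup>2) \<partial>M)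
      + 27 * (\<integral>\<^sup>+x. ennreal ((ramanujan_avg \<tau> f q (q * 2 ^ i) x)\<^sup>2) \<partial>M)
      + ennreal (24 / 2 ^ i) * I"
proof -
  have [measurable]: "\<tau> ^^ k \<in> measurable M M" for k by (rule dynamical_system_funpow_measurable[OF ds])
  have [measurable]: "ramanujan_avg \<tau> f q n \<in> borel_measurable M" for n by (rule measurable_ramanujan_avg[OF ds fm])
  have q0: "q > 0" and q1: "q < 2 ^ Suc i" using q block_pos by (auto simp: block_def)
  define N where "N = q * 2 ^ i"
  have N0: "N \<ge> 1" using q0 by (simp add: N_def Suc_le_eq)
  have Nle: "8 ^ i * N \<le> 2 * 32 ^ i"
  proof -
    have "N \<le> 2 ^ Suc i * 2 ^ i" unfolding N_def using q1 by (intro mult_right_mono) auto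
    also have "\<dots> = 2 * 4 ^ i" by (simp flip: power_mult_distrib)
    finally have "8 ^ i * N \<le> 8 ^ i * (2 * 4 ^ i)" by (rule mult_left_mono) simp
    also have "\<dots> = 2 * 32 ^ i" by (simp flip: power_mult_distrib)
    finally show ?thesis .
  qed
  define G where "G x = \<bar>ramanujan_avg \<tau> f q N x\<bar>" for x
  have [measurable]: "G \<in> borel_measurable M" unfolding G_def by measurable
  define Mx where "Mx = weighted_max (\<lambda>_. 1) (\<tau> ^^ N) G"
  have [measurable]: "Mx \<in> borel_measurable M"
    unfolding Mx_def by (rule measurable_weighted_max[OF dynamical_system_funpow[OF ds]]) simp
  define E where "E m x = real q / (real m * real N) * (\<Sum>k=m * N + 1..m * N + N. \<bar>f ((\<tau> ^^ k) x)\<bar>)" for m x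
  have [measurable]: "E m \<in> borel_measurable M" for m unfolding E_def by measurable
  let ?short = "\<lambda>x. \<Sum>n\<in>short_scales h i. ennreal ((ramanujan_avg \<tau> f q n x)\<^sup>2)"
  \<comment> \<open>Here 3 comes from squaring a sum of three terms. Together with the constant 8 for the maximal
    function in \<open>L\<^sup>2\<close> it produces the coefficient \<open>27 = 3 * (1 + 8)\<close>.\<close>
  let ?long = "\<lambda>x. 3 * (ennreal ((G x)\<^sup>2) + (Mx x)\<^sup>2 + (\<Sum>j. ennreal ((E (8 ^ i + j) x)\<^sup>2)))"
  have pt: "(ramanujan_max \<tau> f h i q x)\<^sup>2 \<le> ?short x + ?long x" for x
    unfolding ramanujan_max_def
  proof (rule SUP_power2_le)
    fix n assume n: "n \<in> {n \<in> scales h. 4 ^ i \<le> n}"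
    have sq: "(ennreal \<bar>ramanujan_avg \<tau> f q n x\<bar>)\<^sup>2 = ennreal ((ramanujan_avg \<tau> f q n x)\<^sup>2)"
      by (simp add: ennreal_power)
    show "(ennreal \<bar>ramanujan_avg \<tau> f q n x\<bar>)\<^sup>2 \<le> ?short x + ?long x"
    proof (cases "n < 2 * 32 ^ i")
      case True
      then have "n \<in> short_scales h i" using n by (simp add: short_scales_def)
      then have "ennreal ((ramanujan_avg \<tau> f q n x)\<^sup>2) \<le> ?short x"
        using short_scales_card(1) by (intro member_le_sum) auto
      then show ?thesis unfolding sq by (rule order_trans) simp
    next
      case False
      define m where "m = n div N"
      have "8 ^ i * N \<le> n" using Nle False by linarith
      then have m8: "8 ^ i \<le> m" using N0 by (simp add: m_def less_eq_div_iff_mult_less_eq)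
      then have m: "m \<ge> 1" using less_le_trans[of 0 "8 ^ i" m] by simp
      have E0: "E m x \<ge> 0" unfolding E_def by (intro mult_nonneg_nonneg sum_nonneg) auto
      have "ennreal \<bar>ramanujan_avg \<tau> f q n x\<bar>
          \<le> ennreal ((\<Sum>j<m. G (((\<tau> ^^ N) ^^ j) x)) / real m + E m x)"
        unfolding G_def E_def
        by (rule ennreal_leI, rule ramanujan_avg_long[OF q0 N_def _ m_def m]) simp
      also have "\<dots> = ennreal ((\<Sum>j<m. G (((\<tau> ^^ N) ^^ j) x)) / real m) + ennreal (E m x)"
        by (rule ennreal_plus[OF _ E0]) (simp add: G_def sum_nonneg)
      also have "\<dots> \<le> (ennreal (G x) + Mx x) + ennreal (E m x)"
        unfolding Mx_def by (intro add_right_mono initial_average_le m) (simp add: G_def)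
      finally have "(ennreal \<bar>ramanujan_avg \<tau> f q n x\<bar>)\<^sup>2 \<le> (ennreal (G x) + Mx x + ennreal (E m x))\<^sup>2"
        by (rule power_mono) simp
      also have "\<dots> \<le> 3 * ((ennreal (G x))\<^sup>2 + (Mx x)\<^sup>2 + (ennreal (E m x))\<^sup>2)" by (rule ennreal_power2_add3)
      also have "\<dots> \<le> ?long x"
      proof -
        have le: "u k \<le> suminf u" for u :: "nat \<Rightarrow> ennreal" and k
          using sum_le_suminf[of u "{k}"] by simp
        have "ennreal ((E (8 ^ i + (m - 8 ^ i)) x)\<^sup>2) \<le> (\<Sum>j. ennreal ((E (8 ^ i + j) x)\<^sup>2))"
          by (rule le[of "\<lambda>j. ennreal ((E (8 ^ i + j) x)\<^sup>2)" "m - 8 ^ i"])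
        then have "(ennreal (E m x))\<^sup>2 \<le> (\<Sum>j. ennreal ((E (8 ^ i + j) x)\<^sup>2))"
          unfolding le_add_diff_inverse[OF m8] ennreal_power[OF E0] .
        moreover have "(ennreal (G x))\<^sup>2 = ennreal ((G x)\<^sup>2)" by (simp add: G_def ennreal_power)
        ultimately show ?thesis by (intro mult_left_mono add_mono) auto
      qed
      finally show ?thesis by (rule order_trans) simp
    qed
  qed
  have intM: "(\<integral>\<^sup>+x. (Mx x)\<^sup>2 \<partial>M) \<le> 8 * (\<integral>\<^sup>+x. ennreal ((G x)\<^sup>2) \<partial>M)"
    unfolding Mx_def by (rule maximal_average_L2[OF dynamical_system_funpow[OF ds]]) (auto simp: G_def)
  have intE: "(\<integral>\<^sup>+x. (\<Sum>j. ennreal ((E (8 ^ i + j) x)\<^sup>2)) \<partial>M) \<le> ennreal (8 / 2 ^ i) * I"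
  proof -
    have "(\<integral>\<^sup>+x. (\<Sum>j. ennreal ((E (8 ^ i + j) x)\<^sup>2)) \<partial>M) = (\<Sum>j. \<integral>\<^sup>+x. ennreal ((E (8 ^ i + j) x)\<^sup>2) \<partial>M)"
      by (rule nn_integral_suminf) measurable
    also have "\<dots> \<le> (\<Sum>j. ennreal ((real q)\<^sup>2) * ennreal (1 / (real (8 ^ i + j))\<^sup>2) * I)"
    proof (intro suminf_le)
      fix j
      have "(8::nat) ^ i + j \<ge> 1" by (simp add: add_increasing2 Suc_le_eq)
      from edge_term_L2[OF ds fm this N0, of q]
      show "(\<integral>\<^sup>+x. ennreal ((E (8 ^ i + j) x)\<^sup>2) \<partial>M) \<le> ennreal ((real q)\<^sup>2) * ennreal (1 / (real (8 ^ i + j))\<^sup>2) * I"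
        unfolding E_def I_def by (simp only: ennreal_mult zero_le_power2 divide_nonneg_nonneg zero_le_one)
    qed auto
    also have "\<dots> = ennreal ((real q)\<^sup>2) * (\<Sum>j. ennreal (1 / (real (8 ^ i + j))\<^sup>2)) * I"
      by (simp only: ennreal_suminf_multc ennreal_suminf_cmult)
    also have "\<dots> \<le> ennreal ((real q)\<^sup>2) * ennreal (2 / real (8 ^ i)) * I"
      by (intro mult_right_mono mult_left_mono suminf_inverse_squares) auto
    also have "\<dots> = ennreal ((real q)\<^sup>2 * (2 / real (8 ^ i))) * I"
      unfolding mult.assoc by (rule ennreal_mult_mult) auto
    also have "\<dots> \<le> ennreal (8 / 2 ^ i) * I"
    proof (intro mult_right_mono ennreal_leI)
      have "real q \<le> 2 ^ Suc i" using q1 by (metis less_imp_le of_nat_le_iff of_nat_numeral of_nat_power)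
      then have "(real q)\<^sup>2 \<le> (2 ^ Suc i)\<^sup>2" by (rule power_mono) simp
      also have "(2 ^ Suc i)\<^sup>2 = (4 * 4 ^ i :: real)" by (simp add: power2_eq_square flip: power_mult_distrib)
      finally have "(real q)\<^sup>2 * (2 / real (8 ^ i)) \<le> 4 * 4 ^ i * (2 / real (8 ^ i))" by (rule mult_right_mono) simp
      also have "\<dots> = 8 * (4 ^ i / 8 ^ i)" by simp
      also have "(4 ^ i / 8 ^ i :: real) = 1 / 2 ^ i" by (simp flip: power_divide add: power_one_over)
      finally show "(real q)\<^sup>2 * (2 / real (8 ^ i)) \<le> 8 / 2 ^ i" by simp
    qed simp
    finally show ?thesis .
  qed
  have "(\<integral>\<^sup>+x. (ramanujan_max \<tau> f h i q x)\<^sup>2 \<partial>M) \<le> (\<integral>\<^sup>+x. ?short x + ?long x \<partial>M)"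
    by (intro nn_integral_mono pt)
  also have "\<dots> = (\<integral>\<^sup>+x. ?short x \<partial>M) + (\<integral>\<^sup>+x. ?long x \<partial>M)" by (rule nn_integral_add) measurable
  also have "(\<integral>\<^sup>+x. ?short x \<partial>M) = (\<Sum>n\<in>short_scales h i. \<integral>\<^sup>+x. ennreal ((ramanujan_avg \<tau> f q n x)\<^sup>2) \<partial>M)"
    by (rule nn_integral_sum) measurable
  also have "(\<integral>\<^sup>+x. ?long x \<partial>M) = 3 * (\<integral>\<^sup>+x. ennreal ((G x)\<^sup>2) + (Mx x)\<^sup>2 + (\<Sum>j. ennreal ((E (8 ^ i + j) x)\<^sup>2)) \<partial>M)"
    by (rule nn_integral_cmult) measurable
  also have "(\<integral>\<^sup>+x. ennreal ((G x)\<^sup>2) + (Mx x)\<^sup>2 + (\<Sum>j. ennreal ((E (8 ^ i + j) x)\<^sup>2)) \<partial>M)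
      = (\<integral>\<^sup>+x. ennreal ((G x)\<^sup>2) + (Mx x)\<^sup>2 \<partial>M) + (\<integral>\<^sup>+x. (\<Sum>j. ennreal ((E (8 ^ i + j) x)\<^sup>2)) \<partial>M)"
    by (rule nn_integral_add) measurable
  also have "(\<integral>\<^sup>+x. ennreal ((G x)\<^sup>2) + (Mx x)\<^sup>2 \<partial>M) = (\<integral>\<^sup>+x. ennreal ((G x)\<^sup>2) \<partial>M) + (\<integral>\<^sup>+x. (Mx x)\<^sup>2 \<partial>M)"
    by (rule nn_integral_add) measurable
  also have "(\<Sum>n\<in>short_scales h i. \<integral>\<^sup>+x. ennreal ((ramanujan_avg \<tau> f q n x)\<^sup>2) \<partial>M)
      + 3 * ((\<integral>\<^sup>+x. ennreal ((G x)\<^sup>2) \<partial>M) + (\<integral>\<^sup>+x. (Mx x)\<^sup>2 \<partial>M) + (\<integral>\<^sup>+x. (\<Sum>j. ennreal ((E (8 ^ i + j) x)\<^sup>2)) \<partial>M))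
    \<le> (\<Sum>n\<in>short_scales h i. \<integral>\<^sup>+x. ennreal ((ramanujan_avg \<tau> f q n x)\<^sup>2) \<partial>M)
      + 3 * ((\<integral>\<^sup>+x. ennreal ((G x)\<^sup>2) \<partial>M) + 8 * (\<integral>\<^sup>+x. ennreal ((G x)\<^sup>2) \<partial>M) + ennreal (8 / 2 ^ i) * I)"
    by (intro add_mono mult_left_mono intM intE order_refl) auto
  also have "3 * ((\<integral>\<^sup>+x. ennreal ((G x)\<^sup>2) \<partial>M) + 8 * (\<integral>\<^sup>+x. ennreal ((G x)\<^sup>2) \<partial>M) + ennreal (8 / 2 ^ i) * I)
      = 27 * (\<integral>\<^sup>+x. ennreal ((G x)\<^sup>2) \<partial>M) + ennreal (24 / 2 ^ i) * I"
  proof -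
    have alg: "3 * (a + 8 * a + b) = 27 * a + 3 * b" for a b :: ennreal
    proof -
      have "3 * (a + 8 * a + b) = (3 * 1 + 3 * 8) * a + 3 * b"
        by (simp only: distrib_left distrib_right mult_1 mult.assoc)
      then show ?thesis by simp
    qed
    have "3 * (ennreal (8 / 2 ^ i) * I) = ennreal (24 / 2 ^ i) * I"
      using ennreal_mult_mult[of 3 "8 / 2 ^ i" I] by simp
    then show ?thesis unfolding alg by simp
  qed
  finally show ?thesis by (simp add: G_def N_def add.assoc)
qed

lemma ln2_le_1: "ln (2::real) \<le> 1"
  using ln_le_minus_one[of 2] by simp

lemma harm_le_ln:
  assumes "n \<ge> 1"
  shows "harm n \<le> 1 + ln (real n)"
  using decseqD[OF decseq_harm_diff_ln, of 0 "n - 1"] assms by (simp add: harm_expand)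

lemma harm_power2_le: "harm (2 ^ j) \<le> 1 + real j"
proof -
  have "harm (2 ^ j) \<le> 1 + ln (real (2 ^ j))" by (rule harm_le_ln) simp
  also have "ln (real (2 ^ j)) = real j * ln 2" by (simp add: ln_realpow)
  also have "\<dots> \<le> real j * 1" by (intro mult_left_mono ln2_le_1) simp
  finally show ?thesis by simp
qed

lemma dirichlet_mass_le: "dirichlet_mass i \<le> 30 * (real i + 1)"
proof -
  have "(4::nat) ^ Suc i = 2 ^ (2 * Suc i)" by (simp only: power_mult) simp
  then have "harm (4 ^ Suc i) \<le> 1 + real (2 * Suc i)" using harm_power2_le[of "2 * Suc i"] by simp
  then show ?thesis by (simp add: dirichlet_mass_def)
qed

text \<open>
  Cauchy-Schwarz over the \<open>2 ^ i\<close> denominators of the block, with weights \<open>1 / q \<le> 1 / 2 ^ i\<close>,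
  gains the factor \<open>1 / 2 ^ i\<close>, provided that the sum over \<open>q\<close> of the squared norms of the maximal
  functions is bounded polynomially in \<open>i\<close>. It is: for each fixed choice of times, Parseval
  estimates all \<open>q\<close> of the block together (\<open>ramanujan_avg_L2\<close>), and for fixed \<open>h\<close> only \<open>O(i)\<close>
  short times occur.
\<close>
lemma block_max_L2:
  fixes f :: "'a \<Rightarrow> real"
  assumes ds: "dynamical_system M \<tau>" and fm[measurable]: "f \<in> borel_measurable M"
  shows "(\<integral>\<^sup>+x. (block_max \<tau> f h i x)\<^sup>2 \<partial>M)
    \<le> ennreal (40000 * 2 ^ h * (real i + 1) ^ 3 / 2 ^ i) * (\<integral>\<^sup>+x. ennreal ((f x)\<^sup>2) \<partial>M)"
proof -
  have [measurable]: "ramanujan_max \<tau> f h i q \<in> borel_measurable M" for q by (rule measurable_ramanujan_max[OF ds fm])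
  define I where "I = (\<integral>\<^sup>+x. ennreal ((f x)\<^sup>2) \<partial>M)"
  define D where "D = (dirichlet_mass i)\<^sup>2"
  have D: "D \<ge> 0" "D \<le> 900 * (real i + 1)\<^sup>2"
  proof -
    have "D \<le> (30 * (real i + 1))\<^sup>2"
      unfolding D_def by (rule power_mono[OF dirichlet_mass_le dirichlet_mass_nonneg])
    also have "\<dots> = 900 * (real i + 1)\<^sup>2" by (simp only: power_mult_distrib) simp
    finally show "D \<le> 900 * (real i + 1)\<^sup>2" .
  qed (simp add: D_def)
  have "(block_max \<tau> f h i x)\<^sup>2 \<le> ennreal (1 / 2 ^ i) * (\<Sum>q\<in>block i. (ramanujan_max \<tau> f h i q x)\<^sup>2)" for x
  proof -
    have "block_max \<tau> f h i x \<le> (\<Sum>q\<in>block i. ennreal (1 / 2 ^ i) * ramanujan_max \<tau> f h i q x)"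
      unfolding block_max_def
    proof (intro sum_mono mult_right_mono ennreal_leI)
      fix q assume "q \<in> block i"
      then have "2 ^ i \<le> q" by (simp add: block_def)
      then have "(2::real) ^ i \<le> real q" by (metis of_nat_le_iff of_nat_numeral of_nat_power)
      then show "1 / real q \<le> 1 / 2 ^ i" by (intro divide_left_mono mult_pos_pos) (auto intro: less_le_trans[of 0 "2 ^ i"])
    qed simp
    then have "(block_max \<tau> f h i x)\<^sup>2 \<le> (ennreal (1 / 2 ^ i) * (\<Sum>q\<in>block i. ramanujan_max \<tau> f h i q x))\<^sup>2"
      by (intro power_mono) (simp_all add: sum_distrib_left)
    also have "\<dots> = ennreal ((1 / 2 ^ i)\<^sup>2) * (\<Sum>q\<in>block i. ramanujan_max \<tau> f h i q x)\<^sup>2"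
      by (simp only: power_mult_distrib) (simp add: ennreal_power)
    also have "\<dots> \<le> ennreal ((1 / 2 ^ i)\<^sup>2) * (of_nat (card (block i)) * (\<Sum>q\<in>block i. (ramanujan_max \<tau> f h i q x)\<^sup>2))"
      by (intro mult_left_mono ennreal_sum_power2_le) auto
    also have "\<dots> = ennreal ((1 / 2 ^ i)\<^sup>2 * 2 ^ i) * (\<Sum>q\<in>block i. (ramanujan_max \<tau> f h i q x)\<^sup>2)"
    proof -
      have "of_nat (card (block i)) = ennreal (2 ^ i)"
        unfolding card_block ennreal_of_nat_eq_real_of_nat by simp
      then show ?thesis using ennreal_mult_mult[of "(1 / 2 ^ i)\<^sup>2" "2 ^ i"] by simp
    qed
    also have "(1 / 2 ^ i)\<^sup>2 * 2 ^ i = (1 / 2 ^ i :: real)" by (simp add: power2_eq_square)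
    finally show ?thesis .
  qed
  then have "(\<integral>\<^sup>+x. (block_max \<tau> f h i x)\<^sup>2 \<partial>M)
      \<le> (\<integral>\<^sup>+x. ennreal (1 / 2 ^ i) * (\<Sum>q\<in>block i. (ramanujan_max \<tau> f h i q x)\<^sup>2) \<partial>M)"
    by (intro nn_integral_mono)
  also have "\<dots> = ennreal (1 / 2 ^ i) * (\<Sum>q\<in>block i. \<integral>\<^sup>+x. (ramanujan_max \<tau> f h i q x)\<^sup>2 \<partial>M)"
    by (subst nn_integral_cmult, measurable, subst nn_integral_sum) auto
  also have "\<dots> \<le> ennreal (1 / 2 ^ i) * (\<Sum>q\<in>block i.
      (\<Sum>n\<in>short_scales h i. \<integral>\<^sup>+x. ennreal ((ramanujan_avg \<tau> f q n x)\<^sup>2) \<partial>M)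
      + 27 * (\<integral>\<^sup>+x. ennreal ((ramanujan_avg \<tau> f q (q * 2 ^ i) x)\<^sup>2) \<partial>M)
      + ennreal (24 / 2 ^ i) * I)"
    unfolding I_def by (intro mult_left_mono sum_mono ramanujan_max_L2[OF ds fm]) auto
  also have "\<dots> \<le> ennreal (1 / 2 ^ i) * (ennreal (2 ^ Suc h * (5 * real i + 2) * D) * I + ennreal (27 * D) * I + ennreal 24 * I)"
  proof (intro mult_left_mono)
    have s1: "(\<Sum>q\<in>block i. \<Sum>n\<in>short_scales h i. \<integral>\<^sup>+x. ennreal ((ramanujan_avg \<tau> f q n x)\<^sup>2) \<partial>M)
        \<le> ennreal (2 ^ Suc h * (5 * real i + 2) * D) * I"
    proof -
      have "(\<Sum>q\<in>block i. \<Sum>n\<in>short_scales h i. \<integral>\<^sup>+x. ennreal ((ramanujan_avg \<tau> f q n x)\<^sup>2) \<partial>M)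
          = (\<Sum>n\<in>short_scales h i. \<Sum>q\<in>block i. \<integral>\<^sup>+x. ennreal ((ramanujan_avg \<tau> f q n x)\<^sup>2) \<partial>M)"
        by (rule sum.swap)
      also have "\<dots> \<le> (\<Sum>n\<in>short_scales h i. ennreal D * I)"
        unfolding D_def I_def by (intro sum_mono ramanujan_avg_L2[OF ds fm]) (simp add: short_scales_def)
      also have "\<dots> = ennreal (real (card (short_scales h i))) * (ennreal D * I)"
        by (simp add: ennreal_of_nat_eq_real_of_nat)
      also have "\<dots> \<le> ennreal (2 ^ Suc h * (5 * real i + 2)) * (ennreal D * I)"
        by (intro mult_right_mono ennreal_leI short_scales_card) auto
      also have "\<dots> = ennreal (2 ^ Suc h * (5 * real i + 2) * D) * I"
        by (rule ennreal_mult_mult) (use D in auto)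
      finally show ?thesis .
    qed
    have s2: "(\<Sum>q\<in>block i. 27 * (\<integral>\<^sup>+x. ennreal ((ramanujan_avg \<tau> f q (q * 2 ^ i) x)\<^sup>2) \<partial>M)) \<le> ennreal (27 * D) * I"
    proof -
      have "(4::nat) ^ i \<le> q * 2 ^ i" if "q \<in> block i" for q
      proof -
        have "(4::nat) ^ i = 2 ^ i * 2 ^ i" by (simp flip: power_mult_distrib)
        also have "\<dots> \<le> q * 2 ^ i" using that by (intro mult_right_mono) (auto simp: block_def)
        finally show ?thesis .
      qed
      then have "(\<Sum>q\<in>block i. \<integral>\<^sup>+x. ennreal ((ramanujan_avg \<tau> f q (q * 2 ^ i) x)\<^sup>2) \<partial>M) \<le> ennreal D * I"
        unfolding D_def I_def by (rule ramanujan_avg_L2[OF ds fm])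
      then have "27 * (\<Sum>q\<in>block i. \<integral>\<^sup>+x. ennreal ((ramanujan_avg \<tau> f q (q * 2 ^ i) x)\<^sup>2) \<partial>M) \<le> 27 * (ennreal D * I)"
        by (rule mult_left_mono) simp
      then show ?thesis using ennreal_mult_mult[of 27 D I] D by (simp add: sum_distrib_left)
    qed
    have s3: "(\<Sum>q\<in>block i. ennreal (24 / 2 ^ i) * I) = ennreal 24 * I"
    proof -
      have "(\<Sum>q\<in>block i. ennreal (24 / 2 ^ i) * I) = ennreal (2 ^ i) * (ennreal (24 / 2 ^ i) * I)"
        by (simp add: card_block ennreal_of_nat_eq_real_of_nat)
      also have "\<dots> = ennreal (2 ^ i * (24 / 2 ^ i)) * I" by (rule ennreal_mult_mult) auto
      finally show ?thesis by simp
    qed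
    show "(\<Sum>q\<in>block i. (\<Sum>n\<in>short_scales h i. \<integral>\<^sup>+x. ennreal ((ramanujan_avg \<tau> f q n x)\<^sup>2) \<partial>M)
      + 27 * (\<integral>\<^sup>+x. ennreal ((ramanujan_avg \<tau> f q (q * 2 ^ i) x)\<^sup>2) \<partial>M) + ennreal (24 / 2 ^ i) * I)
      \<le> ennreal (2 ^ Suc h * (5 * real i + 2) * D) * I + ennreal (27 * D) * I + ennreal 24 * I"
      unfolding sum.distrib s3 by (intro add_mono s1 s2 order_refl)
  qed simp
  also have "\<dots> = ennreal (1 / 2 ^ i * (2 ^ Suc h * (5 * real i + 2) * D + 27 * D + 24)) * I"
  proof -
    have "ennreal (2 ^ Suc h * (5 * real i + 2) * D) * I + ennreal (27 * D) * I + ennreal 24 * I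
        = ennreal (2 ^ Suc h * (5 * real i + 2) * D + 27 * D + 24) * I"
      using D(1) by (subst ennreal_plus, simp, simp, subst ennreal_plus) (simp_all only: distrib_right, auto)
    then show ?thesis using D(1) ennreal_mult_mult[of "1 / 2 ^ i" "2 ^ Suc h * (5 * real i + 2) * D + 27 * D + 24" I] by simp
  qed
  also have "\<dots> \<le> ennreal (40000 * 2 ^ h * (real i + 1) ^ 3 / 2 ^ i) * I"
  proof (intro mult_right_mono ennreal_leI)
    define y where "y = real i + 1"
    have y: "y \<ge> 1" by (simp add: y_def)
    have h: "(2::real) ^ h \<ge> 1" by simp
    have yy: "y\<^sup>2 \<le> y ^ 3" "1 \<le> y ^ 3" using y by (auto intro: power_increasing one_le_power)
    have hy: "1 * y ^ 3 \<le> 2 ^ h * y ^ 3" using h yy by (intro mult_right_mono) linarith+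
    have "2 ^ Suc h * (5 * real i + 2) * D \<le> 2 ^ Suc h * (5 * y) * (900 * y\<^sup>2)"
      using D y by (intro mult_mono) (auto simp: y_def)
    also have "\<dots> = 9000 * (2 ^ h * y ^ 3)" by (simp add: power2_eq_square power3_eq_cube)
    finally have 1: "2 ^ Suc h * (5 * real i + 2) * D \<le> 9000 * (2 ^ h * y ^ 3)" .
    have 2: "27 * D \<le> 24300 * (2 ^ h * y ^ 3)" using D(2) yy hy unfolding y_def[symmetric] by linarith
    have 3: "24 \<le> 24 * (2 ^ h * y ^ 3)" using yy hy by linarith
    have "0 \<le> 2 ^ h * y ^ 3" using y by (intro mult_nonneg_nonneg zero_le_power) auto
    then have "2 ^ Suc h * (5 * real i + 2) * D + 27 * D + 24 \<le> 40000 * (2 ^ h * y ^ 3)" using 1 2 3 by linarith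
    then have "(2 ^ Suc h * (5 * real i + 2) * D + 27 * D + 24) / 2 ^ i \<le> 40000 * (2 ^ h * y ^ 3) / 2 ^ i"
      by (rule divide_right_mono) simp
    then show "1 / 2 ^ i * (2 ^ Suc h * (5 * real i + 2) * D + 27 * D + 24) \<le> 40000 * 2 ^ h * (real i + 1) ^ 3 / 2 ^ i"
      by (simp add: y_def)
  qed simp
  finally show ?thesis unfolding I_def .
qed

text \<open>
  Jensen's inequality for weights whose sum is not normalised. The terms with \<open>z l = 0\<close> are split
  off because convexity of the power is available on the open half-line.
\<close>
lemma powr_sum_jensen:
  fixes c z :: "'b \<Rightarrow> real"
  assumes A: "finite A" and c: "\<And>l. l \<in> A \<Longrightarrow> c l > 0" and z: "\<And>l. l \<in> A \<Longrightarrow> z l \<ge> 0" and r: "r \<ge> 1"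
  shows "(\<Sum>l\<in>A. c l * z l) powr r \<le> (\<Sum>l\<in>A. c l) powr (r - 1) * (\<Sum>l\<in>A. c l * z l powr r)"
proof -
  define A' where "A' = {l\<in>A. z l > 0}"
  have A': "finite A'" "A' \<subseteq> A" using A by (auto simp: A'_def)
  have e1: "(\<Sum>l\<in>A. c l * z l) = (\<Sum>l\<in>A'. c l * z l)"
    by (rule sum.mono_neutral_right) (use A z in \<open>force simp: A'_def\<close>)+
  have e2: "(\<Sum>l\<in>A. c l * z l powr r) = (\<Sum>l\<in>A'. c l * z l powr r)"
    by (rule sum.mono_neutral_right) (use A z r in \<open>force simp: A'_def\<close>)+
  show ?thesis
  proof (cases "A' = {}")
    case True
    then show ?thesis unfolding e1 e2 by simp
  next
    case False
    define D where "D = (\<Sum>l\<in>A'. c l)"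
    have D: "D > 0" unfolding D_def using A' c False by (intro sum_pos) auto
    have DA: "D \<le> (\<Sum>l\<in>A. c l)" unfolding D_def using A A' c by (intro sum_mono2) (auto intro: less_imp_le)
    have nn: "(\<Sum>l\<in>A'. c l * z l powr r) \<ge> 0" using A' c by (intro sum_nonneg mult_nonneg_nonneg) (auto intro: less_imp_le)
    have "(\<Sum>l\<in>A'. (c l / D) *\<^sub>R z l) powr r \<le> (\<Sum>l\<in>A'. (c l / D) * z l powr r)"
    proof (rule convex_on_sum[OF A'(1) False powr_convex[OF r]])
      show "(\<Sum>l\<in>A'. c l / D) = 1" using D by (simp add: D_def flip: sum_divide_distrib)
      show "0 \<le> c l / D" if "l \<in> A'" for l using c[of l] A' that D by (auto intro: less_imp_le)
      show "z l \<in> {0<..}" if "l \<in> A'" for l using that by (simp add: A'_def)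
    qed
    then have "((\<Sum>l\<in>A'. c l * z l) / D) powr r \<le> (\<Sum>l\<in>A'. c l * z l powr r) / D"
      by (simp add: sum_divide_distrib)
    moreover have "(\<Sum>l\<in>A'. c l * z l) \<ge> 0"
      using A' c z by (intro sum_nonneg mult_nonneg_nonneg) (auto intro: less_imp_le)
    ultimately have "(\<Sum>l\<in>A'. c l * z l) powr r \<le> D powr r * ((\<Sum>l\<in>A'. c l * z l powr r) / D)"
      using D by (simp add: powr_divide field_simps)
    also have "\<dots> = D powr (r - 1) * (\<Sum>l\<in>A'. c l * z l powr r)"
      using D by (simp add: powr_diff)
    also have "\<dots> \<le> (\<Sum>l\<in>A. c l) powr (r - 1) * (\<Sum>l\<in>A'. c l * z l powr r)"
      using D DA r nn by (intro mult_right_mono powr_mono2) auto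
    finally show ?thesis unfolding e1 e2 .
  qed
qed

lemma ennreal_powr_sum_jensen:
  fixes y :: "'b \<Rightarrow> ennreal" and c :: "'b \<Rightarrow> real"
  assumes A: "finite A" and c: "\<And>l. l \<in> A \<Longrightarrow> c l > 0" and r: "r \<ge> 1"
  shows "ennreal_powr (\<Sum>l\<in>A. ennreal (c l) * y l) r
    \<le> ennreal ((\<Sum>l\<in>A. c l) powr (r - 1)) * (\<Sum>l\<in>A. ennreal (c l) * ennreal_powr (y l) r)"
proof (cases "\<exists>l\<in>A. y l = top")
  case True
  then obtain l where l: "l \<in> A" "y l = top" by blast
  have "(\<Sum>l\<in>A. c l) > 0" using A l(1) c by (intro sum_pos) auto
  then have "(\<Sum>l\<in>A. c l) powr (r - 1) > 0" by simp
  moreover have "(\<Sum>l\<in>A. ennreal (c l) * ennreal_powr (y l) r) = top"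
    using A l c[OF l(1)] by (subst sum.remove[of _ l]) (auto simp: ennreal_powr_def ennreal_mult_top)
  ultimately show ?thesis by (simp add: ennreal_mult_top)
next
  case False
  define z where "z l = enn2real (y l)" for l
  have y: "y l = ennreal (z l)" if "l \<in> A" for l using False that by (simp add: z_def less_top)
  have z: "z l \<ge> 0" for l by (simp add: z_def)
  have c0: "l \<in> A \<Longrightarrow> c l \<ge> 0" for l using c[of l] by simp
  have "(\<Sum>l\<in>A. ennreal (c l) * y l) = (\<Sum>l\<in>A. ennreal (c l * z l))"
    by (rule sum.cong[OF refl]) (simp add: y ennreal_mult c0 z)
  also have "\<dots> = ennreal (\<Sum>l\<in>A. c l * z l)" by (rule sum_ennreal) (simp add: c0 z)
  finally have "ennreal_powr (\<Sum>l\<in>A. ennreal (c l) * y l) r = ennreal ((\<Sum>l\<in>A. c l * z l) powr r)"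
    by (simp add: sum_nonneg c0 z)
  also have "\<dots> \<le> ennreal ((\<Sum>l\<in>A. c l) powr (r - 1) * (\<Sum>l\<in>A. c l * z l powr r))"
    by (intro ennreal_leI powr_sum_jensen A c z r)
  also have "\<dots> = ennreal ((\<Sum>l\<in>A. c l) powr (r - 1)) * ennreal (\<Sum>l\<in>A. c l * z l powr r)"
    by (rule ennreal_mult) (auto intro!: sum_nonneg mult_nonneg_nonneg c0)
  also have "ennreal (\<Sum>l\<in>A. c l * z l powr r) = (\<Sum>l\<in>A. ennreal (c l * z l powr r))"
    by (rule sum_ennreal[symmetric]) (simp add: c0)
  also have "\<dots> = (\<Sum>l\<in>A. ennreal (c l) * ennreal_powr (y l) r)"
    by (rule sum.cong[OF refl]) (simp add: y ennreal_mult c0 z)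
  finally show ?thesis .
qed

lemma sum_multiples:
  fixes u :: "nat \<Rightarrow> real"
  assumes "e > 0"
  shows "(\<Sum>k=1..n. if e dvd k then u k else 0) = (\<Sum>j=1..n div e. u (e * j))"
proof -
  have "(\<Sum>k=1..n. if e dvd k then u k else 0) = (\<Sum>k | k \<in> {1..n} \<and> e dvd k. u k)"
    by (rule sum.inter_filter[symmetric]) simp
  also have "\<dots> = (\<Sum>j=1..n div e. u (e * j))"
  proof (rule sum.reindex_bij_witness[where i = "\<lambda>j. e * j" and j = "\<lambda>k. k div e"])
    fix k assume k: "k \<in> {k. k \<in> {1..n} \<and> e dvd k}"
    then have "e \<le> k" using dvd_imp_le[of e k] by auto
    then show "k div e \<in> {1..n div e}" using k assms by (simp add: div_le_mono div_greater_zero_iff Suc_le_eq)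
  next
    fix j assume "j \<in> {1..n div e}"
    then show "e * j \<in> {k. k \<in> {1..n} \<and> e dvd k}"
      using assms by (simp add: less_eq_div_iff_mult_less_eq mult.commute Suc_le_eq)
  qed (use assms in auto)
  finally show ?thesis .
qed

text \<open>
  Estimating \<open>\<bar>c\<^sub>q(k)\<bar>\<close> by the sum of the common divisors \<open>e\<close> of \<open>q\<close> and \<open>k\<close>, the average becomes
  a sum of averages along \<open>\<tau> ^^ e\<close>: the factor \<open>e\<close> compensates that only one time in \<open>e\<close> is
  visited.
\<close>
lemma ramanujan_avg_le_max:
  fixes f :: "'a \<Rightarrow> real"
  assumes q: "q > 0"
  shows "ennreal \<bar>ramanujan_avg \<tau> f q n x\<bar> \<le> (\<Sum>e | e dvd q. weighted_max (\<lambda>_. 1) (\<tau> ^^ e) (\<lambda>x. \<bar>f x\<bar>) x)"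
proof -
  have fin: "finite {e. e dvd q}" using q by simp
  let ?S = "\<lambda>e. (\<Sum>j=1..n div e. \<bar>f ((\<tau> ^^ (e * j)) x)\<bar>)"
  have e0: "e > 0" if "e dvd q" for e using q that by (auto intro: Nat.gr0I)
  have "\<bar>\<Sum>k=1..n. ramanujan q k * f ((\<tau> ^^ k) x)\<bar>
      \<le> (\<Sum>k=1..n. (\<Sum>e | e dvd q. if e dvd k then real e else 0) * \<bar>f ((\<tau> ^^ k) x)\<bar>)"
    by (intro order_trans[OF sum_abs] sum_mono) (auto simp: abs_mult intro!: mult_right_mono abs_ramanujan_le_sum q)
  also have "\<dots> = (\<Sum>e | e dvd q. \<Sum>k=1..n. if e dvd k then real e * \<bar>f ((\<tau> ^^ k) x)\<bar> else 0)"
    by (subst sum.swap) (simp add: sum_distrib_right if_distrib[of "\<lambda>y. y * _"] cong: if_cong)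
  also have "\<dots> = (\<Sum>e | e dvd q. real e * ?S e)"
  proof (rule sum.cong[OF refl])
    fix e assume "e \<in> {e. e dvd q}"
    then show "(\<Sum>k=1..n. if e dvd k then real e * \<bar>f ((\<tau> ^^ k) x)\<bar> else 0) = real e * ?S e"
      using sum_multiples[of e "\<lambda>k. real e * \<bar>f ((\<tau> ^^ k) x)\<bar>" n] e0 by (simp add: sum_distrib_left)
  qed
  finally have "\<bar>ramanujan_avg \<tau> f q n x\<bar> \<le> (\<Sum>e | e dvd q. real e * ?S e) / real n"
    by (simp add: ramanujan_avg_def divide_right_mono)
  then have "ennreal \<bar>ramanujan_avg \<tau> f q n x\<bar> \<le> ennreal (\<Sum>e | e dvd q. real e * ?S e / real n)"
    by (simp add: ennreal_leI sum_divide_distrib)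
  also have "\<dots> = (\<Sum>e | e dvd q. ennreal (real e * ?S e / real n))"
    by (rule sum_ennreal[symmetric]) (simp add: sum_nonneg)
  also have "\<dots> \<le> (\<Sum>e | e dvd q. weighted_max (\<lambda>_. 1) (\<tau> ^^ e) (\<lambda>x. \<bar>f x\<bar>) x)"
  proof (rule sum_mono)
    fix e assume "e \<in> {e. e dvd q}"
    then have e: "e > 0" using e0 by simp
    show "ennreal (real e * ?S e / real n) \<le> weighted_max (\<lambda>_. 1) (\<tau> ^^ e) (\<lambda>x. \<bar>f x\<bar>) x"
    proof (cases "n div e \<ge> 1")
      case True
      have ne: "real e * real (n div e) \<le> real n"
        by (simp flip: of_nat_mult)
      have S: "?S e \<ge> 0" by (simp add: sum_nonneg)
      have pos: "real e * real (n div e) > 0" using True e by simp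
      have "real e * ?S e / real n \<le> real e * ?S e / (real e * real (n div e))"
        by (rule divide_left_mono[OF ne _ mult_pos_pos]) (use pos ne S in auto)
      also have "\<dots> = (\<Sum>k=1..n div e. 1 * \<bar>f (((\<tau> ^^ e) ^^ k) x)\<bar>) / weight_sum (\<lambda>_. 1) (n div e)"
        using e by (simp add: weight_sum_one funpow_mult_apply)
      finally have "ennreal (real e * ?S e / real n)
          \<le> ennreal ((\<Sum>k=1..n div e. 1 * \<bar>f (((\<tau> ^^ e) ^^ k) x)\<bar>) / weight_sum (\<lambda>_. 1) (n div e))"
        by (rule ennreal_leI)
      also have "\<dots> \<le> weighted_max (\<lambda>_. 1) (\<tau> ^^ e) (\<lambda>x. \<bar>f x\<bar>) x"
        unfolding weighted_max_def using True by (intro SUP_upper) simp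
      finally show ?thesis .
    next
      case False
      then have "n div e = 0" by simp
      then show ?thesis by (simp only:) simp
    qed
  qed
  finally show ?thesis .
qed

lemma sum_inverse_multiples_block:
  assumes "e > 0"
  shows "(\<Sum>q | q \<in> block i \<and> e dvd q. 1 / real q) \<le> 2 / real e"
proof -
  have "(\<Sum>q | q \<in> block i \<and> e dvd q. 1 / real q) \<le> (\<Sum>q | q \<in> block i \<and> e dvd q. 1 / 2 ^ i)"
  proof (intro sum_mono)
    fix q assume "q \<in> {q. q \<in> block i \<and> e dvd q}"
    then have "2 ^ i \<le> q" by (simp add: block_def)
    then have "(2::real) ^ i \<le> real q" by (metis of_nat_le_iff of_nat_numeral of_nat_power)
    then show "1 / real q \<le> 1 / 2 ^ i" by (intro divide_left_mono mult_pos_pos) (auto intro: less_le_trans[of 0 "2 ^ i"])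
  qed
  also have "\<dots> = real (card {q. q \<in> block i \<and> e dvd q}) / 2 ^ i" by simp
  also have "\<dots> \<le> (2 ^ Suc i / real e) / 2 ^ i"
  proof (rule divide_right_mono)
    have "{q. q \<in> block i \<and> e dvd q} \<subseteq> (\<lambda>j. e * j) ` {1..2 ^ Suc i div e}"
    proof
      fix q assume q: "q \<in> {q. q \<in> block i \<and> e dvd q}"
      then obtain j where j: "q = e * j" by auto
      have "j > 0" using q block_pos[of q i] j by (cases j) auto
      moreover have "j * e \<le> 2 ^ Suc i" using q by (simp add: j block_def mult.commute)
      then have "j \<le> 2 ^ Suc i div e" using assms by (simp only: less_eq_div_iff_mult_less_eq)
      ultimately show "q \<in> (\<lambda>j. e * j) ` {1..2 ^ Suc i div e}" using j by auto
    qed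
    then have "card {q. q \<in> block i \<and> e dvd q} \<le> card ((\<lambda>j. e * j) ` {1..2 ^ Suc i div e})"
      by (rule card_mono[rotated]) simp
    also have "\<dots> \<le> card {1..2 ^ Suc i div e}" by (rule card_image_le) simp
    finally have "real (card {q. q \<in> block i \<and> e dvd q}) \<le> real (2 ^ Suc i div e)" by simp
    also have "\<dots> \<le> real (2 ^ Suc i) / real e" by (rule real_div_le)
    finally show "real (card {q. q \<in> block i \<and> e dvd q}) \<le> 2 ^ Suc i / real e" by simp
  qed simp
  also have "\<dots> = 2 / real e" by simp
  finally show ?thesis .
qed

text \<open>
  The weights \<open>1 / q\<close> of the multiples \<open>q\<close> of \<open>e\<close> in one block add up to at most \<open>2 / e\<close>;
  exchanging the sums over \<open>q\<close> and \<open>e\<close> leaves a combination of Cesaro maximal functions of total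
  mass \<open>O(i)\<close>.
\<close>
lemma block_max_le_averages:
  fixes f :: "'a \<Rightarrow> real"
  shows "block_max \<tau> f h i x
    \<le> (\<Sum>e=1..2 ^ Suc i. ennreal (2 / real e) * weighted_max (\<lambda>_. 1) (\<tau> ^^ e) (\<lambda>x. \<bar>f x\<bar>) x)"
proof -
  let ?M = "\<lambda>e. weighted_max (\<lambda>_. 1) (\<tau> ^^ e) (\<lambda>x. \<bar>f x\<bar>) x"
  have "block_max \<tau> f h i x \<le> (\<Sum>q\<in>block i. \<Sum>e | e \<in> {1..2 ^ Suc i} \<and> e dvd q. ennreal (1 / real q) * ?M e)"
    unfolding block_max_def
  proof (rule sum_mono)
    fix q assume q: "q \<in> block i"
    have q0: "q > 0" using q by (rule block_pos)
    have set: "{e. e dvd q} = {e. e \<in> {1..2 ^ Suc i} \<and> e dvd q}"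
    proof (intro Collect_cong iffI)
      fix e assume e: "e dvd q"
      then have "e \<le> q" using q0 by (rule dvd_imp_le)
      moreover have "e > 0" using e q0 by (auto intro: Nat.gr0I)
      moreover have "q < 2 ^ Suc i" using q by (simp add: block_def)
      ultimately show "e \<in> {1..2 ^ Suc i} \<and> e dvd q" using e by simp
    qed simp
    have "ramanujan_max \<tau> f h i q x \<le> (\<Sum>e | e dvd q. ?M e)"
      unfolding ramanujan_max_def by (intro SUP_least ramanujan_avg_le_max q0)
    then have "ennreal (1 / real q) * ramanujan_max \<tau> f h i q x \<le> ennreal (1 / real q) * (\<Sum>e | e dvd q. ?M e)"
      by (rule mult_left_mono) simp
    then show "ennreal (1 / real q) * ramanujan_max \<tau> f h i q x
        \<le> (\<Sum>e | e \<in> {1..2 ^ Suc i} \<and> e dvd q. ennreal (1 / real q) * ?M e)"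
      unfolding set sum_distrib_left .
  qed
  also have "\<dots> = (\<Sum>e=1..2 ^ Suc i. \<Sum>q | q \<in> block i \<and> e dvd q. ennreal (1 / real q) * ?M e)"
    by (rule sum.swap_restrict) auto
  also have "\<dots> \<le> (\<Sum>e=1..2 ^ Suc i. ennreal (2 / real e) * ?M e)"
  proof (rule sum_mono)
    fix e :: nat assume e: "e \<in> {1..2 ^ Suc i}"
    have "(\<Sum>q | q \<in> block i \<and> e dvd q. ennreal (1 / real q) * ?M e)
        = ennreal (\<Sum>q | q \<in> block i \<and> e dvd q. 1 / real q) * ?M e"
      by (simp only: sum_distrib_right[symmetric]) (subst sum_ennreal, auto)
    also have "\<dots> \<le> ennreal (2 / real e) * ?M e"
      using e by (intro mult_right_mono ennreal_leI sum_inverse_multiples_block) auto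
    finally show "(\<Sum>q | q \<in> block i \<and> e dvd q. ennreal (1 / real q) * ?M e) \<le> ennreal (2 / real e) * ?M e" .
  qed
  finally show ?thesis .
qed

text \<open>
  Jensen's inequality for that combination, and the maximal theorem in \<open>L\<^sup>r\<close>.
\<close>
lemma block_max_Lr:
  fixes f :: "'a \<Rightarrow> real"
  assumes ds: "dynamical_system M \<tau>" and fm[measurable]: "f \<in> borel_measurable M" and r: "1 < r" "r \<le> 2"
  shows "(\<integral>\<^sup>+x. ennreal_powr (block_max \<tau> f h i x) r \<partial>M)
    \<le> ennreal (16 * (real i + 1)\<^sup>2 * (2 powr r * r / (r - 1))) * (\<integral>\<^sup>+x. ennreal (\<bar>f x\<bar> powr r) \<partial>M)"
proof -
  let ?M = "\<lambda>e. weighted_max (\<lambda>_. 1) (\<tau> ^^ e) (\<lambda>x. \<bar>f x\<bar>)"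
  let ?A = "{1..(2::nat) ^ Suc i}"
  define I where "I = (\<integral>\<^sup>+x. ennreal (\<bar>f x\<bar> powr r) \<partial>M)"
  define K where "K = 2 powr r * r / (r - 1)"
  define D where "D = (\<Sum>e\<in>?A. 2 / real e)"
  have K: "K \<ge> 0" using r by (simp add: K_def)
  have Mm[measurable]: "?M e \<in> borel_measurable M" for e
    by (rule measurable_weighted_max[OF dynamical_system_funpow[OF ds]]) measurable
  have PM[measurable]: "(\<lambda>x. ennreal_powr (?M e x) r) \<in> borel_measurable M" for e
    by (rule measurable_compose[OF Mm ennreal_powr_measurable])
  have MI: "(\<integral>\<^sup>+x. ennreal_powr (?M e x) r \<partial>M) \<le> ennreal K * I" for e
  proof -
    have "(\<integral>\<^sup>+x. ennreal_powr (?M e x) r \<partial>M)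
        \<le> ennreal (1 * 2 powr r * r / (r - 1)) * (\<integral>\<^sup>+x. ennreal (\<bar>f x\<bar> powr r) \<partial>M)"
      by (rule weak_type_imp_strong_type[OF weak_type_one admissible_one])
         (use r dynamical_system_funpow[OF ds] in auto)
    then show ?thesis by (simp add: K_def I_def)
  qed
  have D: "D = 2 * harm (2 ^ Suc i)"
    unfolding D_def harm_def by (simp add: sum_distrib_left divide_inverse)
  have "D \<le> 2 * (1 + real (Suc i))" unfolding D by (intro mult_left_mono harm_power2_le) auto
  then have D4: "D \<le> 4 * (real i + 1)" by simp
  have D1: "D \<ge> 1"
  proof -
    have "2 / real 1 \<le> D" unfolding D_def by (rule member_le_sum) auto
    then show ?thesis by simp
  qed
  have "(\<integral>\<^sup>+x. ennreal_powr (block_max \<tau> f h i x) r \<partial>M)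
      \<le> (\<integral>\<^sup>+x. ennreal (D powr (r - 1)) * (\<Sum>e\<in>?A. ennreal (2 / real e) * ennreal_powr (?M e x) r) \<partial>M)"
  proof (rule nn_integral_mono)
    fix x
    have "ennreal_powr (block_max \<tau> f h i x) r \<le> ennreal_powr (\<Sum>e\<in>?A. ennreal (2 / real e) * ?M e x) r"
      using r by (intro ennreal_powr_mono block_max_le_averages) auto
    also have "\<dots> \<le> ennreal (D powr (r - 1)) * (\<Sum>e\<in>?A. ennreal (2 / real e) * ennreal_powr (?M e x) r)"
      unfolding D_def by (rule ennreal_powr_sum_jensen) (use r in auto)
    finally show "ennreal_powr (block_max \<tau> f h i x) r \<le> \<dots>" .
  qed
  also have "\<dots> = ennreal (D powr (r - 1)) * (\<Sum>e\<in>?A. ennreal (2 / real e) * (\<integral>\<^sup>+x. ennreal_powr (?M e x) r \<partial>M))"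
    by (subst nn_integral_cmult, measurable, subst nn_integral_sum, measurable, subst nn_integral_cmult, auto)
  also have "\<dots> \<le> ennreal (D powr (r - 1)) * (\<Sum>e\<in>?A. ennreal (2 / real e) * (ennreal K * I))"
    by (intro mult_left_mono sum_mono MI) auto
  also have "(\<Sum>e\<in>?A. ennreal (2 / real e) * (ennreal K * I)) = ennreal D * (ennreal K * I)"
  proof -
    have "(\<Sum>e\<in>?A. ennreal (2 / real e)) = ennreal D" unfolding D_def by (rule sum_ennreal) simp
    then show ?thesis by (simp only: sum_distrib_right[symmetric])
  qed
  also have "ennreal (D powr (r - 1)) * (ennreal D * (ennreal K * I)) = ennreal (D powr (r - 1) * (D * K)) * I"
    using D1 K by (simp add: ennreal_mult_mult)
  also have "\<dots> \<le> ennreal (16 * (real i + 1)\<^sup>2 * K) * I"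
  proof (intro mult_right_mono ennreal_leI)
    have "D powr (r - 1) * (D * K) = D powr r * K" using D1 by (simp add: powr_diff)
    also have "D powr r \<le> D powr 2" using D1 r by (intro powr_mono) auto
    also have "D powr 2 = D\<^sup>2" using D1 by simp
    also have "D\<^sup>2 \<le> (4 * (real i + 1))\<^sup>2" using D1 D4 by (intro power_mono) auto
    also have "\<dots> = 16 * (real i + 1)\<^sup>2" by (simp only: power_mult_distrib) simp
    finally show "D powr (r - 1) * (D * K) \<le> 16 * (real i + 1)\<^sup>2 * K" using K by (simp add: mult_right_mono)
  qed simp
  finally show ?thesis by (simp only: K_def I_def)
qed

lemma block_max_add:
  "block_max \<tau> (\<lambda>x. f x + g x) h i x \<le> block_max \<tau> f h i x + block_max \<tau> g h i x"
proof -
  have "ramanujan_max \<tau> (\<lambda>x. f x + g x) h i q x \<le> ramanujan_max \<tau> f h i q x + ramanujan_max \<tau> g h i q x" for q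
    unfolding ramanujan_max_def
  proof (rule SUP_least)
    fix n assume n: "n \<in> {n \<in> scales h. 4 ^ i \<le> n}"
    have "ramanujan_avg \<tau> (\<lambda>x. f x + g x) q n x = ramanujan_avg \<tau> f q n x + ramanujan_avg \<tau> g q n x"
      by (simp add: ramanujan_avg_def distrib_left sum.distrib add_divide_distrib)
    then have "ennreal \<bar>ramanujan_avg \<tau> (\<lambda>x. f x + g x) q n x\<bar>
        \<le> ennreal (\<bar>ramanujan_avg \<tau> f q n x\<bar> + \<bar>ramanujan_avg \<tau> g q n x\<bar>)"
      by (intro ennreal_leI) simp
    also have "\<dots> = ennreal \<bar>ramanujan_avg \<tau> f q n x\<bar> + ennreal \<bar>ramanujan_avg \<tau> g q n x\<bar>" by simp
    also have "\<dots> \<le> (SUP n\<in>{n \<in> scales h. 4 ^ i \<le> n}. ennreal \<bar>ramanujan_avg \<tau> f q n x\<bar>)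
        + (SUP n\<in>{n \<in> scales h. 4 ^ i \<le> n}. ennreal \<bar>ramanujan_avg \<tau> g q n x\<bar>)"
      using n by (intro add_mono SUP_upper)
    finally show "ennreal \<bar>ramanujan_avg \<tau> (\<lambda>x. f x + g x) q n x\<bar> \<le> \<dots>" .
  qed
  then show ?thesis
    unfolding block_max_def sum.distrib[symmetric] distrib_left[symmetric] by (intro sum_mono mult_left_mono) auto
qed

section \<open>A weak-type inequality by cutting at a level that depends on the block\<close>

lemma summable_poly_geometric:
  fixes \<rho> :: real
  assumes "0 < \<rho>" "\<rho> < 1"
  shows "summable (\<lambda>i. (real i + 1) ^ k * \<rho> ^ i)"
proof -
  have "(\<lambda>i. (1 + 1 / (real i + 1)) ^ k * \<rho>) \<longlonglongrightarrow> (1 + 0) ^ k * \<rho>"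
    using lim_1_over_n[THEN LIMSEQ_Suc] by (intro tendsto_intros) (simp add: add.commute)
  then have "eventually (\<lambda>i. (1 + 1 / (real i + 1)) ^ k * \<rho> < (1 + \<rho>) / 2) sequentially"
    by (rule order_tendstoD) (use assms in simp)
  then obtain N where N: "\<And>i. i \<ge> N \<Longrightarrow> (1 + 1 / (real i + 1)) ^ k * \<rho> < (1 + \<rho>) / 2"
    by (auto simp: eventually_sequentially)
  show ?thesis
  proof (rule summable_ratio_test[of "(1 + \<rho>) / 2" N])
    show "(1 + \<rho>) / 2 < 1" using assms by simp
    fix i assume "N \<le> i"
    have "real (Suc i) + 1 = (1 + 1 / (real i + 1)) * (real i + 1)" by (simp add: field_simps)
    then have "(real (Suc i) + 1) ^ k * \<rho> ^ Suc i = ((1 + 1 / (real i + 1)) ^ k * \<rho>) * ((real i + 1) ^ k * \<rho> ^ i)"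
      by (simp only: power_mult_distrib power_Suc mult_ac)
    also have "\<dots> \<le> (1 + \<rho>) / 2 * ((real i + 1) ^ k * \<rho> ^ i)"
      using N[OF \<open>N \<le> i\<close>] assms by (intro mult_right_mono) auto
    finally show "norm ((real (Suc i) + 1) ^ k * \<rho> ^ Suc i) \<le> (1 + \<rho>) / 2 * norm ((real i + 1) ^ k * \<rho> ^ i)"
      using assms by (simp add: abs_mult)
  qed
qed

lemma markov_powr:
  assumes [measurable]: "Y \<in> borel_measurable M" and s: "s > 0" and t: "t > 0"
  shows "emeasure M {x\<in>space M. ennreal t < Y x} \<le> ennreal (t powr - s) * (\<integral>\<^sup>+x. ennreal_powr (Y x) s \<partial>M)"
proof -
  have [measurable]: "(\<lambda>x. ennreal_powr (Y x) s) \<in> borel_measurable M"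
    by (rule measurable_compose[OF assms(1) ennreal_powr_measurable])
  have "{x\<in>space M. ennreal t < Y x} \<subseteq> {x\<in>space M. 1 \<le> ennreal (t powr - s) * ennreal_powr (Y x) s}"
  proof safe
    fix x assume "ennreal t < Y x"
    then have "ennreal_powr (ennreal t) s \<le> ennreal_powr (Y x) s" using s by (intro ennreal_powr_mono) auto
    then have "ennreal (t powr - s) * ennreal (t powr s) \<le> ennreal (t powr - s) * ennreal_powr (Y x) s"
      using t by (intro mult_left_mono) auto
    moreover have "ennreal (t powr - s) * ennreal (t powr s) = 1"
      using t by (simp add: powr_minus flip: ennreal_mult)
    ultimately show "1 \<le> ennreal (t powr - s) * ennreal_powr (Y x) s" by simp
  qed
  then have "emeasure M {x\<in>space M. ennreal t < Y x} \<le> emeasure M {x\<in>space M. 1 \<le> ennreal (t powr - s) * ennreal_powr (Y x) s}"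
    by (rule emeasure_mono) measurable
  also have "\<dots> \<le> ennreal (t powr - s) * (\<integral>\<^sup>+x. ennreal_powr (Y x) s * indicator (space M) x \<partial>M)"
    using nn_integral_Markov_inequality[of "\<lambda>x. ennreal_powr (Y x) s" "space M" M "ennreal (t powr - s)"] by simp
  also have "(\<integral>\<^sup>+x. ennreal_powr (Y x) s * indicator (space M) x \<partial>M) = (\<integral>\<^sup>+x. ennreal_powr (Y x) s \<partial>M)"
    by (intro nn_integral_cong) simp
  finally show ?thesis .
qed

text \<open>
  In block \<open>i\<close> each of the two parts of the function is allowed the level \<open>(2 powr - c) ^ i\<close>,
  where \<open>c = (p - 1) / 64\<close>.
\<close>
definition block_threshold :: "real \<Rightarrow> real" where
  "block_threshold p = (\<Sum>i. 2 * (2 powr - ((p - 1) / 64)) ^ i)"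

lemma two_powr_neg_less_1: "e < 0 \<Longrightarrow> (2::real) powr e < 1"
  by (simp add: powr_less_one)

text \<open>
  In block \<open>i\<close> the function is cut at \<open>L i = 2 powr (i / 4)\<close>. The bounded part is estimated in
  \<open>L\<^sup>2\<close>, where the block gains \<open>1 / 2 ^ i\<close> and the cut loses \<open>L i powr (2 - p)\<close>. The unbounded
  part is estimated in \<open>L\<^sup>r\<close> with \<open>1 < r < p\<close>, where the block loses a polynomial and the cut
  gains \<open>L i powr (r - p)\<close>. Both gains are exponential in \<open>i\<close>, so the block may be required to
  stay below a geometrically decreasing level; these levels add up to the threshold. The level is
  fixed because the cut is not invariant under scaling; other levels are reached by multiplying
  \<open>f\<close> by a constant.
\<close>
lemma sum_block_max_weak:
  assumes p: "1 < p" "p < 2"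
  obtains C where "C \<ge> 0"
    "\<And>(M :: 'a measure) \<tau> f. dynamical_system M \<tau> \<Longrightarrow> f \<in> borel_measurable M \<Longrightarrow> (\<And>x. f x \<ge> 0) \<Longrightarrow>
      emeasure M {x\<in>space M. ennreal (block_threshold p) < (\<Sum>i. block_max \<tau> f h i x)}
        \<le> ennreal C * (\<integral>\<^sup>+x. ennreal (f x powr p) \<partial>M)"
proof -
  define r where "r = (1 + p) / 2"
  define c where "c = (p - 1) / 64"
  define K where "K = 2 powr r * r / (r - 1)"
  define e1 where "e1 = - 1 + 2 * c + (2 - p) / 4"
  define e2 where "e2 = r * c - (p - r) / 4"
  define u where "u = 2 powr - c"
  have r: "1 < r" "r < p" "r \<le> 2" using p by (auto simp: r_def)
  have c: "c > 0" using p by (simp add: c_def)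
  have u: "0 < u" "u < 1" using two_powr_neg_less_1[of "- c"] c by (auto simp: u_def)
  \<comment> \<open>The exponents of 2, per unit of \<open>i\<close>, in the two estimates below: \<open>e1\<close> for the bounded part,
    \<open>e2\<close> for the unbounded part. The decay rate \<open>c\<close> of the levels is small enough for both to be
    negative.\<close>
  have e1: "e1 < 0" using p by (simp add: e1_def c_def field_simps)
  have e2: "e2 < 0"
  proof -
    have "e2 = (p - 1) * ((1 + p) / 128 - 1 / 8)" by (simp add: e2_def r_def c_def field_simps)
    also have "\<dots> < 0" using p by (intro mult_pos_neg) auto
    finally show ?thesis .
  qed
  have K: "K \<ge> 0" using r by (simp add: K_def)
  define \<alpha> where "\<alpha> i = 40000 * 2 ^ h * ((real i + 1) ^ 3 * (2 powr e1) ^ i)" for i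
  define \<beta> where "\<beta> i = 16 * K * ((real i + 1) ^ 2 * (2 powr e2) ^ i)" for i
  have s\<alpha>: "summable \<alpha>" unfolding \<alpha>_def
    by (intro summable_mult summable_poly_geometric two_powr_neg_less_1 e1) simp
  have s\<beta>: "summable \<beta>" unfolding \<beta>_def
    by (intro summable_mult summable_poly_geometric two_powr_neg_less_1 e2) simp
  have \<alpha>0: "\<alpha> i \<ge> 0" for i by (simp add: \<alpha>_def)
  have \<beta>0: "\<beta> i \<ge> 0" for i using K by (simp add: \<beta>_def)
  show thesis
  proof (rule that[of "suminf \<alpha> + suminf \<beta>"])
    show "suminf \<alpha> + suminf \<beta> \<ge> 0" using s\<alpha> s\<beta> \<alpha>0 \<beta>0 by (intro add_nonneg_nonneg suminf_nonneg)
    fix M :: "'a measure" and \<tau> and f :: "'a \<Rightarrow> real"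
    assume ds: "dynamical_system M \<tau>" and fm[measurable]: "f \<in> borel_measurable M" and f: "\<And>x. f x \<ge> 0"
    define I where "I = (\<integral>\<^sup>+x. ennreal (f x powr p) \<partial>M)"
    define L where "L i = 2 powr (real i / 4)" for i :: nat
    have L: "L i > 0" for i by (simp add: L_def)
    define g where "g i x = (if f x \<le> L i then f x else 0)" for i x
    define b where "b i x = (if f x \<le> L i then 0 else f x)" for i x
    have [measurable]: "g i \<in> borel_measurable M" "b i \<in> borel_measurable M" for i
      unfolding g_def b_def by measurable
    have bm[measurable]: "block_max \<tau> (g i) h i \<in> borel_measurable M" "block_max \<tau> (b i) h i \<in> borel_measurable M"
      "block_max \<tau> f h i \<in> borel_measurable M" for i
      by (rule measurable_block_max[OF ds], simp)+
    have ui: "u ^ i = 2 powr (- c * real i)" for i by (simp add: u_def powr_realpow[symmetric] powr_powr)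
    have small: "emeasure M {x\<in>space M. ennreal (u ^ i) < block_max \<tau> (g i) h i x} \<le> ennreal (\<alpha> i) * I" for i
    proof -
      have "(\<integral>\<^sup>+x. ennreal ((g i x)\<^sup>2) \<partial>M) \<le> (\<integral>\<^sup>+x. ennreal (L i powr (2 - p)) * ennreal (f x powr p) \<partial>M)"
      proof (rule nn_integral_mono)
        fix x
        have "(g i x)\<^sup>2 \<le> L i powr (2 - p) * f x powr p"
        proof (cases "0 < f x \<and> f x \<le> L i")
          case True
          have "(g i x)\<^sup>2 = f x powr (2 - p) * f x powr p"
            using True by (simp add: g_def flip: powr_add)
          also have "\<dots> \<le> L i powr (2 - p) * f x powr p"
            using True p by (intro mult_right_mono powr_mono2) auto
          finally show ?thesis .
        next
          case False
          then have "g i x = 0" using f[of x] by (auto simp: g_def)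
          then show ?thesis by simp
        qed
        then show "ennreal ((g i x)\<^sup>2) \<le> ennreal (L i powr (2 - p)) * ennreal (f x powr p)"
          by (simp add: ennreal_leI flip: ennreal_mult)
      qed
      also have "\<dots> = ennreal (L i powr (2 - p)) * I" unfolding I_def by (rule nn_integral_cmult) measurable
      finally have gI: "(\<integral>\<^sup>+x. ennreal ((g i x)\<^sup>2) \<partial>M) \<le> ennreal (L i powr (2 - p)) * I" .
      have "emeasure M {x\<in>space M. ennreal (u ^ i) < block_max \<tau> (g i) h i x}
          \<le> ennreal ((u ^ i) powr - 2) * (\<integral>\<^sup>+x. ennreal_powr (block_max \<tau> (g i) h i x) 2 \<partial>M)"
        by (rule markov_powr) (use u in auto)
      also have "\<dots> \<le> ennreal ((u ^ i) powr - 2) * (ennreal (40000 * 2 ^ h * (real i + 1) ^ 3 / 2 ^ i) * (\<integral>\<^sup>+x. ennreal ((g i x)\<^sup>2) \<partial>M))"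
        unfolding ennreal_powr_two by (intro mult_left_mono block_max_L2[OF ds]) auto
      also have "\<dots> \<le> ennreal ((u ^ i) powr - 2) * (ennreal (40000 * 2 ^ h * (real i + 1) ^ 3 / 2 ^ i) * (ennreal (L i powr (2 - p)) * I))"
        by (intro mult_left_mono gI) auto
      also have "\<dots> = ennreal ((u ^ i) powr - 2 * ((40000 * 2 ^ h * (real i + 1) ^ 3 / 2 ^ i) * L i powr (2 - p))) * I"
        by (simp add: ennreal_mult_mult)
      also have "(u ^ i) powr - 2 * ((40000 * 2 ^ h * (real i + 1) ^ 3 / 2 ^ i) * L i powr (2 - p)) = \<alpha> i"
      proof -
        have p1: "(u ^ i) powr - 2 = 2 powr (2 * c * real i)" unfolding ui powr_powr by (simp add: mult_ac)
        have p2: "(1::real) / 2 ^ i = 2 powr (- real i)" by (simp add: powr_minus powr_realpow divide_inverse)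
        have p3: "L i powr (2 - p) = 2 powr ((2 - p) / 4 * real i)" unfolding L_def powr_powr by (simp add: mult.commute)
        have "2 powr (2 * c * real i) * 2 powr (- real i) * 2 powr ((2 - p) / 4 * real i) = 2 powr (e1 * real i)"
          unfolding powr_add[symmetric] by (rule arg_cong[where f = "(powr) 2"]) (simp add: e1_def algebra_simps)
        then have p4: "(u ^ i) powr - 2 * (1 / 2 ^ i) * L i powr (2 - p) = (2 powr e1) ^ i"
          unfolding p1 p2 p3 by (simp add: powr_power mult.commute)
        have "(u ^ i) powr - 2 * ((40000 * 2 ^ h * (real i + 1) ^ 3 / 2 ^ i) * L i powr (2 - p))
            = 40000 * 2 ^ h * ((real i + 1) ^ 3 * ((u ^ i) powr - 2 * (1 / 2 ^ i) * L i powr (2 - p)))"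
          by simp
        then show ?thesis unfolding p4 \<alpha>_def .
      qed
      finally show ?thesis .
    qed
    have large: "emeasure M {x\<in>space M. ennreal (u ^ i) < block_max \<tau> (b i) h i x} \<le> ennreal (\<beta> i) * I" for i
    proof -
      have "(\<integral>\<^sup>+x. ennreal (\<bar>b i x\<bar> powr r) \<partial>M) \<le> (\<integral>\<^sup>+x. ennreal (L i powr (r - p)) * ennreal (f x powr p) \<partial>M)"
      proof (rule nn_integral_mono)
        fix x
        have "\<bar>b i x\<bar> powr r \<le> L i powr (r - p) * f x powr p"
        proof (cases "f x \<le> L i")
          case False
          have "\<bar>b i x\<bar> powr r = f x powr (r - p) * f x powr p"
            using False L[of i] by (simp add: b_def flip: powr_add)
          also have "\<dots> \<le> L i powr (r - p) * f x powr p"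
            using False L[of i] r by (intro mult_right_mono powr_mono2') auto
          finally show ?thesis .
        qed (simp add: b_def)
        then show "ennreal (\<bar>b i x\<bar> powr r) \<le> ennreal (L i powr (r - p)) * ennreal (f x powr p)"
          by (simp add: ennreal_leI flip: ennreal_mult)
      qed
      also have "\<dots> = ennreal (L i powr (r - p)) * I" unfolding I_def by (rule nn_integral_cmult) measurable
      finally have bI: "(\<integral>\<^sup>+x. ennreal (\<bar>b i x\<bar> powr r) \<partial>M) \<le> ennreal (L i powr (r - p)) * I" .
      have "emeasure M {x\<in>space M. ennreal (u ^ i) < block_max \<tau> (b i) h i x}
          \<le> ennreal ((u ^ i) powr - r) * (\<integral>\<^sup>+x. ennreal_powr (block_max \<tau> (b i) h i x) r \<partial>M)"
        by (rule markov_powr) (use u r in auto)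
      also have "\<dots> \<le> ennreal ((u ^ i) powr - r) * (ennreal (16 * (real i + 1)\<^sup>2 * K) * (\<integral>\<^sup>+x. ennreal (\<bar>b i x\<bar> powr r) \<partial>M))"
        unfolding K_def by (intro mult_left_mono block_max_Lr[OF ds]) (use r in auto)
      also have "\<dots> \<le> ennreal ((u ^ i) powr - r) * (ennreal (16 * (real i + 1)\<^sup>2 * K) * (ennreal (L i powr (r - p)) * I))"
        by (intro mult_left_mono bI) auto
      also have "\<dots> = ennreal ((u ^ i) powr - r * ((16 * (real i + 1)\<^sup>2 * K) * L i powr (r - p))) * I"
        using K by (simp add: ennreal_mult_mult)
      also have "(u ^ i) powr - r * ((16 * (real i + 1)\<^sup>2 * K) * L i powr (r - p)) = \<beta> i"
      proof -
        have p1: "(u ^ i) powr - r = 2 powr (r * c * real i)" unfolding ui powr_powr by (simp add: mult_ac)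
        have p3: "L i powr (r - p) = 2 powr ((r - p) / 4 * real i)" unfolding L_def powr_powr by (simp add: mult.commute)
        have "2 powr (r * c * real i) * 2 powr ((r - p) / 4 * real i) = 2 powr (e2 * real i)"
          unfolding powr_add[symmetric]
          by (rule arg_cong[where f = "(powr) 2"]) (simp add: e2_def algebra_simps diff_divide_distrib)
        then have p4: "(u ^ i) powr - r * L i powr (r - p) = (2 powr e2) ^ i"
          unfolding p1 p3 by (simp add: powr_power mult.commute)
        have "(u ^ i) powr - r * ((16 * (real i + 1)\<^sup>2 * K) * L i powr (r - p))
            = 16 * K * ((real i + 1)\<^sup>2 * ((u ^ i) powr - r * L i powr (r - p)))"
          by simp
        then show ?thesis unfolding p4 \<beta>_def .
      qed
      finally show ?thesis .
    qed
    let ?B = "\<lambda>i. {x\<in>space M. ennreal (u ^ i) < block_max \<tau> (g i) h i x} \<union> {x\<in>space M. ennreal (u ^ i) < block_max \<tau> (b i) h i x}"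
    have sub: "{x\<in>space M. ennreal (block_threshold p) < (\<Sum>i. block_max \<tau> f h i x)} \<subseteq> (\<Union>i. ?B i)"
    proof (rule ccontr)
      assume "\<not> ?thesis"
      then obtain x where x: "ennreal (block_threshold p) < (\<Sum>i. block_max \<tau> f h i x)" "x \<in> space M" "\<And>i. x \<notin> ?B i" by blast
      have "block_max \<tau> f h i x \<le> ennreal (2 * u ^ i)" for i
      proof -
        have "f = (\<lambda>x. g i x + b i x)" by (auto simp: g_def b_def)
        then have "block_max \<tau> f h i x \<le> block_max \<tau> (g i) h i x + block_max \<tau> (b i) h i x"
          using block_max_add[of \<tau> "g i" "b i" h i x] by simp
        also have "\<dots> \<le> ennreal (u ^ i) + ennreal (u ^ i)"
          using x(2) x(3)[of i] by (intro add_mono) (auto simp: not_less)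
        also have "\<dots> = ennreal (2 * u ^ i)" using u by (simp flip: ennreal_plus)
        finally show ?thesis .
      qed
      then have "(\<Sum>i. block_max \<tau> f h i x) \<le> (\<Sum>i. ennreal (2 * u ^ i))" by (intro suminf_le) auto
      also have "\<dots> = ennreal (block_threshold p)"
        unfolding block_threshold_def u_def[unfolded c_def, symmetric]
        using u by (intro suminf_ennreal2 summable_mult summable_geometric) auto
      finally show False using x(1) by simp
    qed
    have "emeasure M {x\<in>space M. ennreal (block_threshold p) < (\<Sum>i. block_max \<tau> f h i x)} \<le> emeasure M (\<Union>i. ?B i)"
      by (rule emeasure_mono[OF sub]) measurable
    also have "\<dots> \<le> (\<Sum>i. emeasure M (?B i))" by (rule emeasure_subadditive_countably) auto
    also have "\<dots> \<le> (\<Sum>i. ennreal (\<alpha> i + \<beta> i) * I)"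
    proof (intro suminf_le)
      fix i
      have "emeasure M (?B i) \<le> emeasure M {x\<in>space M. ennreal (u ^ i) < block_max \<tau> (g i) h i x}
          + emeasure M {x\<in>space M. ennreal (u ^ i) < block_max \<tau> (b i) h i x}"
        by (rule emeasure_subadditive) measurable
      also have "\<dots> \<le> ennreal (\<alpha> i) * I + ennreal (\<beta> i) * I" by (intro add_mono small large)
      also have "\<dots> = ennreal (\<alpha> i + \<beta> i) * I" using \<alpha>0 \<beta>0 by (simp add: distrib_right)
      finally show "emeasure M (?B i) \<le> ennreal (\<alpha> i + \<beta> i) * I" .
    qed auto
    also have "\<dots> = (\<Sum>i. ennreal (\<alpha> i + \<beta> i)) * I" by (rule ennreal_suminf_multc)
    also have "(\<Sum>i. ennreal (\<alpha> i + \<beta> i)) = ennreal (suminf \<alpha> + suminf \<beta>)"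
      using \<alpha>0 \<beta>0 by (intro suminf_ennreal_eq sums_add summable_sums s\<alpha> s\<beta>) auto
    finally show "emeasure M {x\<in>space M. ennreal (block_threshold p) < (\<Sum>i. block_max \<tau> f h i x)}
        \<le> ennreal (suminf \<alpha> + suminf \<beta>) * (\<integral>\<^sup>+x. ennreal (f x powr p) \<partial>M)" unfolding I_def .
  qed
qed

section \<open>The number of divisors\<close>

definition divisor_count :: "nat \<Rightarrow> real" where
  "divisor_count k = real (card {e. e dvd k})"

lemma divisor_count_nonneg: "divisor_count k \<ge> 0"
  by (simp add: divisor_count_def)

lemma sum_divisor_count:
  "(\<Sum>k=1..n. divisor_count k * F k) = (\<Sum>m=1..n. \<Sum>j=1..n div m. F (m * j))"
proof -
  have "(\<Sum>k=1..n. divisor_count k * F k) = (\<Sum>k=1..n. (\<Sum>m | m \<in> {1..k} \<and> m dvd k. 1 * 1) * F k)"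
  proof (rule sum.cong[OF refl])
    fix k assume k: "k \<in> {1..n}"
    have "{m. m \<in> {1..k} \<and> m dvd k} = {e. e dvd k}"
      using k by (auto simp: dvd_imp_le Suc_le_eq intro: Nat.gr0I)
    then show "divisor_count k * F k = (\<Sum>m | m \<in> {1..k} \<and> m dvd k. 1 * 1) * F k"
      by (simp add: divisor_count_def)
  qed
  also have "\<dots> = (\<Sum>m=1..n. 1 * (\<Sum>j=1..n div m. 1 * F (m * j)))"
    by (rule sum_divisor_convolution[where b = "\<lambda>m. m"]) simp
  finally show ?thesis by simp
qed

lemma weight_sum_divisor_count: "weight_sum divisor_count n = (\<Sum>m=1..n. real (n div m))"
  using sum_divisor_count[where n = n and F = "\<lambda>_. 1"] weight_sum_eq[of divisor_count n] divisor_count_nonneg by simp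

lemma sum_inverse_harm: "(\<Sum>m=1..n. c / real m) = c * harm n"
  by (simp add: harm_def sum_distrib_left divide_inverse)

lemma weight_sum_divisor_count_le: "weight_sum divisor_count n \<le> real n * harm n"
  unfolding weight_sum_divisor_count sum_inverse_harm[symmetric] by (intro sum_mono real_div_le)

lemma weight_sum_divisor_count_ge: "real n * harm n - real n \<le> weight_sum divisor_count n"
proof -
  have "real n * harm n - real n = (\<Sum>m=1..n. real n / real m - 1)"
    by (simp only: sum_subtractf sum_inverse_harm) simp
  also have "\<dots> \<le> (\<Sum>m=1..n. real (n div m))"
    by (intro sum_mono less_imp_le real_div_gt)
  finally show ?thesis unfolding weight_sum_divisor_count .
qed

lemma weight_sum_divisor_count_ge_half: "real n / 2 * harm n \<le> weight_sum divisor_count n"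
proof -
  have "real n / 2 * harm n = (\<Sum>m=1..n. (real n / 2) / real m)" by (simp only: sum_inverse_harm)
  also have "\<dots> \<le> (\<Sum>m=1..n. real (n div m))"
  proof (rule sum_mono)
    fix m assume m: "m \<in> {1..n}"
    have "n div m \<ge> 1" using m by (simp add: less_eq_div_iff_mult_less_eq)
    then have "real (n div m) \<ge> 1" using of_nat_mono[of 1 "n div m", where ?'a = real] by simp
    then have "real n / real m \<le> 2 * real (n div m)" using real_div_gt[of n m] by linarith
    then show "(real n / 2) / real m \<le> real (n div m)" by simp
  qed
  finally show ?thesis unfolding weight_sum_divisor_count .
qed

lemma harm_ge_1: "n \<ge> 1 \<Longrightarrow> harm n \<ge> (1::real)"
  using harm_mono[of 1 n, where ?'a = real] by (simp add: harm_def)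

lemma weight_sum_divisor_count_pos:
  assumes "n \<ge> 1"
  shows "weight_sum divisor_count n > 0"
proof -
  have "harm n > (0::real)" using assms by (intro harm_pos) simp
  then have "0 < real n / 2 * harm n" using assms by (intro mult_pos_pos) auto
  then show ?thesis using weight_sum_divisor_count_ge_half[of n] by linarith
qed

lemma admissible_divisor_count: "admissible_weight divisor_count"
proof -
  have bd: "real n / 2 \<le> weight_sum divisor_count n" if "n \<ge> 1" for n
  proof -
    have "real n / 2 * 1 \<le> real n / 2 * harm n" using harm_ge_1[OF that] by (intro mult_left_mono) auto
    then show ?thesis using weight_sum_divisor_count_ge_half[of n] by linarith
  qed
  have lim: "filterlim (\<lambda>n. 1 / 2 * real n) at_top sequentially"
    by (intro filterlim_tendsto_pos_mult_at_top[OF tendsto_const] filterlim_real_sequentially) auto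
  have "filterlim (weight_sum divisor_count) at_top sequentially"
  proof (rule filterlim_at_top_mono[OF lim], rule eventually_sequentiallyI[of 1])
    fix n :: nat assume "1 \<le> n"
    then show "1 / 2 * real n \<le> weight_sum divisor_count n" using bd[of n] by simp
  qed
  moreover have "weight_sum divisor_count n \<noteq> 0" if "n \<ge> 1" for n
    using weight_sum_divisor_count_pos[OF that] by simp
  ultimately show ?thesis by (simp add: admissible_weight_def)
qed

definition isqrt :: "nat \<Rightarrow> nat" where
  "isqrt n = nat \<lfloor>sqrt (real n)\<rfloor>"

lemma isqrt_le: "real (isqrt n) \<le> sqrt (real n)"
  by (simp add: isqrt_def)

lemma isqrt_gt: "sqrt (real n) - 1 < real (isqrt n)"
  by (simp add: isqrt_def)

lemma isqrt_square_le: "isqrt n * isqrt n \<le> n"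
proof -
  have "real (isqrt n) * real (isqrt n) \<le> sqrt (real n) * sqrt (real n)"
    by (intro mult_mono isqrt_le) auto
  then show ?thesis by (simp flip: of_nat_mult)
qed

lemma less_isqrt_Suc_square: "n < Suc (isqrt n) * Suc (isqrt n)"
proof -
  have "sqrt (real n) < real (Suc (isqrt n))" using isqrt_gt[of n] by simp
  then have "sqrt (real n) * sqrt (real n) < real (Suc (isqrt n)) * real (Suc (isqrt n))"
    by (intro mult_strict_mono) auto
  then show ?thesis by (simp flip: of_nat_mult del: of_nat_Suc)
qed

text \<open>
  Dirichlet's hyperbola method. Of two factors with product at most \<open>n\<close> at least one is at most
  \<open>isqrt n\<close>; pairs where both are that small are counted twice. Large divisors, for which no
  averaging takes place, are thereby eliminated.
\<close>
lemma divisor_count_hyperbola: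
  fixes F :: "nat \<Rightarrow> real" and n :: nat
  defines "r \<equiv> isqrt n"
  shows "(\<Sum>k=1..n. divisor_count k * F k)
    = 2 * (\<Sum>d=1..r. \<Sum>e=1..n div d. F (d * e)) - (\<Sum>d=1..r. \<Sum>e=1..r. F (d * e))"
proof -
  let ?g = "\<lambda>(d, e). F (d * e)"
  define A where "A = (SIGMA d:{1..r}. {1..n div d})"
  define B where "B = prod.swap ` A"
  define P where "P = (SIGMA d:{1..n}. {1..n div d})"
  have rn: "r \<le> n" using isqrt_square_le[of n] by (cases "r = 0") (auto simp: r_def intro: le_trans[rotated])
  have mem: "(d, e) \<in> P \<longleftrightarrow> d \<ge> 1 \<and> e \<ge> 1 \<and> d * e \<le> n" for d e
  proof -
    have "d \<ge> 1 \<Longrightarrow> e \<le> n div d \<longleftrightarrow> d * e \<le> n" by (simp add: less_eq_div_iff_mult_less_eq mult.commute)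
    moreover have "d \<le> n" if "d * e \<le> n" "e \<ge> 1" 
    proof -
      have "d * 1 \<le> d * e" by (rule mult_le_mono2[OF that(2)])
      then show ?thesis using that(1) by linarith
    qed
    ultimately show ?thesis by (auto simp: P_def)
  qed
  have memA: "(d, e) \<in> A \<longleftrightarrow> (d, e) \<in> P \<and> d \<le> r" for d e using rn by (auto simp: A_def P_def)
  have memB: "(d, e) \<in> B \<longleftrightarrow> (d, e) \<in> P \<and> e \<le> r" for d e
    unfolding B_def pair_in_swap_image memA mem by (auto simp: mult.commute)
  have finA: "finite A" by (simp add: A_def)
  have finB: "finite B" by (simp add: B_def finA)
  have un: "A \<union> B = P"
  proof (rule set_eqI)
    fix z :: "nat \<times> nat"
    obtain d e where z: "z = (d, e)" by (cases z)
    have "d \<le> r \<or> e \<le> r" if "d * e \<le> n"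
    proof (rule ccontr)
      assume "\<not> ?thesis"
      then have "Suc r * Suc r \<le> d * e" by (intro mult_mono) auto
      then show False using that less_isqrt_Suc_square[of n] unfolding r_def by linarith
    qed
    then show "z \<in> A \<union> B \<longleftrightarrow> z \<in> P" unfolding z Un_iff memA memB using mem by blast
  qed
  have int: "A \<inter> B = {1..r} \<times> {1..r}"
  proof (rule set_eqI)
    fix z :: "nat \<times> nat"
    obtain d e where z: "z = (d, e)" by (cases z)
    have "d * e \<le> n" if "d \<le> r" "e \<le> r"
      using mult_mono[OF that] isqrt_square_le[of n] unfolding r_def by linarith
    then show "z \<in> A \<inter> B \<longleftrightarrow> z \<in> {1..r} \<times> {1..r}" unfolding z Int_iff memA memB mem by auto
  qed
  have sumA: "(\<Sum>d=1..r. \<Sum>e=1..n div d. F (d * e)) = sum ?g A"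
    unfolding A_def by (subst sum.Sigma) auto
  have sumB: "sum ?g B = sum ?g A"
    unfolding B_def by (subst sum.reindex) (auto simp: mult.commute case_prod_beta)
  have sumP: "(\<Sum>k=1..n. divisor_count k * F k) = sum ?g P"
    unfolding P_def sum_divisor_count by (subst sum.Sigma) auto
  have sumI: "(\<Sum>d=1..r. \<Sum>e=1..r. F (d * e)) = sum ?g ({1..r} \<times> {1..r})"
    by (subst sum.cartesian_product) simp
  have "sum ?g (A \<union> B) + sum ?g (A \<inter> B) = sum ?g A + sum ?g B" by (rule sum.union_inter[OF finA finB])
  then show ?thesis unfolding sumA sumP sumI un int sumB by simp
qed

text \<open>
  Insert \<open>sum_ramanujan\<close> for the indicator of divisibility by \<open>d\<close> and exchange the sums over \<open>d\<close>
  and \<open>q\<close>: the reciprocals of the multiples of \<open>q\<close> up to \<open>r\<close> add up to \<open>harm (r div q) / q\<close>.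
  Unlike the averages over multiples of \<open>d\<close>, the averages weighted by Ramanujan sums are nearly
  orthogonal for different \<open>q\<close>.
\<close>
lemma sum_short_divisors_ramanujan:
  assumes n: "n \<ge> 1"
  shows "(\<Sum>d=1..r. \<Sum>e=1..n div d. f ((\<tau> ^^ (d * e)) x))
    = real n * (\<Sum>q=1..r. harm (r div q) / real q * ramanujan_avg \<tau> f q n x)"
proof -
  have "(\<Sum>d=1..r. \<Sum>e=1..n div d. f ((\<tau> ^^ (d * e)) x))
      = (\<Sum>d=1..r. \<Sum>q | q \<in> {1..r} \<and> q dvd d. real n * ramanujan_avg \<tau> f q n x / real d)"
  proof (rule sum.cong[OF refl])
    fix d assume d: "d \<in> {1..r}"
    have "real d * (\<Sum>e=1..n div d. f ((\<tau> ^^ (d * e)) x)) = (\<Sum>k=1..n. if d dvd k then real d * f ((\<tau> ^^ k) x) else 0)"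
      using sum_multiples[of d "\<lambda>k. real d * f ((\<tau> ^^ k) x)" n] d by (simp add: sum_distrib_left)
    also have "\<dots> = (\<Sum>k=1..n. (\<Sum>q | q dvd d. ramanujan q k) * f ((\<tau> ^^ k) x))"
      using d by (intro sum.cong refl) (simp add: sum_ramanujan)
    also have "\<dots> = (\<Sum>q | q dvd d. \<Sum>k=1..n. ramanujan q k * f ((\<tau> ^^ k) x))"
      by (simp only: sum_distrib_right) (rule sum.swap)
    also have "\<dots> = (\<Sum>q | q dvd d. real n * ramanujan_avg \<tau> f q n x)"
      using n by (simp add: ramanujan_avg_def)
    also have "{q. q dvd d} = {q. q \<in> {1..r} \<and> q dvd d}"
      using d by (auto simp: Suc_le_eq intro: Nat.gr0I le_trans[OF dvd_imp_le])
    finally have "(\<Sum>e=1..n div d. f ((\<tau> ^^ (d * e)) x)) = (\<Sum>q | q \<in> {1..r} \<and> q dvd d. real n * ramanujan_avg \<tau> f q n x) / real d"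
      using d by (simp add: field_simps)
    then show "(\<Sum>e=1..n div d. f ((\<tau> ^^ (d * e)) x))
        = (\<Sum>q | q \<in> {1..r} \<and> q dvd d. real n * ramanujan_avg \<tau> f q n x / real d)"
      by (simp only: sum_divide_distrib)
  qed
  also have "\<dots> = (\<Sum>q=1..r. \<Sum>d | d \<in> {1..r} \<and> q dvd d. real n * ramanujan_avg \<tau> f q n x / real d)"
    by (rule sum.swap_restrict) auto
  also have "\<dots> = (\<Sum>q=1..r. real n * (harm (r div q) / real q * ramanujan_avg \<tau> f q n x))"
  proof (rule sum.cong[OF refl])
    fix q assume q: "q \<in> {1..r}"
    have "(\<Sum>d | d \<in> {1..r} \<and> q dvd d. 1 / real d) = (\<Sum>d=1..r. if q dvd d then 1 / real d else 0)"
      by (rule sum.inter_filter) simp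
    also have "\<dots> = (\<Sum>j=1..r div q. 1 / real (q * j))" using q by (intro sum_multiples) auto
    also have "\<dots> = (\<Sum>j=1..r div q. (1 / real q) / real j)" by simp
    also have "\<dots> = harm (r div q) / real q" by (simp only: sum_inverse_harm) simp
    finally have h: "(\<Sum>d | d \<in> {1..r} \<and> q dvd d. 1 / real d) = harm (r div q) / real q" .
    have "(\<Sum>d | d \<in> {1..r} \<and> q dvd d. real n * ramanujan_avg \<tau> f q n x / real d)
        = real n * ramanujan_avg \<tau> f q n x * (\<Sum>d | d \<in> {1..r} \<and> q dvd d. 1 / real d)"
      by (simp add: sum_distrib_left)
    then show "(\<Sum>d | d \<in> {1..r} \<and> q dvd d. real n * ramanujan_avg \<tau> f q n x / real d)
        = real n * (harm (r div q) / real q * ramanujan_avg \<tau> f q n x)" unfolding h by simp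
  qed
  also have "\<dots> = real n * (\<Sum>q=1..r. harm (r div q) / real q * ramanujan_avg \<tau> f q n x)"
    by (simp add: sum_distrib_left)
  finally show ?thesis .
qed

lemma sum_dyadic_blocks:
  fixes y :: "nat \<Rightarrow> 'b::comm_monoid_add"
  shows "(\<Sum>q\<in>{1..<2 ^ I}. y q) = (\<Sum>i<I. \<Sum>q\<in>block i. y q)"
proof (induction I)
  case (Suc I)
  have "{1..<(2::nat) ^ Suc I} = {1..<2 ^ I} \<union> block I" by (auto simp: block_def)
  moreover have "{1..<(2::nat) ^ I} \<inter> block I = {}" by (auto simp: block_def)
  ultimately have "(\<Sum>q\<in>{1..<2 ^ Suc I}. y q) = (\<Sum>q\<in>{1..<2 ^ I}. y q) + (\<Sum>q\<in>block I. y q)"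
    by (simp add: sum.union_disjoint)
  then show ?case using Suc by simp
qed simp

text \<open>
  The times for which \<open>q\<close> survives in the hyperbola method.
\<close>
definition tail_max :: "('a \<Rightarrow> 'a) \<Rightarrow> ('a \<Rightarrow> real) \<Rightarrow> nat \<Rightarrow> nat \<Rightarrow> 'a \<Rightarrow> ennreal" where
  "tail_max \<tau> f h q x = (SUP n\<in>{n\<in>scales h. q * q \<le> n}. ennreal \<bar>ramanujan_avg \<tau> f q n x\<bar>)"

lemma sum_tail_max_le:
  "(\<Sum>q=1..r. ennreal (1 / real q) * tail_max \<tau> f h q x) \<le> (\<Sum>i. block_max \<tau> f h i x)"
proof -
  let ?y = "\<lambda>q. ennreal (1 / real q) * tail_max \<tau> f h q x"
  have "r < 2 ^ Suc r" using less_exp[of "Suc r"] by linarith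
  then have "(\<Sum>q=1..r. ?y q) \<le> (\<Sum>q\<in>{1..<2 ^ Suc r}. ?y q)" by (intro sum_mono2) auto
  also have "\<dots> = (\<Sum>i<Suc r. \<Sum>q\<in>block i. ?y q)" by (rule sum_dyadic_blocks)
  also have "\<dots> \<le> (\<Sum>i<Suc r. block_max \<tau> f h i x)"
    unfolding block_max_def
  proof (intro sum_mono mult_left_mono)
    fix i q assume q: "q \<in> block i"
    then have "2 ^ i * 2 ^ i \<le> q * q" by (intro mult_mono) (auto simp: block_def)
    then have "4 ^ i \<le> q * q" by (simp flip: power_mult_distrib)
    then show "tail_max \<tau> f h q x \<le> ramanujan_max \<tau> f h i q x"
      unfolding tail_max_def ramanujan_max_def by (intro SUP_subset_mono) auto
  qed simp
  also have "\<dots> \<le> (\<Sum>i. block_max \<tau> f h i x)" by (rule sum_le_suminf) auto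
  finally show ?thesis .
qed

text \<open>
  As \<open>f \<ge> 0\<close>, the time \<open>n\<close> may be rounded up to a power of 2 at the cost of a constant, and the
  subtracted term of the hyperbola identity may be dropped. The logarithmic factors
  \<open>harm (r div q)\<close> are absorbed by the total weight, which is of order \<open>n * harm n\<close>.
\<close>
lemma divisor_count_max_le_blocks:
  fixes f :: "'a \<Rightarrow> real"
  assumes f: "\<And>x. f x \<ge> 0"
  shows "weighted_max divisor_count \<tau> f x \<le> ennreal 16 * (\<Sum>i. block_max \<tau> f 0 i x)"
  unfolding weighted_max_def
proof (rule SUP_least)
  fix n :: nat assume "n \<in> {1..}"
  then have n: "n \<ge> 1" by simp
  obtain j where j: "n \<le> 2 ^ j" "2 ^ j < 2 * n"
  proof -
    define j where "j = (LEAST j. n \<le> 2 ^ j)"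
    have ex: "n \<le> 2 ^ n" using less_exp[of n] by simp
    have le: "n \<le> 2 ^ j" unfolding j_def using ex by (rule LeastI)
    have "2 ^ j < 2 * n"
    proof (cases j)
      case (Suc i)
      then have "\<not> n \<le> 2 ^ i" using not_less_Least[of i "\<lambda>j. n \<le> 2 ^ j"] by (simp add: j_def)
      then show ?thesis by (simp add: Suc)
    qed (use n in simp)
    then show thesis using le that by blast
  qed
  define N where "N = (2::nat) ^ j"
  define r where "r = isqrt N"
  let ?V = "weight_sum divisor_count"
  let ?S = "\<Sum>q=1..r. 1 / real q * \<bar>ramanujan_avg \<tau> f q N x\<bar>"
  have N: "N \<ge> 1" "n \<le> N" "N < 2 * n" using j by (auto simp: N_def)
  have Ns: "N \<in> scales 0" unfolding scales_def N_def by (intro CollectI exI[of _ 1] exI[of _ j]) simp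
  have r2: "r * r \<le> N" unfolding r_def by (rule isqrt_square_le)
  have S0: "?S \<ge> 0" by (simp add: sum_nonneg)
  \<comment> \<open>In fact \<open>r \<le> n\<close>, since \<open>r * r \<le> N < 2 * n\<close>.\<close>
  have hr: "harm r \<le> 2 * (harm n :: real)"
  proof (cases "r \<le> n")
    case True
    then show ?thesis using harm_mono[OF True, where ?'a = real] harm_nonneg[of n, where ?'a = real] by linarith
  next
    case False
    then have "n * n < r * r" by (intro mult_strict_mono) auto
    then have "n * n < 2 * n" using r2 N by linarith
    then have "n = 1" using n by auto
    then have "r * r < 2" using r2 N by linarith
    have "r \<le> 1"
    proof (rule ccontr)
      assume "\<not> r \<le> 1"
      then have "2 * 2 \<le> r * r" by (intro mult_mono) auto
      then show False using \<open>r * r < 2\<close> by simp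
    qed
    then show ?thesis using False \<open>n = 1\<close> by simp
  qed
  have "(\<Sum>k=1..n. divisor_count k * f ((\<tau> ^^ k) x)) \<le> (\<Sum>k=1..N. divisor_count k * f ((\<tau> ^^ k) x))"
    using N f divisor_count_nonneg by (intro sum_mono2) auto
  also have "\<dots> \<le> 2 * (\<Sum>d=1..r. \<Sum>e=1..N div d. f ((\<tau> ^^ (d * e)) x))"
    using divisor_count_hyperbola[where n = N and F = "\<lambda>k. f ((\<tau> ^^ k) x)"] f by (simp add: r_def sum_nonneg)
  also have "\<dots> = 2 * (real N * (\<Sum>q=1..r. harm (r div q) / real q * ramanujan_avg \<tau> f q N x))"
    by (simp only: sum_short_divisors_ramanujan[OF N(1)])
  also have "\<dots> \<le> 2 * (real N * (harm r * ?S))"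
  proof (intro mult_left_mono)
    show "(\<Sum>q=1..r. harm (r div q) / real q * ramanujan_avg \<tau> f q N x) \<le> harm r * ?S"
      unfolding sum_distrib_left
    proof (rule sum_mono)
      fix q
      have "harm (r div q) / real q * ramanujan_avg \<tau> f q N x \<le> harm (r div q) / real q * \<bar>ramanujan_avg \<tau> f q N x\<bar>"
        by (intro mult_left_mono divide_nonneg_nonneg harm_nonneg) auto
      also have "\<dots> \<le> harm r / real q * \<bar>ramanujan_avg \<tau> f q N x\<bar>"
        by (intro mult_right_mono divide_right_mono harm_mono div_le_dividend) auto
      finally show "harm (r div q) / real q * ramanujan_avg \<tau> f q N x \<le> harm r * (1 / real q * \<bar>ramanujan_avg \<tau> f q N x\<bar>)" by simp
    qed
  qed auto
  also have "\<dots> \<le> 2 * ((2 * real n) * ((2 * harm n) * ?S))"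
    using N hr S0 harm_nonneg[of r, where ?'a = real] harm_nonneg[of n, where ?'a = real]
    by (intro mult_left_mono mult_mono mult_right_mono) auto
  also have "\<dots> = 16 * (real n / 2 * harm n) * ?S" by simp
  also have "\<dots> \<le> 16 * ?V n * ?S"
    using S0 by (intro mult_right_mono mult_left_mono weight_sum_divisor_count_ge_half) auto
  finally have "(\<Sum>k=1..n. divisor_count k * f ((\<tau> ^^ k) x)) / ?V n \<le> 16 * ?S"
    using weight_sum_divisor_count_pos[OF n] by (simp add: field_simps)
  then have "ennreal ((\<Sum>k=1..n. divisor_count k * f ((\<tau> ^^ k) x)) / ?V n) \<le> ennreal (16 * ?S)"
    by (rule ennreal_leI)
  also have "\<dots> = ennreal 16 * ennreal ?S" by (rule ennreal_mult) (use S0 in auto)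
  also have "ennreal ?S = (\<Sum>q=1..r. ennreal (1 / real q * \<bar>ramanujan_avg \<tau> f q N x\<bar>))"
    by (rule sum_ennreal[symmetric]) simp
  also have "\<dots> \<le> (\<Sum>q=1..r. ennreal (1 / real q) * tail_max \<tau> f 0 q x)"
  proof (rule sum_mono)
    fix q assume q: "q \<in> {1..r}"
    then have "q * q \<le> r * r" by (intro mult_mono) auto
    then have "q * q \<le> N" using r2 by linarith
    then have "ennreal \<bar>ramanujan_avg \<tau> f q N x\<bar> \<le> tail_max \<tau> f 0 q x"
      unfolding tail_max_def using Ns by (intro SUP_upper) simp
    then have "ennreal (1 / real q) * ennreal \<bar>ramanujan_avg \<tau> f q N x\<bar> \<le> ennreal (1 / real q) * tail_max \<tau> f 0 q x"
      by (rule mult_left_mono) simp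
    then show "ennreal (1 / real q * \<bar>ramanujan_avg \<tau> f q N x\<bar>) \<le> ennreal (1 / real q) * tail_max \<tau> f 0 q x"
      by (subst ennreal_mult) auto
  qed
  also have "\<dots> \<le> (\<Sum>i. block_max \<tau> f 0 i x)" by (rule sum_tail_max_le)
  finally show "ennreal ((\<Sum>k=1..n. divisor_count k * f ((\<tau> ^^ k) x)) / ?V n) \<le> ennreal 16 * (\<Sum>i. block_max \<tau> f 0 i x)"
    by (simp add: mult_left_mono)
qed

lemma weighted_max_scale:
  assumes "c > 0" and f: "\<And>x. f x \<ge> 0" and w: "\<And>k. k \<ge> 1 \<Longrightarrow> w k \<ge> 0"
  shows "weighted_max w \<tau> (\<lambda>x. c * f x) x = ennreal c * weighted_max w \<tau> f x"
proof -
  have "ennreal ((\<Sum>k=1..n. w k * (c * f ((\<tau> ^^ k) x))) / weight_sum w n)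
      = ennreal c * ennreal ((\<Sum>k=1..n. w k * f ((\<tau> ^^ k) x)) / weight_sum w n)" for n
  proof -
    have eq: "(\<Sum>k=1..n. w k * (c * f ((\<tau> ^^ k) x))) / weight_sum w n
        = c * ((\<Sum>k=1..n. w k * f ((\<tau> ^^ k) x)) / weight_sum w n)"
      by (simp add: sum_distrib_left mult.left_commute)
    have nn: "(\<Sum>k=1..n. w k * f ((\<tau> ^^ k) x)) / weight_sum w n \<ge> 0"
      using f w by (intro divide_nonneg_nonneg sum_nonneg mult_nonneg_nonneg weight_sum_nonneg) auto
    show ?thesis unfolding eq by (rule ennreal_mult[OF _ nn]) (use assms(1) in simp)
  qed
  then show ?thesis unfolding weighted_max_def by (simp add: SUP_mult_left_ennreal)
qed

text \<open>
  The inequality at the fixed level \<open>block_threshold p\<close> becomes the one at level \<open>t\<close> by applying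
  it to a multiple of \<open>f\<close>.
\<close>
lemma weak_type_divisor_count:
  assumes p: "1 < p" "p < 2"
  obtains C where "C \<ge> 0" "weak_type TYPE('a) p divisor_count C"
proof -
  obtain C where C: "C \<ge> 0" and bound: "\<And>(M :: 'a measure) \<tau> f. dynamical_system M \<tau> \<Longrightarrow>
      f \<in> borel_measurable M \<Longrightarrow> (\<And>x. f x \<ge> 0) \<Longrightarrow>
      emeasure M {x\<in>space M. ennreal (block_threshold p) < (\<Sum>i. block_max \<tau> f 0 i x)}
        \<le> ennreal C * (\<integral>\<^sup>+x. ennreal (f x powr p) \<partial>M)"
    using sum_block_max_weak[OF p, where h = 0] by blast
  define \<Lambda> where "\<Lambda> = block_threshold p"
  have \<Lambda>: "\<Lambda> > 0"
  proof -
    have "(2::real) powr - ((p - 1) / 64) < 1" using p by (intro two_powr_neg_less_1) simp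
    then show ?thesis unfolding \<Lambda>_def block_threshold_def
      by (intro suminf_pos summable_mult summable_geometric) auto
  qed
  have "weak_type TYPE('a) p divisor_count (C * (16 * \<Lambda>) powr p)"
    unfolding weak_type_def
  proof (intro allI impI)
    fix M :: "'a measure" and \<tau> and f :: "'a \<Rightarrow> real" and t :: real
    assume ds: "dynamical_system M \<tau>" and fm[measurable]: "f \<in> borel_measurable M" and f: "\<forall>x. 0 \<le> f x" and t: "t > 0"
    define c where "c = 16 * \<Lambda> / t"
    have c: "c > 0" using \<Lambda> t by (simp add: c_def)
    let ?g = "\<lambda>x. c * f x"
    have bm[measurable]: "block_max \<tau> ?g 0 i \<in> borel_measurable M" for i
      by (rule measurable_block_max[OF ds]) measurable
    have "emeasure M {x\<in>space M. ennreal t < weighted_max divisor_count \<tau> f x}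
        \<le> emeasure M {x\<in>space M. ennreal \<Lambda> < (\<Sum>i. block_max \<tau> ?g 0 i x)}"
    proof (rule emeasure_mono)
      show "{x\<in>space M. ennreal t < weighted_max divisor_count \<tau> f x} \<subseteq> {x\<in>space M. ennreal \<Lambda> < (\<Sum>i. block_max \<tau> ?g 0 i x)}"
      proof safe
        fix x assume x: "ennreal t < weighted_max divisor_count \<tau> f x"
        show "ennreal \<Lambda> < (\<Sum>i. block_max \<tau> ?g 0 i x)"
        proof (rule ccontr)
          assume "\<not> ?thesis"
          then have "ennreal 16 * (\<Sum>i. block_max \<tau> ?g 0 i x) \<le> ennreal 16 * ennreal \<Lambda>"
            by (intro mult_left_mono) (auto simp: not_less)
          moreover have "weighted_max divisor_count \<tau> ?g x \<le> ennreal 16 * (\<Sum>i. block_max \<tau> ?g 0 i x)"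
            using f c by (intro divisor_count_max_le_blocks) simp
          ultimately have "ennreal c * weighted_max divisor_count \<tau> f x \<le> ennreal (16 * \<Lambda>)"
            using weighted_max_scale[of c f divisor_count \<tau> x] c f divisor_count_nonneg \<Lambda>
            by (simp add: ennreal_mult)
          then have "ennreal (1 / c) * (ennreal c * weighted_max divisor_count \<tau> f x) \<le> ennreal (1 / c) * ennreal (16 * \<Lambda>)"
            by (rule mult_left_mono) simp
          also have "ennreal (1 / c) * ennreal (16 * \<Lambda>) = ennreal t"
            using c t \<Lambda> by (simp add: c_def flip: ennreal_mult)
          also have "ennreal (1 / c) * (ennreal c * weighted_max divisor_count \<tau> f x) = weighted_max divisor_count \<tau> f x"
            using c by (simp add: ennreal_mult_mult)
          finally show False using x by simp
        qed
      qed
    qed measurable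
    also have "\<dots> \<le> ennreal C * (\<integral>\<^sup>+x. ennreal (?g x powr p) \<partial>M)"
      unfolding \<Lambda>_def by (rule bound[OF ds]) (use f c in auto)
    also have "(\<integral>\<^sup>+x. ennreal (?g x powr p) \<partial>M) = (\<integral>\<^sup>+x. ennreal (c powr p) * ennreal (f x powr p) \<partial>M)"
      using f c by (intro nn_integral_cong) (simp add: powr_mult ennreal_mult)
    also have "\<dots> = ennreal (c powr p) * (\<integral>\<^sup>+x. ennreal (f x powr p) \<partial>M)" by (rule nn_integral_cmult) measurable
    also have "ennreal C * (ennreal (c powr p) * (\<integral>\<^sup>+x. ennreal (f x powr p) \<partial>M))
        = ennreal (C * c powr p) * (\<integral>\<^sup>+x. ennreal (f x powr p) \<partial>M)"
      using C by (intro ennreal_mult_mult) auto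
    also have "C * c powr p = C * (16 * \<Lambda>) powr p / t powr p"
      using t \<Lambda> by (simp add: c_def powr_divide)
    finally show "emeasure M {x\<in>space M. ennreal t < weighted_max divisor_count \<tau> f x}
        \<le> ennreal (C * (16 * \<Lambda>) powr p / t powr p) * (\<integral>\<^sup>+x. ennreal (f x powr p) \<partial>M)" .
  qed
  then show thesis using that[of "C * (16 * \<Lambda>) powr p"] C by simp
qed

section \<open>Pointwise convergence for the number of divisors\<close>

text \<open>
  All binary digits of \<open>n\<close> after the first \<open>h + 1\<close> are set to 0.
\<close>
lemma scales_approx:
  assumes n: "n \<ge> 1" and h: "h \<ge> 1"
  shows "\<exists>m\<in>scales h. m \<le> n \<and> real n - real m \<le> real n / 2 ^ h \<and> n \<le> 2 * m"
proof -
  have "\<exists>m\<in>scales h. m \<le> n \<and> real n - real m \<le> real n / 2 ^ h"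
  proof (cases "n < 2 ^ Suc h")
    case True
    then have "n \<in> scales h" unfolding scales_def by (intro CollectI exI[of _ n] exI[of _ 0]) simp
    then show ?thesis by (intro bexI[of _ n]) auto
  next
    case False
    define k where "k = (LEAST k. n < 2 ^ (Suc h + k))"
    have "n < 2 ^ n" by (rule less_exp)
    also have "(2::nat) ^ n \<le> 2 ^ (Suc h + n)" by (rule power_increasing) auto
    finally have k: "n < 2 ^ (Suc h + k)" unfolding k_def by (rule LeastI)
    have "k \<noteq> 0" using k False by (intro notI) simp
    then obtain k' where k': "k = Suc k'" by (cases k) auto
    have "\<not> n < 2 ^ (Suc h + k')"
      using not_less_Least[of k' "\<lambda>k. n < 2 ^ (Suc h + k)"] k' by (simp add: k_def)
    then have low: "2 ^ h * 2 ^ k \<le> n" by (simp add: k' power_add)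
    define a where "a = n div 2 ^ k"
    have "a < 2 ^ Suc h"
      unfolding a_def using k by (subst div_less_iff_less_mult) (auto simp: power_add)
    then have s: "a * 2 ^ k \<in> scales h" unfolding scales_def by blast
    have nm: "n = a * 2 ^ k + n mod 2 ^ k" unfolding a_def by (rule div_mult_mod_eq[symmetric])
    have "real n = real (a * 2 ^ k + n mod 2 ^ k)" by (rule arg_cong[OF nm])
    then have "real n - real (a * 2 ^ k) = real (n mod 2 ^ k)" unfolding of_nat_add by linarith
    also have "\<dots> \<le> real (2 ^ k)" by (intro of_nat_mono less_imp_le mod_less_divisor) simp
    also have "real (2 ^ k) = 2 ^ k" by simp
    also have "\<dots> \<le> real n / 2 ^ h"
    proof -
      have "real (2 ^ h * 2 ^ k) \<le> real n" using low by (simp only: of_nat_le_iff)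
      then show ?thesis by (simp add: field_simps)
    qed
    finally have "real n - real (a * 2 ^ k) \<le> real n / 2 ^ h" .
    moreover have "a * 2 ^ k \<le> n" using nm by linarith
    ultimately show ?thesis using s by blast
  qed
  then obtain m where m: "m \<in> scales h" "m \<le> n" "real n - real m \<le> real n / 2 ^ h" by blast
  have "(2::real) ^ 1 \<le> 2 ^ h" using h by (intro power_increasing) auto
  then have "real n / 2 ^ h \<le> real n / 2" by (intro divide_left_mono) auto
  then have "real n \<le> 2 * real m" using m(3) by linarith
  then have "n \<le> 2 * m" by linarith
  then show ?thesis using m by blast
qed

text \<open>
  A time of order \<open>n powr \<theta>\<close> has the harmonic number \<open>\<theta> * ln n\<close> to first order. This is used for
  \<open>\<theta> = 1\<close> and, at the square root of the hyperbola method, for \<open>\<theta> = 1 / 2\<close>.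
\<close>
lemma harm_over_ln_lim:
  fixes m :: "nat \<Rightarrow> nat"
  assumes m: "filterlim m at_top sequentially" and c: "c > 0"
    and lim: "(\<lambda>n. real (m n) / real n powr \<theta>) \<longlonglongrightarrow> c"
  shows "(\<lambda>n. harm (m n) / ln (real n)) \<longlonglongrightarrow> \<theta>"
proof -
  have ln_inf: "filterlim (\<lambda>n. ln (real n)) at_top sequentially"
    by (rule filterlim_compose[OF ln_at_top filterlim_real_sequentially])
  have "(\<lambda>n. harm (m n) - ln (real (m n))) \<longlonglongrightarrow> euler_mascheroni"
    by (rule filterlim_compose[OF euler_mascheroni_LIMSEQ m])
  moreover have "(\<lambda>n. ln (real (m n) / real n powr \<theta>)) \<longlonglongrightarrow> ln c"
    using c by (intro tendsto_ln lim) auto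
  ultimately have "(\<lambda>n. (harm (m n) - ln (real (m n)) + ln (real (m n) / real n powr \<theta>)) / ln (real n)) \<longlonglongrightarrow> 0"
    by (intro tendsto_divide_0[OF tendsto_add] filterlim_at_top_imp_at_infinity ln_inf)
  then have "(\<lambda>n. (harm (m n) - ln (real (m n)) + ln (real (m n) / real n powr \<theta>)) / ln (real n) + \<theta>) \<longlonglongrightarrow> 0 + \<theta>"
    by (intro tendsto_intros)
  then have "(\<lambda>n. (harm (m n) - ln (real (m n)) + ln (real (m n) / real n powr \<theta>)) / ln (real n) + \<theta>) \<longlonglongrightarrow> \<theta>" by simp
  then show ?thesis
  proof (rule Lim_transform_eventually)
    have "eventually (\<lambda>n. m n \<ge> 1) sequentially" using m by (simp add: filterlim_at_top)
    then show "\<forall>\<^sub>F n in sequentially. (harm (m n) - ln (real (m n)) + ln (real (m n) / real n powr \<theta>)) / ln (real n) + \<theta>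
        = harm (m n) / ln (real n)"
      using eventually_ge_at_top[of 2]
    proof eventually_elim
      case (elim n)
      have "ln (real (m n) / real n powr \<theta>) = ln (real (m n)) - \<theta> * ln (real n)"
        using elim by (simp add: ln_div ln_powr)
      moreover have "ln (real n) > 0" using elim by (intro ln_gt_zero) auto
      ultimately show ?case by (simp add: field_simps)
    qed
  qed
qed

lemma harm_over_ln: "(\<lambda>n. harm n / ln (real n)) \<longlonglongrightarrow> 1"
proof -
  have "(\<lambda>n. real n / real n powr 1) \<longlonglongrightarrow> 1"
    by (rule tendsto_eventually, rule eventually_sequentiallyI[of 1]) simp
  then show ?thesis by (intro harm_over_ln_lim[of "\<lambda>n. n" 1 1] filterlim_ident) auto
qed

lemma divisor_count_asymp: "(\<lambda>n. weight_sum divisor_count n / (real n * ln (real n))) \<longlonglongrightarrow> 1"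
proof (rule tendsto_sandwich)
  have ln_inf: "filterlim (\<lambda>n. ln (real n)) at_top sequentially"
    by (rule filterlim_compose[OF ln_at_top filterlim_real_sequentially])
  show "\<forall>\<^sub>F n in sequentially. weight_sum divisor_count n / (real n * ln (real n)) \<le> harm n / ln (real n)"
  proof (rule eventually_sequentiallyI[of 2])
    fix n :: nat assume n: "2 \<le> n"
    have "ln (real n) > 0" using n by (intro ln_gt_zero) auto
    then have "weight_sum divisor_count n / (real n * ln (real n)) \<le> (real n * harm n) / (real n * ln (real n))"
      by (intro divide_right_mono weight_sum_divisor_count_le) auto
    then show "weight_sum divisor_count n / (real n * ln (real n)) \<le> harm n / ln (real n)" using n by simp
  qed
  show "\<forall>\<^sub>F n in sequentially. harm n / ln (real n) - 1 / ln (real n) \<le> weight_sum divisor_count n / (real n * ln (real n))"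
  proof (rule eventually_sequentiallyI[of 2])
    fix n :: nat assume n: "2 \<le> n"
    have "ln (real n) > 0" using n by (intro ln_gt_zero) auto
    then have "(real n * harm n - real n) / (real n * ln (real n)) \<le> weight_sum divisor_count n / (real n * ln (real n))"
      by (intro divide_right_mono weight_sum_divisor_count_ge) auto
    moreover have "(real n * harm n - real n) / (real n * ln (real n)) = harm n / ln (real n) - 1 / ln (real n)"
      using n \<open>ln (real n) > 0\<close> by (simp add: field_simps)
    ultimately show "harm n / ln (real n) - 1 / ln (real n) \<le> weight_sum divisor_count n / (real n * ln (real n))" by simp
  qed
  show "(\<lambda>n. harm n / ln (real n)) \<longlonglongrightarrow> (1::real)" by (rule harm_over_ln)
  have "(\<lambda>n. harm n / ln (real n) - 1 / ln (real n)) \<longlonglongrightarrow> (1 - 0 :: real)"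
    by (intro tendsto_diff harm_over_ln tendsto_divide_0[OF tendsto_const] filterlim_at_top_imp_at_infinity ln_inf)
  then show "(\<lambda>n. harm n / ln (real n) - 1 / ln (real n)) \<longlonglongrightarrow> (1::real)" by simp
qed

lemma isqrt_at_top: "filterlim isqrt at_top sequentially"
  unfolding filterlim_at_top
proof
  fix Z :: nat
  show "eventually (\<lambda>n. Z \<le> isqrt n) sequentially"
  proof (rule eventually_sequentiallyI[of "Z * Z"])
    fix n assume "Z * Z \<le> n"
    then have "Z * Z < Suc (isqrt n) * Suc (isqrt n)" using less_isqrt_Suc_square[of n] by linarith
    then have "Z < Suc (isqrt n)" by (meson mult_le_mono not_less)
    then show "Z \<le> isqrt n" by simp
  qed
qed

lemma isqrt_div_ratio:
  assumes q: "q \<ge> 1"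
  shows "(\<lambda>n. real (isqrt n div q) / real n powr (1 / 2)) \<longlonglongrightarrow> 1 / real q"
proof -
  have "(\<lambda>n. real (isqrt n) / real n powr (1 / 2)) \<longlonglongrightarrow> 1"
  proof (rule tendsto_sandwich)
    have "filterlim (\<lambda>n. sqrt (real n)) at_infinity sequentially"
      by (rule filterlim_at_top_imp_at_infinity, rule filterlim_compose[OF sqrt_at_top filterlim_real_sequentially])
    then have "(\<lambda>n. 1 - 1 / sqrt (real n)) \<longlonglongrightarrow> 1 - 0" by (intro tendsto_diff tendsto_const tendsto_divide_0[OF tendsto_const])
    then show "(\<lambda>n. 1 - 1 / sqrt (real n)) \<longlonglongrightarrow> 1" by simp
    show "\<forall>\<^sub>F n in sequentially. 1 - 1 / sqrt (real n) \<le> real (isqrt n) / real n powr (1 / 2)"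
    proof (rule eventually_sequentiallyI[of 1])
      fix n :: nat assume n: "1 \<le> n"
      have "(sqrt (real n) - 1) / sqrt (real n) \<le> real (isqrt n) / sqrt (real n)"
        using isqrt_gt[of n] by (intro divide_right_mono) auto
      then show "1 - 1 / sqrt (real n) \<le> real (isqrt n) / real n powr (1 / 2)"
        using n by (simp add: powr_half_sqrt diff_divide_distrib)
    qed
    show "\<forall>\<^sub>F n in sequentially. real (isqrt n) / real n powr (1 / 2) \<le> 1"
    proof (rule eventually_sequentiallyI[of 1])
      fix n :: nat assume n: "1 \<le> n"
      then show "real (isqrt n) / real n powr (1 / 2) \<le> 1" using isqrt_le[of n] by (simp add: powr_half_sqrt)
    qed
  qed simp
  moreover have "(\<lambda>n. real (isqrt n div q) / real (isqrt n)) \<longlonglongrightarrow> 1 / real q"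
    by (rule filterlim_compose[OF tendsto_div_ratio isqrt_at_top]) (use q in simp)
  ultimately have "(\<lambda>n. (real (isqrt n div q) / real (isqrt n)) * (real (isqrt n) / real n powr (1 / 2))) \<longlonglongrightarrow> 1 / real q * 1"
    by (intro tendsto_mult)
  then have "(\<lambda>n. (real (isqrt n div q) / real (isqrt n)) * (real (isqrt n) / real n powr (1 / 2))) \<longlonglongrightarrow> 1 / real q" by simp
  then show ?thesis
  proof (rule Lim_transform_eventually)
    have "eventually (\<lambda>n. isqrt n \<ge> 1) sequentially" using isqrt_at_top by (simp add: filterlim_at_top)
    then show "\<forall>\<^sub>F n in sequentially. (real (isqrt n div q) / real (isqrt n)) * (real (isqrt n) / real n powr (1 / 2))
        = real (isqrt n div q) / real n powr (1 / 2)"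
      by eventually_elim simp
  qed
qed

text \<open>
  The coefficient of the average weighted by \<open>c\<^sub>q\<close> in the average weighted by the number of
  divisors, according to the hyperbola method. The factor 2 and the square root compensate each
  other in the limit \<open>1 / q\<close>.
\<close>
definition hyperbola_coeff :: "nat \<Rightarrow> nat \<Rightarrow> real" where
  "hyperbola_coeff q n = 2 * real n * harm (isqrt n div q) / (real q * weight_sum divisor_count n)"

lemma hyperbola_coeff_lim:
  assumes q: "q \<ge> 1"
  shows "(\<lambda>n. hyperbola_coeff q n) \<longlonglongrightarrow> 1 / real q"
proof -
  have "filterlim (\<lambda>n. isqrt n div q) at_top sequentially"
    by (rule filterlim_compose[OF filterlim_div_at_top isqrt_at_top]) (use q in simp)
  then have h: "(\<lambda>n. harm (isqrt n div q) / ln (real n)) \<longlonglongrightarrow> (1 / 2 :: real)"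
    by (rule harm_over_ln_lim[OF _ _ isqrt_div_ratio[OF q]]) (use q in simp)
  have "(\<lambda>n. 2 / real q * ((harm (isqrt n div q) / ln (real n)) / (weight_sum divisor_count n / (real n * ln (real n)))))
      \<longlonglongrightarrow> 2 / real q * ((1 / 2) / 1)"
    by (intro tendsto_intros h divisor_count_asymp) simp
  then have "(\<lambda>n. 2 / real q * ((harm (isqrt n div q) / ln (real n)) / (weight_sum divisor_count n / (real n * ln (real n)))))
      \<longlonglongrightarrow> 1 / real q" by simp
  then show ?thesis
  proof (rule Lim_transform_eventually, intro eventually_sequentiallyI[of 2])
    fix n :: nat assume n: "2 \<le> n"
    have "ln (real n) > 0" using n by (intro ln_gt_zero) auto
    moreover have "weight_sum divisor_count n > 0" using n by (intro weight_sum_divisor_count_pos) simp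
    ultimately show "2 / real q * ((harm (isqrt n div q) / ln (real n)) / (weight_sum divisor_count n / (real n * ln (real n)))) = hyperbola_coeff q n"
      using n q by (simp add: hyperbola_coeff_def field_simps)
  qed
qed

lemma hyperbola_coeff_le:
  assumes n: "n \<ge> 1" and q: "q \<ge> 1"
  shows "\<bar>hyperbola_coeff q n\<bar> \<le> 4 / real q"
proof -
  have V: "weight_sum divisor_count n > 0" by (rule weight_sum_divisor_count_pos[OF n])
  have "isqrt n div q \<le> isqrt n" by (rule div_le_dividend)
  also have "isqrt n \<le> isqrt n * isqrt n" by (rule le_square)
  also have "\<dots> \<le> n" by (rule isqrt_square_le)
  finally have "isqrt n div q \<le> n" .
  then have "harm (isqrt n div q) \<le> (harm n :: real)" by (rule harm_mono)
  then have "2 * real n * harm (isqrt n div q) \<le> 2 * real n * harm n" by (intro mult_left_mono) auto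
  also have "\<dots> \<le> 4 * weight_sum divisor_count n"
    using weight_sum_divisor_count_ge_half[of n] by (simp add: mult_ac)
  finally have "2 * real n * harm (isqrt n div q) / (real q * weight_sum divisor_count n) \<le> 4 / real q"
    using V q by (simp add: field_simps)
  moreover have "hyperbola_coeff q n \<ge> 0" unfolding hyperbola_coeff_def
    using V by (intro divide_nonneg_nonneg mult_nonneg_nonneg harm_nonneg) auto
  ultimately show ?thesis by (simp add: hyperbola_coeff_def)
qed

text \<open>
  By its definition \<open>c\<^sub>q\<close> is a finite combination of indicators of multiples of the divisors \<open>e\<close>
  of \<open>q\<close>, so Birkhoff's theorem for the maps \<open>\<tau> ^^ e\<close> applies.
\<close>
lemma ramanujan_avg_convergent:
  fixes f :: "'a \<Rightarrow> real"
  assumes ds: "dynamical_system M \<tau>" and fm: "f \<in> borel_measurable M" and B: "\<And>x. \<bar>f x\<bar> \<le> B" and q: "q \<ge> 1"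
  shows "AE x in M. convergent (\<lambda>n. ramanujan_avg \<tau> f q n x)"
proof -
  have fin: "finite {e. e dvd q}" using q by simp
  have "AE x in M. \<forall>e. convergent (\<lambda>n. (\<Sum>j=1..n. f (((\<tau> ^^ e) ^^ j) x)) / real n)"
    unfolding AE_all_countable by (intro allI birkhoff_bounded[OF dynamical_system_funpow[OF ds] fm B])
  then show ?thesis
  proof eventually_elim
    case (elim x)
    then obtain l where l: "\<And>e. (\<lambda>n. (\<Sum>j=1..n. f (((\<tau> ^^ e) ^^ j) x)) / real n) \<longlonglongrightarrow> l e"
      unfolding convergent_def by metis
    define t where "t e n = real e * real_of_int (moebius_mu (q div e))
        * (real (n div e) / real n * ((\<Sum>j=1..n div e. f (((\<tau> ^^ e) ^^ j) x)) / real (n div e)))" for e n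
    have "(\<lambda>n. \<Sum>e | e dvd q. t e n) \<longlonglongrightarrow> (\<Sum>e | e dvd q. real e * real_of_int (moebius_mu (q div e)) * (1 / real e * l e))"
      unfolding t_def
    proof (intro tendsto_sum tendsto_mult tendsto_const)
      fix e assume "e \<in> {e. e dvd q}"
      then have e: "e > 0" using q by (auto intro: Nat.gr0I)
      show "(\<lambda>n. real (n div e) / real n) \<longlonglongrightarrow> 1 / real e" by (rule tendsto_div_ratio[OF e])
      show "(\<lambda>n. (\<Sum>j=1..n div e. f (((\<tau> ^^ e) ^^ j) x)) / real (n div e)) \<longlonglongrightarrow> l e"
        by (rule filterlim_compose[OF l filterlim_div_at_top[OF e]])
    qed
    moreover have "(\<Sum>e | e dvd q. t e n) = ramanujan_avg \<tau> f q n x" for n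
    proof -
      have "(\<Sum>k=1..n. ramanujan q k * f ((\<tau> ^^ k) x))
          = (\<Sum>k=1..n. \<Sum>e | e dvd q. if e dvd k then real e * real_of_int (moebius_mu (q div e)) * f ((\<tau> ^^ k) x) else 0)"
      proof (rule sum.cong[OF refl])
        fix k
        have "{e. e dvd q \<and> e dvd k} = {e \<in> {e. e dvd q}. e dvd k}" by simp
        then have "ramanujan q k * f ((\<tau> ^^ k) x)
            = (\<Sum>e \<in> {e \<in> {e. e dvd q}. e dvd k}. real e * real_of_int (moebius_mu (q div e)) * f ((\<tau> ^^ k) x))"
          by (simp add: ramanujan_def sum_distrib_right)
        also have "\<dots> = (\<Sum>e | e dvd q. if e dvd k then real e * real_of_int (moebius_mu (q div e)) * f ((\<tau> ^^ k) x) else 0)"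
          by (rule sum.inter_filter[OF fin])
        finally show "ramanujan q k * f ((\<tau> ^^ k) x) = \<dots>" .
      qed
      also have "\<dots> = (\<Sum>e | e dvd q. \<Sum>k=1..n. if e dvd k then real e * real_of_int (moebius_mu (q div e)) * f ((\<tau> ^^ k) x) else 0)"
        by (rule sum.swap)
      also have "\<dots> = (\<Sum>e | e dvd q. real n * t e n)"
      proof (rule sum.cong[OF refl])
        fix e assume "e \<in> {e. e dvd q}"
        then have e: "e > 0" using q by (auto intro: Nat.gr0I)
        have "(\<Sum>k=1..n. if e dvd k then real e * real_of_int (moebius_mu (q div e)) * f ((\<tau> ^^ k) x) else 0)
            = real e * real_of_int (moebius_mu (q div e)) * (\<Sum>j=1..n div e. f ((\<tau> ^^ (e * j)) x))"
          by (subst sum_multiples[OF e]) (simp add: sum_distrib_left)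
        also have "\<dots> = real n * t e n"
        proof (cases "n div e = 0")
          case True
          then show ?thesis by (simp only: t_def) simp
        next
          case False
          then have "n \<noteq> 0" by (intro notI) simp
          then show ?thesis using False by (simp add: t_def funpow_mult_apply)
        qed
        finally show "(\<Sum>k=1..n. if e dvd k then real e * real_of_int (moebius_mu (q div e)) * f ((\<tau> ^^ k) x) else 0) = real n * t e n" .
      qed
      finally show ?thesis by (cases "n = 0") (simp_all add: ramanujan_avg_def t_def sum_distrib_left[symmetric])
    qed
    ultimately show ?case by (auto simp: convergent_def)
  qed
qed

text \<open>
  The exponential decay of the blocks in \<open>L\<^sup>2\<close> makes the sum integrable: each block is at most
  \<open>d + (1 / d)\<close> times its square, with \<open>d = (3/4) ^ i\<close>, and \<open>(4/3) ^ i\<close> is still outweighed by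
  \<open>1 / 2 ^ i\<close>.
\<close>
lemma sum_block_max_finite:
  fixes f :: "'a \<Rightarrow> real"
  assumes ds: "dynamical_system M \<tau>" and fm[measurable]: "f \<in> borel_measurable M" and B: "\<And>x. \<bar>f x\<bar> \<le> B"
  shows "AE x in M. (\<Sum>i. block_max \<tau> f h i x) \<noteq> \<infinity>"
proof (rule nn_integral_PInf_AE)
  interpret prob_space M using ds by (simp add: dynamical_system_def)
  have bm[measurable]: "block_max \<tau> f h i \<in> borel_measurable M" for i by (rule measurable_block_max[OF ds fm])
  show "(\<lambda>x. \<Sum>i. block_max \<tau> f h i x) \<in> borel_measurable M" by measurable
  define K where "K = 40000 * 2 ^ h * B\<^sup>2"
  have K: "K \<ge> 0" by (simp add: K_def)
  have I: "(\<integral>\<^sup>+x. ennreal ((f x)\<^sup>2) \<partial>M) \<le> ennreal (B\<^sup>2)"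
  proof -
    have "(\<integral>\<^sup>+x. ennreal ((f x)\<^sup>2) \<partial>M) \<le> (\<integral>\<^sup>+x. ennreal (B\<^sup>2) \<partial>M)"
      using B by (intro nn_integral_mono ennreal_leI) (metis abs_ge_zero power2_abs power_mono)
    then show ?thesis by (simp add: emeasure_space_1)
  qed
  let ?b = "\<lambda>i. (3/4) ^ i + K * ((real i + 1) ^ 3 * (2/3) ^ i) :: real"
  have term_le: "(\<integral>\<^sup>+x. block_max \<tau> f h i x \<partial>M) \<le> ennreal (?b i)" for i
  proof -
    have "block_max \<tau> f h i x \<le> ennreal ((3/4) ^ i) + ennreal ((4/3) ^ i) * (block_max \<tau> f h i x)\<^sup>2" for x
    proof (cases "block_max \<tau> f h i x")
      case (real y)
      define d :: real where "d = (3/4) ^ i"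
      have d: "d > 0" "(4/3) ^ i = 1 / d" by (simp_all add: d_def power_divide)
      have "y \<le> d + 1 / d * y\<^sup>2"
      proof (cases "y \<le> d")
        case True
        then show ?thesis using d real by (simp add: add_increasing2)
      next
        case False
        then have "y * d \<le> y * y" using real by (intro mult_left_mono) auto
        then have "y \<le> 1 / d * y\<^sup>2" using d by (simp add: field_simps power2_eq_square)
        then show ?thesis using d by linarith
      qed
      then have "ennreal y \<le> ennreal (d + 1 / d * y\<^sup>2)" by (rule ennreal_leI)
      also have "\<dots> = ennreal d + ennreal (1 / d) * ennreal (y\<^sup>2)"
        using d by (subst ennreal_plus, simp, simp, subst ennreal_mult) auto
      finally show ?thesis using real d by (simp add: d_def ennreal_power)
    next
      case top
      then show ?thesis by (simp add: ennreal_mult_top)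
    qed
    then have "(\<integral>\<^sup>+x. block_max \<tau> f h i x \<partial>M)
        \<le> (\<integral>\<^sup>+x. ennreal ((3/4) ^ i) + ennreal ((4/3) ^ i) * (block_max \<tau> f h i x)\<^sup>2 \<partial>M)"
      by (rule nn_integral_mono)
    also have "\<dots> = ennreal ((3/4) ^ i) + ennreal ((4/3) ^ i) * (\<integral>\<^sup>+x. (block_max \<tau> f h i x)\<^sup>2 \<partial>M)"
      by (subst nn_integral_add, measurable, subst nn_integral_cmult, measurable) (simp add: emeasure_space_1)
    also have "\<dots> \<le> ennreal ((3/4) ^ i) + ennreal ((4/3) ^ i)
        * (ennreal (40000 * 2 ^ h * (real i + 1) ^ 3 / 2 ^ i) * ennreal (B\<^sup>2))"
      by (intro add_left_mono mult_left_mono order_trans[OF block_max_L2[OF ds fm] mult_left_mono[OF I]]) auto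
    also have "\<dots> = ennreal ((3/4) ^ i) + ennreal ((4/3) ^ i * (40000 * 2 ^ h * (real i + 1) ^ 3 / 2 ^ i) * B\<^sup>2)"
    proof -
      have "ennreal ((4/3) ^ i) * (ennreal (40000 * 2 ^ h * (real i + 1) ^ 3 / 2 ^ i) * ennreal (B\<^sup>2))
          = ennreal ((4/3) ^ i * (40000 * 2 ^ h * (real i + 1) ^ 3 / 2 ^ i)) * ennreal (B\<^sup>2)"
        by (rule ennreal_mult_mult) auto
      also have "\<dots> = ennreal ((4/3) ^ i * (40000 * 2 ^ h * (real i + 1) ^ 3 / 2 ^ i) * B\<^sup>2)"
        by (rule ennreal_mult[symmetric]) auto
      finally show ?thesis by (rule arg_cong)
    qed
    also have "(4/3) ^ i * (40000 * 2 ^ h * (real i + 1) ^ 3 / 2 ^ i) * B\<^sup>2 = K * ((real i + 1) ^ 3 * (2/3) ^ i)"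
    proof -
      have "(2/3 :: real) ^ i = (4/3) ^ i / 2 ^ i" by (simp flip: power_divide)
      then show ?thesis by (simp add: K_def)
    qed
    also have "ennreal ((3/4) ^ i) + ennreal (K * ((real i + 1) ^ 3 * (2/3) ^ i)) = ennreal (?b i)"
      using K by (intro ennreal_plus[symmetric]) auto
    finally show ?thesis .
  qed
  have sb: "summable ?b"
    by (intro summable_add summable_mult summable_poly_geometric summable_geometric) auto
  have "(\<integral>\<^sup>+x. (\<Sum>i. block_max \<tau> f h i x) \<partial>M) = (\<Sum>i. \<integral>\<^sup>+x. block_max \<tau> f h i x \<partial>M)"
    by (rule nn_integral_suminf) simp
  also have "\<dots> \<le> (\<Sum>i. ennreal (?b i))" by (intro suminf_le term_le) auto
  also have "\<dots> = ennreal (\<Sum>i. ?b i)" using sb K by (intro suminf_ennreal2) auto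
  finally show "(\<integral>\<^sup>+x. (\<Sum>i. block_max \<tau> f h i x) \<partial>M) \<noteq> \<infinity>" by (auto simp: top_unique)
qed

text \<open>
  By the hyperbola method the average is a series over \<open>q\<close>, up to an error that tends to 0 for
  bounded \<open>f\<close>. Its terms converge, and along times from one set of scales they are dominated by
  multiples of \<open>tail_max / q\<close>, whose sum is finite; so the limit may be taken term by term.
\<close>
lemma divisor_average_along_scales:
  fixes f :: "'a \<Rightarrow> real"
  assumes B: "\<And>x. \<bar>f x\<bar> \<le> B" and fin: "(\<Sum>i. block_max \<tau> f h i x) \<noteq> \<infinity>"
    and l: "\<And>q. q \<ge> 1 \<Longrightarrow> (\<lambda>n. ramanujan_avg \<tau> f q n x) \<longlonglongrightarrow> l q"
    and \<phi>: "filterlim \<phi> at_top sequentially" "\<And>n. \<phi> n \<in> scales h"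
  shows "(\<lambda>n. (\<Sum>k=1..\<phi> n. divisor_count k * f ((\<tau> ^^ k) x)) / weight_sum divisor_count (\<phi> n))
    \<longlonglongrightarrow> (\<Sum>q. 1 / real q * l q)"
proof -
  let ?V = "weight_sum divisor_count"
  define s where "s q = enn2real (ennreal (1 / real q) * tail_max \<tau> f h q x)" for q
  have tail_fin: "ennreal (1 / real q) * tail_max \<tau> f h q x < top" for q
  proof (cases "q \<ge> 1")
    case True
    have "ennreal (1 / real q) * tail_max \<tau> f h q x \<le> (\<Sum>q=1..q. ennreal (1 / real q) * tail_max \<tau> f h q x)"
      using True by (intro member_le_sum) auto
    also have "\<dots> \<le> (\<Sum>i. block_max \<tau> f h i x)" by (rule sum_tail_max_le)
    also have "\<dots> < top" using fin by (simp add: less_top)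
    finally show ?thesis .
  qed (simp add: not_less_eq_eq)
  have s_eq: "ennreal (s q) = ennreal (1 / real q) * tail_max \<tau> f h q x" for q
    using tail_fin[of q] by (simp add: s_def)
  have s_nonneg: "s q \<ge> 0" for q by (simp add: s_def)
  have s_summable: "summable s"
  proof (rule summable_suminf_not_top[OF s_nonneg])
    have "(\<Sum>q<n. ennreal (s q)) \<le> (\<Sum>i. block_max \<tau> f h i x)" for n
    proof -
      have "(\<Sum>q<n. ennreal (s q)) \<le> (\<Sum>q\<in>{0..n}. ennreal (s q))" by (intro sum_mono2) auto
      also have "\<dots> = (\<Sum>q=1..n. ennreal (s q))"
        by (rule sum.mono_neutral_right) (auto simp: s_eq not_less_eq_eq Suc_le_eq)
      also have "\<dots> \<le> (\<Sum>i. block_max \<tau> f h i x)" unfolding s_eq by (rule sum_tail_max_le)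
      finally show ?thesis .
    qed
    then have "(\<Sum>q. ennreal (s q)) \<le> (\<Sum>i. block_max \<tau> f h i x)"
      unfolding suminf_eq_SUP[of "\<lambda>q. ennreal (s q)"] by (rule SUP_least)
    then show "(\<Sum>q. ennreal (s q)) \<noteq> top" using fin by (auto simp: top_unique)
  qed
  define a where "a q n = (if 1 \<le> q \<and> q \<le> isqrt (\<phi> n) then hyperbola_coeff q (\<phi> n) * ramanujan_avg \<tau> f q (\<phi> n) x else 0)" for q n
  have lim_a: "(\<lambda>n. \<Sum>q. a q n) \<longlonglongrightarrow> (\<Sum>q. 1 / real q * l q)"
  proof (rule tannery_nat)
    show "(\<lambda>n. a q n) \<longlonglongrightarrow> 1 / real q * l q" for q
    proof (cases "q \<ge> 1")
      case True
      have "(\<lambda>n. hyperbola_coeff q (\<phi> n) * ramanujan_avg \<tau> f q (\<phi> n) x) \<longlonglongrightarrow> 1 / real q * l q"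
        by (intro tendsto_mult filterlim_compose[OF hyperbola_coeff_lim[OF True] \<phi>(1)] filterlim_compose[OF l[OF True] \<phi>(1)])
      moreover have "eventually (\<lambda>n. q \<le> isqrt (\<phi> n)) sequentially"
        using filterlim_compose[OF isqrt_at_top \<phi>(1)] by (simp add: filterlim_at_top)
      then have "eventually (\<lambda>n. hyperbola_coeff q (\<phi> n) * ramanujan_avg \<tau> f q (\<phi> n) x = a q n) sequentially"
        by eventually_elim (use True in \<open>simp add: a_def\<close>)
      ultimately show ?thesis by (rule Lim_transform_eventually)
    qed (simp add: a_def not_less_eq_eq)
    show "\<bar>a q n\<bar> \<le> 4 * s q" for q n
    proof (cases "1 \<le> q \<and> q \<le> isqrt (\<phi> n)")
      case True
      then have "q * q \<le> isqrt (\<phi> n) * isqrt (\<phi> n)" by (intro mult_mono) auto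
      then have qn: "q * q \<le> \<phi> n" using isqrt_square_le[of "\<phi> n"] by linarith
      then have n1: "\<phi> n \<ge> 1" using True by (cases "\<phi> n") auto
      have "ennreal \<bar>ramanujan_avg \<tau> f q (\<phi> n) x\<bar> \<le> tail_max \<tau> f h q x"
        unfolding tail_max_def using \<phi>(2)[of n] qn by (intro SUP_upper) simp
      then have "ennreal (1 / real q) * ennreal \<bar>ramanujan_avg \<tau> f q (\<phi> n) x\<bar> \<le> ennreal (s q)"
        unfolding s_eq by (rule mult_left_mono) simp
      then have "ennreal (1 / real q * \<bar>ramanujan_avg \<tau> f q (\<phi> n) x\<bar>) \<le> ennreal (s q)"
        by (subst ennreal_mult) auto
      then have 1: "1 / real q * \<bar>ramanujan_avg \<tau> f q (\<phi> n) x\<bar> \<le> s q" using s_nonneg[of q] by (simp only: ennreal_le_iff)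
      have "\<bar>a q n\<bar> = \<bar>hyperbola_coeff q (\<phi> n)\<bar> * \<bar>ramanujan_avg \<tau> f q (\<phi> n) x\<bar>"
        using True by (simp add: a_def abs_mult)
      also have "\<dots> \<le> 4 / real q * \<bar>ramanujan_avg \<tau> f q (\<phi> n) x\<bar>"
        using True n1 by (intro mult_right_mono hyperbola_coeff_le) auto
      also have "\<dots> = 4 * (1 / real q * \<bar>ramanujan_avg \<tau> f q (\<phi> n) x\<bar>)" by simp
      also have "\<dots> \<le> 4 * s q" by (intro mult_left_mono 1) simp
      finally show ?thesis .
    next
      case False
      then have "a q n = 0" by (simp only: a_def) simp
      then show ?thesis using s_nonneg[of q] by simp
    qed
    show "summable (\<lambda>q. 4 * s q)" by (rule summable_mult[OF s_summable])
  qed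
  define err where "err N = (\<Sum>d=1..isqrt N. \<Sum>e=1..isqrt N. f ((\<tau> ^^ (d * e)) x)) / ?V N" for N
  have err_lim: "(\<lambda>N. err N) \<longlonglongrightarrow> 0"
  proof (rule Lim_null_comparison)
    show "\<forall>\<^sub>F N in sequentially. norm (err N) \<le> 2 * B / harm N"
    proof (rule eventually_sequentiallyI[of 1])
      fix N :: nat assume N: "1 \<le> N"
      have V: "?V N > 0" by (rule weight_sum_divisor_count_pos[OF N])
      have h: "harm N > (0::real)" using N by (intro harm_pos) simp
      have B0: "B \<ge> 0" using B[of undefined] by linarith
      have "\<bar>\<Sum>d=1..isqrt N. \<Sum>e=1..isqrt N. f ((\<tau> ^^ (d * e)) x)\<bar> \<le> (\<Sum>d=1..isqrt N. \<Sum>e=1..isqrt N. B)"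
        by (intro order_trans[OF sum_abs] sum_mono B)
      also have "\<dots> = B * real (isqrt N * isqrt N)" by simp
      also have "\<dots> \<le> B * real N" using isqrt_square_le[of N] B0 by (intro mult_left_mono) (simp_all only: of_nat_le_iff)
      finally have "\<bar>\<Sum>d=1..isqrt N. \<Sum>e=1..isqrt N. f ((\<tau> ^^ (d * e)) x)\<bar> / ?V N \<le> (B * real N) / (real N / 2 * harm N)"
        using weight_sum_divisor_count_ge_half[of N] V h N B0 by (intro frac_le mult_nonneg_nonneg mult_pos_pos) auto
      also have "\<dots> = 2 * B / harm N" using N h by (simp add: field_simps)
      finally show "norm (err N) \<le> 2 * B / harm N" using V by (simp add: err_def abs_mult)
    qed
    show "(\<lambda>N. 2 * B / harm N) \<longlonglongrightarrow> 0"
      by (intro tendsto_divide_0[OF tendsto_const] filterlim_at_top_imp_at_infinity harm_at_top)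
  qed
  have "(\<lambda>n. (\<Sum>q. a q n) - err (\<phi> n)) \<longlonglongrightarrow> (\<Sum>q. 1 / real q * l q) - 0"
    by (intro tendsto_diff lim_a filterlim_compose[OF err_lim \<phi>(1)])
  then have "(\<lambda>n. (\<Sum>q. a q n) - err (\<phi> n)) \<longlonglongrightarrow> (\<Sum>q. 1 / real q * l q)" by simp
  then show ?thesis
  proof (rule Lim_transform_eventually)
    have "eventually (\<lambda>n. \<phi> n \<ge> 1) sequentially" using \<phi>(1) by (simp add: filterlim_at_top)
    then show "\<forall>\<^sub>F n in sequentially. (\<Sum>q. a q n) - err (\<phi> n)
        = (\<Sum>k=1..\<phi> n. divisor_count k * f ((\<tau> ^^ k) x)) / ?V (\<phi> n)"
    proof eventually_elim
      case (elim n)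
      let ?N = "\<phi> n"
      have "(\<Sum>q. a q n) = (\<Sum>q=1..isqrt ?N. a q n)"
        by (rule suminf_finite) (auto simp: a_def)
      also have "\<dots> = (\<Sum>q=1..isqrt ?N. hyperbola_coeff q ?N * ramanujan_avg \<tau> f q ?N x)"
        by (rule sum.cong) (auto simp: a_def)
      also have "\<dots> = 2 * (real ?N * (\<Sum>q=1..isqrt ?N. harm (isqrt ?N div q) / real q * ramanujan_avg \<tau> f q ?N x)) / ?V ?N"
        unfolding hyperbola_coeff_def sum_distrib_left sum_divide_distrib by (rule sum.cong[OF refl]) simp
      also have "\<dots> = 2 * (\<Sum>d=1..isqrt ?N. \<Sum>e=1..?N div d. f ((\<tau> ^^ (d * e)) x)) / ?V ?N"
        by (simp only: sum_short_divisors_ramanujan[OF elim])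
      finally have "(\<Sum>q. a q n) - err ?N = (2 * (\<Sum>d=1..isqrt ?N. \<Sum>e=1..?N div d. f ((\<tau> ^^ (d * e)) x))
          - (\<Sum>d=1..isqrt ?N. \<Sum>e=1..isqrt ?N. f ((\<tau> ^^ (d * e)) x))) / ?V ?N"
        by (simp only: err_def diff_divide_distrib)
      then show ?case by (simp only: divisor_count_hyperbola[where F = "\<lambda>k. f ((\<tau> ^^ k) x)"])
    qed
  qed
qed

text \<open>
  The share of the total weight carried by the times between \<open>m\<close> and \<open>n\<close>: the main term
  \<open>n * harm n\<close> of the total weight gives the relative length of the interval, its error of order
  \<open>n\<close> gives a multiple of \<open>1 / harm n\<close>.
\<close>
lemma divisor_weight_gap:
  assumes m: "m \<ge> 1" "m \<le> n" "n \<le> 2 * m"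
  shows "(weight_sum divisor_count n - weight_sum divisor_count m) / weight_sum divisor_count n
    \<le> (real n - real m) / (real n / 2) + 6 / harm n"
proof -
  let ?V = "weight_sum divisor_count"
  have n: "n \<ge> 1" using m by simp
  have V: "?V n > 0" by (rule weight_sum_divisor_count_pos[OF n])
  have h: "harm n > (0::real)" using n by (intro harm_pos) simp
  have hm: "harm n - 2 \<le> (harm m :: real)"
  proof -
    have "harm n \<le> 1 + ln (real n)" by (rule harm_le_ln[OF n])
    moreover have "ln (real n) \<le> ln (2 * real m)" using m n by simp
    moreover have "ln (2 * real m) = ln 2 + ln (real m)" using m by (simp add: ln_mult)
    moreover have "ln (real m) \<le> ln (real m + 1)" using m by simp
    moreover have "ln (real m + 1) \<le> harm m" by (rule harm_ge_ln)
    ultimately show ?thesis using ln2_le_1 by linarith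
  qed
  have "?V n - ?V m \<le> real n * harm n - (real m * harm m - real m)"
    using weight_sum_divisor_count_le[of n] weight_sum_divisor_count_ge[of m] by linarith
  also have "\<dots> \<le> real n * harm n - (real m * (harm n - 2) - real m)"
    using mult_left_mono[OF hm, of "real m"] by simp
  also have "\<dots> = (real n - real m) * harm n + 3 * real m" by (simp add: algebra_simps)
  also have "\<dots> \<le> (real n - real m) * harm n + 3 * real n" using m by simp
  finally have "(?V n - ?V m) / ?V n \<le> ((real n - real m) * harm n + 3 * real n) / (real n / 2 * harm n)"
    using V h m n weight_sum_divisor_count_ge_half[of n]
    by (intro frac_le add_nonneg_nonneg mult_nonneg_nonneg mult_pos_pos) (auto simp: harm_nonneg)
  also have "\<dots> = (real n - real m) / (real n / 2) + 6 / harm n"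
  proof -
    have "(a * H + 3 * N) / (N / 2 * H) = a / (N / 2) + 6 / H" if "H > 0" "N > 0" for a H N :: real
      using that by (simp add: field_simps)
    from this[OF h] show ?thesis using n by simp
  qed
  finally show ?thesis .
qed

text \<open>
  For given \<open>\<epsilon>\<close> the number \<open>h\<close> of digits is chosen large. The averages converge along the times in
  \<open>scales h\<close>, to a limit that does not depend on \<open>h\<close>; at any other time the average is compared
  with the one at a slightly earlier time in \<open>scales h\<close>, and the difference is controlled by
  \<open>divisor_weight_gap\<close>.
\<close>
lemma bounded_convergence_divisor_count: "bounded_convergence TYPE('a) divisor_count"
  unfolding bounded_convergence_def
proof (intro allI impI)
  fix M :: "'a measure" and \<tau> and f :: "'a \<Rightarrow> real" and B
  assume ds: "dynamical_system M \<tau>" and fm: "f \<in> borel_measurable M" and "\<forall>x. \<bar>f x\<bar> \<le> B"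
  then have B: "\<And>x. \<bar>f x\<bar> \<le> B" by simp
  have B0: "B \<ge> 0" using B[of undefined] by linarith
  let ?V = "weight_sum divisor_count"
  define D where "D x n = (\<Sum>k=1..n. divisor_count k * f ((\<tau> ^^ k) x)) / ?V n" for x n
  have "AE x in M. \<forall>h. (\<Sum>i. block_max \<tau> f h i x) \<noteq> \<infinity>"
    unfolding AE_all_countable by (intro allI sum_block_max_finite[OF ds fm B])
  moreover have "AE x in M. \<forall>q. q \<ge> 1 \<longrightarrow> convergent (\<lambda>n. ramanujan_avg \<tau> f q n x)"
    unfolding AE_all_countable
  proof
    fix q
    show "AE x in M. q \<ge> 1 \<longrightarrow> convergent (\<lambda>n. ramanujan_avg \<tau> f q n x)"
      using ramanujan_avg_convergent[OF ds fm B, of q] by (cases "q \<ge> 1") auto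
  qed
  ultimately show "AE x in M. convergent (\<lambda>n. (\<Sum>k=1..n. divisor_count k * f ((\<tau> ^^ k) x)) / ?V n)"
  proof eventually_elim
    case (elim x)
    define l where "l q = lim (\<lambda>n. ramanujan_avg \<tau> f q n x)" for q
    have l: "(\<lambda>n. ramanujan_avg \<tau> f q n x) \<longlonglongrightarrow> l q" if "q \<ge> 1" for q
      using elim(2) that by (simp add: l_def convergent_LIMSEQ_iff)
    define Lm where "Lm = (\<Sum>q. 1 / real q * l q)"
    have "(\<lambda>n. D x n) \<longlonglongrightarrow> Lm"
    proof (rule LIMSEQ_I)
      fix \<epsilon> :: real assume \<epsilon>: "\<epsilon> > 0"
      obtain h0 :: nat where h0: "4 * B / (\<epsilon> / 4) < 2 ^ h0" using real_arch_pow[of 2 "4 * B / (\<epsilon> / 4)"] by auto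
      define h where "h = Suc h0"
      have h: "h \<ge> 1" by (simp add: h_def)
      have "4 * B / 2 ^ h \<le> 4 * B / 2 ^ h0" using B0 unfolding h_def by (intro divide_left_mono power_increasing) auto
      also have "\<dots> < \<epsilon> / 4" using h0 \<epsilon> by (simp add: field_simps)
      finally have hB: "4 * B / 2 ^ h < \<epsilon> / 4" .
      have "\<forall>n. \<exists>m. n \<ge> 1 \<longrightarrow> m \<in> scales h \<and> m \<le> n \<and> real n - real m \<le> real n / 2 ^ h \<and> n \<le> 2 * m"
        using scales_approx[OF _ h] by blast
      then obtain \<phi>0 where \<phi>0: "\<And>n. n \<ge> 1 \<Longrightarrow> \<phi>0 n \<in> scales h \<and> \<phi>0 n \<le> n \<and> real n - real (\<phi>0 n) \<le> real n / 2 ^ h \<and> n \<le> 2 * \<phi>0 n"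
        by metis
      define \<phi> where "\<phi> n = \<phi>0 (max 1 n)" for n
      have \<phi>s: "\<phi> n \<in> scales h" for n using \<phi>0[of "max 1 n"] by (simp add: \<phi>_def)
      have \<phi>: "\<phi> n \<le> n" "real n - real (\<phi> n) \<le> real n / 2 ^ h" "n \<le> 2 * \<phi> n" if "n \<ge> 1" for n
        using \<phi>0[of n] that by (auto simp: \<phi>_def max_def)
      have \<phi>top: "filterlim \<phi> at_top sequentially"
        unfolding filterlim_at_top
      proof
        fix Z :: nat
        show "eventually (\<lambda>n. Z \<le> \<phi> n) sequentially"
        proof (rule eventually_sequentiallyI[of "max 1 (2 * Z)"])
          fix n assume "max 1 (2 * Z) \<le> n"
          then show "Z \<le> \<phi> n" using \<phi>(3)[of n] by linarith
        qed
      qed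
      have "(\<lambda>n. D x (\<phi> n)) \<longlonglongrightarrow> Lm"
        unfolding D_def Lm_def using elim(1) by (intro divisor_average_along_scales[OF B _ l \<phi>top \<phi>s]) auto
      then obtain n1 where n1: "\<And>n. n \<ge> n1 \<Longrightarrow> norm (D x (\<phi> n) - Lm) < \<epsilon> / 4"
        using LIMSEQ_D[of "\<lambda>n. D x (\<phi> n)" Lm "\<epsilon> / 4"] \<epsilon> by auto
      have "(\<lambda>n. 12 * B / harm n) \<longlonglongrightarrow> 0"
        by (intro tendsto_divide_0[OF tendsto_const] filterlim_at_top_imp_at_infinity harm_at_top)
      then have "eventually (\<lambda>n. 12 * B / harm n < \<epsilon> / 4) sequentially"
        by (rule order_tendstoD) (use \<epsilon> in simp)
      then obtain n2 where n2: "\<And>n. n \<ge> n2 \<Longrightarrow> 12 * B / harm n < \<epsilon> / 4" by (auto simp: eventually_sequentially)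
      show "\<exists>no. \<forall>n\<ge>no. norm (D x n - Lm) < \<epsilon>"
      proof (intro exI[of _ "max 1 (max n1 n2)"] allI impI)
        fix n assume "n \<ge> max 1 (max n1 n2)"
        then have n: "n \<ge> 1" "n \<ge> n1" "n \<ge> n2" by auto
        define m where "m = \<phi> n"
        have m: "m \<le> n" "real n - real m \<le> real n / 2 ^ h" "n \<le> 2 * m" using \<phi>[OF n(1)] by (auto simp: m_def)
        have m1: "m \<ge> 1" using m(3) n(1) by linarith
        have Vn: "?V n > 0" and Vm: "?V m > 0" using weight_sum_divisor_count_pos n(1) m1 by auto
        have mono: "?V m \<le> ?V n" unfolding weight_sum_def using m(1) by (intro sum_mono2) auto
        define S where "S n = (\<Sum>k=1..n. divisor_count k * f ((\<tau> ^^ k) x))" for n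
        have Vd: "?V j = (\<Sum>k=1..j. divisor_count k)" for j using weight_sum_eq[of divisor_count j] divisor_count_nonneg by simp
        have split: "{1..n} = {1..m} \<union> {m+1..n}" "{1..m} \<inter> {m+1..n} = {}" using m(1) by auto
        have Sdiff: "S n - S m = (\<Sum>k=m+1..n. divisor_count k * f ((\<tau> ^^ k) x))"
          unfolding S_def split(1) by (subst sum.union_disjoint) (use split(2) in auto)
        have Vdiff: "?V n - ?V m = (\<Sum>k=m+1..n. divisor_count k)"
          unfolding Vd split(1) by (subst sum.union_disjoint) (use split(2) in auto)
        have "\<bar>S n - S m\<bar> \<le> (\<Sum>k=m+1..n. divisor_count k * B)"
          unfolding Sdiff by (intro order_trans[OF sum_abs] sum_mono)
            (auto simp: abs_mult divisor_count_nonneg intro!: mult_left_mono B)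
        then have SV: "\<bar>S n - S m\<bar> \<le> B * (?V n - ?V m)" unfolding Vdiff by (simp add: sum_distrib_left mult.commute)
        have Sm: "\<bar>S m\<bar> \<le> B * ?V m"
        proof -
          have "\<bar>S m\<bar> \<le> (\<Sum>k=1..m. divisor_count k * B)"
            unfolding S_def by (intro order_trans[OF sum_abs] sum_mono)
              (auto simp: abs_mult divisor_count_nonneg intro!: mult_left_mono B)
          then show ?thesis unfolding Vd by (simp add: sum_distrib_left mult.commute)
        qed
        \<comment> \<open>Changing the time alters the sum and the normalisation; either change is at most \<open>B\<close>
          times the share of the weight between \<open>m\<close> and \<open>n\<close>.\<close>
        have "D x n - D x m = (S n - S m) / ?V n - S m / ?V m * ((?V n - ?V m) / ?V n)"
          using Vn Vm unfolding D_def S_def[symmetric] by (simp add: field_simps)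
        then have "\<bar>D x n - D x m\<bar> \<le> \<bar>S n - S m\<bar> / ?V n + \<bar>S m\<bar> / ?V m * ((?V n - ?V m) / ?V n)"
          using Vn Vm mono abs_triangle_ineq4[of "(S n - S m) / ?V n" "S m / ?V m * ((?V n - ?V m) / ?V n)"]
          by (simp add: abs_mult)
        also have "\<dots> \<le> B * (?V n - ?V m) / ?V n + B * ((?V n - ?V m) / ?V n)"
          using Vn Vm mono SV Sm by (intro add_mono divide_right_mono mult_right_mono) (auto simp: field_simps)
        also have "\<dots> = 2 * B * ((?V n - ?V m) / ?V n)" by simp
        also have "\<dots> \<le> 2 * B * ((real n - real m) / (real n / 2) + 6 / harm n)"
          using B0 by (intro mult_left_mono divisor_weight_gap m1 m) auto
        also have "\<dots> \<le> 2 * B * ((real n / 2 ^ h) / (real n / 2) + 6 / harm n)"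
          using B0 m(2) by (intro mult_left_mono add_right_mono divide_right_mono) auto
        also have "\<dots> = 4 * B / 2 ^ h + 12 * B / harm n" using n(1) by (simp add: field_simps)
        also have "\<dots> < \<epsilon> / 4 + \<epsilon> / 4" using hB n2[OF n(3)] by linarith
        finally have "\<bar>D x n - D x m\<bar> < \<epsilon> / 4 + \<epsilon> / 4" .
        moreover have "\<bar>D x m - Lm\<bar> < \<epsilon> / 4" using n1[OF n(2)] by (simp add: m_def)
        ultimately have "\<bar>D x n - Lm\<bar> < \<epsilon>" using \<epsilon> by linarith
        then show "norm (D x n - Lm) < \<epsilon>" by simp
      qed
    qed
    then show ?case unfolding D_def by (auto simp: convergent_def)
  qed
qed

section \<open>The arithmetic weights\<close>

text \<open>
  Through the strong inequality at \<open>p\<close>, obtained by interpolation, and Markov's inequality.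
\<close>
lemma weak_type_raise:
  assumes wt: "weak_type TYPE('a) q w C" and adm: "admissible_weight w"
    and w: "\<And>k. k \<ge> 1 \<Longrightarrow> w k \<ge> 0" and q: "0 < q" "q < p" and C: "C \<ge> 0"
  shows "weak_type TYPE('a) p w (C * 2 powr p * p / (p - q))"
  unfolding weak_type_def
proof (intro allI impI)
  fix M :: "'a measure" and \<tau> and f :: "'a \<Rightarrow> real" and t :: real
  assume ds: "dynamical_system M \<tau>" and fm: "f \<in> borel_measurable M" and f: "\<forall>x. 0 \<le> f x" and t: "t > 0"
  let ?K = "C * 2 powr p * p / (p - q)"
  have "emeasure M {x\<in>space M. ennreal t < weighted_max w \<tau> f x}
      \<le> ennreal (t powr - p) * (\<integral>\<^sup>+x. ennreal_powr (weighted_max w \<tau> f x) p \<partial>M)"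
    by (rule markov_powr[OF measurable_weighted_max[OF ds fm]]) (use q t in auto)
  also have "\<dots> \<le> ennreal (t powr - p) * (ennreal ?K * (\<integral>\<^sup>+x. ennreal (f x powr p) \<partial>M))"
    by (intro mult_left_mono weak_type_imp_strong_type[OF wt adm w q C ds fm]) (use f in auto)
  also have "\<dots> = ennreal (t powr - p * ?K) * (\<integral>\<^sup>+x. ennreal (f x powr p) \<partial>M)"
    by (rule ennreal_mult_mult) (use q C in auto)
  also have "t powr - p * ?K = ?K / t powr p" by (simp add: powr_minus divide_inverse mult.commute)
  finally show "emeasure M {x\<in>space M. ennreal t < weighted_max w \<tau> f x}
      \<le> ennreal (?K / t powr p) * (\<integral>\<^sup>+x. ennreal (f x powr p) \<partial>M)" .
qed

lemma weak_type_of_divisor_sum: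
  fixes b :: "nat \<Rightarrow> nat"
  assumes K: "K > 0" and e: "e > 0"
    and le: "\<And>(\<tau> :: 'a \<Rightarrow> 'a) f x. (\<And>x. f x \<ge> 0) \<Longrightarrow>
      weighted_max w \<tau> f x \<le> ennreal K * (\<Sum>m. ennreal (real m powr - (1 + e)) * weighted_max (\<lambda>_. 1) (\<tau> ^^ b m) f x)"
  shows "weak_type TYPE('a) 1 w (K * \<bar>stein_weiss_const e\<bar>)"
  unfolding weak_type_def
proof (intro allI impI)
  fix M :: "'a measure" and \<tau> and f :: "'a \<Rightarrow> real" and t :: real
  assume ds: "dynamical_system M \<tau>" and fm[measurable]: "f \<in> borel_measurable M" and f: "\<forall>x. 0 \<le> f x" and t: "t > 0"
  interpret prob_space M using ds by (simp add: dynamical_system_def)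
  define A where "A = (\<integral>\<^sup>+x. ennreal (f x powr 1) \<partial>M)"
  define Y where "Y m = weighted_max (\<lambda>_. 1) (\<tau> ^^ b m) f" for m
  have ds': "dynamical_system M (\<tau> ^^ b m)" for m by (rule dynamical_system_funpow[OF ds])
  have Ym[measurable]: "Y m \<in> borel_measurable M" for m
    unfolding Y_def by (rule measurable_weighted_max[OF ds' fm])
  have weak: "emeasure M {x \<in> space M. ennreal s < Y m x} \<le> ennreal (1 / s) * A" if "s > 0" for m s
    using weak_typeD[OF weak_type_one ds' fm _ that, of m] f that unfolding Y_def A_def by simp
  let ?Z = "\<lambda>x. \<Sum>m. ennreal (real m powr - (1 + e)) * Y m x"
  have "emeasure M {x \<in> space M. ennreal t < weighted_max w \<tau> f x} \<le> emeasure M {x \<in> space M. ennreal (t / K) < ?Z x}"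
  proof (rule emeasure_mono)
    show "{x \<in> space M. ennreal t < weighted_max w \<tau> f x} \<subseteq> {x \<in> space M. ennreal (t / K) < ?Z x}"
    proof safe
      fix x assume x: "ennreal t < weighted_max w \<tau> f x"
      show "ennreal (t / K) < ?Z x"
      proof (rule ccontr)
        assume "\<not> ?thesis"
        then have "ennreal K * ?Z x \<le> ennreal K * ennreal (t / K)" by (intro mult_left_mono) (auto simp: not_less)
        also have "\<dots> = ennreal t" using K t by (simp flip: ennreal_mult)
        finally have "weighted_max w \<tau> f x \<le> ennreal t" using le[of f \<tau> x] f unfolding Y_def by (auto intro: order_trans)
        then show False using x by simp
      qed
    qed
  qed measurable
  also have "\<dots> \<le> ennreal (stein_weiss_const e / (t / K)) * A"
    by (rule stein_weiss[OF _ Ym e _ weak]) (use t K in \<open>auto intro: sigma_finite_measure_axioms\<close>)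
  also have "\<dots> \<le> ennreal (K * \<bar>stein_weiss_const e\<bar> / t powr 1) * A"
    using t K by (intro mult_right_mono ennreal_leI) (auto simp: divide_right_mono mult.commute)
  finally show "emeasure M {x \<in> space M. ennreal t < weighted_max w \<tau> f x}
      \<le> ennreal (K * \<bar>stein_weiss_const e\<bar> / t powr 1) * (\<integral>\<^sup>+x. ennreal (f x powr 1) \<partial>M)" by (simp only: A_def)
qed

text \<open>
  Divisor sums with inner weight \<open>k powr s\<close>. As the total inner weight is of order
  \<open>n powr (s + 1)\<close>, the \<open>m\<close>-th term has the share \<open>b m powr - (s + 1)\<close>. The decay condition is the
  one that \<open>stein_weiss\<close> needs.
\<close>
locale power_divisor_weight =
  fixes w a :: "nat \<Rightarrow> real" and b :: "nat \<Rightarrow> nat" and s e :: real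
  assumes s: "s \<ge> 0" and e: "e > 0"
    and b: "\<And>m. b m \<ge> m"
    and w_eq: "\<And>k. k \<ge> 1 \<Longrightarrow> w k = (\<Sum>m | m \<in> {1..k} \<and> b m dvd k. a m * real (k div b m) powr s)"
    and w_nonneg: "\<And>k. k \<ge> 1 \<Longrightarrow> w k \<ge> 0" and w1: "w 1 > 0" and a0: "a 0 = 0"
    and decay: "\<And>m. m \<ge> 1 \<Longrightarrow> \<bar>a m\<bar> * real (b m) powr - (s + 1) \<le> real m powr - (1 + e)"
    and nonzero: "(\<Sum>m. a m * real (b m) powr - (s + 1)) \<noteq> 0"
begin

sublocale divisor_sum_weight w "\<lambda>k. real k powr s" a "\<lambda>m. (s + 1) * real m powr - (1 + e)"
  "\<lambda>m. real (b m) powr - (s + 1)" b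
proof
  fix m n :: nat assume m: "m \<ge> 1"
  then have bm: "b m > 0" using b[of m] by simp
  have "\<bar>a m\<bar> * weight_sum (\<lambda>k. real k powr s) (n div b m)
      \<le> \<bar>a m\<bar> * ((s + 1) * real (b m) powr - (s + 1) * weight_sum (\<lambda>k. real k powr s) n)"
    by (intro mult_left_mono weight_sum_powr_div_le s bm) auto
  also have "\<dots> = (s + 1) * (\<bar>a m\<bar> * real (b m) powr - (s + 1)) * weight_sum (\<lambda>k. real k powr s) n" by simp
  also have "\<dots> \<le> (s + 1) * real m powr - (1 + e) * weight_sum (\<lambda>k. real k powr s) n"
    using s by (intro mult_right_mono mult_left_mono decay m weight_sum_nonneg) auto
  finally show "\<bar>a m\<bar> * weight_sum (\<lambda>k. real k powr s) (n div b m)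
      \<le> (s + 1) * real m powr - (1 + e) * weight_sum (\<lambda>k. real k powr s) n" .
next
  fix m :: nat assume m: "m \<ge> 1"
  then have bm: "b m > 0" using b[of m] by simp
  show "(\<lambda>n. weight_sum (\<lambda>k. real k powr s) (n div b m) / weight_sum (\<lambda>k. real k powr s) n) \<longlonglongrightarrow> real (b m) powr - (s + 1)"
    by (rule weight_sum_powr_ratio[OF s bm])
next
  show "summable (\<lambda>m. (s + 1) * real m powr - (1 + e))"
    using e by (intro summable_mult summable_powr_neg) simp
qed (use b w_eq w_nonneg w1 a0 admissible_powr[OF s] s nonzero in auto)

lemma bounded_convergence_weight: "bounded_convergence TYPE('a) w"
  by (rule bounded_convergence[OF bounded_convergence_powr[OF s]])

text \<open>
  All maximal functions in the decomposition are comparable to Cesaro maximal functions, which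
  have weak type (1,1) with the same constant for every power of \<open>\<tau>\<close>.
\<close>
lemma weak_type_weight: "\<exists>C\<ge>0. weak_type TYPE('a) 1 w C"
proof -
  obtain K where K: "K > 0" "\<And>n. weight_sum (\<lambda>k. real k powr s) n \<le> K * weight_sum w n"
    using weight_comparison by blast
  have le: "weighted_max w \<tau> f x
      \<le> ennreal (K * (s + 1)\<^sup>2) * (\<Sum>m. ennreal (real m powr - (1 + e)) * weighted_max (\<lambda>_. 1) (\<tau> ^^ b m) f x)"
    if f: "\<And>x. f x \<ge> 0" for \<tau> :: "'a \<Rightarrow> 'a" and f x
  proof -
    have "weighted_max w \<tau> f x \<le> ennreal K * (\<Sum>m. ennreal ((s + 1) * real m powr - (1 + e))
        * weighted_max (\<lambda>k. real k powr s) (\<tau> ^^ b m) f x)"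
      by (rule weighted_max_le[OF K f])
    also have "\<dots> \<le> ennreal K * (\<Sum>m. ennreal ((s + 1) * real m powr - (1 + e))
        * (ennreal (s + 1) * weighted_max (\<lambda>_. 1) (\<tau> ^^ b m) f x))"
      by (intro mult_left_mono suminf_le weighted_max_powr_le s f) auto
    also have "\<dots> = ennreal K * (\<Sum>m. ennreal ((s + 1)\<^sup>2) * (ennreal (real m powr - (1 + e)) * weighted_max (\<lambda>_. 1) (\<tau> ^^ b m) f x))"
    proof -
      have "ennreal ((s + 1) * real m powr - (1 + e)) * (ennreal (s + 1) * y)
          = ennreal ((s + 1)\<^sup>2) * (ennreal (real m powr - (1 + e)) * y)" for m y
      proof -
        have "ennreal ((s + 1) * real m powr - (1 + e)) * (ennreal (s + 1) * y)
            = ennreal ((s + 1) * real m powr - (1 + e) * (s + 1)) * y"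
          by (rule ennreal_mult_mult) (use s in auto)
        also have "(s + 1) * real m powr - (1 + e) * (s + 1) = (s + 1)\<^sup>2 * real m powr - (1 + e)"
          by (simp add: power2_eq_square)
        also have "ennreal \<dots> * y = ennreal ((s + 1)\<^sup>2) * (ennreal (real m powr - (1 + e)) * y)"
          by (rule ennreal_mult_mult[symmetric]) auto
        finally show ?thesis .
      qed
      then show ?thesis by simp
    qed
    also have "\<dots> = ennreal K * (ennreal ((s + 1)\<^sup>2) * (\<Sum>m. ennreal (real m powr - (1 + e)) * weighted_max (\<lambda>_. 1) (\<tau> ^^ b m) f x))"
      by (simp only: ennreal_suminf_cmult)
    also have "\<dots> = ennreal (K * (s + 1)\<^sup>2) * (\<Sum>m. ennreal (real m powr - (1 + e)) * weighted_max (\<lambda>_. 1) (\<tau> ^^ b m) f x)"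
      by (rule ennreal_mult_mult) (use K in auto)
    finally show ?thesis .
  qed
  have "weak_type TYPE('a) 1 w (K * (s + 1)\<^sup>2 * \<bar>stein_weiss_const e\<bar>)"
  proof (rule weak_type_of_divisor_sum[where b = b])
    show "K * (s + 1)\<^sup>2 > 0" using K s by simp
    show "e > 0" by (rule e)
    show "weighted_max w \<tau> f x \<le> ennreal (K * (s + 1)\<^sup>2)
        * (\<Sum>m. ennreal (real m powr - (1 + e)) * weighted_max (\<lambda>_. 1) (\<tau> ^^ b m) f x)"
      if "\<And>x. f x \<ge> 0" for \<tau> :: "'a \<Rightarrow> 'a" and f x
      by (rule le) (rule that)
  qed
  then show ?thesis using K by (intro exI[of _ "K * (s + 1)\<^sup>2 * \<bar>stein_weiss_const e\<bar>"]) simp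
qed

end

lemma divisors_set_eq: "k \<ge> 1 \<Longrightarrow> {m. m \<in> {1..k} \<and> m dvd k} = {d. d dvd (k::nat)}"
  by (auto simp: dvd_imp_le Suc_le_eq intro: Nat.gr0I)

lemma square_divisors_set_eq: "k \<ge> 1 \<Longrightarrow> {m. m \<in> {1..k} \<and> m ^ 2 dvd k} = {d. d ^ 2 dvd (k::nat)}"
proof (intro Collect_cong iffI)
  fix m assume k: "k \<ge> 1" and m: "m ^ 2 dvd k"
  have "m \<le> m ^ 2" by (simp add: power2_eq_square)
  also have "m ^ 2 \<le> k" using m k by (intro dvd_imp_le) auto
  finally have "m \<le> k" .
  moreover have "m \<noteq> 0" using m k by (intro notI) simp
  ultimately show "m \<in> {1..k} \<and> m ^ 2 dvd k" using m by simp
qed simp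

lemma div_pos_of_dvd: "k \<ge> 1 \<Longrightarrow> d dvd k \<Longrightarrow> k div d > (0::nat)"
  by (metis One_nat_def Suc_le_eq dvd_div_eq_0_iff neq0_conv)

lemma divisor_sigma_nonneg: "divisor_sigma s k \<ge> 0"
  unfolding divisor_sigma_def by (intro sum_nonneg) simp

lemma divisor_sigma_one: "divisor_sigma s 1 = 1"
  by (simp add: divisor_sigma_def)

lemma moebius_mu_0: "moebius_mu 0 = 0"
  by (simp_all add: moebius_mu_def)

lemma suminf_powr_pos: "t > 1 \<Longrightarrow> (\<Sum>m. real m powr - t) > 0"
  using suminf_pos2[OF summable_powr_neg[of t], of 1] by simp

text \<open>
  For \<open>s > 0\<close> the complementary divisor carries the power: \<open>\<sigma>\<^sub>s k\<close> is the sum of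
  \<open>(k div m) powr s\<close>.
\<close>
lemma power_divisor_weight_sigma_pos:
  assumes "s > 0"
  shows "power_divisor_weight (divisor_sigma s) (\<lambda>m. if m = 0 then 0 else 1) (\<lambda>m. m) s s"
proof
  show "divisor_sigma s k = (\<Sum>m | m \<in> {1..k} \<and> m dvd k. (if m = 0 then 0 else 1) * real (k div m) powr s)"
    if k: "k \<ge> 1" for k
    unfolding divisors_set_eq[OF k] using k by (subst divisor_sigma_flip) (auto intro!: sum.cong)
  have eq: "(if m = 0 then 0 else 1) * real m powr - (s + 1) = real m powr - (s + 1)" for m :: nat by simp
  show "(\<Sum>m. (if m = 0 then 0 else 1) * real m powr - (s + 1)) \<noteq> 0"
    unfolding eq using suminf_powr_pos[of "s + 1"] assms by simp
qed (use assms divisor_sigma_nonneg divisor_sigma_one in \<open>auto simp: add.commute\<close>)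

text \<open>
  For \<open>s < 0\<close> the powers \<open>m powr s\<close> are the coefficients and the inner weight is constant.
\<close>
lemma power_divisor_weight_sigma_neg:
  assumes "s < 0"
  shows "power_divisor_weight (divisor_sigma s) (\<lambda>m. real m powr s) (\<lambda>m. m) 0 (- s)"
proof
  show "divisor_sigma s k = (\<Sum>m | m \<in> {1..k} \<and> m dvd k. real m powr s * real (k div m) powr 0)"
    if k: "k \<ge> 1" for k
    unfolding divisors_set_eq[OF k] divisor_sigma_def
  proof (intro sum.cong refl)
    fix d assume "d \<in> {d. d dvd k}"
    then have "k div d > 0" using div_pos_of_dvd[OF k] by simp
    then show "real d powr s = real d powr s * real (k div d) powr 0" by simp
  qed
  have eq: "real m powr s * real m powr - (0 + 1) = real m powr - (1 - s)" for m
  proof -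
    have "real m powr s * real m powr - (0 + 1) = real m powr (s + - (0 + 1))" by (rule powr_add[symmetric])
    also have "s + - (0 + 1) = - (1 - s)" by simp
    finally show ?thesis .
  qed
  show "(\<Sum>m. real m powr s * real m powr - (0 + 1)) \<noteq> 0"
    unfolding eq using suminf_powr_pos[of "1 - s"] assms by simp
  show "\<bar>real m powr s\<bar> * real m powr - (0 + 1) \<le> real m powr - (1 + - s)" for m
    using eq[of m] by simp
qed (use assms divisor_sigma_nonneg divisor_sigma_one in auto)

lemma power_divisor_weight_jordan:
  assumes "s > 0"
  shows "power_divisor_weight (euler_jordan s) (\<lambda>m. real_of_int (moebius_mu m)) (\<lambda>m. m) s s"
proof
  show "euler_jordan s k = (\<Sum>m | m \<in> {1..k} \<and> m dvd k. real_of_int (moebius_mu m) * real (k div m) powr s)"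
    if k: "k \<ge> 1" for k
    unfolding divisors_set_eq[OF k] using k by (intro euler_jordan_flip) simp
  show "(\<Sum>m. real_of_int (moebius_mu m) * real m powr - (s + 1)) \<noteq> 0"
    using assms by (intro suminf_moebius_powr_nonzero) simp
  show "\<bar>real_of_int (moebius_mu m)\<bar> * real m powr - (s + 1) \<le> real m powr - (1 + s)" for m
    using mult_right_mono[OF abs_moebius_mu_le, of "real m powr - (s + 1)" m] by (simp add: add.commute)
  show "euler_jordan s 1 > 0" by (simp add: euler_jordan_def moebius_mu_def)
  show "euler_jordan s k \<ge> 0" if "k \<ge> 1" for k using euler_jordan_nonneg[OF assms] that by simp
qed (use assms moebius_mu_0 in auto)

text \<open>
  Here the maps are \<open>\<tau> ^^ (m ^ 2)\<close> and the shares \<open>1 / m ^ 2\<close>, so even the trivial bound \<open>\<bar>\<mu>\<bar> \<le> 1\<close>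
  for the coefficients gives the decay.
\<close>
lemma power_divisor_weight_abs_moebius:
  "power_divisor_weight abs_moebius (\<lambda>m. real_of_int (moebius_mu m)) (\<lambda>m. m ^ 2) 0 1"
proof
  show "m \<le> m ^ 2" for m :: nat by (simp add: power2_eq_square)
  show "abs_moebius k = (\<Sum>m | m \<in> {1..k} \<and> m ^ 2 dvd k. real_of_int (moebius_mu m) * real (k div m ^ 2) powr 0)"
    if k: "k \<ge> 1" for k
  proof -
    have "abs_moebius k = (\<Sum>d | d ^ 2 dvd k. real_of_int (moebius_mu d))"
      using k by (intro abs_moebius_square_divisors) simp
    also have "\<dots> = (\<Sum>d | d ^ 2 dvd k. real_of_int (moebius_mu d) * real (k div d ^ 2) powr 0)"
    proof (intro sum.cong refl)
      fix d assume "d \<in> {d. d ^ 2 dvd k}"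
      then have "k div d ^ 2 > 0" using div_pos_of_dvd[OF k] by simp
      then show "real_of_int (moebius_mu d) = real_of_int (moebius_mu d) * real (k div d ^ 2) powr 0" by simp
    qed
    finally show ?thesis unfolding square_divisors_set_eq[OF k] .
  qed
  have eq: "real (m ^ 2) powr - (0 + 1) = real m powr - 2" for m :: nat
    by (cases "m = 0") (simp_all add: powr_minus)
  show "(\<Sum>m. real_of_int (moebius_mu m) * real (m ^ 2) powr - (0 + 1)) \<noteq> 0"
    unfolding eq by (rule suminf_moebius_powr_nonzero) simp
  show "\<bar>real_of_int (moebius_mu m)\<bar> * real (m ^ 2) powr - (0 + 1) \<le> real m powr - (1 + 1)" for m
    unfolding eq using mult_right_mono[OF abs_moebius_mu_le, of "real m powr - 2" m] by simp
qed (auto simp: abs_moebius_def moebius_mu_def)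

text \<open>
  The total weight is asymptotic to \<open>n * ln n\<close>, and the logarithms of \<open>n\<close> and \<open>n div b\<close> have ratio
  tending to 1.
\<close>
lemma divisor_count_ratio:
  assumes b: "b > 0"
  shows "(\<lambda>n. weight_sum divisor_count (n div b) / weight_sum divisor_count n) \<longlonglongrightarrow> 1 / real b"
proof -
  let ?V = "weight_sum divisor_count"
  define u where "u n = ?V n / (real n * ln (real n))" for n
  have u: "u \<longlonglongrightarrow> 1" unfolding u_def by (rule divisor_count_asymp)
  have top: "filterlim (\<lambda>n. n div b) at_top sequentially" by (rule filterlim_div_at_top[OF b])
  have ln_inf: "filterlim (\<lambda>n. ln (real n)) at_infinity sequentially"
    by (rule filterlim_at_top_imp_at_infinity, rule filterlim_compose[OF ln_at_top filterlim_real_sequentially])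
  have r: "(\<lambda>n. real (n div b) / real n) \<longlonglongrightarrow> 1 / real b" by (rule tendsto_div_ratio[OF b])
  have "(\<lambda>n. 1 + ln (real (n div b) / real n) / ln (real n)) \<longlonglongrightarrow> 1 + 0"
    by (intro tendsto_add tendsto_const tendsto_divide_0[OF tendsto_ln[OF r]] ln_inf) (use b in simp)
  then have "(\<lambda>n. u (n div b) / u n * (real (n div b) / real n) * (1 + ln (real (n div b) / real n) / ln (real n)))
      \<longlonglongrightarrow> 1 / 1 * (1 / real b) * (1 + 0)"
    by (intro tendsto_mult tendsto_divide u r filterlim_compose[OF u top]) auto
  then have "(\<lambda>n. u (n div b) / u n * (real (n div b) / real n) * (1 + ln (real (n div b) / real n) / ln (real n)))
      \<longlonglongrightarrow> 1 / real b" by simp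
  then show ?thesis
  proof (rule Lim_transform_eventually, intro eventually_sequentiallyI[of "2 * b"])
    fix n assume n: "2 * b \<le> n"
    then have m: "n div b \<ge> 2" using b by (simp add: less_eq_div_iff_mult_less_eq)
    have n2: "n \<ge> 2" using n b by linarith
    have l: "ln (real n) > 0" "ln (real (n div b)) > 0" using m n2 by (auto intro!: ln_gt_zero)
    have "1 + ln (real (n div b) / real n) / ln (real n) = ln (real (n div b)) / ln (real n)"
      using m n2 l by (simp add: ln_div field_simps)
    then show "u (n div b) / u n * (real (n div b) / real n) * (1 + ln (real (n div b) / real n) / ln (real n)) = ?V (n div b) / ?V n"
      using m n2 l by (simp add: u_def)
  qed
qed

lemma divisor_sum_weight_sqfree_count:
  "divisor_sum_weight sqfree_divisor_count divisor_count (\<lambda>m. real_of_int (moebius_mu m))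
    (\<lambda>m. 2 * real m powr - 2) (\<lambda>m. 1 / real (m ^ 2)) (\<lambda>m. m ^ 2)"
proof
  show "m \<le> m ^ 2" for m :: nat by (simp add: power2_eq_square)
  show "sqfree_divisor_count k = (\<Sum>m | m \<in> {1..k} \<and> m ^ 2 dvd k. real_of_int (moebius_mu m) * divisor_count (k div m ^ 2))"
    if k: "k \<ge> 1" for k
    unfolding square_divisors_set_eq[OF k] divisor_count_def using k by (intro sqfree_divisor_count_square_divisors) simp
  show "sqfree_divisor_count k \<ge> 0" for k by (simp add: sqfree_divisor_count_def)
  have "{d. d dvd 1 \<and> squarefree d} = {1::nat}" by auto
  then show "sqfree_divisor_count 1 > 0" by (simp add: sqfree_divisor_count_def)
  show "\<bar>real_of_int (moebius_mu m)\<bar> * weight_sum divisor_count (n div m ^ 2) \<le> 2 * real m powr - 2 * weight_sum divisor_count n"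
    if m: "m \<ge> 1" for m n
  proof -
    have "\<bar>real_of_int (moebius_mu m)\<bar> * weight_sum divisor_count (n div m ^ 2) \<le> 1 * weight_sum divisor_count (n div m ^ 2)"
      by (intro mult_right_mono abs_moebius_mu_le weight_sum_nonneg)
    also have "\<dots> \<le> real (n div m ^ 2) * harm (n div m ^ 2)" using weight_sum_divisor_count_le by simp
    also have "\<dots> \<le> (real n / real (m ^ 2)) * harm n"
      by (intro mult_mono real_div_le harm_mono harm_nonneg) auto
    also have "\<dots> = 2 / real (m ^ 2) * (real n / 2 * harm n)" by simp
    also have "\<dots> \<le> 2 / real (m ^ 2) * weight_sum divisor_count n"
      by (intro mult_left_mono weight_sum_divisor_count_ge_half) auto
    also have "2 / real (m ^ 2) = 2 * real m powr - 2" using m by (simp add: powr_minus divide_inverse)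
    finally show ?thesis .
  qed
  show "summable (\<lambda>m. 2 * real m powr - 2)" by (intro summable_mult summable_powr_neg) simp
  show "(\<lambda>n. weight_sum divisor_count (n div m ^ 2) / weight_sum divisor_count n) \<longlonglongrightarrow> 1 / real (m ^ 2)" if "m \<ge> 1" for m
    by (rule divisor_count_ratio) (use that in simp)
  have eq: "1 / real (m ^ 2) = real m powr - 2" for m :: nat
    by (cases "m = 0") (simp_all add: powr_minus divide_inverse)
  show "(\<Sum>m. real_of_int (moebius_mu m) * (1 / real (m ^ 2))) \<noteq> 0"
    unfolding eq by (rule suminf_moebius_powr_nonzero) simp
qed (auto simp: divisor_count_nonneg admissible_divisor_count moebius_mu_0)

text \<open>
  A squarefree divisor is a divisor, so the sums for this weight are at most those for the number
  of divisors, while the total weights are comparable by \<open>weight_comparison\<close>.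
\<close>
lemma weak_type_sqfree_count:
  assumes p: "1 < p" "p < 2"
  shows "\<exists>C\<ge>0. weak_type TYPE('a) p sqfree_divisor_count C"
proof -
  interpret divisor_sum_weight sqfree_divisor_count divisor_count "\<lambda>m. real_of_int (moebius_mu m)"
    "\<lambda>m. 2 * real m powr - 2" "\<lambda>m. 1 / real (m ^ 2)" "\<lambda>m. m ^ 2"
    by (rule divisor_sum_weight_sqfree_count)
  obtain K where K: "K > 0" "\<And>n. weight_sum divisor_count n \<le> K * weight_sum sqfree_divisor_count n"
    using weight_comparison by blast
  obtain C where C: "C \<ge> 0" "weak_type TYPE('a) p divisor_count C" using weak_type_divisor_count[OF p] by blast
  have le: "sqfree_divisor_count k \<le> divisor_count k" if "k \<ge> 1" for k
    unfolding sqfree_divisor_count_def divisor_count_def using that by (intro of_nat_mono card_mono) auto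
  have max_le: "weighted_max sqfree_divisor_count \<tau> f x \<le> ennreal K * weighted_max divisor_count \<tau> f x"
    if f: "\<And>x. f x \<ge> 0" for \<tau> :: "'a \<Rightarrow> 'a" and f x
    unfolding weighted_max_def[of sqfree_divisor_count]
  proof (rule SUP_least)
    fix n :: nat assume n: "n \<in> {1..}"
    let ?D = "\<Sum>k=1..n. divisor_count k * f ((\<tau> ^^ k) x)"
    have D: "?D \<ge> 0" by (intro sum_nonneg mult_nonneg_nonneg divisor_count_nonneg f)
    have W: "W n > 0" "V n > 0" using W_pos V_pos n by auto
    have "(\<Sum>k=1..n. sqfree_divisor_count k * f ((\<tau> ^^ k) x)) \<le> ?D"
      using le f by (intro sum_mono mult_right_mono) auto
    also have "\<dots> = V n * (?D / V n)" using W by simp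
    also have "\<dots> \<le> (K * W n) * (?D / V n)"
      using D W by (intro mult_right_mono K) auto
    finally have "(\<Sum>k=1..n. sqfree_divisor_count k * f ((\<tau> ^^ k) x)) / W n \<le> K * (?D / V n)"
      using W by (simp add: field_simps)
    then have "ennreal ((\<Sum>k=1..n. sqfree_divisor_count k * f ((\<tau> ^^ k) x)) / W n) \<le> ennreal (K * (?D / V n))"
      by (rule ennreal_leI)
    also have "\<dots> = ennreal K * ennreal (?D / V n)" by (rule ennreal_mult) (use K D W in auto)
    also have "\<dots> \<le> ennreal K * weighted_max divisor_count \<tau> f x"
      unfolding weighted_max_def using n by (intro mult_left_mono SUP_upper) auto
    finally show "ennreal ((\<Sum>k=1..n. sqfree_divisor_count k * f ((\<tau> ^^ k) x)) / W n) \<le> \<dots>" .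
  qed
  have "weak_type TYPE('a) p sqfree_divisor_count (C * K powr p)"
    unfolding weak_type_def
  proof (intro allI impI)
    fix M :: "'a measure" and \<tau> and f :: "'a \<Rightarrow> real" and t :: real
    assume ds: "dynamical_system M \<tau>" and fm[measurable]: "f \<in> borel_measurable M" and f: "\<forall>x. 0 \<le> f x" and t: "t > 0"
    have [measurable]: "weighted_max divisor_count \<tau> f \<in> borel_measurable M" by (rule measurable_weighted_max[OF ds fm])
    have "emeasure M {x\<in>space M. ennreal t < weighted_max sqfree_divisor_count \<tau> f x}
        \<le> emeasure M {x\<in>space M. ennreal (t / K) < weighted_max divisor_count \<tau> f x}"
    proof (rule emeasure_mono)
      show "{x\<in>space M. ennreal t < weighted_max sqfree_divisor_count \<tau> f x}
          \<subseteq> {x\<in>space M. ennreal (t / K) < weighted_max divisor_count \<tau> f x}"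
      proof safe
        fix x assume x: "ennreal t < weighted_max sqfree_divisor_count \<tau> f x"
        show "ennreal (t / K) < weighted_max divisor_count \<tau> f x"
        proof (rule ccontr)
          assume "\<not> ?thesis"
          then have "ennreal K * weighted_max divisor_count \<tau> f x \<le> ennreal K * ennreal (t / K)"
            by (intro mult_left_mono) (auto simp: not_less)
          also have "\<dots> = ennreal t" using K t by (simp flip: ennreal_mult)
          finally show False using x max_le[of f \<tau> x] f by (auto dest: order_trans simp: not_less[symmetric])
        qed
      qed
    qed measurable
    also have "\<dots> \<le> ennreal (C / (t / K) powr p) * (\<integral>\<^sup>+x. ennreal (f x powr p) \<partial>M)"
      by (rule weak_typeD[OF C(2) ds fm]) (use f t K in auto)
    also have "C / (t / K) powr p = C * K powr p / t powr p" using t K by (simp add: powr_divide)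
    finally show "emeasure M {x\<in>space M. ennreal t < weighted_max sqfree_divisor_count \<tau> f x}
        \<le> ennreal (C * K powr p / t powr p) * (\<integral>\<^sup>+x. ennreal (f x powr p) \<partial>M)" .
  qed
  then show ?thesis using C by (intro exI[of _ "C * K powr p"]) simp
qed

text \<open>
  The inequality on the sequence space supplies the constant that serves all types at once, the
  one on the given type the pointwise convergence.
\<close>
lemma good_Lp_of_weak_type:
  assumes adm: "admissible_weight w" and w: "\<And>k. k \<ge> 1 \<Longrightarrow> w k \<ge> 0" and q: "0 < q" "q < p"
    and model: "\<exists>C\<ge>0. weak_type TYPE(nat \<Rightarrow> complex) q w C"
    and wt: "\<exists>C\<ge>0. weak_type TYPE('a) q w C" and bc: "bounded_convergence TYPE('a) w"
  shows "good_dominated_Lp TYPE('a) p w \<and> good_pointwise_Lp TYPE('a) p w"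
proof
  obtain C where "C \<ge> 0" "weak_type TYPE(nat \<Rightarrow> complex) q w C" using model by blast
  then obtain K where "K > 0" "strong_maximal_ineq TYPE(nat \<Rightarrow> complex) p w K"
    using strong_maximal_ineq_of_weak_type[OF _ adm w q] by blast
  then show "good_dominated_Lp TYPE('a) p w" by (intro good_dominated_LpI[OF adm])
  obtain C' where "C' \<ge> 0" "weak_type TYPE('a) q w C'" using wt by blast
  then have "weak_type TYPE('a) p w (C' * 2 powr p * p / (p - q))" by (intro weak_type_raise adm w q)
  then show "good_pointwise_Lp TYPE('a) p w" by (rule pointwise_of_weak_type) (use q adm w bc in auto)
qed

lemma good_weak_L1_of_weak_type:
  assumes adm: "admissible_weight w" and w: "\<And>k. k \<ge> 1 \<Longrightarrow> w k \<ge> 0"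
    and model: "\<exists>C\<ge>0. weak_type TYPE(nat \<Rightarrow> complex) 1 w C"
    and wt: "\<exists>C\<ge>0. weak_type TYPE('a) 1 w C" and bc: "bounded_convergence TYPE('a) w"
  shows "good_dominated_weak_L1 TYPE('a) w \<and> good_pointwise_weak_L1 TYPE('a) w"
proof
  obtain C where C: "C \<ge> 0" "weak_type TYPE(nat \<Rightarrow> complex) 1 w C" using model by blast
  \<comment> \<open>A constant that is strictly positive, as the definition of a good weight demands.\<close>
  have "weak_type TYPE(nat \<Rightarrow> complex) 1 w (C + 1)"
    unfolding weak_type_def
  proof (intro allI impI)
    fix M :: "(nat \<Rightarrow> complex) measure" and \<tau> and f :: "(nat \<Rightarrow> complex) \<Rightarrow> real" and t :: real
    assume "dynamical_system M \<tau>" "f \<in> borel_measurable M" "\<forall>x. 0 \<le> f x" "t > 0"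
    then have "emeasure M {x \<in> space M. ennreal t < weighted_max w \<tau> f x}
        \<le> ennreal (C / t powr 1) * (\<integral>\<^sup>+x. ennreal (f x powr 1) \<partial>M)"
      using C(2) unfolding weak_type_def by blast
    also have "\<dots> \<le> ennreal ((C + 1) / t powr 1) * (\<integral>\<^sup>+x. ennreal (f x powr 1) \<partial>M)"
      by (intro mult_right_mono ennreal_leI divide_right_mono) auto
    finally show "emeasure M {x \<in> space M. ennreal t < weighted_max w \<tau> f x} \<le> \<dots>" .
  qed
  then have "weak_maximal_ineq TYPE(nat \<Rightarrow> complex) w (C + 1)"
    by (rule weak_maximal_ineq_of_weak_type) (use w C in auto)
  then show "good_dominated_weak_L1 TYPE('a) w" using C by (intro good_dominated_weak_L1I[OF adm]) auto
  obtain C' where "weak_type TYPE('a) 1 w C'" using wt by blast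
  then show "good_pointwise_weak_L1 TYPE('a) w"
    unfolding good_pointwise_weak_L1_def by (rule pointwise_of_weak_type) (use adm w bc in auto)
qed

lemma (in power_divisor_weight) good_weight:
  "good_dominated_weak_L1 TYPE('a) w \<and> good_pointwise_weak_L1 TYPE('a) w"
  "p > 1 \<Longrightarrow> good_dominated_Lp TYPE('a) p w \<and> good_pointwise_Lp TYPE('a) p w"
proof -
  note facts = admissible w_nonneg
  show "good_dominated_weak_L1 TYPE('a) w \<and> good_pointwise_weak_L1 TYPE('a) w"
    by (rule good_weak_L1_of_weak_type[OF facts weak_type_weight weak_type_weight bounded_convergence_weight])
  assume "p > 1"
  then show "good_dominated_Lp TYPE('a) p w \<and> good_pointwise_Lp TYPE('a) p w"
    by (intro good_Lp_of_weak_type[OF facts _ _ weak_type_weight weak_type_weight bounded_convergence_weight]) auto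
qed

lemma good_weight_sqfree_count:
  assumes "p > 1"
  shows "good_dominated_Lp TYPE('a) p sqfree_divisor_count \<and> good_pointwise_Lp TYPE('a) p sqfree_divisor_count"
proof -
  interpret divisor_sum_weight sqfree_divisor_count divisor_count "\<lambda>m. real_of_int (moebius_mu m)"
    "\<lambda>m. 2 * real m powr - 2" "\<lambda>m. 1 / real (m ^ 2)" "\<lambda>m. m ^ 2"
    by (rule divisor_sum_weight_sqfree_count)
  \<comment> \<open>An exponent in the range where the number of divisors has weak type, and below \<open>p\<close>.\<close>
  define q where "q = (1 + min p 2) / 2"
  have q: "1 < q" "q < 2" "q < p" "0 < q" using assms by (auto simp: q_def)
  show ?thesis
    by (rule good_Lp_of_weak_type[OF admissible w_nonneg q(4,3) weak_type_sqfree_count[OF q(1,2)]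
          weak_type_sqfree_count[OF q(1,2)] bounded_convergence[OF bounded_convergence_divisor_count]])
qed

theorem theorem3p7:
  shows "(\<forall>p>1. \<forall>w \<in> {divisor_sigma s | s. s \<noteq> 0} \<union> {sqfree_divisor_count}
                   \<union> {euler_jordan s | s. s > 0} \<union> {abs_moebius}.
            good_dominated_Lp TYPE('a) p w \<and> good_pointwise_Lp TYPE('a) p w)
       \<and> (\<forall>w \<in> {divisor_sigma s | s. s \<noteq> 0} \<union> {abs_moebius} \<union> {euler_jordan s | s. s > 0}.
            good_dominated_weak_L1 TYPE('a) w \<and> good_pointwise_weak_L1 TYPE('a) w)"
proof -
  have power: "good_dominated_weak_L1 TYPE('a) w \<and> good_pointwise_weak_L1 TYPE('a) w
      \<and> (\<forall>p>1. good_dominated_Lp TYPE('a) p w \<and> good_pointwise_Lp TYPE('a) p w)"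
    if w: "w \<in> {divisor_sigma s | s. s \<noteq> 0} \<union> {abs_moebius} \<union> {euler_jordan s | s. s > 0}" for w
  proof -
    have "\<exists>a b s e. power_divisor_weight w a b s e"
    proof -
      consider s where "w = divisor_sigma s" "s > 0" | s where "w = divisor_sigma s" "s < 0"
        | "w = abs_moebius" | s where "w = euler_jordan s" "s > 0"
        using w by (auto simp: neq_iff)
      then show ?thesis
        by cases (use power_divisor_weight_sigma_pos power_divisor_weight_sigma_neg
            power_divisor_weight_abs_moebius power_divisor_weight_jordan in blast)+
    qed
    then obtain a b s e where "power_divisor_weight w a b s e" by blast
    then show ?thesis using power_divisor_weight.good_weight by blast
  qed
  then show ?thesis using good_weight_sqfree_count by (auto simp only: Un_iff singleton_iff)
qed

end
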